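(* Let $M$ be a smooth, $m$-dimensional submanifold of a Euclidean space $\mathbf{R}^d$, where $m \geq 1$. Then $M$ is a Salem set if and only if there exists a point $z_0 \in M$ such that for each non-zero $\zeta_0 \in (T_{z_0} M)^\perp$, the function $z \mapsto \zeta_0 \cdot (z - z_0)$ on $M$ has a non-degenerate critical point at $z_0$. In particular, if no point of $M$ has this property, then the Fourier dimension of $M$ is at most $m - 1/3$.
   Context: The Fourier dimension $\dim_{\mathbf{F}}(S)$ of a set $S \subset \mathbf{R}^d$ is the supremum of all $s \in (0,d]$ for which there exists a non-zero, finite, non-negative Borel measure $\mu$ supported on $S$ with $|\widehat{\mu}(\zeta)| \lesssim |\zeta|^{-s/2}$ uniformly for all non-zero $\zeta \in \mathbf{R}^d$ (and it is $0$ if there is no such $s$). A set is Salem if its Fourier dimension equals its Hausdorff dimension. Here $(T_{z_0}M)^\perp$ denotes the orthogonal complement in $\mathbf{R}^d$ of the tangent space $T_{z_0}M$, viewed as a linear subspace of $\mathbf{R}^d$. A critical point is non-degenerate if the Hessian of the function on $M$ at that point is a non-singular quadratic form on $T_{z_0}M$. *)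

theory Defs
  imports "HOL-Analysis.Analysis"
begin

section \<open>Smooth maps, submanifolds and tangent spaces\<close>

text \<open>Only meant for open \<open>U\<close>. In finite dimensions, \<open>f\<close> is of class \<open>C\<close>-\<open>(k+1)\<close> on \<open>U\<close> iff it is
  differentiable there and all its directional derivatives are of class \<open>C\<close>-\<open>k\<close>.\<close>

fun Ck_on :: "nat \<Rightarrow> 'a::euclidean_space set \<Rightarrow> ('a \<Rightarrow> 'b::euclidean_space) \<Rightarrow> bool" where
  "Ck_on 0 U f = continuous_on U f"
| "Ck_on (Suc k) U f =
     (\<exists>f'. (\<forall>x\<in>U. (f has_derivative f' x) (at x)) \<and> (\<forall>v. Ck_on k U (\<lambda>x. f' x v)))"

definition smooth_on :: "'a::euclidean_space set \<Rightarrow> ('a \<Rightarrow> 'b::euclidean_space) \<Rightarrow> bool" where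
  "smooth_on U f \<longleftrightarrow> (\<forall>k. Ck_on k U f)"

text \<open>Embedded submanifold: near each of its points, \<open>M\<close> is straightened to an open piece of an
  \<open>m\<close>-dimensional linear subspace \<open>E\<close> by a diffeomorphism \<open>\<phi>\<close> between open subsets of the ambient
  space.\<close>

definition smooth_submanifold :: "nat \<Rightarrow> 'a::euclidean_space set \<Rightarrow> bool" where
  "smooth_submanifold m M \<longleftrightarrow>
     (\<forall>z\<in>M. \<exists>U V \<phi> \<psi> (E :: 'a set).
        open U \<and> open V \<and> z \<in> U \<and> homeomorphism U V \<phi> \<psi> \<and>
        smooth_on U \<phi> \<and> smooth_on V \<psi> \<and>
        subspace E \<and> dim E = m \<and> \<phi> ` (M \<inter> U) = E \<inter> V)"

definition smooth_curve_in :: "'a::euclidean_space set \<Rightarrow> 'a \<Rightarrow> 'a \<Rightarrow> (real \<Rightarrow> 'a) \<Rightarrow> bool" where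
  "smooth_curve_in M z v \<gamma> \<longleftrightarrow>
     (\<exists>\<epsilon>>0. smooth_on {-\<epsilon><..<\<epsilon>} \<gamma> \<and> \<gamma> ` {-\<epsilon><..<\<epsilon>} \<subseteq> M) \<and>
     \<gamma> 0 = z \<and> (\<gamma> has_vector_derivative v) (at 0)"

definition tangent_space :: "'a::euclidean_space set \<Rightarrow> 'a \<Rightarrow> 'a set" where
  "tangent_space M z = {v. \<exists>\<gamma>. smooth_curve_in M z v \<gamma>}"


section \<open>Critical points and Hessians\<close>

text \<open>Only the values of \<open>f\<close> on \<open>M\<close> matter. The first definition says that the differential
  of \<open>f\<close> restricted to \<open>M\<close> vanishes on the tangent space at \<open>z\<close>.\<close>

definition critical_point_on :: "'a::euclidean_space set \<Rightarrow> ('a \<Rightarrow> real) \<Rightarrow> 'a \<Rightarrow> bool" where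
  "critical_point_on M f z \<longleftrightarrow>
     z \<in> M \<and> (\<forall>v \<gamma>. smooth_curve_in M z v \<gamma> \<longrightarrow> ((f \<circ> \<gamma>) has_real_derivative 0) (at 0))"

text \<open>The Hessian at a critical point is the symmetric bilinear form on the tangent space whose
  value at \<open>(\<gamma>'(0), \<gamma>'(0))\<close> is the second derivative of \<open>f \<circ> \<gamma>\<close> at \<open>0\<close>; at a critical point this
  depends only on \<open>\<gamma>'(0)\<close>. The form \<open>B\<close> is taken on the whole ambient space, but
  only its restriction to the tangent space is constrained, and that restriction is
  unique by polarization.\<close>

definition is_Hessian_on ::
    "'a::euclidean_space set \<Rightarrow> ('a \<Rightarrow> real) \<Rightarrow> 'a \<Rightarrow> ('a \<Rightarrow> 'a \<Rightarrow> real) \<Rightarrow> bool" where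
  "is_Hessian_on M f z B \<longleftrightarrow>
     bilinear B \<and>
     (\<forall>v\<in>tangent_space M z. \<forall>w\<in>tangent_space M z. B v w = B w v) \<and>
     (\<forall>v \<gamma>. smooth_curve_in M z v \<gamma> \<longrightarrow> (deriv (f \<circ> \<gamma>) has_real_derivative B v v) (at 0))"

definition nondegenerate_form_on :: "'a::euclidean_space set \<Rightarrow> ('a \<Rightarrow> 'a \<Rightarrow> real) \<Rightarrow> bool" where
  "nondegenerate_form_on T B \<longleftrightarrow> (\<forall>v\<in>T. (\<forall>w\<in>T. B v w = 0) \<longrightarrow> v = 0)"

definition nondegenerate_critical_point_on ::
    "'a::euclidean_space set \<Rightarrow> ('a \<Rightarrow> real) \<Rightarrow> 'a \<Rightarrow> bool" where
  "nondegenerate_critical_point_on M f z \<longleftrightarrow>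
     critical_point_on M f z \<and>
     (\<exists>B. is_Hessian_on M f z B \<and> nondegenerate_form_on (tangent_space M z) B)"


section \<open>Hausdorff dimension\<close>

text \<open>Covers are by sequences of bounded sets (\<open>diameter\<close> is unspecified on unbounded sets); finite
  covers are padded with empty sets, which contribute \<open>0 powr s = 0\<close>.\<close>

definition Hausdorff_premeasure :: "real \<Rightarrow> real \<Rightarrow> 'a::euclidean_space set \<Rightarrow> ennreal" where
  "Hausdorff_premeasure s \<delta> S =
     (INF A \<in> {A :: nat \<Rightarrow> 'a set. S \<subseteq> (\<Union>i. A i) \<and> (\<forall>i. bounded (A i) \<and> diameter (A i) \<le> \<delta>)}.
        \<Sum>i. ennreal (diameter (A i) powr s))"

definition Hausdorff_measure :: "real \<Rightarrow> 'a::euclidean_space set \<Rightarrow> ennreal" where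
  "Hausdorff_measure s S = (SUP \<delta> \<in> {0<..}. Hausdorff_premeasure s \<delta> S)"

text \<open>Exponents \<open>s > 0\<close> suffice for the infimum, which avoids the convention for \<open>0 powr 0\<close>.\<close>

definition Hausdorff_dim :: "'a::euclidean_space set \<Rightarrow> real" where
  "Hausdorff_dim S = Inf {s. 0 < s \<and> Hausdorff_measure s S = 0}"


section \<open>Fourier dimension and Salem sets\<close>

definition fourier_transform_measure :: "'a::euclidean_space measure \<Rightarrow> 'a \<Rightarrow> complex" where
  "fourier_transform_measure \<mu> \<zeta> = (\<integral>x. cis (- 2 * pi * (\<zeta> \<bullet> x)) \<partial>\<mu>)"

text \<open>A measure is supported on \<open>S\<close> if the complement of \<open>S\<close> is contained in a null set.\<close>

definition fourier_decay_measure_on :: "'a::euclidean_space set \<Rightarrow> real \<Rightarrow> 'a measure \<Rightarrow> bool" where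
  "fourier_decay_measure_on S s \<mu> \<longleftrightarrow>
     sets \<mu> = sets borel \<and> finite_measure \<mu> \<and> emeasure \<mu> UNIV \<noteq> 0 \<and>
     (AE x in \<mu>. x \<in> S) \<and>
     (\<exists>C. \<forall>\<zeta>. \<zeta> \<noteq> 0 \<longrightarrow> cmod (fourier_transform_measure \<mu> \<zeta>) \<le> C * norm \<zeta> powr (- s / 2))"

definition fourier_dim :: "'a::euclidean_space set \<Rightarrow> real" where
  "fourier_dim S =
     Sup (insert 0 {s. 0 < s \<and> s \<le> real DIM('a) \<and> (\<exists>\<mu>. fourier_decay_measure_on S s \<mu>)})"

definition salem :: "'a::euclidean_space set \<Rightarrow> bool" where
  "salem S \<longleftrightarrow> fourier_dim S = Hausdorff_dim S"

end

theory Submission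
  imports Defs
begin

text \<open>
  A submanifold has Hausdorff dimension \<open>m\<close>, so everything rests on its Fourier dimension.

  Upper bounds. Let \<open>\<mu>\<close> be supported on \<open>M\<close> with decay exponent \<open>s/2\<close>. If a unit vector \<open>\<zeta>\<close> is normal to
  \<open>M\<close> at \<open>z\<close>, then \<open>\<zeta> \<bullet> (z' - z)\<close> is \<open>O(\<delta>)\<close> for \<open>z'\<close> in the cap of radius \<open>\<delta>\<^sup>1\<^sup>/\<^sup>2\<close>; testing \<open>\<mu>\<close> against a cut-off to the
  cap modulated with frequency \<open>\<zeta>/\<delta>\<close> shows that the cap has mass at most about \<open>\<delta>\<^sup>s\<^sup>/\<^sup>2\<close>. Since about
  \<open>\<delta>\<^sup>-\<^sup>m\<^sup>/\<^sup>2\<close> caps cover a piece of \<open>M\<close>, \<open>s > m\<close> forces \<open>\<mu> = 0\<close>. If the Hessian of \<open>\<zeta> \<bullet> (\<cdot> - z)\<close> is degenerate in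
  direction \<open>v\<close>, the cap may be lengthened to \<open>\<delta>\<^sup>1\<^sup>/\<^sup>3\<close> along \<open>v\<close>, because the height is cubic there. The same \<open>v\<close>
  serves, up to admissible errors, in the whole \<open>\<delta>\<^sup>1\<^sup>/\<^sup>3\<close>-ball around \<open>z\<close>, which is therefore covered by parallel
  caps; no regularity of \<open>z \<mapsto> v\<close> is needed, and the count drops by \<open>\<delta>\<^sup>1\<^sup>/\<^sup>6\<close>, giving \<open>s \<le> m - 1/3\<close>.

  Lower bound. If all Hessians at \<open>z\<^sub>0\<close> are nondegenerate, then by compactness, for every unit \<open>\<omega>\<close>, near \<open>z\<^sub>0\<close> either the
  gradient of \<open>\<omega> \<bullet> z\<close> along \<open>M\<close> is bounded below, or its Hessian is uniformly invertible. For a bump measure near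
  \<open>z\<^sub>0\<close>, the first case is nonstationary phase. In the second, the squared modulus of the Fourier transform is
  an integral over \<open>u\<close> of correlations with phase \<open>\<lambda>(\<Phi> x - \<Phi> (x + u))\<close>, whose gradient has size \<open>\<lambda>\<bar>u\<bar>\<close>;
  nonstationary phase bounds each by \<open>min 1 ((\<lambda>\<bar>u\<bar>)\<^sup>-\<^sup>2\<^sup>m)\<close>, and integrating in \<open>u\<close> yields \<open>\<lambda>\<^sup>-\<^sup>m\<close>.
\<close>


section \<open>Calculus of smooth maps\<close>

text \<open>Decay controls the Fourier transform only at high frequencies, and \<open>\<mu>\<close>
  may be singular on \<open>M\<close>. The cut-offs to caps must therefore have compactly supported
  Fourier transforms and cannot have compact support themselves; their tails force the caps to be
  widened by a small power \<open>\<delta> powr (-\<epsilon>)\<close>, a loss paid for by the strict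
  inequality assumed for \<open>s\<close>. Nonzero normals exist only in positive codimension; when
  \<open>m\<close> is the full dimension, the upper bound is built into the definition of the
  Fourier dimension. In the lower bound, correlations take the place of the Morse lemma and of
  stationary phase with parameters: integration by parts on lines suffices, with constants uniform
  in the frequency direction, the base point and the line. Integrals over the parameter subspace are
  replaced by integrals over the ambient space, with everything extended constantly along the
  complementary coordinates. For this reason charts are first normalised to coordinate
  subspaces.\<close>

definition dderiv :: "('a::euclidean_space \<Rightarrow> 'b::euclidean_space) \<Rightarrow> 'a \<Rightarrow> 'a \<Rightarrow> 'b" where
  "dderiv f v x = frechet_derivative f (at x) v"

lemma Ck_on_cong:
  assumes "open U" "\<And>x. x \<in> U \<Longrightarrow> f x = g x" "Ck_on k U f"
  shows "Ck_on k U g"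
proof (cases k)
  case 0
  then show ?thesis using assms continuous_on_cong[of U U f g] by auto
next
  case (Suc j)
  then obtain f' where f': "\<And>x. x \<in> U \<Longrightarrow> (f has_derivative f' x) (at x)"
      "\<And>v. Ck_on j U (\<lambda>x. f' x v)"
    using assms by auto
  have "\<And>x. x \<in> U \<Longrightarrow> (g has_derivative f' x) (at x)"
    using f'(1) assms has_derivative_transform_within_open by blast
  then show ?thesis using Suc f'(2) by auto
qed

text \<open>On an open set derivatives are unique, so the existential witness in
  \<open>Ck_on\<close> may be replaced by \<open>dderiv\<close>. In \<open>dderiv\<close> the
  direction precedes the point, so that \<open>dderiv f v\<close> is itself a map that can be
  differentiated again.\<close>

lemma Ck_on_SucD:
  assumes "open U" "Ck_on (Suc k) U f"
  shows "x \<in> U \<Longrightarrow> (f has_derivative (\<lambda>v. dderiv f v x)) (at x)"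
    and "Ck_on k U (dderiv f v)"
proof -
  obtain f' where f': "\<And>x. x \<in> U \<Longrightarrow> (f has_derivative f' x) (at x)"
      "\<And>v. Ck_on k U (\<lambda>x. f' x v)"
    using assms by auto
  have eq: "f' x = (\<lambda>v. dderiv f v x)" if "x \<in> U" for x
    unfolding dderiv_def using frechet_derivative_at[OF f'(1)[OF that]] by simp
  show "x \<in> U \<Longrightarrow> (f has_derivative (\<lambda>v. dderiv f v x)) (at x)"
    using f'(1) eq by auto
  show "Ck_on k U (dderiv f v)"
    by (rule Ck_on_cong[OF assms(1) _ f'(2)[of v]]) (simp add: eq)
qed

lemma smooth_on_has_derivative:
  assumes "open U" "smooth_on U f" "x \<in> U"
  shows "(f has_derivative (\<lambda>v. dderiv f v x)) (at x)"
  using assms Ck_on_SucD(1) unfolding smooth_on_def by blast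

lemma smooth_on_dderiv:
  assumes "open U" "smooth_on U f"
  shows "smooth_on U (dderiv f v)"
  using assms Ck_on_SucD(2) unfolding smooth_on_def by blast

lemma smooth_on_continuous_on: "smooth_on U f \<Longrightarrow> continuous_on U f"
  unfolding smooth_on_def using Ck_on.simps(1) by blast

lemma Ck_on_subset: "Ck_on k U f \<Longrightarrow> W \<subseteq> U \<Longrightarrow> Ck_on k W f"
proof (induction k arbitrary: f)
  case 0
  then show ?case using continuous_on_subset by auto
next
  case (Suc k)
  then obtain f' where "\<forall>x\<in>U. (f has_derivative f' x) (at x)" "\<forall>v. Ck_on k U (\<lambda>x. f' x v)"
    by auto
  then show ?case using Suc by (auto intro!: exI[of _ f'])
qed

lemma smooth_on_subset: "smooth_on U f \<Longrightarrow> W \<subseteq> U \<Longrightarrow> smooth_on W f"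
  unfolding smooth_on_def using Ck_on_subset by blast

lemma Ck_on_bounded_linear:
  assumes "bounded_linear A" "Ck_on k U f"
  shows "Ck_on k U (\<lambda>x. A (f x))"
  using assms(2)
proof (induction k arbitrary: f)
  case 0
  then show ?case using bounded_linear.continuous_on[OF assms(1)] by simp
next
  case (Suc k)
  then obtain f' where f': "\<forall>x\<in>U. (f has_derivative f' x) (at x)" "\<forall>v. Ck_on k U (\<lambda>x. f' x v)"
    by auto
  show ?case
    using f' Suc.IH by (auto intro!: exI[of _ "\<lambda>x v. A (f' x v)"] bounded_linear.has_derivative[OF assms(1)])
qed

lemma smooth_on_bounded_linear:
  "bounded_linear A \<Longrightarrow> smooth_on U f \<Longrightarrow> smooth_on U (\<lambda>x. A (f x))"
  unfolding smooth_on_def using Ck_on_bounded_linear by blast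

lemma Ck_on_affine:
  assumes "bounded_linear B" "Ck_on k U f"
  shows "Ck_on k {t. p + B t \<in> U} (\<lambda>t. f (p + B t))"
  using assms(2)
proof (induction k arbitrary: f)
  case 0
  have "continuous_on UNIV B"
    using bounded_linear.continuous_on[OF assms(1) continuous_on_id] .
  then have "continuous_on {t. p + B t \<in> U} (\<lambda>t. p + B t)"
    by (intro continuous_intros) (auto intro: continuous_on_subset)
  then show ?case using 0 by (auto intro!: continuous_on_compose2[of U f])
next
  case (Suc k)
  then obtain f' where f': "\<forall>x\<in>U. (f has_derivative f' x) (at x)" "\<forall>v. Ck_on k U (\<lambda>x. f' x v)"
    by auto
  have "((\<lambda>t. f (p + B t)) has_derivative (\<lambda>v. f' (p + B t) (B v))) (at t)"
    if "p + B t \<in> U" for t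
  proof -
    have 1: "((\<lambda>t. p + B t) has_derivative B) (at t)"
      using has_derivative_add[OF has_derivative_const bounded_linear.has_derivative[OF assms(1) has_derivative_ident]]
      by simp
    have 2: "(f has_derivative f' (p + B t)) (at (p + B t))"
      using f' that by blast
    show ?thesis using has_derivative_compose[OF 1 2] by simp
  qed
  then show ?case
    using f'(2) Suc.IH by (auto intro!: exI[of _ "\<lambda>t v. f' (p + B t) (B v)"])
qed

lemma smooth_on_affine:
  "bounded_linear B \<Longrightarrow> smooth_on U f \<Longrightarrow> smooth_on {t. p + B t \<in> U} (\<lambda>t. f (p + B t))"
  unfolding smooth_on_def using Ck_on_affine by blast

lemma linear_dderiv:
  assumes "open U" "smooth_on U f" "x \<in> U"
  shows "linear (\<lambda>v. dderiv f v x)"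
  using smooth_on_has_derivative[OF assms] has_derivative_linear by blast

lemma linear_eq_sum_Basis:
  fixes A :: "'a::euclidean_space \<Rightarrow> 'b::real_vector"
  assumes "linear A"
  shows "A v = (\<Sum>b\<in>Basis. (v \<bullet> b) *\<^sub>R A b)"
  using linear_sum[OF assms, of "\<lambda>b. (v \<bullet> b) *\<^sub>R b" Basis] linear_cmul[OF assms]
    euclidean_representation[of v] by simp

lemma dderiv_eq_sum_Basis:
  assumes "open U" "smooth_on U f" "x \<in> U"
  shows "dderiv f v x = (\<Sum>b\<in>Basis. (v \<bullet> b) *\<^sub>R dderiv f b x)"
  using linear_eq_sum_Basis[OF linear_dderiv[OF assms]] .

lemma norm_linear_le_Basis:
  fixes A :: "'a::euclidean_space \<Rightarrow> 'b::real_normed_vector"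
  assumes "linear A" "\<And>b. b \<in> Basis \<Longrightarrow> norm (A b) \<le> B"
  shows "norm (A v) \<le> real DIM('a) * B * norm v"
proof -
  have "norm (A v) \<le> (\<Sum>b\<in>Basis. norm ((v \<bullet> b) *\<^sub>R A b))"
    by (subst linear_eq_sum_Basis[OF assms(1)]) (rule norm_sum)
  also have "\<dots> \<le> (\<Sum>b\<in>(Basis::'a set). norm v * B)"
    using assms(2) by (intro sum_mono) (auto intro!: mult_mono Basis_le_norm)
  finally show ?thesis by (simp add: mult_ac)
qed

lemma continuous_on_cball_bounded:
  fixes f :: "'a::euclidean_space \<Rightarrow> 'b::real_normed_vector"
  assumes "continuous_on (cball p R) f"
  obtains B where "B > 0" "\<And>x. x \<in> cball p R \<Longrightarrow> norm (f x) \<le> B"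
proof -
  have "bounded (f ` cball p R)"
    using compact_continuous_image[OF assms compact_cball] compact_imp_bounded by blast
  then show ?thesis using that bounded_pos by (metis imageI)
qed

text \<open>\<open>Ck_on\<close> yields continuity of \<open>dderiv f v\<close> only for one
  \<open>v\<close> at a time. A bound uniform in \<open>v\<close> follows from linearity and the
  finitely many basis directions; the Lipschitz versions and those for second derivatives repeat
  this argument.\<close>

lemma smooth_on_dderiv_bounded:
  fixes f :: "'a::euclidean_space \<Rightarrow> 'b::euclidean_space"
  assumes "open U" "smooth_on U f" "cball p R \<subseteq> U"
  obtains B where "B > 0" "\<And>x v. x \<in> cball p R \<Longrightarrow> norm (dderiv f v x) \<le> B * norm v"
proof -
  have "\<exists>B>0. \<forall>x\<in>cball p R. norm (dderiv f b x) \<le> B" for b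
    using continuous_on_cball_bounded[of p R "dderiv f b"]
      continuous_on_subset[OF smooth_on_continuous_on[OF smooth_on_dderiv[OF assms(1,2)]] assms(3)]
    by metis
  then obtain B where B: "\<And>b. B b > 0" "\<And>b x. x \<in> cball p R \<Longrightarrow> norm (dderiv f b x) \<le> B b"
    by metis
  define C where "C = real DIM('a) * (\<Sum>b\<in>(Basis::'a set). B b)"
  have "C > 0" unfolding C_def using B(1) by (intro mult_pos_pos sum_pos) auto
  moreover have "norm (dderiv f v x) \<le> C * norm v" if "x \<in> cball p R" for x v
    unfolding C_def
  proof (rule norm_linear_le_Basis)
    show "linear (\<lambda>v. dderiv f v x)" using linear_dderiv assms that by blast
    fix b :: 'a assume "b \<in> Basis"
    have "norm (dderiv f b x) \<le> B b" using B that by auto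
    also have "\<dots> \<le> (\<Sum>b\<in>Basis. B b)"
      using \<open>b \<in> Basis\<close> B(1) by (intro member_le_sum) (auto simp: less_imp_le)
    finally show "norm (dderiv f b x) \<le> (\<Sum>b\<in>Basis. B b)" .
  qed
  ultimately show ?thesis using that by blast
qed

lemma smooth_on_Lipschitz:
  fixes f :: "'a::euclidean_space \<Rightarrow> 'b::euclidean_space"
  assumes "open U" "smooth_on U f" "cball p R \<subseteq> U"
  obtains L where "L > 0"
    "\<And>x y. x \<in> cball p R \<Longrightarrow> y \<in> cball p R \<Longrightarrow> norm (f x - f y) \<le> L * norm (x - y)"
proof -
  obtain B where B: "B > 0" "\<And>x v. x \<in> cball p R \<Longrightarrow> norm (dderiv f v x) \<le> B * norm v"
    using smooth_on_dderiv_bounded[OF assms] by blast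
  have "norm (f x - f y) \<le> B * norm (x - y)" if "x \<in> cball p R" "y \<in> cball p R" for x y
  proof (rule differentiable_bound[of "cball p R" f "\<lambda>x v. dderiv f v x"])
    show "\<And>x. x \<in> cball p R \<Longrightarrow> (f has_derivative (\<lambda>v. dderiv f v x)) (at x within cball p R)"
      using smooth_on_has_derivative[OF assms(1,2)] assms(3) has_derivative_at_withinI by blast
    show "onorm (\<lambda>v. dderiv f v x) \<le> B" if "x \<in> cball p R" for x
      using B that by (intro onorm_le) auto
  qed (use that in auto)
  then show ?thesis using B(1) that by blast
qed

lemma dderiv_Lipschitz:
  fixes f :: "'a::euclidean_space \<Rightarrow> 'b::euclidean_space"
  assumes "open U" "smooth_on U f" "cball p R \<subseteq> U"
  obtains L where "L > 0"
    "\<And>x y v. x \<in> cball p R \<Longrightarrow> y \<in> cball p R \<Longrightarrow>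
       norm (dderiv f v x - dderiv f v y) \<le> L * norm (x - y) * norm v"
proof -
  have "\<exists>L>0. \<forall>x\<in>cball p R. \<forall>y\<in>cball p R. norm (dderiv f b x - dderiv f b y) \<le> L * norm (x - y)" for b
    using smooth_on_Lipschitz[OF assms(1) smooth_on_dderiv[OF assms(1,2)] assms(3)] by metis
  then obtain L where L: "\<And>b. L b > 0"
    "\<And>b x y. x \<in> cball p R \<Longrightarrow> y \<in> cball p R \<Longrightarrow> norm (dderiv f b x - dderiv f b y) \<le> L b * norm (x - y)"
    by metis
  define C where "C = real DIM('a) * (\<Sum>b\<in>(Basis::'a set). L b)"
  have "C > 0" unfolding C_def using L(1) by (intro mult_pos_pos sum_pos) auto
  moreover have "norm (dderiv f v x - dderiv f v y) \<le> C * norm (x - y) * norm v"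
    if "x \<in> cball p R" "y \<in> cball p R" for x y v
  proof -
    have "norm (dderiv f v x - dderiv f v y)
        \<le> real DIM('a) * ((\<Sum>b\<in>(Basis::'a set). L b) * norm (x - y)) * norm v"
    proof (rule norm_linear_le_Basis[where A = "\<lambda>v. dderiv f v x - dderiv f v y"])
      show "linear (\<lambda>v. dderiv f v x - dderiv f v y)"
        using linear_compose_sub linear_dderiv assms that by blast
      fix b :: 'a assume "b \<in> Basis"
      have "norm (dderiv f b x - dderiv f b y) \<le> L b * norm (x - y)" using L that by auto
      also have "\<dots> \<le> (\<Sum>b\<in>Basis. L b) * norm (x - y)"
        using \<open>b \<in> Basis\<close> L(1) by (intro mult_right_mono member_le_sum) (auto simp: less_imp_le)
      finally show "norm (dderiv f b x - dderiv f b y) \<le> (\<Sum>b\<in>Basis. L b) * norm (x - y)" .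
    qed
    then show ?thesis unfolding C_def by (simp add: mult_ac)
  qed
  ultimately show ?thesis using that by blast
qed

text \<open>Linearity in \<open>w\<close> is that of a derivative. In \<open>v\<close> it holds
  because the linearity relations for \<open>dderiv f\<close> are valid on a whole neighbourhood of
  \<open>x\<close>, so that both sides may be differentiated.\<close>

lemma linear_dderiv2:
  assumes "open U" "smooth_on U f" "x \<in> U"
  shows "linear (\<lambda>v. dderiv (dderiv f v) w x)"
proof -
  have D: "(dderiv f v has_derivative (\<lambda>w. dderiv (dderiv f v) w x)) (at x)" for v
    using smooth_on_has_derivative[OF assms(1) smooth_on_dderiv[OF assms(1,2)] assms(3)] .
  have add: "dderiv (dderiv f (u + v)) w x = dderiv (dderiv f u) w x + dderiv (dderiv f v) w x" for u v
  proof -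
    have "(dderiv f (u + v) has_derivative (\<lambda>w. dderiv (dderiv f u) w x + dderiv (dderiv f v) w x)) (at x)"
      by (rule has_derivative_transform_within_open[OF has_derivative_add[OF D D] assms(1,3)])
        (use linear_add[OF linear_dderiv[OF assms(1,2)]] in auto)
    from has_derivative_unique[OF D this] show ?thesis by meson
  qed
  have cmul: "dderiv (dderiv f (c *\<^sub>R u)) w x = c *\<^sub>R dderiv (dderiv f u) w x" for u c
  proof -
    have "(dderiv f (c *\<^sub>R u) has_derivative (\<lambda>w. c *\<^sub>R dderiv (dderiv f u) w x)) (at x)"
      by (rule has_derivative_transform_within_open[OF has_derivative_scaleR_right[OF D] assms(1,3)])
        (use linear_cmul[OF linear_dderiv[OF assms(1,2)]] in auto)
    from has_derivative_unique[OF D this] show ?thesis by meson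
  qed
  show ?thesis by (rule linearI) (auto simp: add cmul)
qed

lemma dderiv2_bounded:
  fixes f :: "'a::euclidean_space \<Rightarrow> 'b::euclidean_space"
  assumes "open U" "smooth_on U f" "cball p R \<subseteq> U"
  obtains B where "B > 0"
    "\<And>x u w. x \<in> cball p R \<Longrightarrow> norm (dderiv (dderiv f u) w x) \<le> B * norm u * norm w"
proof -
  have "\<exists>B>0. \<forall>x\<in>cball p R. \<forall>w. norm (dderiv (dderiv f b) w x) \<le> B * norm w" for b
    using smooth_on_dderiv_bounded[OF assms(1) smooth_on_dderiv[OF assms(1,2)] assms(3)] by metis
  then obtain B where B: "\<And>b. B b > 0"
    "\<And>b x w. x \<in> cball p R \<Longrightarrow> norm (dderiv (dderiv f b) w x) \<le> B b * norm w"
    by metis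
  define C where "C = real DIM('a) * (\<Sum>b\<in>(Basis::'a set). B b)"
  have "C > 0" unfolding C_def using B(1) by (intro mult_pos_pos sum_pos) auto
  moreover have "norm (dderiv (dderiv f u) w x) \<le> C * norm u * norm w"
    if "x \<in> cball p R" for x u w
  proof -
    have "norm (dderiv (dderiv f u) w x)
        \<le> real DIM('a) * ((\<Sum>b\<in>(Basis::'a set). B b) * norm w) * norm u"
    proof (rule norm_linear_le_Basis[where A = "\<lambda>u. dderiv (dderiv f u) w x"])
      show "linear (\<lambda>u. dderiv (dderiv f u) w x)"
        using linear_dderiv2 assms that by blast
      fix b :: 'a assume "b \<in> Basis"
      have "norm (dderiv (dderiv f b) w x) \<le> B b * norm w" using B that by auto
      also have "\<dots> \<le> (\<Sum>b\<in>Basis. B b) * norm w"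
        using \<open>b \<in> Basis\<close> B(1) by (intro mult_right_mono member_le_sum) (auto simp: less_imp_le)
      finally show "norm (dderiv (dderiv f b) w x) \<le> (\<Sum>b\<in>Basis. B b) * norm w" .
    qed
    then show ?thesis unfolding C_def by (simp add: mult_ac)
  qed
  ultimately show ?thesis using that by blast
qed

lemma dderiv2_Lipschitz:
  fixes f :: "'a::euclidean_space \<Rightarrow> 'b::euclidean_space"
  assumes "open U" "smooth_on U f" "cball p R \<subseteq> U"
  obtains L where "L > 0"
    "\<And>x y u w. x \<in> cball p R \<Longrightarrow> y \<in> cball p R \<Longrightarrow>
       norm (dderiv (dderiv f u) w x - dderiv (dderiv f u) w y) \<le> L * norm (x - y) * norm u * norm w"
proof -
  have "\<exists>L>0. \<forall>x\<in>cball p R. \<forall>y\<in>cball p R. \<forall>w.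
      norm (dderiv (dderiv f b) w x - dderiv (dderiv f b) w y) \<le> L * norm (x - y) * norm w" for b
    using dderiv_Lipschitz[OF assms(1) smooth_on_dderiv[OF assms(1,2)] assms(3)] by metis
  then obtain L where L: "\<And>b. L b > 0"
    "\<And>b x y w. x \<in> cball p R \<Longrightarrow> y \<in> cball p R \<Longrightarrow>
       norm (dderiv (dderiv f b) w x - dderiv (dderiv f b) w y) \<le> L b * norm (x - y) * norm w"
    by metis
  define C where "C = real DIM('a) * (\<Sum>b\<in>(Basis::'a set). L b)"
  have "C > 0" unfolding C_def using L(1) by (intro mult_pos_pos sum_pos) auto
  moreover have "norm (dderiv (dderiv f u) w x - dderiv (dderiv f u) w y)
      \<le> C * norm (x - y) * norm u * norm w"
    if "x \<in> cball p R" "y \<in> cball p R" for x y u w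
  proof -
    have "norm (dderiv (dderiv f u) w x - dderiv (dderiv f u) w y)
        \<le> real DIM('a) * ((\<Sum>b\<in>(Basis::'a set). L b) * norm (x - y) * norm w) * norm u"
    proof (rule norm_linear_le_Basis[where A = "\<lambda>u. dderiv (dderiv f u) w x - dderiv (dderiv f u) w y"])
      show "linear (\<lambda>u. dderiv (dderiv f u) w x - dderiv (dderiv f u) w y)"
        using linear_compose_sub linear_dderiv2 assms that by blast
      fix b :: 'a assume "b \<in> Basis"
      have "norm (dderiv (dderiv f b) w x - dderiv (dderiv f b) w y) \<le> L b * norm (x - y) * norm w"
        using L that by auto
      also have "\<dots> \<le> (\<Sum>b\<in>Basis. L b) * norm (x - y) * norm w"
        using \<open>b \<in> Basis\<close> L(1) by (intro mult_right_mono member_le_sum) (auto simp: less_imp_le)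
      finally show "norm (dderiv (dderiv f b) w x - dderiv (dderiv f b) w y)
          \<le> (\<Sum>b\<in>Basis. L b) * norm (x - y) * norm w" .
    qed
    then show ?thesis unfolding C_def by (simp add: mult_ac)
  qed
  ultimately show ?thesis using that by blast
qed

section \<open>Taylor estimates on balls\<close>

lemma taylor1_segment:
  fixes q :: "real \<Rightarrow> 'b::real_normed_vector"
  assumes "\<And>t. t \<in> {0..1} \<Longrightarrow> (q has_vector_derivative q' t) (at t within {0..1})"
    and "\<And>t. t \<in> {0..1} \<Longrightarrow> norm (q' t) \<le> K" and "t \<in> {0..1}"
  shows "norm (q t - q 0) \<le> K * t"
proof -
  have "norm (q t - q 0) \<le> K * norm (t - 0)"
  proof (rule differentiable_bound[of "{0..1}" q "\<lambda>t h. h *\<^sub>R q' t"])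
    show "\<And>t. t \<in> {0..1} \<Longrightarrow> (q has_derivative (\<lambda>h. h *\<^sub>R q' t)) (at t within {0..1})"
      using assms(1) has_vector_derivative_def by blast
    show "\<And>t. t \<in> {0..1} \<Longrightarrow> onorm (\<lambda>h. h *\<^sub>R q' t) \<le> K"
      using assms(2) by (intro onorm_le) (simp add: mult.commute[of K] mult_left_mono)
  qed (use assms in auto)
  then show ?thesis using assms(3) by auto
qed

lemma smooth_on_line:
  assumes "open U" "smooth_on U f" "x + t *\<^sub>R u \<in> U"
  shows "((\<lambda>t. f (x + t *\<^sub>R u)) has_vector_derivative dderiv f u (x + t *\<^sub>R u)) (at t within S)"
proof -
  have 1: "((\<lambda>t. x + t *\<^sub>R u) has_derivative (\<lambda>h. h *\<^sub>R u)) (at t within S)"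
    by (auto intro!: derivative_eq_intros)
  have 2: "(f has_derivative (\<lambda>v. dderiv f v (x + t *\<^sub>R u))) (at (x + t *\<^sub>R u))"
    using smooth_on_has_derivative[OF assms] .
  have "((\<lambda>t. f (x + t *\<^sub>R u)) has_derivative (\<lambda>h. dderiv f (h *\<^sub>R u) (x + t *\<^sub>R u))) (at t within S)"
    using has_derivative_compose[OF 1 2] by simp
  then show ?thesis
    unfolding has_vector_derivative_def
    using linear_cmul[OF linear_dderiv[OF assms]] by simp
qed

lemma segment_in_cball:
  fixes x y :: "'a::real_normed_vector"
  assumes "x \<in> cball p R" "y \<in> cball p R" "t \<in> {0..1}"
  shows "x + t *\<^sub>R (y - x) \<in> cball p R"
proof -
  have "(1 - t) *\<^sub>R x + t *\<^sub>R y \<in> cball p R"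
    using convexD_alt[OF convex_cball assms(1,2)] assms(3) by auto
  then show ?thesis by (simp add: algebra_simps)
qed

lemma smooth_on_taylor1:
  fixes f :: "'a::euclidean_space \<Rightarrow> 'b::euclidean_space"
  assumes "open U" "smooth_on U f" "cball p R \<subseteq> U"
  obtains L where "L > 0"
    "\<And>x y. x \<in> cball p R \<Longrightarrow> y \<in> cball p R \<Longrightarrow>
       norm (f y - f x - dderiv f (y - x) x) \<le> L * norm (y - x) ^ 2"
proof -
  obtain L where L: "L > 0" "\<And>x y v. x \<in> cball p R \<Longrightarrow> y \<in> cball p R \<Longrightarrow>
       norm (dderiv f v x - dderiv f v y) \<le> L * norm (x - y) * norm v"
    using dderiv_Lipschitz[OF assms] by blast
  have "norm (f y - f x - dderiv f (y - x) x) \<le> L * norm (y - x) ^ 2"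
    if xy: "x \<in> cball p R" "y \<in> cball p R" for x y
  proof -
    let ?u = "y - x"
    let ?q = "\<lambda>t. f (x + t *\<^sub>R ?u) - t *\<^sub>R dderiv f ?u x"
    have seg: "x + t *\<^sub>R ?u \<in> cball p R" if "t \<in> {0..1}" for t
      using segment_in_cball[OF xy that] .
    have "norm (?q 1 - ?q 0) \<le> (L * norm ?u ^ 2) * 1"
    proof (rule taylor1_segment)
      fix t :: real assume t: "t \<in> {0..1}"
      show "(?q has_vector_derivative (dderiv f ?u (x + t *\<^sub>R ?u) - dderiv f ?u x)) (at t within {0..1})"
        using smooth_on_line[OF assms(1,2), of x t ?u] seg[OF t] assms(3)
        by (auto intro!: derivative_eq_intros)
      have "norm (dderiv f ?u (x + t *\<^sub>R ?u) - dderiv f ?u x) \<le> L * norm (t *\<^sub>R ?u) * norm ?u"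
        using L(2)[OF seg[OF t] xy(1), of ?u] by simp
      also have "\<dots> = t * (L * norm ?u ^ 2)" using t by (simp add: power2_eq_square)
      also have "\<dots> \<le> 1 * (L * norm ?u ^ 2)" using t L(1) by (intro mult_right_mono) auto
      finally show "norm (dderiv f ?u (x + t *\<^sub>R ?u) - dderiv f ?u x) \<le> L * norm ?u ^ 2" by simp
    qed auto
    then show ?thesis by (simp add: algebra_simps)
  qed
  then show ?thesis using L(1) that by blast
qed

text \<open>The mean value inequality is applied twice: \<open>?q\<close>, the directional
  derivative along the segment minus its linear term, has derivative of size
  \<open>L * norm ?u ^ 3\<close>, and \<open>?q t - ?q 0\<close> is in turn the derivative of
  \<open>?r\<close>. The base point is arbitrary in the ball with one constant, since base points
  move later.\<close>

lemma smooth_on_taylor2: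
  fixes f :: "'a::euclidean_space \<Rightarrow> 'b::euclidean_space"
  assumes "open U" "smooth_on U f" "cball p R \<subseteq> U"
  obtains L where "L > 0"
    "\<And>x y. x \<in> cball p R \<Longrightarrow> y \<in> cball p R \<Longrightarrow>
       norm (f y - f x - dderiv f (y - x) x - (1/2) *\<^sub>R dderiv (dderiv f (y - x)) (y - x) x)
         \<le> L * norm (y - x) ^ 3"
proof -
  obtain L where L: "L > 0" "\<And>x y u w. x \<in> cball p R \<Longrightarrow> y \<in> cball p R \<Longrightarrow>
       norm (dderiv (dderiv f u) w x - dderiv (dderiv f u) w y) \<le> L * norm (x - y) * norm u * norm w"
    using dderiv2_Lipschitz[OF assms] by blast
  have "norm (f y - f x - dderiv f (y - x) x - (1/2) *\<^sub>R dderiv (dderiv f (y - x)) (y - x) x)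
         \<le> L * norm (y - x) ^ 3"
    if xy: "x \<in> cball p R" "y \<in> cball p R" for x y
  proof -
    let ?u = "y - x"
    let ?H = "dderiv (dderiv f ?u) ?u x"
    let ?K = "L * norm ?u ^ 3"
    let ?q = "\<lambda>t. dderiv f ?u (x + t *\<^sub>R ?u) - t *\<^sub>R ?H"
    let ?r = "\<lambda>t. f (x + t *\<^sub>R ?u) - t *\<^sub>R dderiv f ?u x - (t\<^sup>2/2) *\<^sub>R ?H"
    have seg: "x + t *\<^sub>R ?u \<in> cball p R" if "t \<in> {0..1}" for t
      using segment_in_cball[OF xy that] .
    have q: "norm (?q t - ?q 0) \<le> ?K * t" if t: "t \<in> {0..1}" for t
    proof (rule taylor1_segment[OF _ _ t])
      fix t :: real assume t: "t \<in> {0..1}"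
      show "(?q has_vector_derivative (dderiv (dderiv f ?u) ?u (x + t *\<^sub>R ?u) - ?H)) (at t within {0..1})"
        using smooth_on_line[OF assms(1) smooth_on_dderiv[OF assms(1,2)], of x t ?u] seg[OF t] assms(3)
        by (auto intro!: derivative_eq_intros)
      have "norm (dderiv (dderiv f ?u) ?u (x + t *\<^sub>R ?u) - ?H) \<le> L * norm (t *\<^sub>R ?u) * norm ?u * norm ?u"
        using L(2)[OF seg[OF t] xy(1), of ?u ?u] by simp
      also have "\<dots> = t * ?K" using t by (simp add: power3_eq_cube)
      also have "\<dots> \<le> 1 * ?K" using t L(1) by (intro mult_right_mono) auto
      finally show "norm (dderiv (dderiv f ?u) ?u (x + t *\<^sub>R ?u) - ?H) \<le> ?K" by simp
    qed
    have "norm (?r 1 - ?r 0) \<le> ?K * 1"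
    proof (rule taylor1_segment)
      fix t :: real assume t: "t \<in> {0..1}"
      show "(?r has_vector_derivative (?q t - ?q 0)) (at t within {0..1})"
        using smooth_on_line[OF assms(1,2), of x t ?u] seg[OF t] assms(3)
        by (auto intro!: derivative_eq_intros)
      have "norm (?q t - ?q 0) \<le> ?K * t" using q[OF t] .
      also have "\<dots> \<le> ?K * 1" using t L(1) by (intro mult_left_mono) auto
      finally show "norm (?q t - ?q 0) \<le> ?K" by simp
    qed auto
    then show ?thesis by (simp add: algebra_simps)
  qed
  then show ?thesis using L(1) that by blast
qed


section \<open>Charts, tangent spaces and Hessians\<close>

text \<open>A basis of \<open>E\<close> is sent onto a set \<open>D\<close> of standard basis
  vectors, and its extension to a basis of the whole space onto all of \<open>Basis\<close>; the
  resulting map is onto, hence bijective. Composed with a chart it makes the model space a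
  coordinate subspace, where projections, grids and product integrals can be taken
  coordinatewise.\<close>

lemma exists_linear_iso_coordinate_subspace:
  fixes E :: "'a::euclidean_space set"
  assumes "subspace E"
  obtains A A' :: "'a \<Rightarrow> 'a" and D :: "'a set"
  where "linear A" "linear A'" "\<And>x. A (A' x) = x" "\<And>x. A' (A x) = x"
    "D \<subseteq> Basis" "card D = dim E" "A ` E = span D"
proof -
  obtain B where B: "B \<subseteq> E" "independent B" "E \<subseteq> span B" "card B = dim E"
    using basis_exists by blast
  obtain B' where B': "B \<subseteq> B'" "B' \<subseteq> UNIV" "independent B'" "UNIV \<subseteq> span B'"
    by (rule maximal_independent_subset_extend[OF subset_UNIV B(2)])
  have fB': "finite B'" using B'(3) finiteI_independent by blast
  then have fB: "finite B" using B'(1) finite_subset by blast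
  have cB': "card B' = DIM('a)"
    using basis_card_eq_dim[of B' UNIV] B' by auto
  obtain D :: "'a set" where D: "D \<subseteq> Basis" "card D = dim E"
    using obtain_subset_with_card_n[of "dim E" "Basis::'a set"] dim_subset_UNIV[of E] by metis
  have "\<exists>g. bij_betw g B D"
    using fB D B(4) finite_same_card_bij[of B D] finite_subset[OF D(1)] by auto
  then obtain g where g: "bij_betw g B D" by blast
  have "card (B' - B) = card (Basis - D)"
    using card_Diff_subset[OF fB B'(1)] card_Diff_subset[OF finite_subset[OF D(1)] D(1)] cB' B(4) D(2)
    by auto
  then obtain g' where g': "bij_betw g' (B' - B) (Basis - D)"
    using finite_same_card_bij[of "B' - B" "Basis - D"] fB' by auto
  define h where "h x = (if x \<in> B then g x else g' x)" for x
  have hB: "h ` B = D" using g by (auto simp: h_def bij_betw_def image_iff)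
  have hB': "h ` (B' - B) = Basis - D" using g' by (auto simp: h_def bij_betw_def image_iff)
  have h: "h ` B' = Basis"
    using hB hB' B'(1) D(1) by (metis Diff_partition image_Un)
  obtain A where A: "linear A" "\<And>x. x \<in> B' \<Longrightarrow> A x = h x"
    using linear_independent_extend[OF B'(3), of h] by blast
  have AB': "A ` B' = Basis" using A(2) h by auto
  have "surj A"
  proof -
    have "A ` span B' = span Basis" using linear_span_image[OF A(1), of B'] AB' by simp
    then show ?thesis using B'(4) by (simp add: top.extremum_unique)
  qed
  then have "inj A" using A(1) linear_surjective_imp_injective by blast
  then obtain A' where A': "linear A'" "\<And>x. A' (A x) = x" "\<And>x. A (A' x) = x"
    using linear_injective_isomorphism[OF A(1)] by blast
  have "A ` B = D" using A(2) hB B'(1) by (metis image_cong subsetD)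
  moreover have "E = span B" using B(1,3) assms by (simp add: span_minimal subset_antisym)
  ultimately have "A ` E = span D" using linear_span_image[OF A(1), of B] by simp
  then show ?thesis using that[OF A(1) A'(1,3,2) D] by blast
qed

text \<open>No base point is fixed: the upper bounds need the normal space and the Hessian at all
  parameters of one and the same chart.\<close>

locale chart =
  fixes M :: "'a::euclidean_space set" and U V :: "'a set" and \<phi> \<psi> :: "'a \<Rightarrow> 'a" and D :: "'a set"
  assumes open_U: "open U" and open_V: "open V"
    and homeo: "homeomorphism U V \<phi> \<psi>"
    and smooth_phi: "smooth_on U \<phi>" and smooth_psi: "smooth_on V \<psi>"
    and D_subset: "D \<subseteq> Basis"
    and phi_image: "\<phi> ` (M \<inter> U) = span D \<inter> V"

lemma smooth_submanifold_chart:
  fixes M :: "'a::euclidean_space set"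
  assumes "smooth_submanifold m M" "z \<in> M"
  obtains U V \<phi> \<psi> D where "chart M U V \<phi> \<psi> D" "card D = m" "z \<in> U"
proof -
  obtain U V \<phi> \<psi> and E :: "'a set" where c: "open U" "open V" "z \<in> U" "homeomorphism U V \<phi> \<psi>"
    "smooth_on U \<phi>" "smooth_on V \<psi>" "subspace E" "dim E = m" "\<phi> ` (M \<inter> U) = E \<inter> V"
    using assms(1)[unfolded smooth_submanifold_def, rule_format, OF assms(2)]
    by (elim exE conjE) (rule that; assumption)
  obtain A A' and D :: "'a set" where A: "linear A" "linear A'" "\<And>x. A (A' x) = x" "\<And>x. A' (A x) = x"
    "D \<subseteq> Basis" "card D = dim E" "A ` E = span D"
    by (rule exists_linear_iso_coordinate_subspace[OF c(7)]) (rule that; assumption)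
  have bl: "bounded_linear A" "bounded_linear A'"
    using linear_conv_bounded_linear A(1,2) by blast+
  have AV: "A ` V = A' -` V"
  proof (intro equalityI subsetI)
    fix y assume "y \<in> A' -` V"
    then show "y \<in> A ` V" using image_eqI[of y A "A' y" V] A(3) by simp
  qed (use A(4) in auto)
  have AV': "{t. 0 + A' t \<in> V} = A ` V" unfolding AV by auto
  have "chart M U (A ` V) (\<lambda>x. A (\<phi> x)) (\<lambda>x. \<psi> (A' x)) D"
  proof
    show "open (A ` V)" unfolding AV
      using c(2) bl(2) linear_continuous_on[of A' UNIV] open_vimage by blast
    have h: "\<phi> ` U = V" "\<psi> ` V = U" "\<And>x. x \<in> U \<Longrightarrow> \<psi> (\<phi> x) = x" "\<And>x. x \<in> V \<Longrightarrow> \<phi> (\<psi> x) = x"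
      "continuous_on U \<phi>" "continuous_on V \<psi>"
      using c(4) unfolding homeomorphism_def by auto
    show "homeomorphism U (A ` V) (\<lambda>x. A (\<phi> x)) (\<lambda>x. \<psi> (A' x))"
      unfolding homeomorphism_def
    proof (intro conjI ballI)
      show "continuous_on U (\<lambda>x. A (\<phi> x))"
        using bounded_linear.continuous_on[OF bl(1) h(5)] .
      show "continuous_on (A ` V) (\<lambda>x. \<psi> (A' x))"
        by (rule continuous_on_compose2[OF h(6)])
          (use linear_continuous_on[OF bl(2)] A(4) in auto)
    qed (use h A in \<open>auto simp: image_iff\<close>)
    show "smooth_on U (\<lambda>x. A (\<phi> x))" using smooth_on_bounded_linear[OF bl(1) c(5)] .
    show "smooth_on (A ` V) (\<lambda>x. \<psi> (A' x))"
      using smooth_on_affine[OF bl(2) c(6), of 0] unfolding AV' by simp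
    have "(\<lambda>x. A (\<phi> x)) ` (M \<inter> U) = A ` (E \<inter> V)" using c(9) by (metis image_image)
    also have "\<dots> = A ` E \<inter> A ` V"
      by (rule image_Int) (metis A(4) injI)
    finally show "(\<lambda>x. A (\<phi> x)) ` (M \<inter> U) = span D \<inter> A ` V" using A(7) by simp
  qed (use c(1) A(5) in auto)
  from that[OF this _ c(3)] show ?thesis using A(6) c(8) by simp
qed

text \<open>\<open>is_Hessian_on\<close> speaks of the derivative of \<open>deriv\<close>, whereas a
  Taylor expansion in a chart yields the limit of \<open>h t / t^2\<close>; L'Hospital's rule makes
  the two comparable.\<close>

lemma second_order_quotient:
  fixes h h' :: "real \<Rightarrow> real"
  assumes "\<epsilon> > 0" "\<And>t. \<bar>t\<bar> < \<epsilon> \<Longrightarrow> (h has_real_derivative h' t) (at t)"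
    and "h 0 = 0" "h' 0 = 0" "(h' has_real_derivative k) (at 0)"
  shows "((\<lambda>t. h t / t\<^sup>2) \<longlongrightarrow> k / 2) (at 0)"
proof (rule lhopital[where f' = h' and g' = "\<lambda>t. 2 * t"])
  have ev: "eventually (\<lambda>t::real. \<bar>t\<bar> < \<epsilon>) (at 0)"
    using assms(1) by (auto simp: eventually_at intro!: exI[of _ \<epsilon>])
  show "(h \<longlongrightarrow> 0) (at 0)"
    using DERIV_isCont[OF assms(2)[of 0]] assms(1,3) by (auto simp: isCont_def)
  show "((\<lambda>t::real. t\<^sup>2) \<longlongrightarrow> 0) (at 0)" by (auto intro!: tendsto_eq_intros)
  show "\<forall>\<^sub>F x::real in at 0. x\<^sup>2 \<noteq> 0" "\<forall>\<^sub>F x::real in at 0. 2 * x \<noteq> 0"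
    by (auto simp: eventually_at intro!: exI[of _ 1])
  show "\<forall>\<^sub>F x in at 0. (h has_real_derivative h' x) (at x)"
    using ev by eventually_elim (use assms(2) in auto)
  show "\<forall>\<^sub>F x::real in at 0. ((\<lambda>t. t\<^sup>2) has_real_derivative 2 * x) (at x)"
    by (intro always_eventually allI) (auto intro!: derivative_eq_intros)
  have "((\<lambda>t. h' t / t) \<longlongrightarrow> k) (at 0)"
    using assms(5) unfolding has_field_derivative_iff by (simp add: assms(4))
  then have "((\<lambda>t. h' t / t * (1/2)) \<longlongrightarrow> k * (1/2)) (at 0)"
    by (intro tendsto_mult tendsto_const)
  then show "((\<lambda>t. h' t / (2 * t)) \<longlongrightarrow> k / 2) (at 0)" by (simp add: mult.commute)
qed

context chart begin

lemma psi_phi: "z \<in> U \<Longrightarrow> \<psi> (\<phi> z) = z" and phi_psi: "x \<in> V \<Longrightarrow> \<phi> (\<psi> x) = x"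
  and phi_in: "z \<in> U \<Longrightarrow> \<phi> z \<in> V" and psi_in: "x \<in> V \<Longrightarrow> \<psi> x \<in> U"
  using homeo unfolding homeomorphism_def by auto

lemma phi_in_span: "z \<in> M \<Longrightarrow> z \<in> U \<Longrightarrow> \<phi> z \<in> span D"
  using phi_image by auto

lemma psi_in_M: "x \<in> span D \<Longrightarrow> x \<in> V \<Longrightarrow> \<psi> x \<in> M"
proof -
  assume "x \<in> span D" "x \<in> V"
  then have "x \<in> \<phi> ` (M \<inter> U)" using phi_image by simp
  then show "\<psi> x \<in> M" using psi_phi by auto
qed

lemma continuous_phi: "continuous_on U \<phi>" and continuous_psi: "continuous_on V \<psi>"
  using homeo unfolding homeomorphism_def by auto

lemma psi_deriv: "x \<in> V \<Longrightarrow> (\<psi> has_derivative (\<lambda>v. dderiv \<psi> v x)) (at x)"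
  using smooth_on_has_derivative[OF open_V smooth_psi] .

lemma phi_deriv: "z \<in> U \<Longrightarrow> (\<phi> has_derivative (\<lambda>v. dderiv \<phi> v z)) (at z)"
  using smooth_on_has_derivative[OF open_U smooth_phi] .

lemma dphi_dpsi:
  assumes "x \<in> V"
  shows "dderiv \<phi> (dderiv \<psi> v x) (\<psi> x) = v"
proof -
  have "((\<lambda>x. \<phi> (\<psi> x)) has_derivative (\<lambda>v. dderiv \<phi> (dderiv \<psi> v x) (\<psi> x))) (at x)"
    using has_derivative_compose[OF psi_deriv[OF assms] phi_deriv[OF psi_in[OF assms]]] .
  moreover have "((\<lambda>x. \<phi> (\<psi> x)) has_derivative (\<lambda>v. v)) (at x)"
    by (rule has_derivative_transform_within_open[OF has_derivative_ident open_V assms])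
      (simp add: phi_psi)
  ultimately show ?thesis using has_derivative_unique by metis
qed

lemma dpsi_dphi:
  assumes "z \<in> U"
  shows "dderiv \<psi> (dderiv \<phi> v z) (\<phi> z) = v"
proof -
  have "((\<lambda>x. \<psi> (\<phi> x)) has_derivative (\<lambda>v. dderiv \<psi> (dderiv \<phi> v z) (\<phi> z))) (at z)"
    using has_derivative_compose[OF phi_deriv[OF assms] psi_deriv[OF phi_in[OF assms]]] .
  moreover have "((\<lambda>x. \<psi> (\<phi> x)) has_derivative (\<lambda>v. v)) (at z)"
    by (rule has_derivative_transform_within_open[OF has_derivative_ident open_U assms])
      (simp add: psi_phi)
  ultimately show ?thesis using has_derivative_unique by metis
qed

lemma smooth_curve_line:
  assumes "x \<in> span D" "x \<in> V" "e \<in> span D"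
  shows "smooth_curve_in M (\<psi> x) (dderiv \<psi> e x) (\<lambda>t. \<psi> (x + t *\<^sub>R e))"
proof -
  let ?B = "\<lambda>t::real. t *\<^sub>R e"
  have bl: "bounded_linear ?B" by (rule bounded_linear_scaleR_left)
  have "open ((\<lambda>t. x + ?B t) -` V)"
    by (intro open_vimage open_V continuous_intros)
  then obtain \<epsilon> where \<epsilon>: "\<epsilon> > 0" "ball 0 \<epsilon> \<subseteq> (\<lambda>t. x + ?B t) -` V"
    using assms(2) by (force simp: open_contains_ball)
  have sub: "{-\<epsilon><..<\<epsilon>} \<subseteq> {t. x + ?B t \<in> V}"
    using \<epsilon>(2) by (auto simp: subset_eq dist_real_def)
  have "smooth_on {-\<epsilon><..<\<epsilon>} (\<lambda>t. \<psi> (x + ?B t))"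
    using smooth_on_subset[OF smooth_on_affine[OF bl smooth_psi, of x] sub] .
  moreover have "(\<lambda>t. \<psi> (x + ?B t)) ` {-\<epsilon><..<\<epsilon>} \<subseteq> M"
    using sub psi_in_M assms by (auto intro!: psi_in_M span_add span_scale)
  moreover have "((\<lambda>t. \<psi> (x + ?B t)) has_vector_derivative dderiv \<psi> e x) (at 0)"
    using smooth_on_line[OF open_V smooth_psi, of x 0 e UNIV] assms by simp
  ultimately show ?thesis unfolding smooth_curve_in_def using \<epsilon>(1)
    by (intro conjI exI[of _ \<epsilon>]) simp_all
qed

lemma curve_in_U:
  assumes "smooth_curve_in M z v \<gamma>" "z \<in> U"
  obtains \<epsilon> where "\<epsilon> > 0" "smooth_on {-\<epsilon><..<\<epsilon>} \<gamma>" "\<And>t. \<bar>t\<bar> < \<epsilon> \<Longrightarrow> \<gamma> t \<in> M \<inter> U"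
proof -
  obtain \<epsilon> where \<epsilon>: "\<epsilon> > 0" "smooth_on {-\<epsilon><..<\<epsilon>} \<gamma>" "\<gamma> ` {-\<epsilon><..<\<epsilon>} \<subseteq> M" "\<gamma> 0 = z"
    using assms(1)[unfolded smooth_curve_in_def] by (elim conjE exE) (rule that; assumption)
  have "open ({-\<epsilon><..<\<epsilon>} \<inter> \<gamma> -` U)"
    using continuous_open_preimage[OF smooth_on_continuous_on[OF \<epsilon>(2)] _ open_U] by auto
  moreover have "0 \<in> {-\<epsilon><..<\<epsilon>} \<inter> \<gamma> -` U" using \<epsilon>(1,4) assms(2) by simp
  ultimately obtain \<delta> where \<delta>: "\<delta> > 0" "ball 0 \<delta> \<subseteq> {-\<epsilon><..<\<epsilon>} \<inter> \<gamma> -` U"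
    by (rule openE)
  have sub: "t \<in> {-\<epsilon><..<\<epsilon>} \<inter> \<gamma> -` U" if "\<bar>t\<bar> < \<delta>" for t
    using \<delta>(2) that by (auto simp: subset_eq dist_real_def)
  show ?thesis
  proof (rule that[OF \<delta>(1)])
    show "smooth_on {-\<delta><..<\<delta>} \<gamma>" by (rule smooth_on_subset[OF \<epsilon>(2)]) (use sub in fastforce)
    show "\<And>t. \<bar>t\<bar> < \<delta> \<Longrightarrow> \<gamma> t \<in> M \<inter> U" using sub \<epsilon>(3) by fastforce
  qed
qed

lemma phi_curve_quotient:
  assumes "smooth_curve_in M z v \<gamma>" "z \<in> U"
  shows "((\<lambda>t. (1/t) *\<^sub>R (\<phi> (\<gamma> t) - \<phi> z)) \<longlongrightarrow> dderiv \<phi> v z) (at 0)"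
proof -
  have \<gamma>: "\<gamma> 0 = z" "(\<gamma> has_derivative (\<lambda>t. t *\<^sub>R v)) (at 0)"
    using assms(1) unfolding smooth_curve_in_def has_vector_derivative_def by auto
  have "((\<lambda>t. \<phi> (\<gamma> t)) has_derivative (\<lambda>t. dderiv \<phi> (t *\<^sub>R v) z)) (at 0)"
    using has_derivative_compose[OF \<gamma>(2)] phi_deriv[OF assms(2)] \<gamma>(1) by auto
  then have "((\<lambda>t. \<phi> (\<gamma> t)) has_vector_derivative dderiv \<phi> v z) (at 0)"
    unfolding has_vector_derivative_def
    using linear_cmul[OF linear_dderiv[OF open_U smooth_phi assms(2)]] by simp
  then have "((\<lambda>h. norm (\<phi> (\<gamma> (0 + h)) - \<phi> (\<gamma> 0) - h *\<^sub>R dderiv \<phi> v z) / norm h) \<longlongrightarrow> 0) (at 0)"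
    unfolding has_vector_derivative_def has_derivative_at by blast
  then have "((\<lambda>t. norm ((1/t) *\<^sub>R (\<phi> (\<gamma> t) - \<phi> z) - dderiv \<phi> v z)) \<longlongrightarrow> 0) (at 0)"
  proof (rule Lim_transform_eventually)
    have "eventually (\<lambda>t::real. t \<noteq> 0) (at 0)" by (simp add: eventually_at_filter)
    then show "\<forall>\<^sub>F t in at 0. norm (\<phi> (\<gamma> (0 + t)) - \<phi> (\<gamma> 0) - t *\<^sub>R dderiv \<phi> v z) / norm t
        = norm ((1/t) *\<^sub>R (\<phi> (\<gamma> t) - \<phi> z) - dderiv \<phi> v z)"
    proof eventually_elim
      case (elim t)
      have "(1/t) *\<^sub>R (\<phi> (\<gamma> t) - \<phi> z) - dderiv \<phi> v z
          = (1/t) *\<^sub>R (\<phi> (\<gamma> (0 + t)) - \<phi> (\<gamma> 0) - t *\<^sub>R dderiv \<phi> v z)"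
        using elim \<gamma>(1) by (simp add: scaleR_diff_right)
      then show ?case by (simp add: divide_inverse mult.commute)
    qed
  qed
  then have "((\<lambda>t. (1/t) *\<^sub>R (\<phi> (\<gamma> t) - \<phi> z) - dderiv \<phi> v z) \<longlongrightarrow> 0) (at 0)"
    by (simp only: tendsto_norm_zero_iff)
  then show ?thesis by (rule Lim_null[THEN iffD2])
qed

text \<open>One inclusion uses the images of straight lines. For the other, the chart velocity of
  any curve in \<open>M\<close> is a limit of difference quotients lying in \<open>span D\<close>,
  and this subspace is closed.\<close>

lemma tangent_space_eq:
  assumes "x \<in> span D" "x \<in> V"
  shows "tangent_space M (\<psi> x) = (\<lambda>e. dderiv \<psi> e x) ` span D"
proof (intro equalityI subsetI)
  fix v assume "v \<in> (\<lambda>e. dderiv \<psi> e x) ` span D"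
  then show "v \<in> tangent_space M (\<psi> x)"
    unfolding tangent_space_def using smooth_curve_line[OF assms] by auto
next
  fix v assume "v \<in> tangent_space M (\<psi> x)"
  then obtain \<gamma> where \<gamma>: "smooth_curve_in M (\<psi> x) v \<gamma>" unfolding tangent_space_def by auto
  have U: "\<psi> x \<in> U" using psi_in assms by auto
  obtain \<epsilon> where \<epsilon>: "\<epsilon> > 0" "\<And>t. \<bar>t\<bar> < \<epsilon> \<Longrightarrow> \<gamma> t \<in> M \<inter> U"
    using curve_in_U[OF \<gamma> U] by metis
  have "dderiv \<phi> v (\<psi> x) \<in> span D"
  proof (rule Lim_in_closed_set[OF closed_span _ _ phi_curve_quotient[OF \<gamma> U]])
    have "eventually (\<lambda>t::real. \<bar>t\<bar> < \<epsilon>) (at 0)"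
      using \<epsilon>(1) by (auto simp: eventually_at intro!: exI[of _ \<epsilon>])
    then show "\<forall>\<^sub>F t in at 0. (1 / t) *\<^sub>R (\<phi> (\<gamma> t) - \<phi> (\<psi> x)) \<in> span D"
      by eventually_elim (use \<epsilon>(2) phi_in_span assms in \<open>auto intro!: span_scale span_diff simp: phi_psi\<close>)
  qed auto
  moreover have "v = dderiv \<psi> (dderiv \<phi> v (\<psi> x)) x"
    using dpsi_dphi[OF U] phi_psi assms by simp
  ultimately show "v \<in> (\<lambda>e. dderiv \<psi> e x) ` span D" by blast
qed

text \<open>The Hessian at \<open>\<psi> x\<close> of the height \<open>\<zeta> \<bullet> z\<close>
  in chart coordinates, when \<open>\<zeta>\<close> is normal there. It is symmetrised by hand, so
  that symmetry holds by construction; the equality of mixed derivatives enters only in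
  \<open>phase_dichotomy\<close>.\<close>

definition hess :: "'a \<Rightarrow> 'a \<Rightarrow> 'a \<Rightarrow> 'a \<Rightarrow> real" where
  "hess x \<zeta> u e = \<zeta> \<bullet> (dderiv (dderiv \<psi> u) e x + dderiv (dderiv \<psi> e) u x) / 2"

lemma bilinear_dderiv2:
  assumes "x \<in> V"
  shows "bilinear (\<lambda>u e. dderiv (dderiv \<psi> u) e x)"
  unfolding bilinear_def
  using linear_dderiv2[OF open_V smooth_psi assms]
    linear_dderiv[OF open_V smooth_on_dderiv[OF open_V smooth_psi] assms] by auto

lemma bilinear_hess:
  assumes "x \<in> V"
  shows "bilinear (hess x \<zeta>)"
  using bilinear_dderiv2[OF assms] unfolding bilinear_def linear_iff hess_def
  by (simp add: inner_add_right algebra_simps add_divide_distrib)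

lemma hess_sym: "hess x \<zeta> u e = hess x \<zeta> e u"
  unfolding hess_def by (simp add: add.commute)

lemma hess_diag: "hess x \<zeta> u u = \<zeta> \<bullet> dderiv (dderiv \<psi> u) u x"
  unfolding hess_def by (simp add: inner_add_right)

lemma normal_dpsi:
  assumes "x \<in> span D" "x \<in> V" "\<zeta> \<in> (tangent_space M (\<psi> x))\<^sup>\<bottom>" "e \<in> span D"
  shows "\<zeta> \<bullet> dderiv \<psi> e x = 0"
  using assms tangent_space_eq[OF assms(1,2)]
  by (auto simp: orthogonal_comp_def orthogonal_def inner_commute)

text \<open>The expansion of \<open>\<psi>\<close> at \<open>x\<close> is applied to the increment
  \<open>?u t\<close>. Its linear term disappears because \<open>?u t\<close> lies in
  \<open>span D\<close> and \<open>\<zeta>\<close> is normal. After division by \<open>t^2\<close>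
  the quadratic term converges by continuity of the bilinear map, and the cubic remainder is
  \<open>norm (?u t)\<close> times a convergent factor.\<close>

lemma height_second_order:
  assumes "x \<in> span D" "x \<in> V" "\<zeta> \<in> (tangent_space M (\<psi> x))\<^sup>\<bottom>"
    and \<gamma>: "smooth_curve_in M (\<psi> x) v \<gamma>"
  shows "((\<lambda>t. \<zeta> \<bullet> (\<gamma> t - \<psi> x) / t\<^sup>2) \<longlongrightarrow> hess x \<zeta> (dderiv \<phi> v (\<psi> x)) (dderiv \<phi> v (\<psi> x)) / 2) (at 0)"
proof -
  have U: "\<psi> x \<in> U" using psi_in assms by auto
  obtain \<epsilon> where \<epsilon>: "\<epsilon> > 0" "\<And>t. \<bar>t\<bar> < \<epsilon> \<Longrightarrow> \<gamma> t \<in> M \<inter> U"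
    using curve_in_U[OF \<gamma> U] by metis
  obtain R where R: "R > 0" "cball x R \<subseteq> V" using open_V assms(2) open_contains_cball by blast
  obtain L where L: "L > 0"
    "\<And>y y'. y \<in> cball x R \<Longrightarrow> y' \<in> cball x R \<Longrightarrow>
       norm (\<psi> y' - \<psi> y - dderiv \<psi> (y' - y) y - (1/2) *\<^sub>R dderiv (dderiv \<psi> (y' - y)) (y' - y) y)
         \<le> L * norm (y' - y) ^ 3"
    using smooth_on_taylor2[OF open_V smooth_psi R(2)] by blast
  let ?u = "\<lambda>t. \<phi> (\<gamma> t) - x"
  let ?w = "dderiv \<phi> v (\<psi> x)"
  let ?Q = "\<lambda>u e. dderiv (dderiv \<psi> u) e x"
  have bb: "bounded_bilinear ?Q"
    using bilinear_dderiv2[OF assms(2)] bilinear_conv_bounded_bilinear by blast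
  have quot: "((\<lambda>t. (1/t) *\<^sub>R ?u t) \<longlongrightarrow> ?w) (at 0)"
    using phi_curve_quotient[OF \<gamma> U] phi_psi[OF assms(2)] by simp
  have "((\<lambda>t. t *\<^sub>R ((1/t) *\<^sub>R ?u t)) \<longlongrightarrow> 0 *\<^sub>R ?w) (at 0)"
    by (intro tendsto_scaleR quot tendsto_ident_at)
  then have "((\<lambda>t. t *\<^sub>R ((1/t) *\<^sub>R ?u t)) \<longlongrightarrow> 0) (at 0)" by (simp only: scale_zero_left)
  then have u0: "(?u \<longlongrightarrow> 0) (at 0)"
    by (rule Lim_transform_eventually) (auto simp: eventually_at intro!: exI[of _ 1])
  have evt: "eventually (\<lambda>t::real. \<bar>t\<bar> < \<epsilon>) (at 0)"
    using \<epsilon>(1) by (auto simp: eventually_at intro!: exI[of _ \<epsilon>])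
  have evu: "eventually (\<lambda>t. norm (?u t) < R) (at 0)"
    using tendstoD[OF u0 R(1)] by (simp add: dist_norm)
  have ev0: "eventually (\<lambda>t::real. t \<noteq> 0) (at 0)" by (simp add: eventually_at_filter)
  have main: "((\<lambda>t. \<zeta> \<bullet> ?Q ((1/t) *\<^sub>R ?u t) ((1/t) *\<^sub>R ?u t) / 2) \<longlongrightarrow> \<zeta> \<bullet> ?Q ?w ?w / 2) (at 0)"
    by (intro tendsto_intros bounded_bilinear.tendsto[OF bb] quot) auto
  have "((\<lambda>t. norm \<zeta> * L * (norm (?u t) * (norm ((1/t) *\<^sub>R ?u t))\<^sup>2)) \<longlongrightarrow> norm \<zeta> * L * (norm (0::'a) * (norm ?w)\<^sup>2)) (at 0)"
    by (intro tendsto_intros quot u0)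
  then have err0: "((\<lambda>t. norm \<zeta> * L * (norm (?u t) * (norm ((1/t) *\<^sub>R ?u t))\<^sup>2)) \<longlongrightarrow> 0) (at 0)" by simp
  have "\<forall>\<^sub>F t in at 0. norm (\<zeta> \<bullet> (\<gamma> t - \<psi> x) / t\<^sup>2 - \<zeta> \<bullet> ?Q ((1/t) *\<^sub>R ?u t) ((1/t) *\<^sub>R ?u t) / 2)
      \<le> norm \<zeta> * L * (norm (?u t) * (norm ((1/t) *\<^sub>R ?u t))\<^sup>2)"
    using evt evu ev0
  proof eventually_elim
    case (elim t)
    have g: "\<gamma> t \<in> M" "\<gamma> t \<in> U" using \<epsilon>(2)[OF elim(1)] by auto
    have us: "?u t \<in> span D" using phi_in_span[OF g] assms(1) span_diff by blast
    have "norm (\<psi> (\<phi> (\<gamma> t)) - \<psi> x - dderiv \<psi> (?u t) x - (1/2) *\<^sub>R ?Q (?u t) (?u t)) \<le> L * norm (?u t) ^ 3"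
      using L(2)[of x "\<phi> (\<gamma> t)"] elim(2) R(1) by (simp add: dist_norm norm_minus_commute)
    moreover have "\<zeta> \<bullet> (\<gamma> t - \<psi> x) - \<zeta> \<bullet> ?Q (?u t) (?u t) / 2
        = \<zeta> \<bullet> (\<psi> (\<phi> (\<gamma> t)) - \<psi> x - dderiv \<psi> (?u t) x - (1/2) *\<^sub>R ?Q (?u t) (?u t))"
      using normal_dpsi[OF assms(1-3) us] psi_phi[OF g(2)] by (simp add: inner_diff_right)
    ultimately have "\<bar>\<zeta> \<bullet> (\<gamma> t - \<psi> x) - \<zeta> \<bullet> ?Q (?u t) (?u t) / 2\<bar> \<le> norm \<zeta> * (L * norm (?u t) ^ 3)"
      using order_trans[OF Cauchy_Schwarz_ineq2 mult_left_mono[OF _ norm_ge_zero[of \<zeta>]]] by presburger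
    then have "\<bar>\<zeta> \<bullet> (\<gamma> t - \<psi> x) - \<zeta> \<bullet> ?Q (?u t) (?u t) / 2\<bar> / t\<^sup>2 \<le> norm \<zeta> * (L * norm (?u t) ^ 3) / t\<^sup>2"
      by (intro divide_right_mono) auto
    moreover have "?Q ((1/t) *\<^sub>R ?u t) ((1/t) *\<^sub>R ?u t) = (1/t\<^sup>2) *\<^sub>R ?Q (?u t) (?u t)"
      using bilinear_lmul[OF bilinear_dderiv2[OF assms(2)]] bilinear_rmul[OF bilinear_dderiv2[OF assms(2)]]
      by (simp add: power2_eq_square)
    ultimately have "\<bar>\<zeta> \<bullet> (\<gamma> t - \<psi> x) / t\<^sup>2 - \<zeta> \<bullet> ?Q ((1/t) *\<^sub>R ?u t) ((1/t) *\<^sub>R ?u t) / 2\<bar>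
        \<le> norm \<zeta> * (L * norm (?u t) ^ 3) / t\<^sup>2"
    proof -
      have eq: "a / t\<^sup>2 - 1 / t\<^sup>2 * q / 2 = (a - q / 2) / t\<^sup>2" for a q :: real
        by (simp add: diff_divide_distrib)
      assume *: "\<bar>\<zeta> \<bullet> (\<gamma> t - \<psi> x) - \<zeta> \<bullet> ?Q (?u t) (?u t) / 2\<bar> / t\<^sup>2 \<le> norm \<zeta> * (L * norm (?u t) ^ 3) / t\<^sup>2"
        and **: "?Q ((1/t) *\<^sub>R ?u t) ((1/t) *\<^sub>R ?u t) = (1/t\<^sup>2) *\<^sub>R ?Q (?u t) (?u t)"
      show ?thesis unfolding ** inner_scaleR_right eq using * by (simp add: abs_divide)
    qed
    also have "\<dots> = norm \<zeta> * L * (norm (?u t) * (norm ((1/t) *\<^sub>R ?u t))\<^sup>2)"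
      by (simp add: power2_eq_square power3_eq_cube)
    finally show ?case by simp
  qed
  then have "((\<lambda>t. \<zeta> \<bullet> (\<gamma> t - \<psi> x) / t\<^sup>2 - \<zeta> \<bullet> ?Q ((1/t) *\<^sub>R ?u t) ((1/t) *\<^sub>R ?u t) / 2) \<longlongrightarrow> 0) (at 0)"
    by (rule Lim_null_comparison[OF _ err0])
  from tendsto_add[OF this main] show ?thesis by (simp add: hess_diag)
qed

lemma height_critical:
  assumes "x \<in> span D" "x \<in> V" "\<zeta> \<in> (tangent_space M (\<psi> x))\<^sup>\<bottom>"
    and \<gamma>: "smooth_curve_in M (\<psi> x) v \<gamma>"
  shows "(((\<lambda>z. \<zeta> \<bullet> (z - \<psi> x)) \<circ> \<gamma>) has_real_derivative 0) (at 0)"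
proof -
  have "v \<in> tangent_space M (\<psi> x)" using \<gamma> unfolding tangent_space_def by blast
  then have "\<zeta> \<bullet> v = 0" using assms(3) by (auto simp: orthogonal_comp_def orthogonal_def inner_commute)
  moreover have "(\<gamma> has_derivative (\<lambda>t. t *\<^sub>R v)) (at 0)"
    using \<gamma> unfolding smooth_curve_in_def has_vector_derivative_def by blast
  then have "((\<lambda>t. \<zeta> \<bullet> (\<gamma> t - \<psi> x)) has_derivative (\<lambda>t. \<zeta> \<bullet> (t *\<^sub>R v))) (at 0)"
    by (auto intro!: derivative_eq_intros)
  ultimately show ?thesis
    unfolding has_field_derivative_def o_def by (simp add: lambda_zero)
qed

text \<open>The second derivative exists because \<open>\<gamma>\<close> is smooth; its value is
  identified without a second-order chain rule, by comparing two expressions for the limit of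
  \<open>h t / t^2\<close>.\<close>

lemma height_hessian:
  assumes "x \<in> span D" "x \<in> V" "\<zeta> \<in> (tangent_space M (\<psi> x))\<^sup>\<bottom>"
    and \<gamma>: "smooth_curve_in M (\<psi> x) v \<gamma>"
  shows "(deriv ((\<lambda>z. \<zeta> \<bullet> (z - \<psi> x)) \<circ> \<gamma>) has_real_derivative
     hess x \<zeta> (dderiv \<phi> v (\<psi> x)) (dderiv \<phi> v (\<psi> x))) (at 0)"
proof -
  have U: "\<psi> x \<in> U" using psi_in assms by auto
  obtain \<epsilon> where \<epsilon>: "\<epsilon> > 0" "smooth_on {-\<epsilon><..<\<epsilon>} \<gamma>"
    using curve_in_U[OF \<gamma> U] by metis
  let ?I = "{-\<epsilon><..<\<epsilon>}"
  define h where "h = (\<lambda>z. \<zeta> \<bullet> (z - \<psi> x)) \<circ> \<gamma>"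
  have vd: "(g has_vector_derivative dderiv g 1 t) (at t)" if "smooth_on ?I g" "t \<in> ?I" for g :: "real \<Rightarrow> 'a" and t
    using smooth_on_line[OF _ that(1), of 0 t 1 UNIV] that(2) by simp
  have hd: "(h has_real_derivative \<zeta> \<bullet> dderiv \<gamma> 1 t) (at t)" if "t \<in> ?I" for t
  proof -
    have "(\<gamma> has_derivative (\<lambda>s. s *\<^sub>R dderiv \<gamma> 1 t)) (at t)"
      using vd[OF \<epsilon>(2) that] unfolding has_vector_derivative_def .
    then show ?thesis unfolding has_field_derivative_def h_def o_def
      by (auto intro!: derivative_eq_intros simp: mult.commute)
  qed
  have hd': "deriv h t = \<zeta> \<bullet> dderiv \<gamma> 1 t" if "t \<in> ?I" for t
    using DERIV_imp_deriv[OF hd[OF that]] .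
  let ?k = "\<zeta> \<bullet> dderiv (dderiv \<gamma> 1) 1 0"
  have "(dderiv \<gamma> 1 has_derivative (\<lambda>s. s *\<^sub>R dderiv (dderiv \<gamma> 1) 1 0)) (at 0)"
    using vd[OF smooth_on_dderiv[OF _ \<epsilon>(2)], of 0] \<epsilon>(1) unfolding has_vector_derivative_def by simp
  then have "((\<lambda>t. \<zeta> \<bullet> dderiv \<gamma> 1 t) has_real_derivative ?k) (at 0)"
    unfolding has_field_derivative_def by (auto intro!: derivative_eq_intros simp: mult.commute)
  then have hk: "(deriv h has_real_derivative ?k) (at 0)"
    by (rule DERIV_cong_ev[THEN iffD1, rotated 3])
      (use \<epsilon>(1) hd' in \<open>auto intro!: eventually_nhds_in_open[THEN eventually_mono, of ?I]\<close>)
  have "\<gamma> 0 = \<psi> x" using \<gamma> unfolding smooth_curve_in_def by auto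
  then have h0: "h 0 = 0" unfolding h_def by simp
  have h0': "deriv h 0 = 0"
    using height_critical[OF assms] DERIV_imp_deriv unfolding h_def by blast
  have "((\<lambda>t. h t / t\<^sup>2) \<longlongrightarrow> ?k / 2) (at 0)"
    by (rule second_order_quotient[where h = h and h' = "deriv h", OF \<epsilon>(1) _ h0 h0' hk])
      (metis abs_less_iff greaterThanLessThan_iff hd hd' minus_less_iff)
  moreover have "((\<lambda>t. h t / t\<^sup>2) \<longlongrightarrow> hess x \<zeta> (dderiv \<phi> v (\<psi> x)) (dderiv \<phi> v (\<psi> x)) / 2) (at 0)"
    using height_second_order[OF assms] unfolding h_def by simp
  ultimately have "?k / 2 = hess x \<zeta> (dderiv \<phi> v (\<psi> x)) (dderiv \<phi> v (\<psi> x)) / 2"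
    by (rule tendsto_unique[rotated]) simp
  then show ?thesis using hk unfolding h_def by simp
qed

text \<open>The pullback \<open>B\<close> of \<open>hess\<close> by the derivative of
  \<open>\<phi>\<close> is one admissible Hessian, and by polarization every other one agrees with
  it on the tangent space, so the existential in the definition can be tested on \<open>B\<close>
  alone. The derivative of \<open>\<psi>\<close> then carries \<open>span D\<close> onto the tangent
  space.\<close>

lemma nondegenerate_critical_point_iff:
  assumes "x \<in> span D" "x \<in> V" "\<zeta> \<in> (tangent_space M (\<psi> x))\<^sup>\<bottom>"
  shows "nondegenerate_critical_point_on M (\<lambda>z. \<zeta> \<bullet> (z - \<psi> x)) (\<psi> x) \<longleftrightarrow>
    (\<forall>u\<in>span D. (\<forall>e\<in>span D. hess x \<zeta> u e = 0) \<longrightarrow> u = 0)"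
proof -
  define T where "T = tangent_space M (\<psi> x)"
  define A where "A v = dderiv \<phi> v (\<psi> x)" for v
  define A' where "A' v = dderiv \<psi> v x" for v
  have linA: "linear A" unfolding A_def using linear_dderiv[OF open_U smooth_phi psi_in[OF assms(2)]] .
  have linA': "linear A'" unfolding A'_def using linear_dderiv[OF open_V smooth_psi assms(2)] .
  have AA': "A (A' v) = v" for v unfolding A_def A'_def using dphi_dpsi[OF assms(2)] .
  have T: "T = A' ` span D" unfolding T_def A'_def using tangent_space_eq[OF assms(1,2)] .
  define B where "B v w = hess x \<zeta> (A v) (A w)" for v w
  have bilB: "bilinear B"
    using bilinear_hess[OF assms(2), of \<zeta>] linA unfolding bilinear_def B_def linear_iff by simp
  have HB: "is_Hessian_on M (\<lambda>z. \<zeta> \<bullet> (z - \<psi> x)) (\<psi> x) B"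
    unfolding is_Hessian_on_def
    using bilB hess_sym height_hessian[OF assms] unfolding B_def A_def by metis
  have crit: "critical_point_on M (\<lambda>z. \<zeta> \<bullet> (z - \<psi> x)) (\<psi> x)"
    unfolding critical_point_on_def using psi_in_M height_critical assms by blast
  have uniq: "B' v w = B v w" if H: "is_Hessian_on M (\<lambda>z. \<zeta> \<bullet> (z - \<psi> x)) (\<psi> x) B'" and vw: "v \<in> T" "w \<in> T"
    for B' v w
  proof -
    have diag: "B' v v = B v v" if "v \<in> T" for v
    proof -
      obtain \<gamma> where \<gamma>: "smooth_curve_in M (\<psi> x) v \<gamma>" using \<open>v \<in> T\<close> unfolding T_def tangent_space_def by blast
      show ?thesis using H HB \<gamma> unfolding is_Hessian_on_def by (metis DERIV_unique)
    qed
    have bil: "bilinear B'" and sym: "B' v w = B' w v"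
      using H vw unfolding is_Hessian_on_def T_def by auto
    have symB: "B v w = B w v" unfolding B_def using hess_sym by blast
    \<comment> \<open>Polarization needs the tangent space to be closed under addition; this is
      visible from its description as an image of \<open>span D\<close>, not from curves.\<close>
    have "v + w \<in> T" using vw unfolding T
      by (auto simp: linear_add[OF linA', symmetric] intro!: imageI span_add)
    from diag[OF this] diag[OF vw(1)] diag[OF vw(2)] show ?thesis
      using bil bilB sym symB by (simp add: bilinear_ladd bilinear_radd)
  qed
  have "nondegenerate_critical_point_on M (\<lambda>z. \<zeta> \<bullet> (z - \<psi> x)) (\<psi> x) \<longleftrightarrow> nondegenerate_form_on T B"
    unfolding nondegenerate_critical_point_on_def
  proof (intro iffI conjI crit)
    assume "nondegenerate_form_on T B"
    then show "\<exists>B. is_Hessian_on M (\<lambda>z. \<zeta> \<bullet> (z - \<psi> x)) (\<psi> x) B \<and> nondegenerate_form_on (tangent_space M (\<psi> x)) B"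
      using HB unfolding T_def by blast
  next
    assume "critical_point_on M (\<lambda>z. \<zeta> \<bullet> (z - \<psi> x)) (\<psi> x) \<and>
      (\<exists>B. is_Hessian_on M (\<lambda>z. \<zeta> \<bullet> (z - \<psi> x)) (\<psi> x) B \<and> nondegenerate_form_on (tangent_space M (\<psi> x)) B)"
    then obtain B' where B': "is_Hessian_on M (\<lambda>z. \<zeta> \<bullet> (z - \<psi> x)) (\<psi> x) B'" "nondegenerate_form_on T B'"
      unfolding T_def by blast
    show "nondegenerate_form_on T B"
      using B'(2) uniq[OF B'(1)] unfolding nondegenerate_form_on_def by auto
  qed
  also have "\<dots> \<longleftrightarrow> (\<forall>u\<in>span D. (\<forall>e\<in>span D. hess x \<zeta> u e = 0) \<longrightarrow> u = 0)"
    unfolding nondegenerate_form_on_def T B_def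
    using AA' linear_0[OF linA'] by (simp add: ball_simps) (metis AA')
  finally show ?thesis .
qed

end


section \<open>The Hausdorff dimension of a submanifold\<close>

text \<open>Points are sorted by the integer parts of their rescaled coordinates and one point is
  chosen from each occupied cell, so the net lies in \<open>X\<close> itself. The radii may depend
  on \<open>v\<close>, as caps of unequal widths require. The summand 2 accounts for rounding in the
  number of possible integer parts.\<close>

lemma finite_grid_net:
  fixes g :: "'x \<Rightarrow> 'v \<Rightarrow> real"
  assumes "finite B" "\<And>v. v \<in> B \<Longrightarrow> r v > 0"
    and "\<And>x v. x \<in> X \<Longrightarrow> v \<in> B \<Longrightarrow> \<bar>g x v - c v\<bar> \<le> l v"
    and l: "\<And>v. v \<in> B \<Longrightarrow> l v \<ge> 0"
  shows "\<exists>F\<subseteq>X. finite F \<and> real (card F) \<le> (\<Prod>v\<in>B. 2 * l v / r v + 2) \<and>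
    (\<forall>x\<in>X. \<exists>y\<in>F. \<forall>v\<in>B. \<bar>g x v - g y v\<bar> \<le> r v)"
proof (cases "X = {}")
  case True
  show ?thesis
  proof (intro exI[of _ "{}"] conjI)
    have "0 \<le> 2 * l v / r v + 2" if "v \<in> B" for v
      using l[OF that] assms(2)[OF that] by (intro add_nonneg_nonneg divide_nonneg_pos) auto
    then show "real (card {}) \<le> (\<Prod>v\<in>B. 2 * l v / r v + 2)" by (simp add: prod_nonneg)
  qed (use True in auto)
next
  case False
  define h where "h x = restrict (\<lambda>v. \<lfloor>(g x v - c v) / r v\<rfloor>) B" for x
  define K where "K v = {\<lfloor>- l v / r v\<rfloor>..\<lfloor>l v / r v\<rfloor>}" for v
  have hK: "h ` X \<subseteq> PiE B K"
  proof
    fix k assume "k \<in> h ` X"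
    then obtain x where x: "x \<in> X" "k = h x" by auto
    have "\<lfloor>(g x v - c v) / r v\<rfloor> \<in> K v" if v: "v \<in> B" for v
    proof -
      have "- l v \<le> g x v - c v" "g x v - c v \<le> l v" using assms(3)[OF x(1) v] by auto
      then have "(- l v) / r v \<le> (g x v - c v) / r v" "(g x v - c v) / r v \<le> l v / r v"
        using assms(2)[OF v] divide_right_mono[of "- l v" "g x v - c v" "r v"]
          divide_right_mono[of "g x v - c v" "l v" "r v"] by simp_all
      then show ?thesis unfolding K_def by (simp add: floor_mono)
    qed
    then show "k \<in> PiE B K" unfolding x(2) h_def by auto
  qed
  have finK: "finite (PiE B K)" using assms(1) by (intro finite_PiE) (auto simp: K_def)
  have finh: "finite (h ` X)" using hK finK finite_subset by blast
  have cardK: "real (card (K v)) \<le> 2 * l v / r v + 2" if v: "v \<in> B" for v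
  proof -
    have "real (card (K v)) = of_int (\<lfloor>l v / r v\<rfloor> - \<lfloor>- l v / r v\<rfloor> + 1)"
    proof -
      have "- l v / r v \<le> l v / r v" using l[OF v] assms(2)[OF v] by (intro divide_right_mono) auto
      then have "\<lfloor>- l v / r v\<rfloor> \<le> \<lfloor>l v / r v\<rfloor>" by (rule floor_mono)
      then show ?thesis unfolding K_def by simp
    qed
    also have "\<dots> \<le> 2 * l v / r v + 2" by simp linarith
    finally show ?thesis .
  qed
  define F where "F = (\<lambda>k. SOME x. x \<in> X \<and> h x = k) ` (h ` X)"
  have some: "(SOME y. y \<in> X \<and> h y = h x) \<in> X \<and> h (SOME y. y \<in> X \<and> h y = h x) = h x" if "x \<in> X" for x
    by (rule someI[of _ x]) (use that in auto)
  have "card F \<le> card (h ` X)" unfolding F_def by (rule card_image_le[OF finh])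
  also have "\<dots> \<le> card (PiE B K)" by (rule card_mono[OF finK hK])
  also have "\<dots> = (\<Prod>v\<in>B. card (K v))" by (rule card_PiE[OF assms(1)])
  finally have "real (card F) \<le> (\<Prod>v\<in>B. real (card (K v)))" by (metis of_nat_le_iff of_nat_prod)
  also have "\<dots> \<le> (\<Prod>v\<in>B. 2 * l v / r v + 2)" by (intro prod_mono) (auto simp: cardK)
  finally have cF: "real (card F) \<le> (\<Prod>v\<in>B. 2 * l v / r v + 2)" .
  show ?thesis
  proof (intro exI[of _ F] conjI ballI)
    show "F \<subseteq> X" using some unfolding F_def by auto
    show "finite F" unfolding F_def using finh by blast
    fix x assume x: "x \<in> X"
    define y where "y = (SOME y. y \<in> X \<and> h y = h x)"
    have y: "y \<in> F" "h y = h x" using x some[OF x] unfolding F_def y_def by auto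
    show "\<exists>y\<in>F. \<forall>v\<in>B. \<bar>g x v - g y v\<bar> \<le> r v"
    proof (intro bexI[OF _ y(1)] ballI)
      fix v assume v: "v \<in> B"
      have "\<lfloor>(g x v - c v) / r v\<rfloor> = \<lfloor>(g y v - c v) / r v\<rfloor>"
        using fun_cong[OF y(2), of v] v unfolding h_def by simp
      then have "\<bar>(g x v - c v) / r v - (g y v - c v) / r v\<bar> \<le> 1" by linarith
      moreover have "(g x v - c v) / r v - (g y v - c v) / r v = (g x v - g y v) / r v"
        by (simp add: diff_divide_distrib)
      ultimately show "\<bar>g x v - g y v\<bar> \<le> r v" using assms(2)[OF v] by (simp add: abs_divide)
    qed
  qed (rule cF)
qed

context chart begin

text \<open>As \<open>D\<close> consists of standard basis vectors, this is the orthogonal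
  projection onto \<open>span D\<close>. Through it the Lebesgue measure of the ambient space
  replaces one on \<open>span D\<close>, both in the lower bound for the Hausdorff measure and in
  the construction of the decaying measure.\<close>

definition proj :: "'a \<Rightarrow> 'a" where "proj x = (\<Sum>b\<in>D. (x \<bullet> b) *\<^sub>R b)"

lemma finite_D: "finite D" using D_subset finite_Basis finite_subset by blast

lemma proj_inner: "b \<in> Basis \<Longrightarrow> proj x \<bullet> b = (if b \<in> D then x \<bullet> b else 0)"
  using D_subset finite_D unfolding proj_def
  by (auto simp: inner_sum_left inner_Basis if_distrib subset_eq sum.delta cong: sum.cong if_cong intro!: sum.neutral)

lemma proj_in: "proj x \<in> span D"
  unfolding proj_def by (intro span_sum span_scale span_base)

lemma span_D_inner: "x \<in> span D \<Longrightarrow> b \<in> Basis - D \<Longrightarrow> x \<bullet> b = 0"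
proof (induction rule: span_induct_alt)
  case (step c v y)
  then have "v \<bullet> b = 0" using D_subset by (auto intro: inner_not_same_Basis)
  then show ?case using step by (simp add: inner_left_distrib)
qed auto

lemma proj_id: "x \<in> span D \<Longrightarrow> proj x = x"
proof (rule euclidean_eqI)
  fix b :: 'a assume "x \<in> span D" "b \<in> Basis"
  then show "proj x \<bullet> b = x \<bullet> b" using span_D_inner by (cases "b \<in> D") (simp_all add: proj_inner)
qed

lemma linear_proj: "linear proj"
proof (rule linearI)
  show "proj (x + y) = proj x + proj y" for x y
    unfolding proj_def by (simp only: inner_left_distrib scaleR_left_distrib sum.distrib)
  show "proj (c *\<^sub>R x) = c *\<^sub>R proj x" for c x
    unfolding proj_def by (simp only: inner_scaleR_left scaleR_sum_right scaleR_scaleR)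
qed

lemma norm_proj_le: "norm (proj x) \<le> norm x"
proof -
  have "(norm (proj x))\<^sup>2 \<le> (norm x)\<^sup>2"
    unfolding power2_norm_eq_inner euclidean_inner[of "proj x" "proj x"] euclidean_inner[of x x]
    by (intro sum_mono) (auto simp: proj_inner)
  then show ?thesis by (rule power2_le_imp_le) auto
qed

lemma continuous_proj: "continuous_on S proj"
  using linear_continuous_on linear_proj linear_conv_bounded_linear by blast

lemma proj_cball: "x0 \<in> span D \<Longrightarrow> x \<in> cball x0 R \<Longrightarrow> proj x \<in> cball x0 R"
  using norm_proj_le[of "x0 - x"] linear_diff[OF linear_proj] proj_id by (simp add: dist_norm)

lemma chart_radius:
  assumes "z0 \<in> U"
  obtains R R' L where "R > 0" "R' > 0" "L > 0" "cball (\<phi> z0) R \<subseteq> V" "cball z0 R' \<subseteq> U"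
    "\<psi> ` cball (\<phi> z0) R \<subseteq> cball z0 R'"
    "\<And>x y. x \<in> cball (\<phi> z0) R \<Longrightarrow> y \<in> cball (\<phi> z0) R \<Longrightarrow> norm (\<psi> x - \<psi> y) \<le> L * norm (x - y)"
    "\<And>x y. x \<in> cball (\<phi> z0) R \<Longrightarrow> y \<in> cball (\<phi> z0) R \<Longrightarrow> norm (x - y) \<le> L * norm (\<psi> x - \<psi> y)"
proof -
  obtain R' where R': "R' > 0" "cball z0 R' \<subseteq> U" using open_U assms open_contains_cball by blast
  obtain L1 where L1: "L1 > 0"
    "\<And>x y. x \<in> cball z0 R' \<Longrightarrow> y \<in> cball z0 R' \<Longrightarrow> norm (\<phi> x - \<phi> y) \<le> L1 * norm (x - y)"
    using smooth_on_Lipschitz[OF open_U smooth_phi R'(2)] by blast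
  have "open (V \<inter> \<psi> -` ball z0 R')" using continuous_open_preimage[OF continuous_psi open_V] by blast
  moreover have "\<phi> z0 \<in> V \<inter> \<psi> -` ball z0 R'" using assms phi_in psi_phi R' by simp
  ultimately obtain R where R: "R > 0" "cball (\<phi> z0) R \<subseteq> V \<inter> \<psi> -` ball z0 R'"
    using open_contains_cball by blast
  then have RV: "cball (\<phi> z0) R \<subseteq> V" by blast
  obtain L2 where L2: "L2 > 0"
    "\<And>x y. x \<in> cball (\<phi> z0) R \<Longrightarrow> y \<in> cball (\<phi> z0) R \<Longrightarrow> norm (\<psi> x - \<psi> y) \<le> L2 * norm (x - y)"
    using smooth_on_Lipschitz[OF open_V smooth_psi RV] by blast
  have im: "\<psi> ` cball (\<phi> z0) R \<subseteq> cball z0 R'" using R(2) by (auto simp: subset_eq less_imp_le)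
  show ?thesis
  proof (rule that[OF R(1) R'(1) _ RV R'(2) im])
    show "L1 + L2 > 0" using L1 L2 by simp
    fix x y assume xy: "x \<in> cball (\<phi> z0) R" "y \<in> cball (\<phi> z0) R"
    show "norm (\<psi> x - \<psi> y) \<le> (L1 + L2) * norm (x - y)"
      using L2(2)[OF xy] mult_right_mono[of L2 "L1 + L2" "norm (x - y)"] L1(1) by simp
    have "norm (\<phi> (\<psi> x) - \<phi> (\<psi> y)) \<le> L1 * norm (\<psi> x - \<psi> y)" using L1(2) xy im by blast
    then show "norm (x - y) \<le> (L1 + L2) * norm (\<psi> x - \<psi> y)"
      using mult_right_mono[of L1 "L1 + L2" "norm (\<psi> x - \<psi> y)"] L2(1) phi_psi RV xy by (auto simp: subset_eq)
  qed
qed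

end

lemma Hausdorff_premeasure_mono: "S \<subseteq> T \<Longrightarrow> Hausdorff_premeasure s \<delta> S \<le> Hausdorff_premeasure s \<delta> T"
  unfolding Hausdorff_premeasure_def by (rule INF_superset_mono) auto

lemma Hausdorff_premeasure_le_finite:
  fixes A :: "'i \<Rightarrow> 'a::euclidean_space set"
  assumes "finite I" "S \<subseteq> (\<Union>i\<in>I. A i)" "\<And>i. i \<in> I \<Longrightarrow> bounded (A i) \<and> diameter (A i) \<le> \<delta>" "\<delta> \<ge> 0"
  shows "Hausdorff_premeasure s \<delta> S \<le> (\<Sum>i\<in>I. ennreal (diameter (A i) powr s))"
proof -
  obtain f where f: "bij_betw f {..<card I} I"
    using ex_bij_betw_nat_finite[OF assms(1)] by (auto simp: atLeast0LessThan)
  define B where "B n = (if n < card I then A (f n) else {})" for n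
  have fI: "f n \<in> I" if "n < card I" for n using f that unfolding bij_betw_def by auto
  have fs: "\<exists>n<card I. f n = i" if "i \<in> I" for i using f that unfolding bij_betw_def by (metis imageE lessThan_iff)
  have "S \<subseteq> (\<Union>n. B n)"
  proof
    fix x assume "x \<in> S"
    then obtain i where i: "i \<in> I" "x \<in> A i" using assms(2) by auto
    then obtain n where "n < card I" "f n = i" using fs by blast
    then show "x \<in> (\<Union>n. B n)" using i by (auto simp: B_def)
  qed
  moreover have "bounded (B n) \<and> diameter (B n) \<le> \<delta>" for n
    using fI assms(3,4) by (auto simp: B_def)
  ultimately have "Hausdorff_premeasure s \<delta> S \<le> (\<Sum>n. ennreal (diameter (B n) powr s))"
    unfolding Hausdorff_premeasure_def by (intro INF_lower) auto
  also have "\<dots> = (\<Sum>n<card I. ennreal (diameter (B n) powr s))"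
    by (rule suminf_finite) (auto simp: B_def)
  also have "\<dots> = (\<Sum>n<card I. ennreal (diameter (A (f n)) powr s))"
    by (rule sum.cong) (auto simp: B_def)
  also have "\<dots> = (\<Sum>i\<in>I. ennreal (diameter (A i) powr s))"
    by (rule sum.reindex_bij_betw[OF f])
  finally show ?thesis .
qed

lemma Hausdorff_premeasure_UN_zero:
  fixes Q :: "nat \<Rightarrow> 'a::euclidean_space set"
  assumes "\<And>n. Hausdorff_premeasure s \<delta> (Q n) = 0"
  shows "Hausdorff_premeasure s \<delta> (\<Union>n. Q n) = 0"
proof -
  have "Hausdorff_premeasure s \<delta> (\<Union>n. Q n) \<le> 0 + ennreal e" if e: "e > 0" for e
  proof -
    have "\<exists>A. Q n \<subseteq> (\<Union>i. A i) \<and> (\<forall>i. bounded (A i) \<and> diameter (A i) \<le> \<delta>) \<and>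
        (\<Sum>i. ennreal (diameter (A i) powr s)) < ennreal (e * (1/2) ^ Suc n)" for n
    proof -
      have "Hausdorff_premeasure s \<delta> (Q n) < ennreal (e * (1/2) ^ Suc n)"
        using assms e by (simp add: ennreal_lessI)
      then show ?thesis unfolding Hausdorff_premeasure_def INF_less_iff by auto
    qed
    then obtain A where A: "\<And>n. Q n \<subseteq> (\<Union>i. A n i)" "\<And>n i. bounded (A n i)" "\<And>n i. diameter (A n i) \<le> \<delta>"
      "\<And>n. (\<Sum>i. ennreal (diameter (A n i) powr s)) < ennreal (e * (1/2) ^ Suc n)" by metis
    define B where "B k = A (fst (prod_decode k)) (snd (prod_decode k))" for k
    have "(\<Union>n. Q n) \<subseteq> (\<Union>k. B k)"
    proof
      fix x assume "x \<in> (\<Union>n. Q n)"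
      then obtain n i where "x \<in> A n i" using A(1) by blast
      then have "x \<in> B (prod_encode (n, i))" by (simp add: B_def)
      then show "x \<in> (\<Union>k. B k)" by blast
    qed
    moreover have "bounded (B k) \<and> diameter (B k) \<le> \<delta>" for k
      using A by (auto simp: B_def split: prod.split)
    ultimately have "Hausdorff_premeasure s \<delta> (\<Union>n. Q n) \<le> (\<Sum>k. ennreal (diameter (B k) powr s))"
      unfolding Hausdorff_premeasure_def by (intro INF_lower) auto
    also have "\<dots> = (\<Sum>n. \<Sum>i. ennreal (diameter (A n i) powr s))"
      unfolding B_def
      by (rule suminf_ennreal_2dimen[where f = "\<lambda>p. ennreal (diameter (A (fst p) (snd p)) powr s)"]) simp
    also have "\<dots> \<le> (\<Sum>n. ennreal (e * (1/2) ^ Suc n))"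
      by (intro suminf_le less_imp_le[OF A(4)]) auto
    also have "\<dots> = ennreal (\<Sum>n. e * (1/2) ^ Suc n)"
      using e sums_mult[OF power_half_series, of e]
      by (intro suminf_ennreal2) (auto simp: sums_iff)
    also have "(\<Sum>n. e * (1/2) ^ Suc n) = e"
      using sums_mult[OF power_half_series, of e] by (simp add: sums_iff)
    finally show ?thesis by simp
  qed
  then show ?thesis
    using ennreal_le_epsilon[of 0 "Hausdorff_premeasure s \<delta> (\<Union>n. Q n)"] by simp
qed

text \<open>A grid of mesh \<open>r\<close> cuts the parameter ball into about
  \<open>r powr (-m)\<close> cells whose images have diameter at most \<open>k * r\<close>; the
  resulting sum is of order \<open>r powr (s - m)\<close>, which can be made arbitrarily
  small.\<close>

lemma (in chart) local_Hausdorff_premeasure_zero: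
  assumes "z0 \<in> M" "z0 \<in> U" "s > real (card D)" "\<delta> > 0"
  obtains W where "open W" "z0 \<in> W" "Hausdorff_premeasure s \<delta> (M \<inter> W) = 0"
proof -
  define x0 where "x0 = \<phi> z0"
  obtain R R' L where R: "R > 0" "L > 0" "cball x0 R \<subseteq> V"
    "\<And>x y. x \<in> cball x0 R \<Longrightarrow> y \<in> cball x0 R \<Longrightarrow> norm (\<psi> x - \<psi> y) \<le> L * norm (x - y)"
    using chart_radius[OF assms(2)] unfolding x0_def by metis
  define W where "W = U \<inter> \<phi> -` ball x0 R"
  define m where "m = card D"
  define k where "k = 2 * L * real (m + 1)"
  have k: "k > 0" unfolding k_def using R by simp
  have W: "open W" "z0 \<in> W"
    using continuous_open_preimage[OF continuous_phi open_U open_ball] assms R unfolding W_def x0_def by auto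
  define X where "X = span D \<inter> cball x0 R"
  have MW: "M \<inter> W \<subseteq> \<psi> ` X"
  proof
    fix z assume z: "z \<in> M \<inter> W"
    then have "z = \<psi> (\<phi> z)" "\<phi> z \<in> X" using psi_phi phi_in_span unfolding W_def X_def by auto
    then show "z \<in> \<psi> ` X" by blast
  qed
  have bound: "Hausdorff_premeasure s \<delta> (M \<inter> W) \<le> ennreal ((4 * R) ^ m * k powr s * r powr (s - m))"
    if r: "0 < r" "r \<le> R" "k * r \<le> \<delta>" for r
  proof -
    have bd0: "\<bar>x \<bullet> v - x0 \<bullet> v\<bar> \<le> R" if "x \<in> X" "v \<in> D" for x v
    proof -
      have "\<bar>(x - x0) \<bullet> v\<bar> \<le> norm (x - x0)" using that D_subset by (intro Basis_le_norm) auto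
      then show ?thesis using that unfolding X_def by (simp add: dist_norm norm_minus_commute inner_diff_left)
    qed
    from finite_grid_net[where g = "\<lambda>x v. x \<bullet> v" and r = "\<lambda>_. r" and c = "\<lambda>v. x0 \<bullet> v" and l = "\<lambda>_. R" and X = X, OF finite_D _ bd0] r R(1) obtain F where
      F: "F \<subseteq> X" "finite F" "real (card F) \<le> (\<Prod>v\<in>D. 2 * R / r + 2)"
      "\<And>x. x \<in> X \<Longrightarrow> \<exists>y\<in>F. \<forall>v\<in>D. \<bar>x \<bullet> v - y \<bullet> v\<bar> \<le> r" by auto
    define A where "A y = \<psi> ` {x\<in>X. \<forall>v\<in>D. \<bar>x \<bullet> v - y \<bullet> v\<bar> \<le> r}" for y
    have dist: "norm (p - q) \<le> k * r" if pq: "p \<in> A y" "q \<in> A y" for p q y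
    proof -
      obtain x x' where x: "p = \<psi> x" "q = \<psi> x'" "x \<in> X" "x' \<in> X"
        "\<forall>v\<in>D. \<bar>x \<bullet> v - y \<bullet> v\<bar> \<le> r" "\<forall>v\<in>D. \<bar>x' \<bullet> v - y \<bullet> v\<bar> \<le> r"
        using pq unfolding A_def by auto
      have "x - x' = proj (x - x')" using proj_id x(3,4) span_diff unfolding X_def by force
      also have "norm \<dots> \<le> (\<Sum>b\<in>D. norm (((x - x') \<bullet> b) *\<^sub>R b))" unfolding proj_def by (rule norm_sum)
      also have "\<dots> \<le> (\<Sum>b\<in>D. 2 * r)"
      proof (rule sum_mono)
        fix b assume b: "b \<in> D"
        have "\<bar>x \<bullet> b - x' \<bullet> b\<bar> \<le> 2 * r" using x(5,6) b by fastforce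
        then show "norm (((x - x') \<bullet> b) *\<^sub>R b) \<le> 2 * r" using b D_subset by (auto simp: inner_diff_left)
      qed
      finally have "norm (x - x') \<le> 2 * m * r" by (simp add: m_def)
      then have "L * norm (x - x') \<le> L * (2 * m * r)" using R(2) by (intro mult_left_mono) auto
      also have "\<dots> \<le> k * r" unfolding k_def using r R by (simp add: algebra_simps)
      finally show ?thesis using R(4)[of x x'] x unfolding X_def by auto
    qed
    have bd: "bounded (A y)" for y
    proof (cases "A y = {}")
      case False
      then obtain q where "q \<in> A y" by blast
      then show ?thesis using dist by (auto simp: bounded_def dist_norm intro!: exI[of _ q] exI[of _ "k * r"])
    qed simp
    have diam: "diameter (A y) \<le> k * r" for y
      by (rule diameter_le) (use dist k r in auto)
    have "Hausdorff_premeasure s \<delta> (M \<inter> W) \<le> (\<Sum>y\<in>F. ennreal (diameter (A y) powr s))"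
    proof (rule Hausdorff_premeasure_le_finite[OF F(2)])
      show "M \<inter> W \<subseteq> (\<Union>y\<in>F. A y)" using MW F(4) unfolding A_def by fastforce
      show "\<And>i. i \<in> F \<Longrightarrow> bounded (A i) \<and> diameter (A i) \<le> \<delta>" using bd diam r by (meson order_trans)
    qed (use assms in auto)
    also have "\<dots> \<le> (\<Sum>y\<in>F. ennreal ((k * r) powr s))"
      using diam assms by (intro sum_mono ennreal_leI powr_mono2) (auto simp: diameter_ge_0 bd)
    also have "\<dots> = ennreal (real (card F) * (k * r) powr s)"
      by (simp add: ennreal_mult ennreal_of_nat_eq_real_of_nat)
    also have "\<dots> \<le> ennreal ((4 * R / r) ^ m * (k * r) powr s)"
    proof (intro ennreal_leI mult_right_mono)
      have "2 \<le> 2 * R / r" using r by (simp add: field_simps)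
      then have "(\<Prod>v\<in>D. 2 * R / r + 2) \<le> (\<Prod>v\<in>D. 4 * R / r)"
        using r R by (intro prod_mono) (auto simp: field_simps)
      then show "real (card F) \<le> (4 * R / r) ^ m" using F(3) by (simp add: m_def)
    qed auto
    also have "(4 * R / r) ^ m * (k * r) powr s = (4 * R) ^ m * k powr s * r powr (s - m)"
      using r k by (simp add: powr_mult powr_diff powr_realpow power_divide)
    finally show ?thesis .
  qed
  define C where "C = (4 * R) ^ m * k powr s"
  have C: "C > 0" unfolding C_def using R k by simp
  have "Hausdorff_premeasure s \<delta> (M \<inter> W) \<le> 0 + ennreal e" if e: "e > 0" for e
  proof -
    \<comment> \<open>Small enough for the net, for diameters at most \<open>\<delta>\<close>, and
      for \<open>C * r powr (s - m) \<le> e\<close>.\<close>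
    define r where "r = min (min R (\<delta> / k)) ((e / C) powr (1 / (s - m)))"
    have sm: "s - m > 0" using assms(3) m_def by simp
    have r: "r > 0" "r \<le> R" "r \<le> \<delta> / k" "r \<le> (e / C) powr (1 / (s - m))"
      unfolding r_def using R assms k e C by auto
    have "k * r \<le> \<delta>" using r(3) k by (simp add: field_simps)
    from bound[OF r(1,2) this] have "Hausdorff_premeasure s \<delta> (M \<inter> W) \<le> ennreal (C * r powr (s - m))"
      by (simp add: C_def)
    also have "\<dots> \<le> ennreal (C * (e / C))"
    proof (intro ennreal_leI mult_left_mono)
      have "r powr (s - m) \<le> ((e / C) powr (1 / (s - m))) powr (s - m)"
        using r sm by (intro powr_mono2) auto
      also have "\<dots> = e / C" using sm e C by (simp add: powr_powr)
      finally show "r powr (s - m) \<le> e / C" .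
    qed (use C in auto)
    finally show ?thesis using C by simp
  qed
  then have "Hausdorff_premeasure s \<delta> (M \<inter> W) = 0"
    using ennreal_le_epsilon[of 0 "Hausdorff_premeasure s \<delta> (M \<inter> W)"] by simp
  then show ?thesis using that W by blast
qed

text \<open>For each fixed \<open>\<delta>\<close>, every point has a neighbourhood of zero
  premeasure. Lindelof's theorem leaves countably many of them, and zero premeasure is stable under
  countable unions.\<close>

lemma submanifold_Hausdorff_measure_zero:
  fixes M :: "'a::euclidean_space set"
  assumes "smooth_submanifold m M" "s > real m"
  shows "Hausdorff_measure s M = 0"
proof -
  have "Hausdorff_premeasure s \<delta> M = 0" if \<delta>: "\<delta> > 0" for \<delta>
  proof -
    have "\<exists>W. open W \<and> z \<in> W \<and> Hausdorff_premeasure s \<delta> (M \<inter> W) = 0" if "z \<in> M" for z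
    proof -
      obtain U V \<phi> \<psi> D where c: "chart M U V \<phi> \<psi> D" "card D = m" "z \<in> U"
        by (rule smooth_submanifold_chart[OF assms(1) \<open>z \<in> M\<close>])
      show ?thesis
        using chart.local_Hausdorff_premeasure_zero[OF c(1) \<open>z \<in> M\<close> c(3) _ \<delta>] assms(2) c(2) by metis
    qed
    then obtain W where W: "\<And>z. z \<in> M \<Longrightarrow> open (W z) \<and> z \<in> W z \<and> Hausdorff_premeasure s \<delta> (M \<inter> W z) = 0"
      by metis
    obtain F' where F': "F' \<subseteq> W ` M" "countable F'" "\<Union>F' = \<Union>(W ` M)"
      using Lindelof[of "W ` M"] W by blast
    show ?thesis
    proof (cases "F' = {}")
      case True
      then have "M = {}" using F'(3) W by blast
      then have "M \<subseteq> (\<Union>n::nat. {})" by simp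
      then have "Hausdorff_premeasure s \<delta> M \<le> (\<Sum>i::nat. ennreal (diameter ({}::'a set) powr s))"
        unfolding Hausdorff_premeasure_def using \<delta> by (intro INF_lower) auto
      then show ?thesis by simp
    next
      case False
      then have ran: "range (from_nat_into F') = F'" by (rule range_from_nat_into[OF _ F'(2)])
      have "Hausdorff_premeasure s \<delta> (\<Union>n. M \<inter> from_nat_into F' n) = 0"
      proof (rule Hausdorff_premeasure_UN_zero)
        fix n
        obtain z where "z \<in> M" "from_nat_into F' n = W z"
          using F'(1) from_nat_into[OF False, of n] by blast
        then show "Hausdorff_premeasure s \<delta> (M \<inter> from_nat_into F' n) = 0" using W by simp
      qed
      moreover have "M \<subseteq> (\<Union>n. M \<inter> from_nat_into F' n)"
      proof
        fix z assume z: "z \<in> M"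
        then have "z \<in> \<Union>F'" using W F'(3) by blast
        then show "z \<in> (\<Union>n. M \<inter> from_nat_into F' n)" using z ran by blast
      qed
      ultimately show ?thesis using Hausdorff_premeasure_mono by (metis le_zero_eq)
    qed
  qed
  then show ?thesis unfolding Hausdorff_measure_def by (simp add: SUP_constant)
qed

text \<open>A volume comparison. The map sending \<open>x\<close> to \<open>\<psi> (proj x)\<close>
  pulls a cover of \<open>M\<close> back to a cover of an ambient ball; a set of diameter
  \<open>d i\<close> comes from a box with sides \<open>2 * L * d i\<close> in the \<open>D\<close>
  directions and \<open>2 * R\<close> in the others, hence of volume \<open>C * d i ^ m\<close>. Too
  small a sum of the \<open>d i powr s\<close> would contradict the volume of the ball.\<close>

lemma submanifold_Hausdorff_measure_pos:
  fixes M :: "'a::euclidean_space set"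
  assumes "smooth_submanifold m M" "M \<noteq> {}" "0 < s" "s \<le> real m"
  shows "Hausdorff_measure s M \<noteq> 0"
proof
  assume "Hausdorff_measure s M = 0"
  then have pre0: "Hausdorff_premeasure s 1 M = 0"
    unfolding Hausdorff_measure_def by (metis SUP_upper greaterThan_iff le_zero_eq zero_less_one)
  obtain z0 where z0: "z0 \<in> M" using assms by blast
  obtain U V \<phi> \<psi> D where c: "chart M U V \<phi> \<psi> D" "card D = m" "z0 \<in> U"
    by (rule smooth_submanifold_chart[OF assms(1) z0])
  interpret chart M U V \<phi> \<psi> D by fact
  define x0 where "x0 = \<phi> z0"
  have x0: "x0 \<in> span D" unfolding x0_def using phi_in_span z0 c by blast
  obtain R R' L where R: "R > 0" "L > 0" "cball x0 R \<subseteq> V"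
    "\<And>x y. x \<in> cball x0 R \<Longrightarrow> y \<in> cball x0 R \<Longrightarrow> norm (x - y) \<le> L * norm (\<psi> x - \<psi> y)"
    using chart_radius[OF c(3)] unfolding x0_def by metis
  define C where "C = (2 * L) ^ m * (2 * R) ^ (DIM('a) - m)"
  have C: "C > 0" unfolding C_def using R by simp
  \<comment> \<open>The threshold below which the boxes cannot fill the ball. Scale 1 is enough:
    diameters at most 1 give \<open>d i ^ m \<le> d i powr s\<close>.\<close>
  define e where "e = measure lborel (ball x0 R) / C"
  have e: "e > 0" unfolding e_def using C R content_ball_pos by simp
  have "Hausdorff_premeasure s 1 M < ennreal e" using pre0 e by simp
  then obtain A :: "nat \<Rightarrow> 'a set" where A: "M \<subseteq> (\<Union>i. A i)" "\<And>i. bounded (A i)" "\<And>i. diameter (A i) \<le> 1"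
    "(\<Sum>i. ennreal (diameter (A i) powr s)) < ennreal e"
    unfolding Hausdorff_premeasure_def INF_less_iff by auto
  define d where "d i = diameter (A i)" for i
  have d: "0 \<le> d i" "d i \<le> 1" for i unfolding d_def using A diameter_ge_0 by auto
  define Z where "Z i = {x \<in> ball x0 R. \<psi> (proj x) \<in> A i}" for i
  have "\<exists>B. Z i \<subseteq> B \<and> B \<in> sets lborel \<and> emeasure lborel B \<le> ennreal (C * d i ^ m)" for i
  proof (cases "Z i = {}")
    case True
    then show ?thesis by (intro exI[of _ "{}"]) auto
  next
    case False
    then obtain y where y: "y \<in> Z i" by blast
    define lo where "lo = (\<Sum>b\<in>Basis. (if b \<in> D then y \<bullet> b - L * d i else x0 \<bullet> b - R) *\<^sub>R b)"
    define hi where "hi = (\<Sum>b\<in>Basis. (if b \<in> D then y \<bullet> b + L * d i else x0 \<bullet> b + R) *\<^sub>R b)"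
    have "Z i \<subseteq> cbox lo hi"
    proof
      fix x assume x: "x \<in> Z i"
      have p: "proj x \<in> cball x0 R" "proj y \<in> cball x0 R"
        using proj_cball[OF x0] x y unfolding Z_def by auto
      have "norm (\<psi> (proj x) - \<psi> (proj y)) \<le> d i"
        unfolding d_def using diameter_bounded_bound[OF A(2)] x y unfolding Z_def by (simp add: dist_norm)
      then have "norm (proj x - proj y) \<le> L * d i"
        using R(4)[OF p] mult_left_mono[of _ "d i" L] R(2) by (meson less_imp_le order_trans)
      then have "\<bar>(x - y) \<bullet> b\<bar> \<le> L * d i" if "b \<in> D" for b
        using Basis_le_norm[of b "proj x - proj y"] that D_subset by (auto simp: proj_inner inner_diff_left)
      moreover have "\<bar>(x - x0) \<bullet> b\<bar> \<le> R" if "b \<in> Basis" for b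
        using Basis_le_norm[OF that, of "x - x0"] x unfolding Z_def by (auto simp: dist_norm norm_minus_commute)
      ultimately show "x \<in> cbox lo hi"
        unfolding cbox_def lo_def hi_def by (fastforce simp: inner_diff_left abs_le_iff)
    qed
    moreover have "emeasure lborel (cbox lo hi) = ennreal (C * d i ^ m)"
    proof -
      have "(\<Prod>b\<in>Basis. (hi - lo) \<bullet> b) = (\<Prod>b\<in>Basis. if b \<in> D then 2 * L * d i else 2 * R)"
        by (rule prod.cong) (auto simp: lo_def hi_def inner_diff_left)
      also have "\<dots> = (\<Prod>b\<in>D. 2 * L * d i) * (\<Prod>b\<in>Basis - D. 2 * R)"
        by (subst prod.If_cases) (use D_subset in \<open>auto simp: Int_absorb1 Diff_eq\<close>)
      also have "\<dots> = C * d i ^ m"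
        unfolding C_def using card_Diff_subset[OF finite_D D_subset] c(2) by (simp add: power_mult_distrib mult_ac)
      finally have "(\<Prod>b\<in>Basis. (hi - lo) \<bullet> b) = C * d i ^ m" .
      moreover have "lo \<bullet> b \<le> hi \<bullet> b" if "b \<in> Basis" for b
        using that R d(1)[of i] by (auto simp: lo_def hi_def)
      ultimately show ?thesis by (simp add: emeasure_lborel_cbox)
    qed
    ultimately show ?thesis by (intro exI[of _ "cbox lo hi"]) auto
  qed
  then obtain B where B: "\<And>i. Z i \<subseteq> B i" "\<And>i. B i \<in> sets lborel" "\<And>i. emeasure lborel (B i) \<le> ennreal (C * d i ^ m)"
    by metis
  have cover: "ball x0 R \<subseteq> (\<Union>i. B i)"
  proof
    fix x assume x: "x \<in> ball x0 R"
    then have "proj x \<in> cball x0 R" using proj_cball[OF x0] by auto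
    then have "\<psi> (proj x) \<in> M" using psi_in_M proj_in R(3) by blast
    then obtain i where "\<psi> (proj x) \<in> A i" using A(1) by blast
    then show "x \<in> (\<Union>i. B i)" using B(1)[of i] x unfolding Z_def by auto
  qed
  have "ennreal (C * e) = emeasure lborel (ball x0 R)"
    unfolding e_def using C emeasure_lborel_ball_finite[of x0 R] by (simp add: emeasure_eq_ennreal_measure)
  also have "\<dots> \<le> emeasure lborel (\<Union>i. B i)" using cover B(2) by (intro emeasure_mono) auto
  also have "\<dots> \<le> (\<Sum>i. emeasure lborel (B i))"
    by (rule emeasure_subadditive_countably) (use B(2) in auto)
  also have "\<dots> \<le> (\<Sum>i. ennreal C * ennreal (d i powr s))"
  proof (intro suminf_le)
    fix i
    have "d i ^ m \<le> d i powr s"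
    proof (cases "d i = 0")
      case False
      then have "d i ^ m = d i powr real m" using d(1)[of i] by (simp add: powr_realpow)
      also have "\<dots> \<le> d i powr s" using d[of i] assms by (intro powr_mono') auto
      finally show ?thesis .
    qed (use assms in \<open>auto simp: zero_power\<close>)
    then have "ennreal (C * d i ^ m) \<le> ennreal (C * d i powr s)"
      using C by (intro ennreal_leI mult_left_mono) auto
    then show "emeasure lborel (B i) \<le> ennreal C * ennreal (d i powr s)"
      using B(3)[of i] C by (simp add: ennreal_mult)
  qed auto
  also have "\<dots> = ennreal C * (\<Sum>i. ennreal (d i powr s))" by simp
  also have "\<dots> < ennreal C * ennreal e"
    using A(4) C unfolding d_def by (intro ennreal_mult_strict_left_mono) auto
  finally show False using C e by (simp add: ennreal_mult)
qed

lemma Hausdorff_dim_submanifold: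
  fixes M :: "'a::euclidean_space set"
  assumes "smooth_submanifold m M" "M \<noteq> {}"
  shows "Hausdorff_dim M = real m"
proof -
  let ?S = "{s. 0 < s \<and> Hausdorff_measure s M = 0}"
  have up: "s \<in> ?S" if "s > real m" for s
    using submanifold_Hausdorff_measure_zero[OF assms(1) that] that by auto
  have lo: "real m \<le> s" if "s \<in> ?S" for s
    using submanifold_Hausdorff_measure_pos[OF assms, of s] that by (cases "s \<le> real m") auto
  have "Inf ?S \<le> real m"
    by (rule dense_ge) (use up lo in \<open>auto intro!: cInf_lower bdd_belowI[of _ "real m"]\<close>)
  moreover have "real m \<le> Inf ?S"
    by (rule cInf_greatest[OF _ lo]) (metis up empty_iff less_add_one)
  ultimately show ?thesis unfolding Hausdorff_dim_def by simp
qed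


section \<open>Upper bounds for the Fourier dimension\<close>

text \<open>Half the Fourier transform of the indicator function of the interval from -1 to 1. As an
  average of characters it shifts frequencies only by bounded amounts, while it is at least 1/2 for
  arguments of modulus at most 1 and decays like \<open>1 / \<bar>x\<bar>\<close>.\<close>

definition sinc :: "real \<Rightarrow> real" where "sinc x = (if x = 0 then 1 else sin x / x)"

lemma sinc_integral:
  "(\<integral>t. indicator {-1..1} t *\<^sub>R cis (t * x) \<partial>lborel) = complex_of_real (2 * sinc x)"
proof (cases "x = 0")
  case True
  have "(\<integral>t. indicator {-1..1::real} t *\<^sub>R (1::complex) \<partial>lborel) = 2"
    by (subst integral_scaleR_left) (auto simp: scaleR_conv_of_real)
  then show ?thesis using True by (simp add: sinc_def)
next
  case False
  define F where "F t = cis (t * x) / (\<i> * complex_of_real x)" for t :: real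
  have "(F has_vector_derivative cis (t * x)) (at t within {-1..1})" for t
  proof -
    have "((\<lambda>w. exp (\<i> * w * complex_of_real x) / (\<i> * complex_of_real x)) has_field_derivative
        exp (\<i> * of_real t * complex_of_real x)) (at (of_real t))"
      using False by (auto intro!: derivative_eq_intros)
    from has_vector_derivative_real_field[OF this] show ?thesis
      unfolding F_def cis_conv_exp by (simp add: mult.assoc)
  qed
  then have "(\<integral>t. indicator {-1..1} t *\<^sub>R cis (t * x) \<partial>lborel) = F 1 - F (-1)"
    by (intro integral_FTC_Icc) (auto intro!: continuous_intros)
  also have "\<dots> = complex_of_real (2 * sinc x)"
  proof -
    have "cis x - cis (- x) = \<i> * complex_of_real (2 * sin x)" by (simp add: complex_eq_iff)
    then have "F 1 - F (-1) = \<i> * complex_of_real (2 * sin x) / (\<i> * complex_of_real x)"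
      unfolding F_def by (simp flip: diff_divide_distrib)
    then show ?thesis using False by (simp add: sinc_def)
  qed
  finally show ?thesis .
qed

lemma abs_sinc_le_1: "\<bar>sinc x\<bar> \<le> 1"
  unfolding sinc_def using abs_sin_x_le_abs_x[of x] by (auto simp: abs_divide)

lemma abs_sinc_le_inverse: "x \<noteq> 0 \<Longrightarrow> \<bar>sinc x\<bar> \<le> 1 / \<bar>x\<bar>"
  unfolding sinc_def using abs_sin_le_one[of x] by (auto simp: abs_divide divide_right_mono)

lemma cos_ge_half: "\<bar>x::real\<bar> \<le> 1 \<Longrightarrow> cos x \<ge> 1/2"
proof -
  assume "\<bar>x\<bar> \<le> 1"
  then have "cos (pi / 3) \<le> cos \<bar>x\<bar>" using pi_gt3 by (intro cos_monotone_0_pi_le) auto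
  then show ?thesis by (simp add: cos_60)
qed

lemma sinc_ge_half: "\<bar>x\<bar> \<le> 1 \<Longrightarrow> sinc x \<ge> 1/2"
proof -
  have pos: "sinc x \<ge> 1/2" if "0 < x" "x \<le> 1" for x
  proof -
    have "\<exists>y. 0 < y \<and> y < x \<and> sin x - sin 0 = (x - 0) * cos y"
      using that(1) by (intro MVT2 DERIV_sin) auto
    then obtain y where y: "0 < y" "y < x" "sin x - sin 0 = (x - 0) * cos y" by blast
    then show ?thesis using that cos_ge_half[of y] by (simp add: sinc_def)
  qed
  have even: "sinc (- x) = sinc x" for x by (simp add: sinc_def)
  assume "\<bar>x\<bar> \<le> 1"
  then show ?thesis using pos[of x] pos[of "- x"] even[of x] by (cases "x > 0"; cases "x = 0") (auto simp: sinc_def)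
qed

lemma sinc_measurable[measurable]: "sinc \<in> borel_measurable borel"
  unfolding sinc_def by measurable

lemma cis_measurable[measurable]: "cis \<in> borel_measurable borel"
  by (intro borel_measurable_continuous_onI continuous_intros)

text \<open>Replacing \<open>sinc\<close> by its integral over \<open>t\<close> and exchanging the
  integrals leaves an average of Fourier integrals at the frequencies
  \<open>\<eta> + t *\<^sub>R c\<close> with \<open>\<bar>t\<bar> \<le> 1\<close>, each bounded by
  \<open>B\<close>. The base point \<open>p\<close> contributes only a unimodular factor.\<close>

lemma norm_integral_sinc_mult_le:
  fixes \<mu> :: "'a::euclidean_space measure" and f :: "'a \<Rightarrow> complex"
  assumes "finite_measure \<mu>" and [measurable_cong]: "sets \<mu> = sets borel"
    and [measurable]: "f \<in> borel_measurable borel" and fb: "\<And>z. cmod (f z) \<le> 1"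
    and B: "\<And>\<xi>. norm (\<xi> - \<eta>) \<le> norm c \<Longrightarrow> cmod (\<integral>z. f z * cis (\<xi> \<bullet> z) \<partial>\<mu>) \<le> B"
  shows "cmod (\<integral>z. sinc (c \<bullet> (z - p)) * f z * cis (\<eta> \<bullet> z) \<partial>\<mu>) \<le> B"
proof -
  interpret \<mu>: finite_measure \<mu> by fact
  define N where "N = restrict_space lborel {-1..1::real}"
  have fN: "finite_measure N" unfolding N_def by (rule finite_measureI) (simp add: emeasure_restrict_space space_restrict_space)
  interpret N: finite_measure N by fact
  interpret P: pair_sigma_finite N \<mu> ..
  have idN[measurable]: "(\<lambda>t. t) \<in> borel_measurable N"
    unfolding N_def by (intro measurable_restrict_space1) auto
  have fstm[measurable]: "fst \<in> borel_measurable (N \<Otimes>\<^sub>M \<mu>)"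
    using measurable_compose[OF measurable_fst idN] by simp
  have sndm[measurable]: "snd \<in> borel_measurable (N \<Otimes>\<^sub>M \<mu>)"
    using measurable_snd[of N \<mu>] assms(2) by (metis measurable_cong_sets)
  define h where "h t z = cis (t * (c \<bullet> (z - p))) * (f z * cis (\<eta> \<bullet> z))" for t z
  have inner: "(\<integral>t. h t z \<partial>N) = 2 * (sinc (c \<bullet> (z - p)) * f z * cis (\<eta> \<bullet> z))" for z
  proof -
    have "(\<integral>t. h t z \<partial>N) = (\<integral>t. cis (t * (c \<bullet> (z - p))) \<partial>N) * (f z * cis (\<eta> \<bullet> z))"
      unfolding h_def by simp
    also have "(\<integral>t. cis (t * (c \<bullet> (z - p))) \<partial>N) = 2 * sinc (c \<bullet> (z - p))"
      unfolding N_def by (subst integral_restrict_space) (auto simp: sinc_integral)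
    finally show ?thesis by (simp add: mult_ac)
  qed
  have int: "integrable (N \<Otimes>\<^sub>M \<mu>) (\<lambda>(t, z). h t z)"
  proof (rule finite_measure.integrable_const_bound[where B = 1])
    show "finite_measure (N \<Otimes>\<^sub>M \<mu>)" by (rule finite_measure_pair_measure[OF assms(1) fN])
    show "AE x in N \<Otimes>\<^sub>M \<mu>. norm (case x of (t, z) \<Rightarrow> h t z) \<le> 1"
      using fb by (auto simp: h_def norm_mult)
    show "(\<lambda>(t, z). h t z) \<in> borel_measurable (N \<Otimes>\<^sub>M \<mu>)"
      unfolding h_def case_prod_beta' by measurable
  qed
  have outer: "cmod (\<integral>z. h t z \<partial>\<mu>) \<le> B" if "t \<in> space N" for t
  proof -
    have "h t z = cis (- (t * (c \<bullet> p))) * (f z * cis ((\<eta> + t *\<^sub>R c) \<bullet> z))" for z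
    proof -
      have "cis (t * (c \<bullet> (z - p))) * cis (\<eta> \<bullet> z) = cis (- (t * (c \<bullet> p))) * cis ((\<eta> + t *\<^sub>R c) \<bullet> z)"
        unfolding cis_mult by (simp add: inner_diff_right inner_add_left algebra_simps)
      then show ?thesis unfolding h_def by (metis mult.left_commute)
    qed
    then have "(\<integral>z. h t z \<partial>\<mu>) = cis (- (t * (c \<bullet> p))) * (\<integral>z. f z * cis ((\<eta> + t *\<^sub>R c) \<bullet> z) \<partial>\<mu>)"
      by simp
    moreover have "norm (\<eta> + t *\<^sub>R c - \<eta>) \<le> norm c"
      using that unfolding N_def by (auto simp: space_restrict_space abs_le_iff intro!: mult_left_le_one_le)
    ultimately show ?thesis using B by (simp add: norm_mult)
  qed
  have "2 * cmod (\<integral>z. sinc (c \<bullet> (z - p)) * f z * cis (\<eta> \<bullet> z) \<partial>\<mu>)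
      = cmod (\<integral>z. 2 * (sinc (c \<bullet> (z - p)) * f z * cis (\<eta> \<bullet> z)) \<partial>\<mu>)"
    by (simp add: norm_mult)
  also have "\<dots> = cmod (\<integral>z. (\<integral>t. h t z \<partial>N) \<partial>\<mu>)" by (simp add: inner)
  also have "\<dots> = cmod (\<integral>t. (\<integral>z. h t z \<partial>\<mu>) \<partial>N)"
    using P.Fubini_integral[OF int] by simp
  also have "\<dots> \<le> (\<integral>t. cmod (\<integral>z. h t z \<partial>\<mu>) \<partial>N)" by (rule integral_norm_bound)
  also have "\<dots> \<le> (\<integral>t. B \<partial>N)"
    using P.integrable_fst'[OF int]
    by (intro integral_mono_AE) (auto simp: outer)
  also have "\<dots> = 2 * B"
    unfolding N_def by (simp add: measure_restrict_space space_restrict_space)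
  finally show ?thesis by simp
qed

text \<open>Each factor enlarges the ball of frequencies on which the bound is required by
  \<open>norm c\<close>. A list of vectors rather than a set allows repetitions, which is how powers
  of the cut-off are obtained.\<close>

lemma norm_integral_prod_sinc_le:
  fixes \<mu> :: "'a::euclidean_space measure"
  assumes "finite_measure \<mu>" "sets \<mu> = sets borel"
    and "\<And>\<xi>. norm (\<xi> - \<eta>) \<le> (\<Sum>c\<leftarrow>cs. norm c) \<Longrightarrow> cmod (\<integral>z. cis (\<xi> \<bullet> z) \<partial>\<mu>) \<le> B"
  shows "cmod (\<integral>z. (\<Prod>c\<leftarrow>cs. sinc (c \<bullet> (z - p))) * cis (\<eta> \<bullet> z) \<partial>\<mu>) \<le> B"
  using assms(3)
proof (induction cs arbitrary: \<eta>)
  case Nil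
  then show ?case by simp
next
  case (Cons c cs)
  have m: "(\<lambda>z. complex_of_real (\<Prod>c\<leftarrow>cs. sinc (c \<bullet> (z - p)))) \<in> borel_measurable borel"
    by (induction cs) auto
  have b: "cmod (complex_of_real (\<Prod>c\<leftarrow>cs. sinc (c \<bullet> (z - p)))) \<le> 1" for z
    unfolding norm_of_real by (induction cs) (auto simp: abs_mult abs_sinc_le_1 mult_le_one)
  have "cmod (\<integral>z. sinc (c \<bullet> (z - p)) * complex_of_real (\<Prod>c\<leftarrow>cs. sinc (c \<bullet> (z - p))) * cis (\<eta> \<bullet> z) \<partial>\<mu>) \<le> B"
  proof (rule norm_integral_sinc_mult_le[OF assms(1,2) m b])
    fix \<xi> assume \<xi>: "norm (\<xi> - \<eta>) \<le> norm c"
    show "cmod (\<integral>z. complex_of_real (\<Prod>c\<leftarrow>cs. sinc (c \<bullet> (z - p))) * cis (\<xi> \<bullet> z) \<partial>\<mu>) \<le> B"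
    proof (rule Cons.IH)
      fix \<xi>' assume "norm (\<xi>' - \<xi>) \<le> (\<Sum>c\<leftarrow>cs. norm c)"
      then have "norm (\<xi>' - \<eta>) \<le> (\<Sum>c\<leftarrow>c # cs. norm c)"
        using \<xi> norm_triangle_ineq[of "\<xi>' - \<xi>" "\<xi> - \<eta>"] by simp
      then show "cmod (\<integral>z. cis (\<xi>' \<bullet> z) \<partial>\<mu>) \<le> B" by (rule Cons.prems)
    qed
  qed
  then show ?case by simp
qed

text \<open>The function \<open>(\<Prod>c. sinc (c \<bullet> (z - p)))\<^sup>2\<^sup>k\<close> is a cut-off to the slab-like set where all
  \<open>\<bar>c \<bullet> (z - p)\<bar> \<le> \<kappa>\<close>, up to an error \<open>\<kappa>\<^sup>-\<^sup>2\<^sup>k\<close>, and its Fourier transform has compact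
  support; there the modulation \<open>cis (\<eta> \<bullet> (z - p))\<close> has real part at least \<open>1/2\<close>.\<close>

lemma measure_cap_le:
  fixes \<mu> :: "'a::euclidean_space measure"
  assumes fin: "finite_measure \<mu>" and sets[measurable_cong]: "sets \<mu> = sets borel"
    and B: "\<And>\<xi>. norm (\<xi> - \<eta>) \<le> 2 * real k * (\<Sum>c\<leftarrow>cs. norm c) \<Longrightarrow> cmod (\<integral>z. cis (\<xi> \<bullet> z) \<partial>\<mu>) \<le> B"
    and \<kappa>: "\<kappa> \<ge> 1"
    and phase: "AE z in \<mu>. (\<forall>c\<in>set cs. \<bar>c \<bullet> (z - p)\<bar> \<le> \<kappa>) \<longrightarrow> \<bar>\<eta> \<bullet> (z - p)\<bar> \<le> 1"
  shows "measure \<mu> {z. \<forall>c\<in>set cs. \<bar>c \<bullet> (z - p)\<bar> \<le> 1}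
    \<le> 2 * 4 ^ (k * length cs) * (B + measure \<mu> UNIV * (1/\<kappa>) ^ (2 * k))"
proof -
  interpret finite_measure \<mu> by fact
  have space: "space \<mu> = UNIV" using sets_eq_imp_space_eq[OF sets] by simp
  define core where "core = {z. \<forall>c\<in>set cs. \<bar>c \<bullet> (z - p)\<bar> \<le> 1}"
  have core: "core \<in> sets \<mu>"
  proof -
    have "core = (\<Inter>c\<in>set cs. {z. \<bar>c \<bullet> (z - p)\<bar> \<le> 1})" unfolding core_def by auto
    also have "closed \<dots>" by (intro closed_INT ballI closed_Collect_le continuous_intros)
    finally show ?thesis unfolding sets by (rule borel_closed)
  qed
  define g where "g z = (\<Prod>c\<leftarrow>cs. sinc (c \<bullet> (z - p)))" for z
  have gm[measurable]: "g \<in> borel_measurable borel"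
    unfolding g_def by (induction cs) auto
  have g1: "\<bar>g z\<bar> \<le> 1" for z
    unfolding g_def by (induction cs) (auto simp: abs_mult abs_sinc_le_1 mult_le_one)
  have gcore: "(1/2) ^ length cs \<le> g z" if "z \<in> core" for z
  proof -
    have "\<forall>c\<in>set cs. 1/2 \<le> sinc (c \<bullet> (z - p))" using that sinc_ge_half unfolding core_def by blast
    then show ?thesis unfolding g_def
    proof (induction cs)
      case (Cons c cs)
      then have "(1/2) * (1/2) ^ length cs \<le> sinc (c \<bullet> (z - p)) * (\<Prod>c\<leftarrow>cs. sinc (c \<bullet> (z - p)))"
        by (intro mult_mono) (auto intro: order_trans[of 0 "1/2"])
      then show ?case by simp
    qed simp
  qed
  have gout: "\<bar>g z\<bar> \<le> 1 / \<kappa>" if "\<exists>c\<in>set cs. \<bar>c \<bullet> (z - p)\<bar> > \<kappa>" for z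
    using that unfolding g_def
  proof (induction cs)
    case (Cons c cs)
    have b: "\<bar>\<Prod>c\<leftarrow>cs. sinc (c \<bullet> (z - p))\<bar> \<le> 1"
      by (induction cs) (auto simp: abs_mult abs_sinc_le_1 mult_le_one)
    show ?case
    proof (cases "\<bar>c \<bullet> (z - p)\<bar> > \<kappa>")
      case True
      then have "\<bar>sinc (c \<bullet> (z - p))\<bar> \<le> 1 / \<bar>c \<bullet> (z - p)\<bar>" using \<kappa> by (intro abs_sinc_le_inverse) auto
      also have "\<dots> \<le> 1 / \<kappa>" using True \<kappa> by (intro divide_left_mono) auto
      finally have "\<bar>sinc (c \<bullet> (z - p))\<bar> * \<bar>\<Prod>c\<leftarrow>cs. sinc (c \<bullet> (z - p))\<bar> \<le> (1 / \<kappa>) * 1"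
        using b \<kappa> by (intro mult_mono) auto
      then show ?thesis by (simp add: abs_mult)
    next
      case False
      then have "\<bar>\<Prod>c\<leftarrow>cs. sinc (c \<bullet> (z - p))\<bar> \<le> 1 / \<kappa>" using Cons by auto
      then have "\<bar>sinc (c \<bullet> (z - p))\<bar> * \<bar>\<Prod>c\<leftarrow>cs. sinc (c \<bullet> (z - p))\<bar> \<le> 1 * (1 / \<kappa>)"
        using abs_sinc_le_1 by (intro mult_mono) auto
      then show ?thesis by (simp add: abs_mult)
    qed
  qed simp
  have gpow: "(\<Prod>c\<leftarrow>concat (replicate n cs). sinc (c \<bullet> (z - p))) = g z ^ n" for n z
    unfolding g_def by (induction n) auto
  have spow: "(\<Sum>c\<leftarrow>concat (replicate n cs). norm c) = real n * (\<Sum>c\<leftarrow>cs. norm c)" for n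
    by (induction n) (auto simp: algebra_simps)
  \<comment> \<open>The lower bound of the integrand on \<open>core\<close>: each
    \<open>sinc\<close> there is at least 1/2 and is raised to the power \<open>2 * k\<close>, and
    the cosine contributes another 1/2.\<close>
  define a where "a = (1/2::real) * (1/4) ^ (k * length cs)"
  have a: "a > 0" unfolding a_def by simp
  have int: "integrable \<mu> (\<lambda>z. g z ^ (2 * k) * cos (\<eta> \<bullet> (z - p)))"
  proof (rule integrable_const_bound[where B = 1])
    show "AE z in \<mu>. norm (g z ^ (2 * k) * cos (\<eta> \<bullet> (z - p))) \<le> 1"
      using g1 by (auto simp: abs_mult power_abs intro!: mult_le_one power_le_one)
  qed measurable
  \<comment> \<open>Where the phase is controlled the integrand is nonnegative, thanks to the even
    exponent; elsewhere some slab variable exceeds \<open>\<kappa>\<close> and the integrand is at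
    most \<open>(1/\<kappa>) ^ (2 * k)\<close> in modulus.\<close>
  have "AE z in \<mu>. a * indicator core z - (1/\<kappa>) ^ (2 * k) \<le> g z ^ (2 * k) * cos (\<eta> \<bullet> (z - p))"
    using phase
  proof eventually_elim
    case (elim z)
    have gp: "g z ^ (2 * k) \<ge> 0" by simp
    show ?case
    proof (cases "\<forall>c\<in>set cs. \<bar>c \<bullet> (z - p)\<bar> \<le> \<kappa>")
      case True
      then have cos: "cos (\<eta> \<bullet> (z - p)) \<ge> 1/2" using elim cos_ge_half by blast
      have "a * indicator core z \<le> g z ^ (2 * k) * (1/2)"
      proof (cases "z \<in> core")
        case True
        have "((1/2::real) ^ length cs) ^ (2 * k) \<le> g z ^ (2 * k)"
          by (intro power_mono gcore True) auto
        moreover have "((1/2::real) ^ length cs) ^ (2 * k) = (1/4) ^ (k * length cs)"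
        proof -
          have "((1/2::real) ^ length cs) ^ (2 * k) = ((1/2)\<^sup>2) ^ (k * length cs)"
            unfolding power_mult[symmetric] by (simp add: mult_ac)
          then show ?thesis by (simp add: power2_eq_square)
        qed
        ultimately show ?thesis using True by (simp add: a_def)
      qed simp
      also have "\<dots> \<le> g z ^ (2 * k) * cos (\<eta> \<bullet> (z - p))" using cos gp by (intro mult_left_mono) auto
      moreover have "0 \<le> (1/\<kappa>) ^ (2 * k)" using \<kappa> by simp
      ultimately show ?thesis by linarith
    next
      case False
      then have c: "\<exists>c\<in>set cs. \<bar>c \<bullet> (z - p)\<bar> > \<kappa>" by (meson not_le)
      then have "z \<notin> core" using \<kappa> unfolding core_def by fastforce
      have "g z ^ (2 * k) \<le> (1/\<kappa>) ^ (2 * k)"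
        using power_mono[OF gout[OF c], of "2 * k"] by (simp add: power_even_abs)
      then have "\<bar>g z ^ (2 * k) * cos (\<eta> \<bullet> (z - p))\<bar> \<le> (1/\<kappa>) ^ (2 * k) * 1"
        unfolding abs_mult using gp \<kappa> by (intro mult_mono) auto
      then show ?thesis using \<open>z \<notin> core\<close> by simp
    qed
  qed
  then have "(\<integral>z. a * indicator core z - (1/\<kappa>) ^ (2 * k) \<partial>\<mu>) \<le> (\<integral>z. g z ^ (2 * k) * cos (\<eta> \<bullet> (z - p)) \<partial>\<mu>)"
    using core by (intro integral_mono_AE int Bochner_Integration.integrable_diff integrable_mult_right
        integrable_real_indicator) (auto simp: less_top[symmetric])
  moreover have "(\<integral>z. a * indicator core z - (1/\<kappa>) ^ (2 * k) \<partial>\<mu>) = a * measure \<mu> core - measure \<mu> UNIV * (1/\<kappa>) ^ (2 * k)"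
    using core by (subst Bochner_Integration.integral_diff) (auto simp: space less_top[symmetric])
  moreover have "(\<integral>z. g z ^ (2 * k) * cos (\<eta> \<bullet> (z - p)) \<partial>\<mu>) \<le> B"
  proof -
    have pw: "complex_of_real (g z ^ (2 * k)) * cis (\<eta> \<bullet> z) * cis (- (\<eta> \<bullet> p))
        = complex_of_real (g z ^ (2 * k)) * cis (\<eta> \<bullet> (z - p))" for z
      unfolding mult.assoc cis_mult by (simp add: inner_diff_right)
    have eq: "(\<integral>z. g z ^ (2 * k) * cis (\<eta> \<bullet> (z - p)) \<partial>\<mu>)
        = (\<integral>z. complex_of_real (g z ^ (2 * k)) * cis (\<eta> \<bullet> z) \<partial>\<mu>) * cis (- (\<eta> \<bullet> p))"
      unfolding pw[symmetric] by (rule integral_mult_left_zero)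
    have intc: "integrable \<mu> (\<lambda>z. complex_of_real (g z ^ (2 * k)) * cis (\<eta> \<bullet> (z - p)))"
    proof (rule integrable_const_bound[where B = 1])
      show "AE z in \<mu>. norm (complex_of_real (g z ^ (2 * k)) * cis (\<eta> \<bullet> (z - p))) \<le> 1"
        using g1 by (auto simp: norm_mult norm_power power_abs intro!: power_le_one)
    qed measurable
    have "(\<integral>z. g z ^ (2 * k) * cos (\<eta> \<bullet> (z - p)) \<partial>\<mu>)
        = (\<integral>z. Re (complex_of_real (g z ^ (2 * k)) * cis (\<eta> \<bullet> (z - p))) \<partial>\<mu>)"
      by (intro Bochner_Integration.integral_cong) (auto simp flip: of_real_power)
    also have "\<dots> = Re (\<integral>z. complex_of_real (g z ^ (2 * k)) * cis (\<eta> \<bullet> (z - p)) \<partial>\<mu>)"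
      by (rule integral_Re[OF intc])
    also have "\<dots> \<le> cmod (\<integral>z. complex_of_real (g z ^ (2 * k)) * cis (\<eta> \<bullet> (z - p)) \<partial>\<mu>)"
      by (rule complex_Re_le_cmod)
    also have "\<dots> = cmod (\<integral>z. complex_of_real (g z ^ (2 * k)) * cis (\<eta> \<bullet> z) \<partial>\<mu>)"
      unfolding eq by (simp add: norm_mult)
    also have "\<dots> \<le> B"
      unfolding gpow[symmetric]
      by (rule norm_integral_prod_sinc_le[OF fin sets]) (use B in \<open>simp add: spow\<close>)
    finally show ?thesis .
  qed
  ultimately have "a * measure \<mu> core \<le> B + measure \<mu> UNIV * (1/\<kappa>) ^ (2 * k)" by linarith
  then have "measure \<mu> core \<le> (B + measure \<mu> UNIV * (1/\<kappa>) ^ (2 * k)) / a"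
    using a by (simp add: field_simps)
  also have "\<dots> = 2 * 4 ^ (k * length cs) * (B + measure \<mu> UNIV * (1/\<kappa>) ^ (2 * k))"
    unfolding a_def by (simp add: power_one_over field_simps)
  finally show ?thesis unfolding core_def .
qed

section \<open>Comparison of parameter caps with ambient slabs\<close>

text \<open>The radius \<open>2 * R\<close> gives room: caps are centred at parameters in the ball
  of radius \<open>R\<close>, and points of their widened versions may leave it.\<close>

locale chart_ball = chart +
  fixes z0 :: 'a and R R' L :: real
  assumes z0_in_M: "z0 \<in> M" and z0_in_U: "z0 \<in> U"
    and R_pos: "R > 0" and R'_pos: "R' > 0" and L_pos: "L > 0"
    and ball_V: "cball (\<phi> z0) (2 * R) \<subseteq> V" and ball_U: "cball z0 R' \<subseteq> U"
    and psi_ball: "\<psi> ` cball (\<phi> z0) (2 * R) \<subseteq> cball z0 R'"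
    and psi_Lipschitz: "\<And>x y. x \<in> cball (\<phi> z0) (2 * R) \<Longrightarrow> y \<in> cball (\<phi> z0) (2 * R) \<Longrightarrow>
          norm (\<psi> x - \<psi> y) \<le> L * norm (x - y)"
    and psi_Lipschitz_inv: "\<And>x y. x \<in> cball (\<phi> z0) (2 * R) \<Longrightarrow> y \<in> cball (\<phi> z0) (2 * R) \<Longrightarrow>
          norm (x - y) \<le> L * norm (\<psi> x - \<psi> y)"

lemma (in chart) chart_ball_exists:
  assumes "z0 \<in> M" "z0 \<in> U"
  obtains R R' L where "chart_ball M U V \<phi> \<psi> D z0 R R' L"
proof -
  obtain R R' L where R: "R > 0" "R' > 0" "L > 0" "cball (\<phi> z0) R \<subseteq> V" "cball z0 R' \<subseteq> U"
    "\<psi> ` cball (\<phi> z0) R \<subseteq> cball z0 R'"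
    "\<And>x y. x \<in> cball (\<phi> z0) R \<Longrightarrow> y \<in> cball (\<phi> z0) R \<Longrightarrow> norm (\<psi> x - \<psi> y) \<le> L * norm (x - y)"
    "\<And>x y. x \<in> cball (\<phi> z0) R \<Longrightarrow> y \<in> cball (\<phi> z0) R \<Longrightarrow> norm (x - y) \<le> L * norm (\<psi> x - \<psi> y)"
    by (rule chart_radius[OF assms(2)]) (rule that; assumption)
  have "chart_ball M U V \<phi> \<psi> D z0 (R / 2) R' L"
    by unfold_locales (use assms R in \<open>simp_all\<close>)
  then show ?thesis by (rule that)
qed

context chart_ball begin

definition x0 :: 'a where "x0 = \<phi> z0"

definition param :: "real \<Rightarrow> 'a set" where "param r = span D \<inter> cball x0 r"

lemma param_V: "x \<in> param (2 * R) \<Longrightarrow> x \<in> V" and param_span: "x \<in> param r \<Longrightarrow> x \<in> span D"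
  using ball_V unfolding param_def x0_def by auto

lemma param_mono: "x \<in> param R \<Longrightarrow> x \<in> param (2 * R)"
  using R_pos unfolding param_def by auto

lemma x0_in_param: "x0 \<in> param R"
  using phi_in_span z0_in_M z0_in_U R_pos unfolding param_def x0_def by simp

lemma psi_param_U: "x \<in> param (2 * R) \<Longrightarrow> \<psi> x \<in> cball z0 R'"
  using psi_ball unfolding param_def x0_def by blast

text \<open>The adjoint of the derivative of \<open>\<phi>\<close> at \<open>z\<close>, applied to
  \<open>v\<close>: to first order,
  \<open>cov v (\<psi> x2) \<bullet> (\<psi> x - \<psi> x2)\<close> is the chart quantity
  \<open>v \<bullet> (x - x2)\<close>.\<close>

definition cov :: "'a \<Rightarrow> 'a \<Rightarrow> 'a" where
  "cov v z = (\<Sum>e\<in>Basis. (v \<bullet> dderiv \<phi> e z) *\<^sub>R e)"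

lemma cov_inner: "z \<in> U \<Longrightarrow> cov v z \<bullet> y = v \<bullet> dderiv \<phi> y z"
  using dderiv_eq_sum_Basis[OF open_U smooth_phi, of z y]
  by (simp add: cov_def inner_sum_left inner_sum_right inner_commute mult.commute)

lemma cov_bounded:
  obtains B where "B > 0" "\<And>v z. z \<in> cball z0 R' \<Longrightarrow> norm (cov v z) \<le> B * norm v"
proof -
  obtain B where B: "B > 0" "\<And>z v. z \<in> cball z0 R' \<Longrightarrow> norm (dderiv \<phi> v z) \<le> B * norm v"
    using smooth_on_dderiv_bounded[OF open_U smooth_phi ball_U] by blast
  have "norm (cov v z) \<le> B * norm v" if "z \<in> cball z0 R'" for v z
  proof (cases "cov v z = 0")
    case False
    have "norm (cov v z) * norm (cov v z) = v \<bullet> dderiv \<phi> (cov v z) z"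
      using cov_inner[of z v "cov v z"] that ball_U by (auto simp flip: power2_eq_square power2_norm_eq_inner)
    also have "\<dots> \<le> norm v * (B * norm (cov v z))"
      using norm_cauchy_schwarz[of v] B(2)[OF that] by (meson mult_left_mono norm_ge_zero order_trans)
    finally show ?thesis using False by (simp add: mult_ac)
  qed (use B in simp)
  then show ?thesis using that B(1) by blast
qed

text \<open>The slabs bound all ambient coordinates at scale \<open>a\<close> and the covectors of
  \<open>W\<close> at scale \<open>b\<close>. Linearising \<open>\<phi>\<close> costs a quadratic
  error, which \<open>\<kappa> * a\<^sup>2 \<le> b\<close> keeps of the order of the slab width. The
  condition \<open>K * \<kappa> * a \<le> 1\<close> keeps the widened slab region so close to its
  centre that only the sheet of \<open>M\<close> seen by the chart can enter it.\<close>

lemma cap_geometry: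
  obtains K where "K \<ge> 1"
    "\<And>x2 W a b \<kappa>. \<lbrakk>x2 \<in> param R; finite W; card W \<le> DIM('a); \<And>v. v \<in> W \<Longrightarrow> norm v \<le> 1;
       0 < b; b \<le> a; \<kappa> \<ge> 1; \<kappa> * a\<^sup>2 \<le> b; K * \<kappa> * a \<le> 1\<rbrakk> \<Longrightarrow>
     \<exists>cs. length cs \<le> 2 * DIM('a) \<and> (\<forall>c\<in>set cs. norm c \<le> K / b) \<and>
       (\<forall>x\<in>param R. norm (x - x2) \<le> real DIM('a) * a \<and> (\<forall>v\<in>W. \<bar>v \<bullet> (x - x2)\<bar> \<le> b) \<longrightarrow>
          (\<forall>c\<in>set cs. \<bar>c \<bullet> (\<psi> x - \<psi> x2)\<bar> \<le> 1)) \<and>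
       (\<forall>z\<in>M. (\<forall>c\<in>set cs. \<bar>c \<bullet> (z - \<psi> x2)\<bar> \<le> \<kappa>) \<longrightarrow>
          (\<exists>x\<in>param (2 * R). z = \<psi> x \<and> norm (x - x2) \<le> K * \<kappa> * a \<and> (\<forall>v\<in>W. \<bar>v \<bullet> (x - x2)\<bar> \<le> K * \<kappa> * b)))"
proof -
  obtain B where B: "B > 0" "\<And>v z. z \<in> cball z0 R' \<Longrightarrow> norm (cov v z) \<le> B * norm v"
    using cov_bounded by blast
  obtain T where T: "T > 0" "\<And>z z'. z \<in> cball z0 R' \<Longrightarrow> z' \<in> cball z0 R' \<Longrightarrow>
       norm (\<phi> z' - \<phi> z - dderiv \<phi> (z' - z) z) \<le> T * norm (z' - z) ^ 2"
    using smooth_on_taylor1[OF open_U smooth_phi ball_U] by blast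
  \<comment> \<open>A compact set inside the open set \<open>G\<close> has a uniform margin
    \<open>\<rho>\<close>; within it the points of \<open>M\<close> are given by the chart.\<close>
  define G where "G = U \<inter> \<phi> -` ball x0 (2 * R)"
  have "open G" unfolding G_def using continuous_open_preimage[OF continuous_phi open_U] by blast
  moreover have "compact (\<psi> ` cball x0 R)"
    using ball_V R_pos unfolding x0_def
    by (intro compact_continuous_image compact_cball continuous_on_subset[OF continuous_psi]) auto
  moreover have "\<psi> ` cball x0 R \<subseteq> G"
    using ball_V R_pos psi_in phi_psi unfolding G_def x0_def by (auto simp: subset_eq)
  ultimately obtain \<rho> where \<rho>: "\<rho> > 0" "(\<Union>z\<in>\<psi> ` cball x0 R. cball z \<rho>) \<subseteq> G"
    using compact_subset_open_imp_cball_epsilon_subset[of "\<psi> ` cball x0 R" G] by blast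
  define d where "d = real DIM('a)"
  have d: "d \<ge> 1" unfolding d_def by (simp add: Suc_leI)
  \<comment> \<open>\<open>K1\<close> makes the slabs wide enough to contain the image of a cap;
    \<open>K2\<close> converts slab bounds back into bounds on parameters; \<open>K\<close> also
    accounts for the norms of the covectors and for the margin \<open>\<rho>\<close>.\<close>
  define K1 where "K1 = 1 + L * d + T * L\<^sup>2 * d\<^sup>2"
  have K1: "K1 \<ge> 1" "K1 \<ge> L * d" "K1 \<ge> 1 + T * L\<^sup>2 * d\<^sup>2"
    unfolding K1_def using L_pos T(1) d by auto
  define K2 where "K2 = L * d * K1 + K1 + T * d\<^sup>2 * K1\<^sup>2"
  define K where "K = 1 + B + K2 + d * K1 / \<rho>"
  have K2: "K2 \<ge> L * d * K1" "K2 \<ge> K1 + T * d\<^sup>2 * K1\<^sup>2" "K2 \<ge> 0"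
    unfolding K2_def using L_pos T(1) d K1 by auto
  have KK: "K \<ge> 1 + B" "K \<ge> K2" "K \<ge> d * K1 / \<rho>"
    unfolding K_def using B(1) K2(3) d K1(1) \<rho>(1) by (auto intro!: add_nonneg_nonneg)
  have taylor: "\<bar>cov v (\<psi> x2) \<bullet> (\<psi> x - \<psi> x2) - v \<bullet> (x - x2)\<bar> \<le> T * norm (\<psi> x - \<psi> x2) ^ 2"
    if x: "x \<in> param (2 * R)" "x2 \<in> param (2 * R)" and v: "norm v \<le> 1" for x x2 v
  proof -
    have U: "\<psi> x2 \<in> U" using psi_param_U[OF x(2)] ball_U by blast
    have "norm (\<phi> (\<psi> x) - \<phi> (\<psi> x2) - dderiv \<phi> (\<psi> x - \<psi> x2) (\<psi> x2)) \<le> T * norm (\<psi> x - \<psi> x2) ^ 2"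
      by (rule T(2)) (use x psi_param_U in auto)
    then have e: "norm (x - x2 - dderiv \<phi> (\<psi> x - \<psi> x2) (\<psi> x2)) \<le> T * norm (\<psi> x - \<psi> x2) ^ 2"
      using phi_psi param_V x by simp
    have "\<bar>cov v (\<psi> x2) \<bullet> (\<psi> x - \<psi> x2) - v \<bullet> (x - x2)\<bar>
        = \<bar>v \<bullet> (x - x2 - dderiv \<phi> (\<psi> x - \<psi> x2) (\<psi> x2))\<bar>"
      unfolding cov_inner[OF U] by (simp add: inner_diff_right)
    also have "\<dots> \<le> norm v * norm (x - x2 - dderiv \<phi> (\<psi> x - \<psi> x2) (\<psi> x2))"
      by (rule Cauchy_Schwarz_ineq2)
    also have "\<dots> \<le> 1 * (T * norm (\<psi> x - \<psi> x2) ^ 2)"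
      using e v T(1) by (intro mult_mono) auto
    finally show ?thesis by simp
  qed
  show ?thesis
  proof (rule that)
    show "K \<ge> 1" using KK(1) B(1) by simp
    fix x2 a b \<kappa> and W :: "'a set"
    assume x2: "x2 \<in> param R" and W: "finite W" "card W \<le> DIM('a)" "\<And>v. v \<in> W \<Longrightarrow> norm v \<le> 1"
      and ab: "0 < b" "b \<le> a" and \<kappa>: "\<kappa> \<ge> 1" "\<kappa> * a\<^sup>2 \<le> b" "K * \<kappa> * a \<le> 1"
    have x2': "x2 \<in> param (2 * R)" using param_mono[OF x2] .
    have a: "a > 0" using ab by simp
    have a2b: "a\<^sup>2 \<le> b" using \<kappa> mult_right_mono[of 1 \<kappa> "a\<^sup>2"] by simp
    obtain bs where bs: "set bs = (Basis :: 'a set)" "distinct bs" using finite_distinct_list[OF finite_Basis] by blast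
    obtain ws where ws: "set ws = W" "distinct ws" using finite_distinct_list[OF W(1)] by blast
    define z2 where "z2 = \<psi> x2"
    have z2: "z2 \<in> cball z0 R'" unfolding z2_def using psi_param_U[OF x2'] .
    define cs where "cs = map (\<lambda>e. (1 / (K1 * a)) *\<^sub>R e) bs @ map (\<lambda>v. (1 / (K1 * b)) *\<^sub>R cov v z2) ws"
    have K1a: "K1 * a > 0" "K1 * b > 0" using K1(1) ab a by auto
    have cs_iff: "(\<forall>c\<in>set cs. \<bar>c \<bullet> y\<bar> \<le> t) \<longleftrightarrow>
        (\<forall>e\<in>Basis. \<bar>e \<bullet> y\<bar> \<le> t * (K1 * a)) \<and> (\<forall>v\<in>W. \<bar>cov v z2 \<bullet> y\<bar> \<le> t * (K1 * b))" for y t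
      unfolding cs_def set_append set_map bs(1) ws(1) ball_Un ball_simps
      using K1(1) a ab by (simp add: abs_mult pos_divide_le_eq)
    show "\<exists>cs. length cs \<le> 2 * DIM('a) \<and> (\<forall>c\<in>set cs. norm c \<le> K / b) \<and>
       (\<forall>x\<in>param R. norm (x - x2) \<le> real DIM('a) * a \<and> (\<forall>v\<in>W. \<bar>v \<bullet> (x - x2)\<bar> \<le> b) \<longrightarrow>
          (\<forall>c\<in>set cs. \<bar>c \<bullet> (\<psi> x - \<psi> x2)\<bar> \<le> 1)) \<and>
       (\<forall>z\<in>M. (\<forall>c\<in>set cs. \<bar>c \<bullet> (z - \<psi> x2)\<bar> \<le> \<kappa>) \<longrightarrow>
          (\<exists>x\<in>param (2 * R). z = \<psi> x \<and> norm (x - x2) \<le> K * \<kappa> * a \<and> (\<forall>v\<in>W. \<bar>v \<bullet> (x - x2)\<bar> \<le> K * \<kappa> * b)))"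
    proof (intro exI[of _ cs] conjI ballI impI)
      have "length bs = DIM('a)" "length ws = card W"
        using distinct_card[OF bs(2)] distinct_card[OF ws(2)] bs(1) ws(1) by auto
      then show "length cs \<le> 2 * DIM('a)" unfolding cs_def using W(2) by simp
    next
      fix c assume "c \<in> set cs"
      then consider e where "e \<in> Basis" "c = (1 / (K1 * a)) *\<^sub>R e" | v where "v \<in> W" "c = (1 / (K1 * b)) *\<^sub>R cov v z2"
        unfolding cs_def using bs(1) ws(1) by auto
      then show "norm c \<le> K / b"
      proof cases
        case 1
        have "norm c = 1 / (K1 * a)" using 1 K1a by simp
        also have "\<dots> \<le> 1 / b" using K1(1) ab a mult_mono[of 1 K1 b a] by (intro divide_left_mono) auto
        also have "\<dots> \<le> K / b" using KK(1) B(1) ab by (intro divide_right_mono) auto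
        finally show ?thesis .
      next
        case 2
        have "norm c = norm (cov v z2) / (K1 * b)" using 2 K1a by simp
        also have "\<dots> \<le> (B * 1) / (1 * b)"
        proof (intro frac_le)
          have "norm (cov v z2) \<le> B * norm v" using B(2)[OF z2] .
          also have "\<dots> \<le> B * 1" using B(1) W(3)[OF 2(1)] by (intro mult_left_mono) auto
          finally show "norm (cov v z2) \<le> B * 1" .
        qed (use B(1) ab K1 in auto)
        also have "\<dots> \<le> K / b" using KK(1) ab by (simp add: divide_right_mono)
        finally show ?thesis .
      qed
    next
      fix x c assume x: "x \<in> param R" and u: "norm (x - x2) \<le> real DIM('a) * a \<and> (\<forall>v\<in>W. \<bar>v \<bullet> (x - x2)\<bar> \<le> b)"
        and c: "c \<in> set cs"
      have x': "x \<in> param (2 * R)" using param_mono[OF x] .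
      have "norm (\<psi> x - \<psi> x2) \<le> L * norm (x - x2)"
        using psi_Lipschitz x' x2' unfolding param_def x0_def by blast
      also have "\<dots> \<le> L * (d * a)" using u L_pos unfolding d_def by (intro mult_left_mono) auto
      finally have y: "norm (\<psi> x - \<psi> x2) \<le> L * d * a" by simp
      have "\<forall>c\<in>set cs. \<bar>c \<bullet> (\<psi> x - \<psi> x2)\<bar> \<le> 1"
        unfolding cs_iff
      proof (intro conjI ballI)
        fix e :: 'a assume "e \<in> Basis"
        then have "\<bar>e \<bullet> (\<psi> x - \<psi> x2)\<bar> \<le> norm (\<psi> x - \<psi> x2)" using Basis_le_norm by (metis inner_commute)
        also have "\<dots> \<le> K1 * a" by (rule order_trans[OF y mult_right_mono[OF K1(2)]]) (use a in simp)
        finally show "\<bar>e \<bullet> (\<psi> x - \<psi> x2)\<bar> \<le> 1 * (K1 * a)" by simp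
      next
        fix v assume v: "v \<in> W"
        have "\<bar>cov v z2 \<bullet> (\<psi> x - \<psi> x2)\<bar> \<le> \<bar>v \<bullet> (x - x2)\<bar> + T * norm (\<psi> x - \<psi> x2) ^ 2"
          using taylor[OF x' x2' W(3)[OF v]] unfolding z2_def by linarith
        also have "\<dots> \<le> b + T * (L * d * a)\<^sup>2"
          using u v y T(1) by (intro add_mono mult_left_mono power_mono) auto
        also have "\<dots> = b + T * L\<^sup>2 * d\<^sup>2 * a\<^sup>2" by (simp add: power_mult_distrib)
        also have "\<dots> \<le> b + T * L\<^sup>2 * d\<^sup>2 * b" using a2b T(1) by (intro add_left_mono mult_left_mono) auto
        also have "\<dots> = (1 + T * L\<^sup>2 * d\<^sup>2) * b" by (simp add: algebra_simps)
        also have "\<dots> \<le> K1 * b" using K1(3) ab by (intro mult_right_mono) auto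
        finally show "\<bar>cov v z2 \<bullet> (\<psi> x - \<psi> x2)\<bar> \<le> 1 * (K1 * b)" by simp
      qed
      then show "\<bar>c \<bullet> (\<psi> x - \<psi> x2)\<bar> \<le> 1" using c by blast
    next
      fix z assume z: "z \<in> M" and "\<forall>c\<in>set cs. \<bar>c \<bullet> (z - \<psi> x2)\<bar> \<le> \<kappa>"
      then have e: "\<And>e. e \<in> Basis \<Longrightarrow> \<bar>e \<bullet> (z - z2)\<bar> \<le> \<kappa> * (K1 * a)"
        and v: "\<And>v. v \<in> W \<Longrightarrow> \<bar>cov v z2 \<bullet> (z - z2)\<bar> \<le> \<kappa> * (K1 * b)"
        unfolding cs_iff z2_def by auto
      have "norm (z - z2) \<le> (\<Sum>e\<in>Basis. \<bar>(z - z2) \<bullet> e\<bar>)" by (rule norm_le_l1)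
      also have "\<dots> \<le> (\<Sum>e\<in>(Basis::'a set). \<kappa> * (K1 * a))" using e by (intro sum_mono) (simp add: inner_commute)
      finally have y: "norm (z - z2) \<le> d * K1 * \<kappa> * a" by (simp add: d_def mult_ac)
      have "d * K1 / \<rho> * (\<kappa> * a) \<le> K * (\<kappa> * a)" using KK(3) \<kappa> a by (intro mult_right_mono) auto
      then have "d * K1 / \<rho> * (\<kappa> * a) \<le> 1" using \<kappa>(3) by (simp add: mult.assoc)
      from mult_right_mono[OF this, of \<rho>] have "d * K1 * \<kappa> * a \<le> \<rho>" using \<rho>(1) by simp
      then have "z \<in> cball z2 \<rho>" using y by (simp add: dist_norm norm_minus_commute)
      moreover have "z2 \<in> \<psi> ` cball x0 R" using x2 unfolding z2_def param_def by auto
      ultimately have "z \<in> G" using \<rho>(2) by blast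
      define x where "x = \<phi> z"
      have x: "x \<in> param (2 * R)" "z = \<psi> x"
        using \<open>z \<in> G\<close> z phi_in_span psi_phi unfolding G_def x_def param_def by auto
      have Kka: "\<kappa> * a \<ge> 0" "\<kappa> * b \<ge> 0" using \<kappa> a ab by auto
      have "norm (x - x2) \<le> L * norm (\<psi> x - \<psi> x2)"
        using psi_Lipschitz_inv x(1) x2' unfolding param_def x0_def by blast
      also have "\<dots> \<le> L * (d * K1 * \<kappa> * a)" using y L_pos unfolding x(2) z2_def by (intro mult_left_mono) auto
      also have "\<dots> = (L * d * K1) * (\<kappa> * a)" by simp
      also have "\<dots> \<le> K * (\<kappa> * a)" using K2(1) KK(2) Kka by (intro mult_right_mono) auto
      finally have n: "norm (x - x2) \<le> K * \<kappa> * a" by simp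
      have "\<bar>v \<bullet> (x - x2)\<bar> \<le> K * \<kappa> * b" if vW: "v \<in> W" for v
      proof -
        have "\<bar>v \<bullet> (x - x2)\<bar> \<le> \<bar>cov v z2 \<bullet> (\<psi> x - \<psi> x2)\<bar> + T * norm (\<psi> x - \<psi> x2) ^ 2"
          using taylor[OF x(1) x2' W(3)[OF vW]] unfolding z2_def by linarith
        also have "\<dots> \<le> \<kappa> * (K1 * b) + T * (d * K1 * \<kappa> * a)\<^sup>2"
          using v[OF vW] y T(1) unfolding x(2) z2_def by (intro add_mono mult_left_mono power_mono) auto
        also have "\<dots> = \<kappa> * (K1 * b) + T * d\<^sup>2 * K1\<^sup>2 * \<kappa> * (\<kappa> * a\<^sup>2)"
          by (simp add: power_mult_distrib power2_eq_square mult_ac)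
        also have "\<dots> \<le> \<kappa> * (K1 * b) + T * d\<^sup>2 * K1\<^sup>2 * \<kappa> * b"
          using \<kappa> T(1) by (intro add_left_mono mult_left_mono) auto
        also have "\<dots> = (K1 + T * d\<^sup>2 * K1\<^sup>2) * (\<kappa> * b)" by (simp add: algebra_simps)
        also have "\<dots> \<le> K * (\<kappa> * b)" using K2(2) KK(2) Kka by (intro mult_right_mono) auto
        finally show ?thesis by simp
      qed
      then show "\<exists>x\<in>param (2 * R). z = \<psi> x \<and> norm (x - x2) \<le> K * \<kappa> * a \<and> (\<forall>v\<in>W. \<bar>v \<bullet> (x - x2)\<bar> \<le> K * \<kappa> * b)"
        using x n by blast
    qed
  qed
qed

text \<open>\<open>K\<close> is enlarged until the frequencies reached by the
  \<open>2 * k\<close>-th power of the cut-off stay within \<open>norm \<eta> / 2\<close> of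
  \<open>\<eta>\<close>; the decay hypothesis then applies to all of them with the same power of
  \<open>norm \<eta>\<close>. The phase has to be controlled only at parameters, because
  \<open>\<mu>\<close> lives on \<open>M\<close>.\<close>

lemma cap_measure:
  assumes dec: "fourier_decay_measure_on M s \<mu>" and s: "s \<ge> 0"
  obtains C K where "C > 0" "K \<ge> 1"
    "\<And>x2 W a b \<kappa> \<eta>. \<lbrakk>x2 \<in> param R; finite W; card W \<le> DIM('a); \<And>v. v \<in> W \<Longrightarrow> norm v \<le> 1;
       0 < b; b \<le> a; \<kappa> \<ge> 1; \<kappa> * a\<^sup>2 \<le> b; K * \<kappa> * a \<le> 1; K / b \<le> norm \<eta>;
       \<And>x. \<lbrakk>x \<in> param (2 * R); norm (x - x2) \<le> K * \<kappa> * a; \<And>v. v \<in> W \<Longrightarrow> \<bar>v \<bullet> (x - x2)\<bar> \<le> K * \<kappa> * b\<rbrakk>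
          \<Longrightarrow> \<bar>\<eta> \<bullet> (\<psi> x - \<psi> x2)\<bar> \<le> 1\<rbrakk> \<Longrightarrow>
     \<exists>Q\<in>sets \<mu>. measure \<mu> Q \<le> C * (norm \<eta> powr (- s / 2) + (1 / \<kappa>) ^ (2 * k)) \<and>
       (\<forall>x\<in>param R. norm (x - x2) \<le> real DIM('a) * a \<and> (\<forall>v\<in>W. \<bar>v \<bullet> (x - x2)\<bar> \<le> b) \<longrightarrow> \<psi> x \<in> Q)"
proof -
  have sets: "sets \<mu> = sets borel" and fin: "finite_measure \<mu>" and AEM: "AE z in \<mu>. z \<in> M"
    using dec unfolding fourier_decay_measure_on_def by auto
  obtain C0' where C0': "\<And>\<zeta>. \<zeta> \<noteq> 0 \<Longrightarrow> cmod (fourier_transform_measure \<mu> \<zeta>) \<le> C0' * norm \<zeta> powr (- s / 2)"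
    using dec unfolding fourier_decay_measure_on_def by auto
  define C0 where "C0 = \<bar>C0'\<bar> + 1"
  have C0: "cmod (fourier_transform_measure \<mu> \<zeta>) \<le> C0 * norm \<zeta> powr (- s / 2)" if "\<zeta> \<noteq> 0" for \<zeta>
  proof -
    have "C0' \<le> C0" unfolding C0_def by linarith
    from mult_right_mono[OF this, of "norm \<zeta> powr (- s / 2)"] show ?thesis using C0'[OF that] by simp
  qed
  have C0_pos: "C0 > 0" unfolding C0_def by linarith
  obtain K0 where K0: "K0 \<ge> 1" and geom:
    "\<And>x2 W a b \<kappa>. \<lbrakk>x2 \<in> param R; finite W; card W \<le> DIM('a); \<And>v. v \<in> W \<Longrightarrow> norm v \<le> 1;
       0 < b; b \<le> a; \<kappa> \<ge> 1; \<kappa> * a\<^sup>2 \<le> b; K0 * \<kappa> * a \<le> 1\<rbrakk> \<Longrightarrow>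
     \<exists>cs. length cs \<le> 2 * DIM('a) \<and> (\<forall>c\<in>set cs. norm c \<le> K0 / b) \<and>
       (\<forall>x\<in>param R. norm (x - x2) \<le> real DIM('a) * a \<and> (\<forall>v\<in>W. \<bar>v \<bullet> (x - x2)\<bar> \<le> b) \<longrightarrow>
          (\<forall>c\<in>set cs. \<bar>c \<bullet> (\<psi> x - \<psi> x2)\<bar> \<le> 1)) \<and>
       (\<forall>z\<in>M. (\<forall>c\<in>set cs. \<bar>c \<bullet> (z - \<psi> x2)\<bar> \<le> \<kappa>) \<longrightarrow>
          (\<exists>x\<in>param (2 * R). z = \<psi> x \<and> norm (x - x2) \<le> K0 * \<kappa> * a \<and> (\<forall>v\<in>W. \<bar>v \<bullet> (x - x2)\<bar> \<le> K0 * \<kappa> * b)))"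
    by (rule cap_geometry) blast
  define n where "n = DIM('a)"
  \<comment> \<open>At most \<open>2 * n\<close> slab vectors of norm at most \<open>K0 / b\<close>,
    each repeated \<open>2 * k\<close> times, have total norm at most
    \<open>4 * k * n * K0 / b\<close>; the factor 8 makes this at most half of
    \<open>K / b\<close>.\<close>
  define K where "K = K0 * (1 + 8 * real k * real n)"
  have K: "K \<ge> K0" unfolding K_def using K0 by (simp add: algebra_simps)
  define C where "C = 2 * 4 ^ (k * (2 * n)) * (C0 * (4 * pi) powr (s / 2) + measure \<mu> UNIV)"
  have C: "C > 0" unfolding C_def using C0_pos by (intro mult_pos_pos add_pos_nonneg) auto
  show ?thesis
  proof (rule that[OF C])
    show "K \<ge> 1" using K K0 by simp
    fix x2 a b \<kappa> \<eta> and W :: "'a set"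
    assume x2: "x2 \<in> param R" and W: "finite W" "card W \<le> DIM('a)" "\<And>v. v \<in> W \<Longrightarrow> norm v \<le> 1"
      and ab: "0 < b" "b \<le> a" and \<kappa>: "\<kappa> \<ge> 1" "\<kappa> * a\<^sup>2 \<le> b" "K * \<kappa> * a \<le> 1" and \<eta>: "K / b \<le> norm \<eta>"
      and phase: "\<And>x. \<lbrakk>x \<in> param (2 * R); norm (x - x2) \<le> K * \<kappa> * a; \<And>v. v \<in> W \<Longrightarrow> \<bar>v \<bullet> (x - x2)\<bar> \<le> K * \<kappa> * b\<rbrakk>
          \<Longrightarrow> \<bar>\<eta> \<bullet> (\<psi> x - \<psi> x2)\<bar> \<le> 1"
    have kap: "\<kappa> * a \<ge> 0" "\<kappa> * b \<ge> 0" using \<kappa> ab by auto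
    have Ka: "K0 * \<kappa> * a \<le> K * \<kappa> * a" "K0 * \<kappa> * b \<le> K * \<kappa> * b"
      using mult_right_mono[OF K kap(1)] mult_right_mono[OF K kap(2)] by (simp_all add: mult.assoc)
    have "K0 * \<kappa> * a \<le> 1" using Ka \<kappa>(3) by simp
    from geom[OF x2 W ab \<kappa>(1,2) this] obtain cs where cs: "length cs \<le> 2 * DIM('a)" "\<forall>c\<in>set cs. norm c \<le> K0 / b"
      "\<And>x. x \<in> param R \<Longrightarrow> norm (x - x2) \<le> real DIM('a) * a \<and> (\<forall>v\<in>W. \<bar>v \<bullet> (x - x2)\<bar> \<le> b) \<Longrightarrow>
          \<forall>c\<in>set cs. \<bar>c \<bullet> (\<psi> x - \<psi> x2)\<bar> \<le> 1"
      "\<And>z. z \<in> M \<Longrightarrow> \<forall>c\<in>set cs. \<bar>c \<bullet> (z - \<psi> x2)\<bar> \<le> \<kappa> \<Longrightarrow>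
          \<exists>x\<in>param (2 * R). z = \<psi> x \<and> norm (x - x2) \<le> K0 * \<kappa> * a \<and> (\<forall>v\<in>W. \<bar>v \<bullet> (x - x2)\<bar> \<le> K0 * \<kappa> * b)"
      by blast
    define Q where "Q = {z. \<forall>c\<in>set cs. \<bar>c \<bullet> (z - \<psi> x2)\<bar> \<le> 1}"
    have Q: "Q \<in> sets \<mu>"
    proof -
      have "Q = (\<Inter>c\<in>set cs. {z. \<bar>c \<bullet> (z - \<psi> x2)\<bar> \<le> 1})" unfolding Q_def by auto
      also have "closed \<dots>" by (intro closed_INT ballI closed_Collect_le continuous_intros)
      finally show ?thesis unfolding sets by (rule borel_closed)
    qed
    have "(\<Sum>c\<leftarrow>cs. norm c) \<le> (\<Sum>c\<leftarrow>cs. K0 / b)" using cs(2) by (intro sum_list_mono) auto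
    also have "\<dots> = real (length cs) * (K0 / b)" by (simp add: sum_list_triv)
    also have "\<dots> \<le> (2 * real n) * (K0 / b)"
      using cs(1) K0 ab unfolding n_def by (intro mult_right_mono) auto
    finally have "2 * real k * (\<Sum>c\<leftarrow>cs. norm c) \<le> 2 * real k * ((2 * real n) * (K0 / b))"
      by (intro mult_left_mono) auto
    also have "\<dots> = (K0 * (8 * real k * real n)) / b / 2" by simp
    also have "\<dots> \<le> K / b / 2" unfolding K_def using K0 ab by (intro divide_right_mono) (auto simp: algebra_simps)
    also have "\<dots> \<le> norm \<eta> / 2" using \<eta> by simp
    finally have rad: "2 * real k * (\<Sum>c\<leftarrow>cs. norm c) \<le> norm \<eta> / 2" .
    have \<eta>0: "norm \<eta> > 0" using \<eta> K K0 ab by (smt (verit) divide_pos_pos)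
    define B where "B = C0 * (4 * pi) powr (s / 2) * norm \<eta> powr (- s / 2)"
    have B: "cmod (\<integral>z. cis (\<xi> \<bullet> z) \<partial>\<mu>) \<le> B" if "norm (\<xi> - \<eta>) \<le> 2 * real k * (\<Sum>c\<leftarrow>cs. norm c)" for \<xi>
    proof -
      have n\<xi>: "norm \<xi> \<ge> norm \<eta> / 2" using that rad norm_triangle_ineq3[of \<xi> \<eta>] by linarith
      \<comment> \<open>Passes from the phase \<open>\<xi> \<bullet> z\<close> to the normalisation
        by \<open>- 2 * pi\<close> in \<open>fourier_transform_measure\<close>; together with
        \<open>norm \<xi> \<ge> norm \<eta> / 2\<close> this produces the factor
        \<open>4 * pi\<close>.\<close>
      define \<zeta> where "\<zeta> = (- 1 / (2 * pi)) *\<^sub>R \<xi>"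
      have \<zeta>: "norm \<zeta> = norm \<xi> / (2 * pi)" unfolding \<zeta>_def by simp
      have "\<zeta> \<noteq> 0" using \<zeta> n\<xi> \<eta>0 by auto
      have eq: "- (2 * pi * (\<zeta> \<bullet> x)) = \<xi> \<bullet> x" for x unfolding \<zeta>_def by simp
      have "cmod (\<integral>z. cis (\<xi> \<bullet> z) \<partial>\<mu>) = cmod (fourier_transform_measure \<mu> \<zeta>)"
        unfolding fourier_transform_measure_def by (simp add: eq)
      also have "\<dots> \<le> C0 * norm \<zeta> powr (- s / 2)" using C0[OF \<open>\<zeta> \<noteq> 0\<close>] .
      also have "\<dots> \<le> C0 * (norm \<eta> / (4 * pi)) powr (- s / 2)"
      proof (intro mult_left_mono powr_mono2')
        show "norm \<eta> / (4 * pi) \<le> norm \<zeta>" unfolding \<zeta> using n\<xi> by (simp add: field_simps)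
      qed (use s \<eta>0 C0_pos in auto)
      also have "\<dots> = B" unfolding B_def using \<eta>0 by (simp add: powr_divide powr_minus field_simps)
      finally show ?thesis .
    qed
    have ph: "AE z in \<mu>. (\<forall>c\<in>set cs. \<bar>c \<bullet> (z - \<psi> x2)\<bar> \<le> \<kappa>) \<longrightarrow> \<bar>\<eta> \<bullet> (z - \<psi> x2)\<bar> \<le> 1"
      using AEM
    proof eventually_elim
      case (elim z)
      show ?case
      proof
        assume "\<forall>c\<in>set cs. \<bar>c \<bullet> (z - \<psi> x2)\<bar> \<le> \<kappa>"
        from cs(4)[OF elim this] obtain x where x: "x \<in> param (2 * R)" "z = \<psi> x" "norm (x - x2) \<le> K0 * \<kappa> * a"
          "\<forall>v\<in>W. \<bar>v \<bullet> (x - x2)\<bar> \<le> K0 * \<kappa> * b" by blast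
        show "\<bar>\<eta> \<bullet> (z - \<psi> x2)\<bar> \<le> 1" unfolding x(2)
          by (rule phase) (use x Ka in \<open>auto intro: order_trans\<close>)
      qed
    qed
    have "measure \<mu> Q \<le> 2 * 4 ^ (k * length cs) * (B + measure \<mu> UNIV * (1/\<kappa>) ^ (2 * k))"
      unfolding Q_def by (rule measure_cap_le[OF fin sets B \<kappa>(1) ph])
    also have "\<dots> \<le> 2 * 4 ^ (k * (2 * n)) * (B + measure \<mu> UNIV * (1/\<kappa>) ^ (2 * k))"
      using cs(1) \<kappa>(1) C0_pos unfolding n_def B_def
      by (intro mult_right_mono mult_left_mono power_increasing mult_le_mono add_nonneg_nonneg) auto
    also have "\<dots> \<le> C * (norm \<eta> powr (- s / 2) + (1 / \<kappa>) ^ (2 * k))"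
    proof -
      define A1 where "A1 = C0 * (4 * pi) powr (s / 2)"
      have "A1 \<ge> 0" unfolding A1_def using C0_pos by simp
      moreover have "(1 / \<kappa>) ^ (2 * k) \<ge> 0" using \<kappa> by simp
      ultimately have "A1 * norm \<eta> powr (- s / 2) + measure \<mu> UNIV * (1/\<kappa>) ^ (2 * k)
          \<le> (A1 + measure \<mu> UNIV) * (norm \<eta> powr (- s / 2) + (1 / \<kappa>) ^ (2 * k))"
        by (simp add: algebra_simps)
      then show ?thesis unfolding C_def B_def A1_def[symmetric] mult.assoc by (intro mult_left_mono) auto
    qed
    finally have mQ: "measure \<mu> Q \<le> C * (norm \<eta> powr (- s / 2) + (1 / \<kappa>) ^ (2 * k))" .
    show "\<exists>Q\<in>sets \<mu>. measure \<mu> Q \<le> C * (norm \<eta> powr (- s / 2) + (1 / \<kappa>) ^ (2 * k)) \<and>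
       (\<forall>x\<in>param R. norm (x - x2) \<le> real DIM('a) * a \<and> (\<forall>v\<in>W. \<bar>v \<bullet> (x - x2)\<bar> \<le> b) \<longrightarrow> \<psi> x \<in> Q)"
      using Q mQ cs(3) unfolding Q_def by (intro bexI[of _ Q]) (auto simp: Q_def)
  qed
qed

end

section \<open>Normal vectors and the heights of caps\<close>

text \<open>Here \<open>v1\<close> will be the long axis of a degenerate cap and \<open>W\<close>
  the set of its short axes.\<close>

lemma orthonormal_complement_vector:
  fixes v1 :: "'a::euclidean_space"
  assumes "subspace E" "v1 \<in> E" "norm v1 = 1"
  obtains W where "finite W" "W \<subseteq> E" "Suc (card W) = dim E" "\<And>v. v \<in> W \<Longrightarrow> norm v = 1" "v1 \<notin> W"
    "\<And>u. u \<in> E \<Longrightarrow> u = (v1 \<bullet> u) *\<^sub>R v1 + (\<Sum>v\<in>W. (v \<bullet> u) *\<^sub>R v)"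
proof -
  define E' where "E' = {x \<in> E. orthogonal v1 x}"
  have sub: "subspace E'"
    unfolding E'_def subspace_def using assms(1)
    by (auto simp: subspace_0 subspace_add subspace_scale orthogonal_clauses)
  obtain W where W: "W \<subseteq> E'" "pairwise orthogonal W" "\<And>x. x \<in> W \<Longrightarrow> norm x = 1"
    "independent W" "card W = dim E'" "span W = E'"
    by (rule orthonormal_basis_subspace[OF sub]) (rule that; assumption)
  have finW: "finite W" using W(4) finiteI_independent by blast
  have v1W: "v1 \<notin> W" using W(1) assms(3) unfolding E'_def by (auto simp: orthogonal_def norm_eq_1)
  have pw: "pairwise orthogonal (insert v1 W)"
    using W(1,2) unfolding E'_def by (auto simp: pairwise_insert orthogonal_commute)
  have n1: "norm i = 1" if "i \<in> insert v1 W" for i using that W(3) assms(3) by auto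
  have ind: "independent (insert v1 W)"
    by (rule pairwise_orthogonal_independent[OF pw]) (use n1 in force)
  have E: "E \<subseteq> span (insert v1 W)"
  proof
    fix u assume u: "u \<in> E"
    have "u - (v1 \<bullet> u) *\<^sub>R v1 \<in> E'"
      unfolding E'_def using u assms
      by (auto simp: subspace_diff subspace_scale orthogonal_def inner_diff_right norm_eq_1)
    then have "u - (v1 \<bullet> u) *\<^sub>R v1 \<in> span W" using W(6) by simp
    then show "u \<in> span (insert v1 W)" unfolding span_insert by blast
  qed
  have WE: "W \<subseteq> E" using W(1) unfolding E'_def by auto
  have "card (insert v1 W) = dim E"
    by (rule basis_card_eq_dim[OF _ E ind]) (use WE assms(2) in auto)
  then have c: "Suc (card W) = dim E" using finW v1W by simp
  have ex: "u = (v1 \<bullet> u) *\<^sub>R v1 + (\<Sum>v\<in>W. (v \<bullet> u) *\<^sub>R v)" if "u \<in> E" for u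
  proof -
    have "(\<Sum>i\<in>insert v1 W. (u \<bullet> i) *\<^sub>R i) = u"
      by (rule orthonormal_basis_expand[OF pw n1]) (use E that finW in auto)
    then show ?thesis using finW v1W by (simp add: inner_commute)
  qed
  show ?thesis by (rule that[OF finW WE c W(3) v1W ex])
qed

context chart_ball begin

text \<open>Normality at \<open>\<psi> x\<close>, phrased by chart derivatives so that no curves are
  involved; on \<open>span D \<inter> V\<close> it is membership in the orthogonal complement of the
  tangent space.\<close>

definition normal_at :: "'a \<Rightarrow> 'a \<Rightarrow> bool" where
  "normal_at x \<zeta> \<longleftrightarrow> (\<forall>e\<in>span D. \<zeta> \<bullet> dderiv \<psi> e x = 0)"

lemma ball_V': "cball x0 (2 * R) \<subseteq> V" using ball_V unfolding x0_def .

lemma norm_span_D_le: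
  assumes "u \<in> span D"
  shows "norm u \<le> (\<Sum>b\<in>D. \<bar>u \<bullet> b\<bar>)"
proof -
  have "norm (proj u) \<le> (\<Sum>b\<in>D. norm ((u \<bullet> b) *\<^sub>R b))" unfolding proj_def by (rule norm_sum)
  also have "\<dots> = (\<Sum>b\<in>D. \<bar>u \<bullet> b\<bar>)" using D_subset by (intro sum.cong) auto
  finally show ?thesis using proj_id[OF assms] by simp
qed

text \<open>The vectors \<open>cov e z2\<close> with \<open>e \<in> D\<close> are dual to the
  tangent vectors \<open>dderiv \<psi> e x2\<close>, so subtracting \<open>q\<close> cancels the
  products of \<open>\<zeta>1\<close> with all of these. The coefficients of \<open>q\<close> are
  small because the corresponding products vanish at \<open>x1\<close> and the derivative is
  Lipschitz. This gives nearby normals without the choice of a normal frame.\<close>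

lemma normal_correction:
  obtains C where "C > 0"
    "\<And>x1 x2 \<zeta>1. \<lbrakk>x1 \<in> param (2 * R); x2 \<in> param (2 * R); normal_at x1 \<zeta>1\<rbrakk> \<Longrightarrow>
       \<exists>\<zeta>2. normal_at x2 \<zeta>2 \<and> norm (\<zeta>2 - \<zeta>1) \<le> C * norm (x1 - x2) * norm \<zeta>1"
proof -
  obtain B where B: "B > 0" "\<And>v z. z \<in> cball z0 R' \<Longrightarrow> norm (cov v z) \<le> B * norm v"
    using cov_bounded by blast
  obtain L1 where L1: "L1 > 0" "\<And>x y v. x \<in> cball x0 (2 * R) \<Longrightarrow> y \<in> cball x0 (2 * R) \<Longrightarrow>
       norm (dderiv \<psi> v x - dderiv \<psi> v y) \<le> L1 * norm (x - y) * norm v"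
    using dderiv_Lipschitz[OF open_V smooth_psi ball_V'] by blast
  define C where "C = real (card D) * (L1 * B) + 1"
  have C: "C > 0" unfolding C_def using L1 B by (intro add_nonneg_pos) auto
  show ?thesis
  proof (rule that[OF C])
    fix x1 x2 \<zeta>1 assume x: "x1 \<in> param (2 * R)" "x2 \<in> param (2 * R)" and n: "normal_at x1 \<zeta>1"
    define z2 where "z2 = \<psi> x2"
    have z2: "z2 \<in> cball z0 R'" "z2 \<in> U" unfolding z2_def using psi_param_U[OF x(2)] ball_U by auto
    define q where "q = (\<Sum>e\<in>D. (\<zeta>1 \<bullet> dderiv \<psi> e x2) *\<^sub>R cov e z2)"
    have lin: "linear (\<lambda>v. dderiv \<psi> v x2)" using linear_dderiv[OF open_V smooth_psi param_V[OF x(2)]] .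
    have qe: "q \<bullet> dderiv \<psi> e x2 = \<zeta>1 \<bullet> dderiv \<psi> e x2" if "e \<in> span D" for e
    proof -
      have "q \<bullet> dderiv \<psi> e x2 = (\<Sum>b\<in>D. (\<zeta>1 \<bullet> dderiv \<psi> b x2) * (b \<bullet> e))"
        unfolding q_def inner_sum_left inner_scaleR_left cov_inner[OF z2(2)]
        using dphi_dpsi[OF param_V[OF x(2)]] unfolding z2_def by simp
      also have "\<dots> = \<zeta>1 \<bullet> dderiv \<psi> (proj e) x2"
        unfolding proj_def linear_sum[OF lin] linear_cmul[OF lin] inner_sum_right
        by (simp add: inner_commute mult.commute)
      finally show ?thesis using proj_id[OF that] by simp
    qed
    have "norm q \<le> (\<Sum>e\<in>D. norm ((\<zeta>1 \<bullet> dderiv \<psi> e x2) *\<^sub>R cov e z2))" unfolding q_def by (rule norm_sum)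
    also have "\<dots> \<le> (\<Sum>e\<in>D. (norm \<zeta>1 * (L1 * norm (x1 - x2))) * B)"
    proof (rule sum_mono)
      fix e assume e: "e \<in> D"
      then have ne: "norm e = 1" using D_subset by auto
      have "\<zeta>1 \<bullet> dderiv \<psi> e x1 = 0" using n e span_base unfolding normal_at_def by blast
      then have "\<bar>\<zeta>1 \<bullet> dderiv \<psi> e x2\<bar> = \<bar>\<zeta>1 \<bullet> (dderiv \<psi> e x1 - dderiv \<psi> e x2)\<bar>"
        by (simp add: inner_diff_right)
      also have "\<dots> \<le> norm \<zeta>1 * norm (dderiv \<psi> e x1 - dderiv \<psi> e x2)" by (rule Cauchy_Schwarz_ineq2)
      also have "\<dots> \<le> norm \<zeta>1 * (L1 * norm (x1 - x2))"
        using L1(2)[of x1 x2 e] x ne unfolding param_def by (intro mult_left_mono) auto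
      finally have 1: "\<bar>\<zeta>1 \<bullet> dderiv \<psi> e x2\<bar> \<le> norm \<zeta>1 * (L1 * norm (x1 - x2))" .
      have 2: "norm (cov e z2) \<le> B" using B(2)[OF z2(1), of e] ne by simp
      show "norm ((\<zeta>1 \<bullet> dderiv \<psi> e x2) *\<^sub>R cov e z2) \<le> (norm \<zeta>1 * (L1 * norm (x1 - x2))) * B"
        unfolding norm_scaleR using 1 2 L1(1) by (intro mult_mono) auto
    qed
    also have "\<dots> = (real (card D) * (L1 * B)) * (norm (x1 - x2) * norm \<zeta>1)" by simp
    also have "\<dots> \<le> C * (norm (x1 - x2) * norm \<zeta>1)" unfolding C_def by (intro mult_right_mono) auto
    finally have "norm q \<le> C * norm (x1 - x2) * norm \<zeta>1" by simp
    then show "\<exists>\<zeta>2. normal_at x2 \<zeta>2 \<and> norm (\<zeta>2 - \<zeta>1) \<le> C * norm (x1 - x2) * norm \<zeta>1"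
      using qe by (intro exI[of _ "\<zeta>1 - q"]) (auto simp: normal_at_def inner_diff_left)
  qed
qed

lemma normal_height_quadratic:
  obtains C where "C > 0"
    "\<And>x x2 \<zeta>. \<lbrakk>x \<in> param (2 * R); x2 \<in> param (2 * R); normal_at x2 \<zeta>\<rbrakk> \<Longrightarrow>
       \<bar>\<zeta> \<bullet> (\<psi> x - \<psi> x2)\<bar> \<le> C * norm \<zeta> * norm (x - x2) ^ 2"
proof -
  obtain T where T: "T > 0" "\<And>x y. x \<in> cball x0 (2 * R) \<Longrightarrow> y \<in> cball x0 (2 * R) \<Longrightarrow>
       norm (\<psi> y - \<psi> x - dderiv \<psi> (y - x) x) \<le> T * norm (y - x) ^ 2"
    using smooth_on_taylor1[OF open_V smooth_psi ball_V'] by blast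
  show ?thesis
  proof (rule that[OF T(1)])
    fix x x2 \<zeta> assume x: "x \<in> param (2 * R)" "x2 \<in> param (2 * R)" and n: "normal_at x2 \<zeta>"
    have "x - x2 \<in> span D" using x span_diff unfolding param_def by blast
    then have "\<zeta> \<bullet> (\<psi> x - \<psi> x2) = \<zeta> \<bullet> (\<psi> x - \<psi> x2 - dderiv \<psi> (x - x2) x2)"
      using n unfolding normal_at_def by (simp add: inner_diff_right)
    also have "\<bar>\<dots>\<bar> \<le> norm \<zeta> * norm (\<psi> x - \<psi> x2 - dderiv \<psi> (x - x2) x2)" by (rule Cauchy_Schwarz_ineq2)
    also have "\<dots> \<le> norm \<zeta> * (T * norm (x - x2) ^ 2)"
      using T(2)[of x2 x] x unfolding param_def by (intro mult_left_mono) auto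
    finally show "\<bar>\<zeta> \<bullet> (\<psi> x - \<psi> x2)\<bar> \<le> T * norm \<zeta> * norm (x - x2) ^ 2" by (simp add: mult_ac)
  qed
qed

text \<open>The quadratic term at \<open>x2\<close> paired with \<open>\<zeta>2\<close> is moved to
  \<open>\<zeta>1\<close> and then to the base point \<open>x1\<close>, each move costing a factor
  \<open>norm (x1 - x2)\<close>. There only the part of the displacement orthogonal to
  \<open>v1\<close> is felt when \<open>v1\<close> is a unit vector. The resulting three terms are
  balanced by displacements of order \<open>\<delta> powr (1/3)\<close> whose part across
  \<open>v1\<close> is of order \<open>\<delta> powr (1/2)\<close>.\<close>

lemma degenerate_height_bound:
  obtains C where "C > 0"
    "\<And>x x1 x2 \<zeta>1 \<zeta>2 v1 c0. \<lbrakk>x \<in> param (2 * R); x1 \<in> param (2 * R); x2 \<in> param (2 * R);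
       norm \<zeta>1 = 1; norm \<zeta>2 \<le> 2; normal_at x2 \<zeta>2; norm (\<zeta>2 - \<zeta>1) \<le> c0 * norm (x1 - x2); v1 \<in> span D;
       \<And>e. e \<in> span D \<Longrightarrow> hess x1 \<zeta>1 v1 e = 0\<rbrakk> \<Longrightarrow>
       \<bar>\<zeta>2 \<bullet> (\<psi> x - \<psi> x2)\<bar> \<le> C * (norm (x - x2 - (v1 \<bullet> (x - x2)) *\<^sub>R v1) ^ 2
          + (1 + c0) * norm (x1 - x2) * norm (x - x2) ^ 2 + norm (x - x2) ^ 3)"
proof -
  obtain T where T: "T > 0" "\<And>x y. x \<in> cball x0 (2 * R) \<Longrightarrow> y \<in> cball x0 (2 * R) \<Longrightarrow>
       norm (\<psi> y - \<psi> x - dderiv \<psi> (y - x) x - (1/2) *\<^sub>R dderiv (dderiv \<psi> (y - x)) (y - x) x)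
         \<le> T * norm (y - x) ^ 3"
    using smooth_on_taylor2[OF open_V smooth_psi ball_V'] by blast
  obtain B where B: "B > 0"
    "\<And>x u w. x \<in> cball x0 (2 * R) \<Longrightarrow> norm (dderiv (dderiv \<psi> u) w x) \<le> B * norm u * norm w"
    using dderiv2_bounded[OF open_V smooth_psi ball_V'] by blast
  obtain L2 where L2: "L2 > 0" "\<And>x y u w. x \<in> cball x0 (2 * R) \<Longrightarrow> y \<in> cball x0 (2 * R) \<Longrightarrow>
       norm (dderiv (dderiv \<psi> u) w x - dderiv (dderiv \<psi> u) w y) \<le> L2 * norm (x - y) * norm u * norm w"
    using dderiv2_Lipschitz[OF open_V smooth_psi ball_V'] by blast
  define C where "C = B + L2 + 2 * T"
  have C: "C > 0" "B \<le> C" "L2 \<le> C" "2 * T \<le> C" unfolding C_def using B L2 T by auto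
  show ?thesis
  proof (rule that[OF C(1)])
    fix x x1 x2 \<zeta>1 \<zeta>2 v1 c0
    assume x: "x \<in> param (2 * R)" "x1 \<in> param (2 * R)" "x2 \<in> param (2 * R)"
      and \<zeta>1: "norm \<zeta>1 = 1" and \<zeta>2: "norm \<zeta>2 \<le> 2" and n: "normal_at x2 \<zeta>2"
      and close: "norm (\<zeta>2 - \<zeta>1) \<le> c0 * norm (x1 - x2)" and v1: "v1 \<in> span D"
      and deg: "\<And>e. e \<in> span D \<Longrightarrow> hess x1 \<zeta>1 v1 e = 0"
    have xb: "x \<in> cball x0 (2 * R)" "x1 \<in> cball x0 (2 * R)" "x2 \<in> cball x0 (2 * R)"
      using x unfolding param_def by auto
    define u where "u = x - x2"
    define w where "w = u - (v1 \<bullet> u) *\<^sub>R v1"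
    let ?Q = "\<lambda>y. dderiv (dderiv \<psi> u) u y"
    have us: "u \<in> span D" using x span_diff unfolding u_def param_def by blast
    have ws: "w \<in> span D" unfolding w_def using us v1 by (intro span_diff span_scale)
    have "\<zeta>2 \<bullet> (\<psi> x - \<psi> x2) - \<zeta>2 \<bullet> ?Q x2 / 2
        = \<zeta>2 \<bullet> (\<psi> x - \<psi> x2 - dderiv \<psi> u x2 - (1/2) *\<^sub>R ?Q x2)"
      using n us unfolding normal_at_def by (simp add: inner_diff_right)
    also have "\<bar>\<dots>\<bar> \<le> norm \<zeta>2 * norm (\<psi> x - \<psi> x2 - dderiv \<psi> u x2 - (1/2) *\<^sub>R ?Q x2)"
      by (rule Cauchy_Schwarz_ineq2)
    also have "\<dots> \<le> 2 * (T * norm u ^ 3)"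
      using T(2)[OF xb(3,1)] \<zeta>2 T(1) unfolding u_def by (intro mult_mono) auto
    finally have e1: "\<bar>\<zeta>2 \<bullet> (\<psi> x - \<psi> x2) - \<zeta>2 \<bullet> ?Q x2 / 2\<bar> \<le> C * norm u ^ 3"
      using mult_right_mono[OF C(4), of "norm u ^ 3"] by simp
    have "\<bar>(\<zeta>2 - \<zeta>1) \<bullet> ?Q x2\<bar> \<le> norm (\<zeta>2 - \<zeta>1) * norm (?Q x2)" by (rule Cauchy_Schwarz_ineq2)
    also have "\<dots> \<le> (c0 * norm (x1 - x2)) * (B * norm u * norm u)"
      using close B(2)[OF xb(3), of u u] by (intro mult_mono) (auto intro: order_trans[OF norm_ge_zero close])
    also have "\<dots> \<le> (c0 * norm (x1 - x2)) * (C * norm u * norm u)"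
      using C(2) order_trans[OF norm_ge_zero close] by (intro mult_left_mono mult_right_mono) auto
    finally have e2: "\<bar>(\<zeta>2 - \<zeta>1) \<bullet> ?Q x2\<bar> \<le> C * (c0 * norm (x1 - x2) * norm u ^ 2)"
      by (simp add: power2_eq_square mult_ac)
    have "\<bar>\<zeta>1 \<bullet> (?Q x2 - ?Q x1)\<bar> \<le> norm \<zeta>1 * norm (?Q x2 - ?Q x1)" by (rule Cauchy_Schwarz_ineq2)
    also have "\<dots> \<le> L2 * norm (x2 - x1) * norm u * norm u" using L2(2)[OF xb(3,2), of u u] \<zeta>1 by simp
    also have "\<dots> \<le> C * norm (x2 - x1) * norm u * norm u" using C(3) by (intro mult_right_mono) auto
    finally have e3: "\<bar>\<zeta>1 \<bullet> (?Q x2 - ?Q x1)\<bar> \<le> C * (norm (x1 - x2) * norm u ^ 2)"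
      by (simp add: power2_eq_square mult_ac norm_minus_commute)
    have bil: "bilinear (hess x1 \<zeta>1)" using bilinear_hess[OF param_V[OF x(2)]] .
    \<comment> \<open>Since \<open>v1\<close> lies in the radical of the form, the component of
      \<open>u\<close> along \<open>v1\<close> can be removed from both arguments.\<close>
    have "hess x1 \<zeta>1 u u = hess x1 \<zeta>1 (w + (v1 \<bullet> u) *\<^sub>R v1) (w + (v1 \<bullet> u) *\<^sub>R v1)"
      unfolding w_def by simp
    also have "\<dots> = hess x1 \<zeta>1 w w"
      using deg[OF ws] deg[OF v1] hess_sym[of x1 \<zeta>1 w v1]
      by (simp add: bilinear_ladd[OF bil] bilinear_radd[OF bil] bilinear_lmul[OF bil] bilinear_rmul[OF bil])
    finally have "\<zeta>1 \<bullet> ?Q x1 = \<zeta>1 \<bullet> dderiv (dderiv \<psi> w) w x1" by (simp add: hess_diag)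
    also have "\<bar>\<dots>\<bar> \<le> norm \<zeta>1 * norm (dderiv (dderiv \<psi> w) w x1)" by (rule Cauchy_Schwarz_ineq2)
    also have "\<dots> \<le> B * norm w * norm w" using B(2)[OF xb(2), of w w] \<zeta>1 by simp
    also have "\<dots> \<le> C * norm w * norm w" using C(2) by (intro mult_right_mono) auto
    finally have e4: "\<bar>\<zeta>1 \<bullet> ?Q x1\<bar> \<le> C * norm w ^ 2" by (simp add: power2_eq_square mult_ac)
    have eq: "\<zeta>2 \<bullet> ?Q x2 = (\<zeta>2 - \<zeta>1) \<bullet> ?Q x2 + \<zeta>1 \<bullet> (?Q x2 - ?Q x1) + \<zeta>1 \<bullet> ?Q x1"
      by (simp add: inner_diff_left inner_diff_right)
    have "\<bar>\<zeta>2 \<bullet> ?Q x2\<bar> \<le> C * (c0 * norm (x1 - x2) * norm u ^ 2) + C * (norm (x1 - x2) * norm u ^ 2) + C * norm w ^ 2"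
      unfolding eq using e2 e3 e4 by linarith
    then have "\<bar>\<zeta>2 \<bullet> (\<psi> x - \<psi> x2)\<bar> \<le> C * (c0 * norm (x1 - x2) * norm u ^ 2) + C * (norm (x1 - x2) * norm u ^ 2) + C * norm w ^ 2 + C * norm u ^ 3"
      using e1 by linarith
    then show "\<bar>\<zeta>2 \<bullet> (\<psi> x - \<psi> x2)\<bar> \<le> C * (norm (x - x2 - (v1 \<bullet> (x - x2)) *\<^sub>R v1) ^ 2
          + (1 + c0) * norm (x1 - x2) * norm (x - x2) ^ 2 + norm (x - x2) ^ 3)"
      unfolding u_def[symmetric] w_def[symmetric] by (simp add: algebra_simps)
  qed
qed

section \<open>From families of caps to local null sets\<close>

definition nbhd :: "'a set" where "nbhd = U \<inter> \<phi> -` ball x0 R"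

lemma open_nbhd: "open nbhd" and z0_in_nbhd: "z0 \<in> nbhd"
  using continuous_open_preimage[OF continuous_phi open_U open_ball] z0_in_U R_pos
  unfolding nbhd_def x0_def by auto

lemma nbhd_param: "z \<in> M \<Longrightarrow> z \<in> nbhd \<Longrightarrow> \<exists>x\<in>param R. z = \<psi> x"
  using phi_in_span psi_phi unfolding nbhd_def param_def by (intro bexI[of _ "\<phi> z"]) auto

text \<open>A family \<open>F\<close> of caps: \<open>x2\<close> is the centre, \<open>W\<close> the set of directions in which the cap has
  width \<open>\<delta>\<^sup>1\<^sup>/\<^sup>2\<close> rather than \<open>\<delta>\<^sup>\<alpha>\<close>, and \<open>\<zeta>\<close> the direction in which it has height \<open>O(\<delta>)\<close>.\<close>

definition cap_family :: "real \<Rightarrow> real \<Rightarrow> real \<Rightarrow> ('a \<times> 'a set \<times> 'a) set \<Rightarrow> bool" where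
  "cap_family \<alpha> C \<delta> F \<longleftrightarrow> finite F \<and>
    (\<forall>(x2, W, \<zeta>)\<in>F. x2 \<in> param R \<and> finite W \<and> card W \<le> DIM('a) \<and> (\<forall>v\<in>W. norm v \<le> 1) \<and> norm \<zeta> \<ge> 1/2 \<and>
       (\<forall>x\<in>param (2 * R). \<forall>\<tau>\<ge>1. norm (x - x2) \<le> \<tau> * \<delta> powr \<alpha> \<and> (\<forall>v\<in>W. \<bar>v \<bullet> (x - x2)\<bar> \<le> \<tau> * \<delta> powr (1/2))
          \<longrightarrow> \<bar>\<zeta> \<bullet> (\<psi> x - \<psi> x2)\<bar> \<le> C * \<tau> ^ 3 * \<delta>)) \<and>
    (\<forall>x\<in>param R. \<exists>(x2, W, \<zeta>)\<in>F. norm (x - x2) \<le> real DIM('a) * \<delta> powr \<alpha> \<and>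
       (\<forall>v\<in>W. \<bar>v \<bullet> (x - x2)\<bar> \<le> \<delta> powr (1/2)))"

text \<open>Number of caps times mass of a cap. The number is of order
  \<open>\<delta> powr (- p)\<close> and the mass of order
  \<open>\<delta> powr q1 + \<delta> powr q2\<close>, where \<open>q1\<close> is
  \<open>s / 2\<close> reduced by the widening and \<open>q2\<close> comes from the tails of the
  cut-off. Both exponents exceed \<open>p\<close>, so the measure of \<open>nbhd\<close> is at most
  a constant times a positive power of \<open>\<delta>\<close>.\<close>

lemma cap_family_null:
  assumes dec: "fourier_decay_measure_on M s \<mu>" and p: "p \<ge> 0" "s > 2 * p"
    and \<alpha>: "1/3 \<le> \<alpha>" "\<alpha> \<le> 1/2" and C1: "C1 > 0" and \<delta>0: "\<delta>0 > 0"
    and fam: "\<And>\<delta>. 0 < \<delta> \<Longrightarrow> \<delta> < \<delta>0 \<Longrightarrow> \<exists>F. cap_family \<alpha> C1 \<delta> F \<and> real (card F) \<le> C1 * \<delta> powr (- p)"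
  shows "emeasure \<mu> nbhd = 0"
proof -
  have sets: "sets \<mu> = sets borel" and fin: "finite_measure \<mu>" and AEM: "AE z in \<mu>. z \<in> M"
    using dec unfolding fourier_decay_measure_on_def by auto
  interpret \<mu>: finite_measure \<mu> by fact
  have s: "s > 0" using p by simp
  \<comment> \<open>The bound 1/12 makes \<open>\<alpha> - \<epsilon> \<ge> 1/4\<close> and
    \<open>2 * \<alpha> - \<epsilon> \<ge> 1/2\<close> for \<open>\<alpha> \<ge> 1/3\<close>; the
    other one keeps \<open>(1 - 3 * \<epsilon>) * s / 2\<close> above \<open>p\<close>.\<close>
  define \<epsilon> where "\<epsilon> = min (1/12) ((s - 2 * p) / (6 * s))"
  have \<epsilon>: "\<epsilon> > 0" "\<epsilon> \<le> 1/12" "\<epsilon> \<le> (s - 2 * p) / (6 * s)" unfolding \<epsilon>_def using p s by auto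
  \<comment> \<open>Enough repetitions for the tail \<open>(1 / \<kappa>) ^ (2 * k)\<close>, which
    is \<open>\<delta> powr (2 * k * \<epsilon>)\<close>, to beat the number of caps.\<close>
  define k where "k = nat \<lceil>p / (2 * \<epsilon>)\<rceil> + 1"
  have "p / (2 * \<epsilon>) < real k" unfolding k_def by linarith
  then have k: "2 * real k * \<epsilon> > p" using \<epsilon>(1) by (simp add: field_simps)
  define q1 where "q1 = (1 - 3 * \<epsilon>) * s / 2"
  have "\<epsilon> * (6 * s) \<le> s - 2 * p" using \<epsilon>(3) s by (simp add: field_simps)
  then have q1: "q1 > p" unfolding q1_def using p by (simp add: algebra_simps)
  define q2 where "q2 = 2 * real k * \<epsilon>"
  define r where "r = min q1 q2 - p"
  have r: "r > 0" "q1 - p \<ge> r" "q2 - p \<ge> r" unfolding r_def using q1 k q2_def by auto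
  obtain C K where C: "C > 0" and K: "K \<ge> 1" and cap:
    "\<And>x2 W a b \<kappa> \<eta>. \<lbrakk>x2 \<in> param R; finite W; card W \<le> DIM('a); \<And>v. v \<in> W \<Longrightarrow> norm v \<le> 1;
       0 < b; b \<le> a; \<kappa> \<ge> 1; \<kappa> * a\<^sup>2 \<le> b; K * \<kappa> * a \<le> 1; K / b \<le> norm \<eta>;
       \<And>x. \<lbrakk>x \<in> param (2 * R); norm (x - x2) \<le> K * \<kappa> * a; \<And>v. v \<in> W \<Longrightarrow> \<bar>v \<bullet> (x - x2)\<bar> \<le> K * \<kappa> * b\<rbrakk>
          \<Longrightarrow> \<bar>\<eta> \<bullet> (\<psi> x - \<psi> x2)\<bar> \<le> 1\<rbrakk> \<Longrightarrow>
     \<exists>Q\<in>sets \<mu>. measure \<mu> Q \<le> C * (norm \<eta> powr (- s / 2) + (1 / \<kappa>) ^ (2 * k)) \<and>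
       (\<forall>x\<in>param R. norm (x - x2) \<le> real DIM('a) * a \<and> (\<forall>v\<in>W. \<bar>v \<bullet> (x - x2)\<bar> \<le> b) \<longrightarrow> \<psi> x \<in> Q)"
    by (rule cap_measure[OF dec less_imp_le[OF s], of k]) blast
  define A where "A = 2 * C1 * K ^ 3"
  have A: "A > 0" unfolding A_def using C1 K by simp
  define C2 where "C2 = C1 * C * (A powr (s / 2) + 1)"
  \<comment> \<open>Fourth powers, because the conditions below compare
    \<open>\<delta> powr (1/4)\<close> with \<open>1 / K\<close> and
    \<open>1 / (A * K)\<close>.\<close>
  define \<delta>1 where "\<delta>1 = min (min \<delta>0 1) (min ((1 / K) powr 4) ((1 / (A * K)) powr 4))"
  have \<delta>1: "\<delta>1 > 0" unfolding \<delta>1_def using \<delta>0 K A by auto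
  have bound: "measure \<mu> nbhd \<le> C2 * \<delta> powr r" if \<delta>: "0 < \<delta>" "\<delta> < \<delta>1" for \<delta>
  proof -
    have d: "\<delta> < \<delta>0" "\<delta> < 1" "\<delta> \<le> (1 / K) powr 4" "\<delta> \<le> (1 / (A * K)) powr 4"
      using \<delta> unfolding \<delta>1_def by auto
    have pm: "\<delta> powr x \<le> \<delta> powr y" if "y \<le> x" for x y
      using \<delta> d(2) that by (intro powr_mono') auto
    have root4: "\<delta> powr (1/4) \<le> t" if "\<delta> \<le> t powr 4" "t > 0" for t
    proof -
      have "\<delta> powr (1/4) \<le> (t powr 4) powr (1/4)" using \<delta> that by (intro powr_mono2) auto
      also have "\<dots> = t" unfolding powr_powr using that(2) by simp
      finally show ?thesis .
    qed
    have d4: "\<delta> powr (1/4) \<le> 1 / K" "\<delta> powr (1/4) \<le> 1 / (A * K)"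
      using root4[OF d(3)] root4[OF d(4)] K A by auto
    obtain F where F: "cap_family \<alpha> C1 \<delta> F" "real (card F) \<le> C1 * \<delta> powr (- p)"
      using fam[OF \<delta>(1) d(1)] by blast
    define a where "a = \<delta> powr \<alpha>"
    define b where "b = \<delta> powr (1/2)"
    define \<kappa> where "\<kappa> = \<delta> powr (- \<epsilon>)"
    \<comment> \<open>The reciprocal of the height bound for the cap widened by the factor
      \<open>K * \<kappa>\<close>: the largest frequency for which this bound keeps the phase within
      1.\<close>
    define \<theta> where "\<theta> = 1 / (C1 * (K * \<kappa>) ^ 3 * \<delta>)"
    have \<kappa>3: "\<kappa> ^ 3 = \<delta> powr (- 3 * \<epsilon>)"
      unfolding \<kappa>_def using \<delta>(1) by (simp add: powr_power)
    have lam: "\<theta> = (2 / A) * \<delta> powr (3 * \<epsilon> - 1)"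
    proof -
      have "\<theta> = 1 / (C1 * K ^ 3 * (\<delta> powr (- 3 * \<epsilon>) * \<delta> powr 1))"
        unfolding \<theta>_def power_mult_distrib \<kappa>3 using \<delta>(1) by (simp add: mult_ac)
      also have "\<delta> powr (- 3 * \<epsilon>) * \<delta> powr 1 = 1 / \<delta> powr (3 * \<epsilon> - 1)"
        unfolding powr_add[symmetric] powr_minus_divide[symmetric] by simp
      finally show ?thesis unfolding A_def by simp
    qed
    have lam0: "\<theta> > 0" unfolding lam using A \<delta>(1) by simp
    have b: "0 < b" "b \<le> a" unfolding a_def b_def using \<delta>(1) \<alpha> pm by auto
    have \<kappa>1: "\<kappa> \<ge> 1" unfolding \<kappa>_def using pm[of "- \<epsilon>" 0] \<epsilon>(1) \<delta>(1) by simp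
    have \<kappa>a2: "\<kappa> * a\<^sup>2 \<le> b"
    proof -
      have "\<kappa> * a\<^sup>2 = \<delta> powr (2 * \<alpha> - \<epsilon>)"
        unfolding \<kappa>_def a_def power2_eq_square by (simp add: algebra_simps flip: powr_add)
      also have "\<dots> \<le> b" unfolding b_def by (rule pm) (use \<alpha> \<epsilon> in auto)
      finally show ?thesis .
    qed
    have K\<kappa>a: "K * \<kappa> * a \<le> 1"
    proof -
      have "\<kappa> * a = \<delta> powr (\<alpha> - \<epsilon>)" unfolding \<kappa>_def a_def by (simp add: algebra_simps flip: powr_add)
      also have "\<dots> \<le> \<delta> powr (1/4)" by (rule pm) (use \<alpha> \<epsilon> in auto)
      also have "\<dots> \<le> 1 / K" by (rule d4)
      finally show ?thesis using K by (simp add: field_simps)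
    qed
    \<comment> \<open>The frequency is of order \<open>\<delta> powr (3 * \<epsilon> - 1)\<close>,
      which is at least \<open>\<delta> powr (-3/4)\<close>, and so exceeds the inverse width
      \<open>\<delta> powr (-1/2)\<close> by a power of \<open>1 / \<delta>\<close>.\<close>
    have freq: "K / b \<le> \<theta> / 2"
    proof -
      have "A * K * \<delta> powr (1/4) \<le> 1" using d4(2) A K by (simp add: field_simps)
      then have "A * K * \<delta> powr (1/4) * \<delta> powr (-3/4) \<le> 1 * \<delta> powr (-3/4)" by (intro mult_right_mono) auto
      then have "A * K * \<delta> powr (-1/2) \<le> \<delta> powr (-3/4)" by (simp add: mult.assoc flip: powr_add)
      also have "\<dots> \<le> \<delta> powr (3 * \<epsilon> - 1)" by (rule pm) (use \<epsilon> in auto)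
      finally have "K * \<delta> powr (-1/2) \<le> \<delta> powr (3 * \<epsilon> - 1) / A" using A by (simp add: field_simps)
      then show ?thesis unfolding lam b_def using powr_minus_divide[of \<delta> "1/2"] by simp
    qed
    define E where "E = C * (A powr (s / 2) * \<delta> powr q1 + \<delta> powr q2)"
    have capQ: "\<exists>Q\<in>sets \<mu>. measure \<mu> Q \<le> E \<and>
       (\<forall>x\<in>param R. norm (x - x2) \<le> real DIM('a) * a \<and> (\<forall>v\<in>W. \<bar>v \<bullet> (x - x2)\<bar> \<le> b) \<longrightarrow> \<psi> x \<in> Q)"
      if f: "(x2, W, \<zeta>) \<in> F" for x2 W \<zeta>
    proof -
      have f': "x2 \<in> param R" "finite W" "card W \<le> DIM('a)" "\<forall>v\<in>W. norm v \<le> 1" "norm \<zeta> \<ge> 1/2"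
        "\<forall>x\<in>param (2 * R). \<forall>\<tau>\<ge>1. norm (x - x2) \<le> \<tau> * \<delta> powr \<alpha> \<and> (\<forall>v\<in>W. \<bar>v \<bullet> (x - x2)\<bar> \<le> \<tau> * \<delta> powr (1/2))
          \<longrightarrow> \<bar>\<zeta> \<bullet> (\<psi> x - \<psi> x2)\<bar> \<le> C1 * \<tau> ^ 3 * \<delta>"
        using F(1) f unfolding cap_family_def by auto
      have n\<eta>: "norm (\<theta> *\<^sub>R \<zeta>) \<ge> \<theta> / 2" using f'(5) lam0 by simp
      have ex: "\<exists>Q\<in>sets \<mu>. measure \<mu> Q \<le> C * (norm (\<theta> *\<^sub>R \<zeta>) powr (- s / 2) + (1 / \<kappa>) ^ (2 * k)) \<and>
       (\<forall>x\<in>param R. norm (x - x2) \<le> real DIM('a) * a \<and> (\<forall>v\<in>W. \<bar>v \<bullet> (x - x2)\<bar> \<le> b) \<longrightarrow> \<psi> x \<in> Q)"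
      proof (rule cap[OF f'(1-3) _ b \<kappa>1 \<kappa>a2 K\<kappa>a])
        show "K / b \<le> norm (\<theta> *\<^sub>R \<zeta>)" by (rule order_trans[OF freq n\<eta>])
        fix x assume x: "x \<in> param (2 * R)" "norm (x - x2) \<le> K * \<kappa> * a"
          "\<And>v. v \<in> W \<Longrightarrow> \<bar>v \<bullet> (x - x2)\<bar> \<le> K * \<kappa> * b"
        have "K * \<kappa> \<ge> 1" using K \<kappa>1 mult_mono[of 1 K 1 \<kappa>] by simp
        then have "\<bar>\<zeta> \<bullet> (\<psi> x - \<psi> x2)\<bar> \<le> C1 * (K * \<kappa>) ^ 3 * \<delta>"
          using f'(6) x unfolding a_def b_def by blast
        then have "\<theta> * \<bar>\<zeta> \<bullet> (\<psi> x - \<psi> x2)\<bar> \<le> \<theta> * (C1 * (K * \<kappa>) ^ 3 * \<delta>)"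
          using lam0 by (intro mult_left_mono) auto
        also have "\<dots> = 1" unfolding \<theta>_def using C1 K \<kappa>1 \<delta>(1) by simp
        finally show "\<bar>\<theta> *\<^sub>R \<zeta> \<bullet> (\<psi> x - \<psi> x2)\<bar> \<le> 1" using lam0 by (simp add: abs_mult)
      qed (use f' in auto)
      have le: "norm (\<theta> *\<^sub>R \<zeta>) powr (- s / 2) \<le> A powr (s / 2) * \<delta> powr q1"
      proof -
        have "norm (\<theta> *\<^sub>R \<zeta>) powr (- s / 2) \<le> (\<theta> / 2) powr (- s / 2)"
          using n\<eta> lam0 s by (intro powr_mono2') auto
        also have "\<theta> / 2 = \<delta> powr (3 * \<epsilon> - 1) / A" unfolding lam by simp
        also have "(\<delta> powr (3 * \<epsilon> - 1) / A) powr (- s / 2) = A powr (s / 2) * \<delta> powr ((3 * \<epsilon> - 1) * (- s / 2))"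
          using A \<delta>(1) by (simp add: powr_divide powr_powr powr_minus field_simps)
        also have "(3 * \<epsilon> - 1) * (- s / 2) = q1" unfolding q1_def by (simp add: field_simps)
        finally show ?thesis .
      qed
      have eq: "(1 / \<kappa>) ^ (2 * k) = \<delta> powr q2"
      proof -
        have "1 / \<kappa> = \<delta> powr \<epsilon>" unfolding \<kappa>_def using powr_minus_divide[of \<delta> "\<epsilon>"] by simp
        then show ?thesis unfolding q2_def using \<delta>(1) by (simp add: powr_power mult_ac)
      qed
      have "C * (norm (\<theta> *\<^sub>R \<zeta>) powr (- s / 2) + (1 / \<kappa>) ^ (2 * k)) \<le> E"
        unfolding E_def eq using le C by (intro mult_left_mono add_right_mono) auto
      then show ?thesis using ex order_trans by blast
    qed
    have "\<forall>f\<in>F. \<exists>Q. Q \<in> sets \<mu> \<and> measure \<mu> Q \<le> E \<and>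
       (\<forall>x\<in>param R. norm (x - fst f) \<le> real DIM('a) * a \<and> (\<forall>v\<in>fst (snd f). \<bar>v \<bullet> (x - fst f)\<bar> \<le> b) \<longrightarrow> \<psi> x \<in> Q)"
    proof
      fix f assume "f \<in> F"
      then have "(fst f, fst (snd f), snd (snd f)) \<in> F" by simp
      from capQ[OF this] show "\<exists>Q. Q \<in> sets \<mu> \<and> measure \<mu> Q \<le> E \<and>
       (\<forall>x\<in>param R. norm (x - fst f) \<le> real DIM('a) * a \<and> (\<forall>v\<in>fst (snd f). \<bar>v \<bullet> (x - fst f)\<bar> \<le> b) \<longrightarrow> \<psi> x \<in> Q)"
        by blast
    qed
    from bchoice[OF this] obtain Q where Q': "\<forall>f\<in>F. Q f \<in> sets \<mu> \<and> measure \<mu> (Q f) \<le> E \<and>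
       (\<forall>x\<in>param R. norm (x - fst f) \<le> real DIM('a) * a \<and> (\<forall>v\<in>fst (snd f). \<bar>v \<bullet> (x - fst f)\<bar> \<le> b) \<longrightarrow> \<psi> x \<in> Q f)" ..
    have Q: "Q f \<in> sets \<mu>" "measure \<mu> (Q f) \<le> E" if "f \<in> F" for f
      using conjunct1[OF bspec[OF Q' that]] conjunct1[OF conjunct2[OF bspec[OF Q' that]]] .
    have Q3: "\<psi> x \<in> Q f" if "f \<in> F" "x \<in> param R" "norm (x - fst f) \<le> real DIM('a) * a"
      "\<forall>v\<in>fst (snd f). \<bar>v \<bullet> (x - fst f)\<bar> \<le> b" for f x
      using bspec[OF conjunct2[OF conjunct2[OF bspec[OF Q' that(1)]]] that(2)] that(3,4) by (rule mp[OF _ conjI])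
    have finF: "finite F" using F(1) unfolding cap_family_def by blast
    have cov: "\<exists>f\<in>F. norm (x - fst f) \<le> real DIM('a) * a \<and> (\<forall>v\<in>fst (snd f). \<bar>v \<bullet> (x - fst f)\<bar> \<le> b)"
      if "x \<in> param R" for x
    proof -
      have "\<exists>(x2, W, \<zeta>)\<in>F. norm (x - x2) \<le> real DIM('a) * a \<and> (\<forall>v\<in>W. \<bar>v \<bullet> (x - x2)\<bar> \<le> b)"
        using conjunct2[OF conjunct2[OF F(1)[unfolded cap_family_def]]] that unfolding a_def b_def by (rule bspec)
      then show ?thesis unfolding split_beta .
    qed
    have UQ: "(\<Union>f\<in>F. Q f) \<in> sets \<mu>" using finF Q(1) by auto
    have "AE z in \<mu>. z \<in> nbhd \<longrightarrow> z \<in> (\<Union>f\<in>F. Q f)"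
      using AEM
    proof eventually_elim
      case (elim z)
      show ?case
      proof
        assume "z \<in> nbhd"
        then obtain x where x: "x \<in> param R" "z = \<psi> x" using nbhd_param elim by blast
        obtain f where "f \<in> F" "norm (x - fst f) \<le> real DIM('a) * a" "\<forall>v\<in>fst (snd f). \<bar>v \<bullet> (x - fst f)\<bar> \<le> b"
          using cov[OF x(1)] by blast
        then have "\<psi> x \<in> Q f" using Q3 x(1) by blast
        then show "z \<in> (\<Union>f\<in>F. Q f)" using \<open>f \<in> F\<close> x(2) by blast
      qed
    qed
    then have "measure \<mu> nbhd \<le> measure \<mu> (\<Union>f\<in>F. Q f)"
      using UQ by (rule \<mu>.finite_measure_mono_AE)
    also have "\<dots> \<le> (\<Sum>f\<in>F. measure \<mu> (Q f))"
      using finF Q(1) by (intro \<mu>.finite_measure_subadditive_finite) auto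
    also have "\<dots> \<le> real (card F) * E" using sum_bounded_above[of F "\<lambda>f. measure \<mu> (Q f)" E] Q(2) by simp
    also have "\<dots> \<le> (C1 * \<delta> powr (- p)) * E"
      using F(2) C unfolding E_def by (intro mult_right_mono) auto
    also have "\<dots> = C1 * C * (A powr (s / 2) * \<delta> powr (q1 - p) + \<delta> powr (q2 - p))"
      unfolding E_def using powr_add[of \<delta> "- p" q1] powr_add[of \<delta> "- p" q2] by (simp add: algebra_simps)
    also have "\<dots> \<le> C1 * C * (A powr (s / 2) * \<delta> powr r + \<delta> powr r)"
      using C1 C pm[OF r(2)] pm[OF r(3)] by (intro mult_left_mono add_mono) auto
    also have "\<dots> = C2 * \<delta> powr r" unfolding C2_def by (simp add: algebra_simps)
    finally show ?thesis .
  qed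
  have "((\<lambda>\<delta>. C2 * \<delta> powr r) \<longlongrightarrow> C2 * 0) (at_right 0)"
    by (intro tendsto_mult tendsto_const tendsto_zero_powrI[OF _ tendsto_const _ r(1)])
      (auto simp: eventually_at_right_less intro: tendsto_ident_at eventually_mono[OF eventually_at_right_less])
  then have "((\<lambda>\<delta>. C2 * \<delta> powr r) \<longlongrightarrow> 0) (at_right 0)" by simp
  moreover have "eventually (\<lambda>\<delta>. measure \<mu> nbhd \<le> C2 * \<delta> powr r) (at_right 0)"
    using \<delta>1 bound by (auto simp: eventually_at_right)
  ultimately have "measure \<mu> nbhd \<le> 0"
    by (rule tendsto_lowerbound) simp
  then show ?thesis by (simp add: \<mu>.emeasure_eq_measure measure_le_0_iff)
qed


lemma abs_inner_unit_le: "norm v = 1 \<Longrightarrow> \<bar>v \<bullet> u\<bar> \<le> norm u"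
  using Cauchy_Schwarz_ineq2[of v u] by simp

lemma param_net:
  assumes "r > 0" "r \<le> R"
  obtains F where "F \<subseteq> param R" "finite F" "real (card F) \<le> (4 * R / r) ^ card D"
    "\<And>x. x \<in> param R \<Longrightarrow> \<exists>y\<in>F. \<forall>v\<in>D. \<bar>x \<bullet> v - y \<bullet> v\<bar> \<le> r"
proof -
  have bd: "\<bar>x \<bullet> v - x0 \<bullet> v\<bar> \<le> R" if "x \<in> param R" "v \<in> D" for x v
  proof -
    have "\<bar>(x - x0) \<bullet> v\<bar> \<le> norm (x - x0)" using that D_subset by (intro Basis_le_norm) auto
    then show ?thesis using that unfolding param_def by (simp add: dist_norm norm_minus_commute inner_diff_left)
  qed
  obtain F where F: "F \<subseteq> param R" "finite F" "real (card F) \<le> (\<Prod>v\<in>D. 2 * R / r + 2)"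
    "\<And>x. x \<in> param R \<Longrightarrow> \<exists>y\<in>F. \<forall>v\<in>D. \<bar>x \<bullet> v - y \<bullet> v\<bar> \<le> r"
    using finite_grid_net[where g = "\<lambda>x v. x \<bullet> v" and r = "\<lambda>_. r" and c = "\<lambda>v. x0 \<bullet> v" and l = "\<lambda>_. R" and X = "param R", OF finite_D _ bd]
      assms R_pos by auto
  have "2 * R / r + 2 \<le> 4 * R / r" using assms by (simp add: field_simps)
  then have "(\<Prod>v\<in>D. 2 * R / r + 2) \<le> (\<Prod>v\<in>D. 4 * R / r)"
    using assms R_pos by (intro prod_mono) (auto intro: add_nonneg_nonneg)
  then have "real (card F) \<le> (4 * R / r) ^ card D" using F(3) by simp
  then show ?thesis using that F by blast
qed

lemma param_diff_norm_le:
  assumes "x \<in> param r'" "y \<in> param r'" "\<forall>v\<in>D. \<bar>x \<bullet> v - y \<bullet> v\<bar> \<le> r"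
  shows "norm (x - y) \<le> real (card D) * r"
proof -
  have "norm (x - y) \<le> (\<Sum>b\<in>D. \<bar>(x - y) \<bullet> b\<bar>)"
    using assms by (intro norm_span_D_le span_diff) (auto simp: param_def)
  also have "\<dots> \<le> (\<Sum>b\<in>D. r)" using assms(3) by (intro sum_mono) (auto simp: inner_diff_left)
  finally show ?thesis by simp
qed

lemma card_D_le: "card D \<le> DIM('a)"
  using card_mono[OF finite_Basis D_subset] .

text \<open>Isotropic caps: \<open>W\<close> is empty and the radius is of order
  \<open>\<delta> powr (1/2)\<close>, so the quadratic height bound for a normal suffices. Positive
  codimension supplies a unit normal at every parameter, chosen without any regularity.\<close>

lemma nbhd_null_quadratic:
  assumes dec: "fourier_decay_measure_on M s \<mu>" and s: "s > real (card D)" and codim: "card D < DIM('a)"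
  shows "emeasure \<mu> nbhd = 0"
proof -
  define m where "m = card D"
  obtain C where C: "C > 0" "\<And>x x2 \<zeta>. \<lbrakk>x \<in> param (2 * R); x2 \<in> param (2 * R); normal_at x2 \<zeta>\<rbrakk> \<Longrightarrow>
       \<bar>\<zeta> \<bullet> (\<psi> x - \<psi> x2)\<bar> \<le> C * norm \<zeta> * norm (x - x2) ^ 2"
    using normal_height_quadratic by blast
  have ex: "\<exists>\<zeta>. normal_at x \<zeta> \<and> norm \<zeta> = 1" if x: "x \<in> param R" for x
  proof -
    have V: "x \<in> V" using param_V param_mono x by blast
    let ?A = "\<lambda>e. dderiv \<psi> e x"
    have "dim (?A ` D) \<le> card (?A ` D)" using finite_D by (intro dim_le_card') auto
    also have "\<dots> \<le> card D" by (rule card_image_le[OF finite_D])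
    finally have "dim (?A ` D) < DIM('a)" using codim by simp
    then obtain y where y: "y \<noteq> 0" "\<And>w. w \<in> span (?A ` D) \<Longrightarrow> orthogonal y w"
      by (rule orthogonal_to_subspace_exists) (rule that; assumption)
    have "span (?A ` D) = ?A ` span D"
      using linear_span_image[OF linear_dderiv[OF open_V smooth_psi V]] by blast
    then have "normal_at x ((1 / norm y) *\<^sub>R y)"
      unfolding normal_at_def using y(2) by (auto simp: orthogonal_def)
    moreover have "norm ((1 / norm y) *\<^sub>R y) = 1" using y(1) by simp
    ultimately show ?thesis by blast
  qed
  then obtain nu where nu: "\<And>x. x \<in> param R \<Longrightarrow> normal_at x (nu x)" "\<And>x. x \<in> param R \<Longrightarrow> norm (nu x) = 1"
    by metis
  define C1 where "C1 = C + (4 * R) ^ m"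
  have C1: "C1 > 0" "C \<le> C1" "(4 * R) ^ m \<le> C1" unfolding C1_def using C(1) R_pos by (auto intro: add_pos_nonneg)
  show ?thesis
  proof (rule cap_family_null[OF dec, of "real m / 2" "1/2" C1 "min 1 (R\<^sup>2)"])
    fix \<delta> :: real assume \<delta>: "0 < \<delta>" "\<delta> < min 1 (R\<^sup>2)"
    define a where "a = \<delta> powr (1/2)"
    have a: "a > 0" "a = sqrt \<delta>" unfolding a_def using \<delta>(1) by (auto simp: powr_half_sqrt)
    have "a \<le> R" unfolding a(2) using \<delta>(2) R_pos by (intro real_le_lsqrt) auto
    then obtain F where F: "F \<subseteq> param R" "finite F" "real (card F) \<le> (4 * R / a) ^ card D"
      "\<And>x. x \<in> param R \<Longrightarrow> \<exists>y\<in>F. \<forall>v\<in>D. \<bar>x \<bullet> v - y \<bullet> v\<bar> \<le> a"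
      by (rule param_net[OF a(1)]) (rule that; assumption)
    define G where "G = (\<lambda>x2. (x2, {} :: 'a set, nu x2)) ` F"
    have "card G \<le> card F" unfolding G_def by (rule card_image_le[OF F(2)])
    then have "real (card G) \<le> (4 * R / a) ^ m" using F(3) unfolding m_def by linarith
    also have "\<dots> = (4 * R) ^ m * \<delta> powr (- (real m / 2))"
      unfolding a_def using \<delta>(1) by (simp add: power_divide powr_power powr_minus_divide)
    also have "\<dots> \<le> C1 * \<delta> powr (- (real m / 2))" using C1 by (intro mult_right_mono) auto
    finally have cG: "real (card G) \<le> C1 * \<delta> powr (- (real m / 2))" .
    have "cap_family (1/2) C1 \<delta> G"
      unfolding cap_family_def
    proof (intro conjI)
      show "finite G" unfolding G_def using F(2) by blast
      have "\<bar>nu x2 \<bullet> (\<psi> x - \<psi> x2)\<bar> \<le> C1 * \<tau> ^ 3 * \<delta>"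
        if x: "x2 \<in> F" "x \<in> param (2 * R)" "\<tau> \<ge> 1" "norm (x - x2) \<le> \<tau> * \<delta> powr (1/2)" for x2 x \<tau>
      proof -
        have "\<bar>nu x2 \<bullet> (\<psi> x - \<psi> x2)\<bar> \<le> C * norm (nu x2) * norm (x - x2) ^ 2"
          using C(2) x F(1) nu(1) param_mono by blast
        also have "\<dots> = C * norm (x - x2) ^ 2" using nu(2) x F(1) by auto
        also have "\<dots> \<le> C1 * (\<tau> * a) ^ 2" using x(4) C1 C(1) unfolding a_def by (intro mult_mono power_mono) auto
        also have "\<dots> = C1 * \<tau> ^ 2 * \<delta>" unfolding a(2) using \<delta>(1) by (simp add: power_mult_distrib)
        also have "\<dots> \<le> C1 * \<tau> ^ 3 * \<delta>"
          using x(3) C1 \<delta>(1) by (intro mult_right_mono mult_left_mono power_increasing) auto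
        finally show ?thesis .
      qed
      then show "\<forall>(x2, W, \<zeta>)\<in>G. x2 \<in> param R \<and> finite W \<and> card W \<le> DIM('a) \<and> (\<forall>v\<in>W. norm v \<le> 1) \<and> norm \<zeta> \<ge> 1/2 \<and>
       (\<forall>x\<in>param (2 * R). \<forall>\<tau>\<ge>1. norm (x - x2) \<le> \<tau> * \<delta> powr (1/2) \<and> (\<forall>v\<in>W. \<bar>v \<bullet> (x - x2)\<bar> \<le> \<tau> * \<delta> powr (1/2))
          \<longrightarrow> \<bar>\<zeta> \<bullet> (\<psi> x - \<psi> x2)\<bar> \<le> C1 * \<tau> ^ 3 * \<delta>)"
        unfolding G_def using F(1) nu(2) by auto
      show "\<forall>x\<in>param R. \<exists>(x2, W, \<zeta>)\<in>G. norm (x - x2) \<le> real DIM('a) * \<delta> powr (1/2) \<and>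
       (\<forall>v\<in>W. \<bar>v \<bullet> (x - x2)\<bar> \<le> \<delta> powr (1/2))"
      proof
        fix x assume x: "x \<in> param R"
        obtain y where y: "y \<in> F" "\<forall>v\<in>D. \<bar>x \<bullet> v - y \<bullet> v\<bar> \<le> a" using F(4)[OF x] by blast
        have "norm (x - y) \<le> real (card D) * a"
          using param_diff_norm_le x y F(1) by blast
        also have "\<dots> \<le> real DIM('a) * a" using card_D_le a(1) by (intro mult_right_mono) auto
        finally show "\<exists>(x2, W, \<zeta>)\<in>G. norm (x - x2) \<le> real DIM('a) * \<delta> powr (1/2) \<and>
            (\<forall>v\<in>W. \<bar>v \<bullet> (x - x2)\<bar> \<le> \<delta> powr (1/2))"
          unfolding G_def a_def using y(1) by auto
      qed
    qed
    then show "\<exists>F. cap_family (1/2) C1 \<delta> F \<and> real (card F) \<le> C1 * \<delta> powr (- (real m / 2))"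
      using cG by blast
  qed (use s C1 R_pos m_def in auto)
qed

lemma nbhd_null_degenerate:
  assumes dec: "fourier_decay_measure_on M s \<mu>" and s: "s > real (card D) - 1/3"
    and deg: "\<And>x. x \<in> param R \<Longrightarrow> \<exists>\<zeta> v. norm \<zeta> = 1 \<and> normal_at x \<zeta> \<and> v \<in> span D \<and> norm v = 1 \<and>
        (\<forall>e\<in>span D. hess x \<zeta> v e = 0)"
  shows "emeasure \<mu> nbhd = 0"
proof -
  define m where "m = card D"
  define d where "d = real DIM('a)"
  have md: "real m \<le> d" unfolding m_def d_def using card_D_le by simp
  have d1: "d \<ge> 1" unfolding d_def by (simp add: Suc_leI)
  obtain nu1 vv where nu1: "\<And>x. x \<in> param R \<Longrightarrow> norm (nu1 x) = 1" "\<And>x. x \<in> param R \<Longrightarrow> normal_at x (nu1 x)"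
    and vv: "\<And>x. x \<in> param R \<Longrightarrow> vv x \<in> span D" "\<And>x. x \<in> param R \<Longrightarrow> norm (vv x) = 1"
    and hv: "\<And>x e. x \<in> param R \<Longrightarrow> e \<in> span D \<Longrightarrow> hess x (nu1 x) (vv x) e = 0"
    using deg by metis
  have "\<exists>W. finite W \<and> W \<subseteq> span D \<and> Suc (card W) = m \<and> (\<forall>v\<in>W. norm v = 1) \<and> vv x \<notin> W \<and>
     (\<forall>u\<in>span D. u = (vv x \<bullet> u) *\<^sub>R vv x + (\<Sum>v\<in>W. (v \<bullet> u) *\<^sub>R v))" if x: "x \<in> param R" for x
  proof -
    have dm: "dim (span D) = m"
      unfolding m_def dim_span using independent_mono[OF independent_Basis D_subset]
      by (simp add: dim_eq_card_independent)
    obtain W where W: "finite W" "W \<subseteq> span D" "Suc (card W) = dim (span D)" "\<And>v. v \<in> W \<Longrightarrow> norm v = 1"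
      "vv x \<notin> W" "\<And>u. u \<in> span D \<Longrightarrow> u = (vv x \<bullet> u) *\<^sub>R vv x + (\<Sum>v\<in>W. (v \<bullet> u) *\<^sub>R v)"
      by (rule orthonormal_complement_vector[OF subspace_span vv(1)[OF x] vv(2)[OF x]]) (rule that; assumption)
    have "Suc (card W) = m" using W(3) dm by simp
    then show ?thesis by (intro exI[of _ W] conjI ballI W) assumption+
  qed
  then have "\<forall>x\<in>param R. \<exists>W. finite W \<and> W \<subseteq> span D \<and> Suc (card W) = m \<and> (\<forall>v\<in>W. norm v = 1) \<and> vv x \<notin> W \<and>
     (\<forall>u\<in>span D. u = (vv x \<bullet> u) *\<^sub>R vv x + (\<Sum>v\<in>W. (v \<bullet> u) *\<^sub>R v))" by (rule ballI)
  from bchoice[OF this] obtain WW where WW': "\<forall>x\<in>param R. finite (WW x) \<and> WW x \<subseteq> span D \<and> Suc (card (WW x)) = m \<and>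
     (\<forall>v\<in>WW x. norm v = 1) \<and> vv x \<notin> WW x \<and>
     (\<forall>u\<in>span D. u = (vv x \<bullet> u) *\<^sub>R vv x + (\<Sum>v\<in>WW x. (v \<bullet> u) *\<^sub>R v))" ..
  have WW: "\<And>x. x \<in> param R \<Longrightarrow> finite (WW x)" "\<And>x. x \<in> param R \<Longrightarrow> Suc (card (WW x)) = m"
    "\<And>x v. x \<in> param R \<Longrightarrow> v \<in> WW x \<Longrightarrow> norm v = 1" "\<And>x. x \<in> param R \<Longrightarrow> vv x \<notin> WW x"
    "\<And>x u. x \<in> param R \<Longrightarrow> u \<in> span D \<Longrightarrow> u = (vv x \<bullet> u) *\<^sub>R vv x + (\<Sum>v\<in>WW x. (v \<bullet> u) *\<^sub>R v)"
    subgoal using WW' by blast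
    subgoal using WW' by blast
    subgoal using WW' by blast
    subgoal using WW' by blast
    subgoal premises prems for x u using bspec[OF WW' prems(1)] prems(2) by (elim conjE) (rule bspec)
    done
  have m1: "m \<ge> 1" using WW(2)[OF x0_in_param] by simp
  obtain c0 where c0: "c0 > 0"
    "\<And>x1 x2 \<zeta>1. \<lbrakk>x1 \<in> param (2 * R); x2 \<in> param (2 * R); normal_at x1 \<zeta>1\<rbrakk> \<Longrightarrow>
       \<exists>\<zeta>2. normal_at x2 \<zeta>2 \<and> norm (\<zeta>2 - \<zeta>1) \<le> c0 * norm (x1 - x2) * norm \<zeta>1"
    using normal_correction by blast
  have "\<exists>\<zeta>2. normal_at x2 \<zeta>2 \<and> norm (\<zeta>2 - nu1 x1) \<le> c0 * norm (x1 - x2)"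
    if "x1 \<in> param R" "x2 \<in> param R" for x1 x2
    using c0(2)[OF param_mono[OF that(1)] param_mono[OF that(2)] nu1(2)[OF that(1)]] nu1(1)[OF that(1)] by simp
  then obtain nu2 where nu2: "\<And>x1 x2. x1 \<in> param R \<Longrightarrow> x2 \<in> param R \<Longrightarrow> normal_at x2 (nu2 x1 x2)"
    "\<And>x1 x2. x1 \<in> param R \<Longrightarrow> x2 \<in> param R \<Longrightarrow> norm (nu2 x1 x2 - nu1 x1) \<le> c0 * norm (x1 - x2)"
    by metis
  obtain C where C: "C > 0"
    "\<And>x x1 x2 \<zeta>1 \<zeta>2 v1 c0. \<lbrakk>x \<in> param (2 * R); x1 \<in> param (2 * R); x2 \<in> param (2 * R);
       norm \<zeta>1 = 1; norm \<zeta>2 \<le> 2; normal_at x2 \<zeta>2; norm (\<zeta>2 - \<zeta>1) \<le> c0 * norm (x1 - x2); v1 \<in> span D;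
       \<And>e. e \<in> span D \<Longrightarrow> hess x1 \<zeta>1 v1 e = 0\<rbrakk> \<Longrightarrow>
       \<bar>\<zeta>2 \<bullet> (\<psi> x - \<psi> x2)\<bar> \<le> C * (norm (x - x2 - (v1 \<bullet> (x - x2)) *\<^sub>R v1) ^ 2
          + (1 + c0) * norm (x1 - x2) * norm (x - x2) ^ 2 + norm (x - x2) ^ 3)"
    by (rule degenerate_height_bound) blast
  define C3 where "C3 = C * (d\<^sup>2 + (1 + c0) * d + 1)"
  define C4 where "C4 = (4 * R) ^ m * (2 * d + 2) ^ m"
  define C1 where "C1 = C3 + C4"
  have C3: "C3 > 0" unfolding C3_def using C(1) c0(1) d1 by (intro mult_pos_pos add_nonneg_pos add_nonneg_nonneg) auto
  have C4: "C4 > 0" unfolding C4_def using R_pos d1 by simp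
  have C1: "C1 > 0" "C3 \<le> C1" "C4 \<le> C1" unfolding C1_def using C3 C4 by auto
  define p where "p = (real m - 1) / 2 + 1/3"
  \<comment> \<open>The cube of \<open>R\<close> ensures \<open>a \<le> R\<close>; the last term
    keeps the corrected normals within 1/2 of a unit vector.\<close>
  define \<delta>0 where "\<delta>0 = min 1 (min (R powr 3) ((1 / (2 * c0 * d)) powr 3))"
  show ?thesis
  proof (rule cap_family_null[OF dec, of p "1/3" C1 \<delta>0])
    have "2 * p = real m - 1/3" unfolding p_def by (simp add: field_simps)
    then show "s > 2 * p" using s by (simp add: m_def)
    show "p \<ge> 0" unfolding p_def using m1 by simp
    show "\<delta>0 > 0" unfolding \<delta>0_def using R_pos c0(1) d1 by simp
    fix \<delta> :: real assume \<delta>: "0 < \<delta>" "\<delta> < \<delta>0"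
    have \<delta>': "\<delta> \<le> 1" "\<delta> \<le> R powr 3" "\<delta> \<le> (1 / (2 * c0 * d)) powr 3"
      using \<delta>(2) unfolding \<delta>0_def by auto
    define a where "a = \<delta> powr (1/3)"
    define b where "b = \<delta> powr (1/2)"
    have root3: "a \<le> t" if "\<delta> \<le> t powr 3" "t > 0" for t
    proof -
      have "a \<le> (t powr 3) powr (1/3)" unfolding a_def using \<delta> that by (intro powr_mono2) auto
      also have "\<dots> = t" unfolding powr_powr using that(2) by simp
      finally show ?thesis .
    qed
    have a: "a > 0" "a \<le> R" "a \<le> 1 / (2 * c0 * d)"
      using root3[OF \<delta>'(2) R_pos] root3[OF \<delta>'(3)] c0(1) d1 \<delta>(1) by (auto simp: a_def)
    have b: "b > 0" "b \<le> a" unfolding a_def b_def using \<delta> \<delta>'(1) by (auto intro: powr_mono')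
    have a3: "a ^ 3 = \<delta>" unfolding a_def using \<delta>(1) by (simp add: powr_power)
    have b2: "b ^ 2 = \<delta>" unfolding b_def using \<delta>(1) by (simp add: powr_power)
    obtain F1 where F1: "F1 \<subseteq> param R" "finite F1" "real (card F1) \<le> (4 * R / a) ^ card D"
      "\<And>x. x \<in> param R \<Longrightarrow> \<exists>y\<in>F1. \<forall>v\<in>D. \<bar>x \<bullet> v - y \<bullet> v\<bar> \<le> a"
      by (rule param_net[OF a(1,2)]) (rule that; assumption)
    define X where "X x1 = {x \<in> param R. \<forall>v\<in>D. \<bar>x \<bullet> v - x1 \<bullet> v\<bar> \<le> a}" for x1
    have X: "norm (x - x1) \<le> d * a" if "x \<in> X x1" "x1 \<in> param R" for x x1
    proof -
      have "norm (x - x1) \<le> real (card D) * a"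
        using param_diff_norm_le that unfolding X_def by blast
      also have "\<dots> \<le> d * a" using md a(1) unfolding m_def by (intro mult_right_mono) auto
      finally show ?thesis .
    qed
    \<comment> \<open>One factor \<open>2 * d + 2\<close> for the long axis, and
      \<open>(2 * d + 2) * (a / b)\<close> for each of the \<open>m - 1\<close> short axes.\<close>
    define N2 where "N2 = (2 * d + 2) ^ m * (a / b) ^ (m - 1)"
    have "\<exists>F. F \<subseteq> X x1 \<and> finite F \<and> real (card F) \<le> N2 \<and>
        (\<forall>x\<in>X x1. \<exists>y\<in>F. \<bar>vv x1 \<bullet> (x - y)\<bar> \<le> a \<and> (\<forall>v\<in>WW x1. \<bar>v \<bullet> (x - y)\<bar> \<le> b))" if x1: "x1 \<in> param R" for x1
    proof -
      define B1 where "B1 = insert (vv x1) (WW x1)"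
      define r where "r v = (if v = vv x1 then a else b)" for v
      have fB: "finite B1" unfolding B1_def using WW(1)[OF x1] by simp
      have bd: "\<bar>v \<bullet> x - v \<bullet> x1\<bar> \<le> d * a" if "x \<in> X x1" "v \<in> B1" for x v
      proof -
        have "norm v = 1" using that(2) vv(2)[OF x1] WW(3)[OF x1] unfolding B1_def by auto
        then have "\<bar>v \<bullet> (x - x1)\<bar> \<le> norm (x - x1)" by (rule abs_inner_unit_le)
        also have "\<dots> \<le> d * a" using X[OF that(1) x1] .
        finally show ?thesis by (simp add: inner_diff_right)
      qed
      have r0: "r v > 0" for v unfolding r_def using a b by simp
      obtain F where F: "F \<subseteq> X x1" "finite F" "real (card F) \<le> (\<Prod>v\<in>B1. 2 * (d * a) / r v + 2)"
        "\<forall>x\<in>X x1. \<exists>y\<in>F. \<forall>v\<in>B1. \<bar>v \<bullet> x - v \<bullet> y\<bar> \<le> r v"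
        using finite_grid_net[where g = "\<lambda>x v. v \<bullet> x" and r = r and c = "\<lambda>v. v \<bullet> x1" and l = "\<lambda>_. d * a" and X = "X x1", OF fB r0 bd]
          a(1) d1 by auto
      have "(\<Prod>v\<in>B1. 2 * (d * a) / r v + 2) = (2 * (d * a) / a + 2) * (\<Prod>v\<in>WW x1. 2 * (d * a) / b + 2)"
      proof -
        have "(\<Prod>v\<in>WW x1. 2 * (d * a) / r v + 2) = (\<Prod>v\<in>WW x1. 2 * (d * a) / b + 2)"
          by (rule prod.cong) (use WW(4)[OF x1] in \<open>auto simp: r_def\<close>)
        then show ?thesis unfolding B1_def using WW(1,4)[OF x1] by (simp add: r_def)
      qed
      also have "\<dots> = (2 * d + 2) * (2 * (d * a) / b + 2) ^ (m - 1)"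
      proof -
        have "card (WW x1) = m - 1" using WW(2)[OF x1] by linarith
        then show ?thesis using a(1) by simp
      qed
      also have "\<dots> \<le> (2 * d + 2) * ((2 * d + 2) * (a / b)) ^ (m - 1)"
      proof (intro mult_left_mono power_mono)
        have "1 \<le> a / b" using b by simp
        moreover have "(2 * d + 2) * (a / b) = 2 * (d * a) / b + 2 * (a / b)" by (simp add: algebra_simps)
        ultimately show "2 * (d * a) / b + 2 \<le> (2 * d + 2) * (a / b)" by linarith
      qed (use a b d1 in auto)
      also have "\<dots> = N2"
        unfolding N2_def power_mult_distrib using power_Suc[of "2 * d + 2" "m - 1"] m1 by simp
      finally have cF: "real (card F) \<le> N2" using F(3) by linarith
      show ?thesis
      proof (intro exI[of _ F] conjI ballI)
        fix x assume "x \<in> X x1"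
        then obtain y where y: "y \<in> F" "\<forall>v\<in>B1. \<bar>v \<bullet> x - v \<bullet> y\<bar> \<le> r v" using F(4) by blast
        have "\<bar>v \<bullet> (x - y)\<bar> \<le> b" if "v \<in> WW x1" for v
        proof -
          have "v \<noteq> vv x1" "v \<in> B1" using that WW(4)[OF x1] unfolding B1_def by auto
          then show ?thesis using bspec[OF y(2), of v] by (simp add: r_def inner_diff_right)
        qed
        moreover have "\<bar>vv x1 \<bullet> (x - y)\<bar> \<le> a"
          using y(2) unfolding B1_def by (simp add: r_def inner_diff_right)
        ultimately show "\<exists>y\<in>F. \<bar>vv x1 \<bullet> (x - y)\<bar> \<le> a \<and> (\<forall>v\<in>WW x1. \<bar>v \<bullet> (x - y)\<bar> \<le> b)"
          using y(1) by blast
      qed (use F cF in auto)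
    qed
    then obtain F2 where F2: "\<And>x1. x1 \<in> param R \<Longrightarrow> F2 x1 \<subseteq> X x1" "\<And>x1. x1 \<in> param R \<Longrightarrow> finite (F2 x1)"
      "\<And>x1. x1 \<in> param R \<Longrightarrow> real (card (F2 x1)) \<le> N2"
      "\<And>x1 x. x1 \<in> param R \<Longrightarrow> x \<in> X x1 \<Longrightarrow> \<exists>y\<in>F2 x1. \<bar>vv x1 \<bullet> (x - y)\<bar> \<le> a \<and> (\<forall>v\<in>WW x1. \<bar>v \<bullet> (x - y)\<bar> \<le> b)"
      by metis
    \<comment> \<open>The short axes come from the coarse centre \<open>x1\<close>; the normal is
      that of \<open>x1\<close>, corrected to the fine centre \<open>x2\<close>.\<close>
    define G where "G = (\<lambda>(x1, x2). (x2, WW x1, nu2 x1 x2)) ` (SIGMA x1:F1. F2 x1)"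
    have finS: "finite (SIGMA x1:F1. F2 x1)" using F1 F2(2) by (intro finite_SigmaI) auto
    have "card G \<le> card (SIGMA x1:F1. F2 x1)" unfolding G_def by (rule card_image_le[OF finS])
    also have "\<dots> = (\<Sum>x1\<in>F1. card (F2 x1))" using F1 F2(2) by (intro card_SigmaI) auto
    finally have "real (card G) \<le> (\<Sum>x1\<in>F1. real (card (F2 x1)))" by (simp flip: of_nat_sum)
    also have "\<dots> \<le> real (card F1) * N2" using F1(1) F2(3) by (intro sum_bounded_above) auto
    also have "\<dots> \<le> (4 * R / a) ^ m * N2"
      using F1(3) a b d1 unfolding m_def N2_def by (intro mult_right_mono) auto
    also have "\<dots> = C4 * ((1 / a) ^ m * (a / b) ^ (m - 1))"
      unfolding N2_def C4_def by (simp add: power_mult_distrib power_divide)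
    also have "(1 / a) ^ m * (a / b) ^ (m - 1) = (1 / a) * (1 / b) ^ (m - 1)"
    proof -
      have "(1 / a) ^ m = (1 / a) * (1 / a) ^ (m - 1)" using m1 by (cases m) auto
      then show ?thesis using a(1) by (simp flip: power_mult_distrib)
    qed
    also have "\<dots> = \<delta> powr (- p)"
    proof -
      have "1 / a = \<delta> powr (- 1/3)" "1 / b = \<delta> powr (- 1/2)"
        unfolding a_def b_def using powr_minus_divide[of \<delta>] by simp_all
      then have "(1 / a) * (1 / b) ^ (m - 1) = \<delta> powr (- 1/3) * \<delta> powr (- 1/2 * real (m - 1))"
        using \<delta>(1) by (simp add: powr_power)
      also have "\<dots> = \<delta> powr (- 1/3 + - 1/2 * real (m - 1))" by (rule powr_add[symmetric])
      also have "- 1/3 + - 1/2 * real (m - 1) = - p" unfolding p_def using m1 by (simp add: of_nat_diff field_simps)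
      finally show ?thesis .
    qed
    also have "C4 * \<delta> powr (- p) \<le> C1 * \<delta> powr (- p)" using C1 by (intro mult_right_mono) auto
    finally have cG: "real (card G) \<le> C1 * \<delta> powr (- p)" .
    have "cap_family (1/3) C1 \<delta> G"
      unfolding cap_family_def
    proof (intro conjI)
      show "finite G" unfolding G_def using finS by blast
      have pt: "x2 \<in> param R \<and> finite (WW x1) \<and> card (WW x1) \<le> DIM('a) \<and> (\<forall>v\<in>WW x1. norm v \<le> 1) \<and> norm (nu2 x1 x2) \<ge> 1/2 \<and>
       (\<forall>x\<in>param (2 * R). \<forall>\<tau>\<ge>1. norm (x - x2) \<le> \<tau> * \<delta> powr (1/3) \<and> (\<forall>v\<in>WW x1. \<bar>v \<bullet> (x - x2)\<bar> \<le> \<tau> * \<delta> powr (1/2))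
          \<longrightarrow> \<bar>nu2 x1 x2 \<bullet> (\<psi> x - \<psi> x2)\<bar> \<le> C1 * \<tau> ^ 3 * \<delta>)"
        if f: "x1 \<in> F1" "x2 \<in> F2 x1" for x1 x2
      proof -
        have x1: "x1 \<in> param R" using f F1 by auto
        have x2X: "x2 \<in> X x1" using f F2(1)[OF x1] by auto
        then have x2: "x2 \<in> param R" unfolding X_def by auto
        have dist: "norm (x1 - x2) \<le> d * a" using X[OF x2X x1] by (simp add: norm_minus_commute)
        have cW: "card (WW x1) \<le> DIM('a)" "real (card (WW x1)) \<le> d"
          using WW(2)[OF x1] md unfolding d_def by auto
        have "norm (nu2 x1 x2 - nu1 x1) \<le> c0 * norm (x1 - x2)" using nu2(2)[OF x1 x2] .
        also have "\<dots> \<le> c0 * (d * a)" using dist c0(1) by (intro mult_left_mono) auto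
        also have "\<dots> \<le> c0 * (d * (1 / (2 * c0 * d)))" using a(3) c0(1) d1 by (intro mult_left_mono) auto
        also have "\<dots> = 1/2" using c0(1) d1 by simp
        finally have nn: "norm (nu2 x1 x2 - nu1 x1) \<le> 1/2" .
        have n2: "norm (nu2 x1 x2) \<ge> 1/2" "norm (nu2 x1 x2) \<le> 2"
          using nn nu1(1)[OF x1] norm_triangle_ineq3[of "nu2 x1 x2" "nu1 x1"] by linarith+
        have "\<bar>nu2 x1 x2 \<bullet> (\<psi> x - \<psi> x2)\<bar> \<le> C1 * \<tau> ^ 3 * \<delta>"
          if x: "x \<in> param (2 * R)" and \<tau>: "\<tau> \<ge> 1" and u: "norm (x - x2) \<le> \<tau> * \<delta> powr (1/3)"
            and v: "\<forall>v\<in>WW x1. \<bar>v \<bullet> (x - x2)\<bar> \<le> \<tau> * \<delta> powr (1/2)" for x \<tau>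
        proof -
          define w where "w = x - x2 - (vv x1 \<bullet> (x - x2)) *\<^sub>R vv x1"
          have us: "x - x2 \<in> span D" using x x2 span_diff unfolding param_def by blast
          have "w = (\<Sum>v\<in>WW x1. (v \<bullet> (x - x2)) *\<^sub>R v)"
            unfolding w_def using WW(5)[OF x1 us] by (metis add_diff_cancel_left')
          then have "norm w \<le> (\<Sum>v\<in>WW x1. norm ((v \<bullet> (x - x2)) *\<^sub>R v))" using norm_sum by metis
          also have "\<dots> \<le> real (card (WW x1)) * (\<tau> * b)"
            using v WW(3)[OF x1] unfolding b_def by (intro sum_bounded_above) auto
          also have "\<dots> \<le> d * (\<tau> * b)" using cW(2) \<tau> b by (intro mult_right_mono) auto
          finally have w: "norm w \<le> d * (\<tau> * b)" .
          have u': "norm (x - x2) \<le> \<tau> * a" using u unfolding a_def .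
          have t23: "\<tau>\<^sup>2 \<le> \<tau> ^ 3" using \<tau> by (intro power_increasing) auto
          have "\<bar>nu2 x1 x2 \<bullet> (\<psi> x - \<psi> x2)\<bar> \<le> C * (norm w ^ 2
              + (1 + c0) * norm (x1 - x2) * norm (x - x2) ^ 2 + norm (x - x2) ^ 3)"
            unfolding w_def
            by (rule C(2)[OF x param_mono[OF x1] param_mono[OF x2] nu1(1)[OF x1] n2(2) nu2(1)[OF x1 x2]
                nu2(2)[OF x1 x2] vv(1)[OF x1] hv[OF x1]])
          \<comment> \<open>For fixed \<open>\<tau>\<close> all three terms are of order
            \<open>\<delta>\<close>, since \<open>b ^ 2\<close> and \<open>a ^ 3\<close> both equal
            \<open>\<delta>\<close>; this balance fixes the exponents 1/2 and 1/3.\<close>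
          also have "\<dots> \<le> C * ((d * (\<tau> * b)) ^ 2 + (1 + c0) * (d * a) * (\<tau> * a) ^ 2 + (\<tau> * a) ^ 3)"
            using w u' dist c0(1) C(1) d1 a(1) by (intro mult_left_mono add_mono power_mono mult_mono) auto
          also have "\<dots> = C * (d\<^sup>2 * (\<tau>\<^sup>2 * b\<^sup>2) + (1 + c0) * d * (\<tau>\<^sup>2 * a ^ 3) + \<tau> ^ 3 * a ^ 3)"
            by (simp add: power_mult_distrib power2_eq_square power3_eq_cube mult_ac)
          also have "\<dots> \<le> C * (d\<^sup>2 * (\<tau> ^ 3 * \<delta>) + (1 + c0) * d * (\<tau> ^ 3 * \<delta>) + \<tau> ^ 3 * \<delta>)"
            unfolding a3 b2 using t23 c0(1) C(1) d1 \<delta>(1) by (intro mult_left_mono add_mono mult_right_mono) auto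
          also have "\<dots> = C3 * \<tau> ^ 3 * \<delta>" unfolding C3_def by (simp add: algebra_simps)
          also have "\<dots> \<le> C1 * \<tau> ^ 3 * \<delta>" using C1 \<tau> \<delta>(1) by (intro mult_right_mono) auto
          finally show ?thesis .
        qed
        then show ?thesis using x2 WW(1)[OF x1] cW(1) WW(3)[OF x1] n2(1) by auto
      qed
      show "\<forall>(x2, W, \<zeta>)\<in>G. x2 \<in> param R \<and> finite W \<and> card W \<le> DIM('a) \<and> (\<forall>v\<in>W. norm v \<le> 1) \<and> norm \<zeta> \<ge> 1/2 \<and>
       (\<forall>x\<in>param (2 * R). \<forall>\<tau>\<ge>1. norm (x - x2) \<le> \<tau> * \<delta> powr (1/3) \<and> (\<forall>v\<in>W. \<bar>v \<bullet> (x - x2)\<bar> \<le> \<tau> * \<delta> powr (1/2))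
          \<longrightarrow> \<bar>\<zeta> \<bullet> (\<psi> x - \<psi> x2)\<bar> \<le> C1 * \<tau> ^ 3 * \<delta>)"
        (is "\<forall>f\<in>G. ?P f")
      proof -
        have pt': "?P (x2, WW x1, nu2 x1 x2)" if "x1 \<in> F1" "x2 \<in> F2 x1" for x1 x2
          unfolding prod.case by (rule pt[OF that])
        have "?P f" if "f \<in> G" for f
        proof -
          obtain x1 x2 where f: "x1 \<in> F1" "x2 \<in> F2 x1" "f = (x2, WW x1, nu2 x1 x2)"
            using \<open>f \<in> G\<close> unfolding G_def by auto
          show ?thesis unfolding f(3) by (rule pt'[OF f(1,2)])
        qed
        then show ?thesis by (rule ballI)
      qed
      show "\<forall>x\<in>param R. \<exists>(x2, W, \<zeta>)\<in>G. norm (x - x2) \<le> real DIM('a) * \<delta> powr (1/3) \<and>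
       (\<forall>v\<in>W. \<bar>v \<bullet> (x - x2)\<bar> \<le> \<delta> powr (1/2))"
      proof
        fix x assume x: "x \<in> param R"
        obtain x1 where x1: "x1 \<in> F1" "\<forall>v\<in>D. \<bar>x \<bullet> v - x1 \<bullet> v\<bar> \<le> a" using F1(4)[OF x] by blast
        have x1p: "x1 \<in> param R" using x1 F1 by auto
        have "x \<in> X x1" unfolding X_def using x x1 by auto
        then obtain y where y: "y \<in> F2 x1" "\<bar>vv x1 \<bullet> (x - y)\<bar> \<le> a" "\<forall>v\<in>WW x1. \<bar>v \<bullet> (x - y)\<bar> \<le> b"
          using F2(4)[OF x1p] by blast
        have yp: "y \<in> param R" using y(1) F2(1)[OF x1p] unfolding X_def by auto
        have us: "x - y \<in> span D" using x yp span_diff unfolding param_def by blast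
        have "norm (x - y) \<le> norm ((vv x1 \<bullet> (x - y)) *\<^sub>R vv x1) + norm (\<Sum>v\<in>WW x1. (v \<bullet> (x - y)) *\<^sub>R v)"
          by (subst WW(5)[OF x1p us]) (rule norm_triangle_ineq)
        also have "\<dots> \<le> a + (\<Sum>v\<in>WW x1. norm ((v \<bullet> (x - y)) *\<^sub>R v))"
          using y(2) vv(2)[OF x1p] by (intro add_mono norm_sum) simp
        also have "\<dots> \<le> a + real (card (WW x1)) * a"
          using y(3) b WW(3)[OF x1p] by (intro add_left_mono sum_bounded_above) fastforce
        also have "\<dots> = real (Suc (card (WW x1))) * a" by (simp add: algebra_simps)
        also have "\<dots> \<le> d * a" unfolding WW(2)[OF x1p] using md a(1) by (intro mult_right_mono) auto
        finally have "norm (x - y) \<le> d * a" .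
        moreover have "(y, WW x1, nu2 x1 y) \<in> G" unfolding G_def using x1(1) y(1) by force
        ultimately show "\<exists>(x2, W, \<zeta>)\<in>G. norm (x - x2) \<le> real DIM('a) * \<delta> powr (1/3) \<and>
            (\<forall>v\<in>W. \<bar>v \<bullet> (x - x2)\<bar> \<le> \<delta> powr (1/2))"
          using y(3) unfolding a_def b_def d_def by (intro bexI[of _ "(y, WW x1, nu2 x1 y)"]) auto
      qed
    qed
    then show "\<exists>F. cap_family (1/3) C1 \<delta> F \<and> real (card F) \<le> C1 * \<delta> powr (- p)"
      using cG by blast
  qed (use C1 in auto)
qed

end

section \<open>From local null sets to bounds on the dimension\<close>

lemma fourier_dim_leI:
  fixes S :: "'a::euclidean_space set"
  assumes "q \<ge> 0" "\<And>s \<mu>. s > q \<Longrightarrow> s \<le> real DIM('a) \<Longrightarrow> \<not> fourier_decay_measure_on S s \<mu>"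
  shows "fourier_dim S \<le> q"
  unfolding fourier_dim_def
proof (rule cSup_least)
  fix s assume "s \<in> insert 0 {s. 0 < s \<and> s \<le> real DIM('a) \<and> (\<exists>\<mu>. fourier_decay_measure_on S s \<mu>)}"
  then show "s \<le> q" using assms by (cases "s > q") auto
qed simp

text \<open>By Lindelof's theorem countably many of the null neighbourhoods cover \<open>M\<close>,
  which carries the whole measure.\<close>

lemma locally_null_imp_no_decay:
  fixes M :: "'a::euclidean_space set"
  assumes dec: "fourier_decay_measure_on M s \<mu>"
    and loc: "\<And>z. z \<in> M \<Longrightarrow> \<exists>W. open W \<and> z \<in> W \<and> emeasure \<mu> W = 0"
  shows False
proof -
  have sets: "sets \<mu> = sets borel" and AEM: "AE z in \<mu>. z \<in> M" and pos: "emeasure \<mu> UNIV \<noteq> 0"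
    using dec unfolding fourier_decay_measure_on_def by auto
  obtain W where W: "\<And>z. z \<in> M \<Longrightarrow> open (W z) \<and> z \<in> W z \<and> emeasure \<mu> (W z) = 0"
    using loc by metis
  obtain F where F: "F \<subseteq> W ` M" "countable F" "\<Union>F = \<Union>(W ` M)"
    using Lindelof[of "W ` M"] W by blast
  have "(\<Union>G\<in>F. G) \<in> null_sets \<mu>"
  proof (rule null_sets_UN'[OF F(2)])
    fix G assume "G \<in> F"
    then obtain z where "z \<in> M" "G = W z" using F(1) by blast
    then show "G \<in> null_sets \<mu>" using W sets by (auto simp: null_sets_def)
  qed
  then have "AE z in \<mu>. z \<notin> (\<Union>G\<in>F. G)" by (rule AE_not_in)
  then have "AE z in \<mu>. False"
    using AEM
  proof eventually_elim
    case (elim z)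
    then show ?case using W F(3) by auto
  qed
  then have "emeasure \<mu> (space \<mu>) = 0" by (simp add: AE_iff_null null_sets_def)
  then show False using pos sets_eq_imp_space_eq[OF sets] by simp
qed

lemma fourier_dim_submanifold_le:
  fixes M :: "'a::euclidean_space set"
  assumes "smooth_submanifold m M"
  shows "fourier_dim M \<le> real m"
proof (rule fourier_dim_leI)
  fix s \<mu> assume s: "s > real m" "s \<le> real DIM('a)"
  show "\<not> fourier_decay_measure_on M s \<mu>"
  proof
    assume dec: "fourier_decay_measure_on M s \<mu>"
    show False
    proof (rule locally_null_imp_no_decay[OF dec])
      fix z0 assume z0: "z0 \<in> M"
      obtain U V \<phi> \<psi> D where c: "chart M U V \<phi> \<psi> D" "card D = m" "z0 \<in> U"
        by (rule smooth_submanifold_chart[OF assms z0])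
      interpret chart M U V \<phi> \<psi> D by fact
      obtain R R' L where "chart_ball M U V \<phi> \<psi> D z0 R R' L" by (rule chart_ball_exists[OF z0 c(3)])
      then interpret chart_ball M U V \<phi> \<psi> D z0 R R' L .
      \<comment> \<open>The two bounds on \<open>s\<close> force \<open>m < DIM('a)\<close>, the
        positive codimension required for the existence of normals.\<close>
      have "emeasure \<mu> nbhd = 0" by (rule nbhd_null_quadratic[OF dec]) (use s c in auto)
      then show "\<exists>W. open W \<and> z0 \<in> W \<and> emeasure \<mu> W = 0" using open_nbhd z0_in_nbhd by blast
    qed
  qed
qed simp

lemma fourier_dim_degenerate_le:
  fixes M :: "'a::euclidean_space set"
  assumes "smooth_submanifold m M" "m \<ge> 1"
    and deg: "\<not> (\<exists>z0\<in>M. \<forall>\<zeta>0\<in>(tangent_space M z0)\<^sup>\<bottom>. \<zeta>0 \<noteq> 0 \<longrightarrow>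
              nondegenerate_critical_point_on M (\<lambda>z. \<zeta>0 \<bullet> (z - z0)) z0)"
  shows "fourier_dim M \<le> real m - 1/3"
proof (rule fourier_dim_leI)
  fix s \<mu> assume s: "s > real m - 1/3" "s \<le> real DIM('a)"
  show "\<not> fourier_decay_measure_on M s \<mu>"
  proof
    assume dec: "fourier_decay_measure_on M s \<mu>"
    show False
    proof (rule locally_null_imp_no_decay[OF dec])
      fix z0 assume z0: "z0 \<in> M"
      obtain U V \<phi> \<psi> D where c: "chart M U V \<phi> \<psi> D" "card D = m" "z0 \<in> U"
        by (rule smooth_submanifold_chart[OF assms(1) z0])
      interpret chart M U V \<phi> \<psi> D by fact
      obtain R R' L where "chart_ball M U V \<phi> \<psi> D z0 R R' L" by (rule chart_ball_exists[OF z0 c(3)])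
      then interpret chart_ball M U V \<phi> \<psi> D z0 R R' L .
      have "\<exists>\<zeta> v. norm \<zeta> = 1 \<and> normal_at x \<zeta> \<and> v \<in> span D \<and> norm v = 1 \<and> (\<forall>e\<in>span D. hess x \<zeta> v e = 0)"
        if x: "x \<in> param R" for x
      proof -
        have xV: "x \<in> V" "x \<in> span D" using x param_V param_mono param_span by auto
        have xM: "\<psi> x \<in> M" using psi_in_M xV by blast
        obtain \<zeta> where \<zeta>: "\<zeta> \<in> (tangent_space M (\<psi> x))\<^sup>\<bottom>" "\<zeta> \<noteq> 0"
          "\<not> nondegenerate_critical_point_on M (\<lambda>z. \<zeta> \<bullet> (z - \<psi> x)) (\<psi> x)"
          using deg xM by blast
        obtain u where u: "u \<in> span D" "u \<noteq> 0" "\<And>e. e \<in> span D \<Longrightarrow> hess x \<zeta> u e = 0"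
          using \<zeta>(3) nondegenerate_critical_point_iff[OF xV(2,1) \<zeta>(1)] by blast
        \<comment> \<open>Both vectors are scaled to unit length; the form is homogeneous in each of
          them, so the degeneracy persists.\<close>
        define \<zeta>' where "\<zeta>' = (1 / norm \<zeta>) *\<^sub>R \<zeta>"
        define v where "v = (1 / norm u) *\<^sub>R u"
        have "normal_at x \<zeta>'"
          unfolding normal_at_def \<zeta>'_def using normal_dpsi[OF xV(2,1) \<zeta>(1)] by simp
        moreover have "hess x \<zeta>' v e = 0" if "e \<in> span D" for e
        proof -
          have "hess x \<zeta>' v e = (1 / norm \<zeta>) * hess x \<zeta> v e" unfolding hess_def \<zeta>'_def by simp
          also have "hess x \<zeta> v e = (1 / norm u) * hess x \<zeta> u e"
            unfolding v_def using bilinear_lmul[OF bilinear_hess[OF xV(1)]] by simp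
          finally show ?thesis using u(3)[OF that] by simp
        qed
        ultimately show ?thesis
          using u(1,2) \<zeta>(2) by (intro exI[of _ \<zeta>'] exI[of _ v]) (auto simp: \<zeta>'_def v_def span_scale)
      qed
      then have "emeasure \<mu> nbhd = 0" by (intro nbhd_null_degenerate[OF dec]) (use s c in auto)
      then show "\<exists>W. open W \<and> z0 \<in> W \<and> emeasure \<mu> W = 0" using open_nbhd z0_in_nbhd by blast
    qed
  qed
qed (use assms in auto)


section \<open>Oscillatory integrals\<close>

text \<open>The increment of \<open>f\<close> from \<open>x\<close> to \<open>x + t (u + e)\<close>
  is expanded directly and by way of \<open>x + t u\<close>. Up to \<open>O(t^3)\<close> the two
  expansions differ by \<open>t^2 / 2\<close> times the difference of the mixed derivatives, which
  must therefore vanish.\<close>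

lemma dderiv2_symmetric:
  fixes f :: "'a::euclidean_space \<Rightarrow> 'b::euclidean_space"
  assumes U: "open U" "smooth_on U f" "x \<in> U"
  shows "dderiv (dderiv f u) e x = dderiv (dderiv f e) u x"
proof -
  obtain R where R: "R > 0" "cball x R \<subseteq> U" using U open_contains_cball by blast
  obtain T2 where T2: "T2 > 0" "\<And>p q. p \<in> cball x R \<Longrightarrow> q \<in> cball x R \<Longrightarrow>
       norm (f q - f p - dderiv f (q - p) p - (1/2) *\<^sub>R dderiv (dderiv f (q - p)) (q - p) p) \<le> T2 * norm (q - p) ^ 3"
    using smooth_on_taylor2[OF U(1,2) R(2)] by blast
  obtain T1 where T1: "T1 > 0" "\<And>p q. p \<in> cball x R \<Longrightarrow> q \<in> cball x R \<Longrightarrow>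
       norm (dderiv f e q - dderiv f e p - dderiv (dderiv f e) (q - p) p) \<le> T1 * norm (q - p) ^ 2"
    using smooth_on_taylor1[OF U(1) smooth_on_dderiv[OF U(1,2)] R(2)] by blast
  obtain L where L: "L > 0" "\<And>p q u w. p \<in> cball x R \<Longrightarrow> q \<in> cball x R \<Longrightarrow>
       norm (dderiv (dderiv f u) w p - dderiv (dderiv f u) w q) \<le> L * norm (p - q) * norm u * norm w"
    using dderiv2_Lipschitz[OF U(1,2) R(2)] by blast
  define Q where "Q p v w = dderiv (dderiv f v) w p" for p v w
  define S where "S = norm u + norm e"
  define K where "K = 2 * T2 * S ^ 3 + T1 * S ^ 2 + L * S ^ 3"
  have Ssmall: "norm u \<le> S" "norm e \<le> S" "norm (u + e) \<le> S" unfolding S_def by (auto intro: norm_triangle_ineq)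
  have S0: "S \<ge> 0" unfolding S_def by simp
  have Qbil: "bilinear (Q p)" if "p \<in> U" for p
    unfolding bilinear_def Q_def
    using linear_dderiv2[OF U(1,2) that] linear_dderiv[OF U(1) smooth_on_dderiv[OF U(1,2)] that] by auto
  have main: "norm ((1/2) *\<^sub>R (Q x e u - Q x u e)) \<le> (K + T2 * S ^ 3) * t" if t: "t > 0" "t * S \<le> R" for t
  proof -
    have tn: "norm (t *\<^sub>R v) \<le> R" if "norm v \<le> S" for v :: 'a
      using order_trans[OF mult_left_mono[OF that less_imp_le[OF t(1)]] t(2)] t(1) by simp
    define y where "y = x + t *\<^sub>R u"
    define p where "p = x + t *\<^sub>R (u + e)"
    have "dist x y \<le> R" "dist x p \<le> R"
      using tn[OF Ssmall(1)] tn[OF Ssmall(3)] unfolding y_def p_def by (simp_all add: dist_norm)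
    then have mem: "x \<in> cball x R" "y \<in> cball x R" "p \<in> cball x R" using R(1) by auto
    have yU: "y \<in> U" using mem R(2) by blast
    note lin = linear_cmul[OF linear_dderiv[OF U]] linear_add[OF linear_dderiv[OF U]]
    note bil = bilinear_lmul[OF Qbil] bilinear_rmul[OF Qbil] bilinear_ladd[OF Qbil] bilinear_radd[OF Qbil]
    have d: "p - x = t *\<^sub>R (u + e)" "p - y = t *\<^sub>R e" "y - x = t *\<^sub>R u" unfolding p_def y_def by (auto simp: algebra_simps)
    define E1 where "E1 = f p - f x - dderiv f (t *\<^sub>R (u + e)) x - (1/2) *\<^sub>R Q x (t *\<^sub>R (u + e)) (t *\<^sub>R (u + e))"
    define E2 where "E2 = f p - f y - dderiv f (t *\<^sub>R e) y - (1/2) *\<^sub>R Q y (t *\<^sub>R e) (t *\<^sub>R e)"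
    define E3 where "E3 = f y - f x - dderiv f (t *\<^sub>R u) x - (1/2) *\<^sub>R Q x (t *\<^sub>R u) (t *\<^sub>R u)"
    define E4 where "E4 = dderiv f e y - dderiv f e x - Q x e (t *\<^sub>R u)"
    define E5 where "E5 = Q y e e - Q x e e"
    have pw: "norm (t *\<^sub>R v) ^ n \<le> t ^ n * S ^ n" if "norm v \<le> S" for v :: 'a and n
    proof -
      have "norm (t *\<^sub>R v) \<le> t * S" using that t by simp
      from power_mono[OF this, of n] show ?thesis by (simp add: power_mult_distrib)
    qed
    have e1: "norm E1 \<le> T2 * (t ^ 3 * S ^ 3)"
      using T2(2)[OF mem(1,3)] mult_left_mono[OF pw[OF Ssmall(3), of 3] less_imp_le[OF T2(1)]]
      unfolding d E1_def Q_def by linarith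
    have e2: "norm E2 \<le> T2 * (t ^ 3 * S ^ 3)"
      using T2(2)[OF mem(2,3)] mult_left_mono[OF pw[OF Ssmall(2), of 3] less_imp_le[OF T2(1)]]
      unfolding d E2_def Q_def by linarith
    have e3: "norm E3 \<le> T2 * (t ^ 3 * S ^ 3)"
      using T2(2)[OF mem(1,2)] mult_left_mono[OF pw[OF Ssmall(1), of 3] less_imp_le[OF T2(1)]]
      unfolding d E3_def Q_def by linarith
    have e4: "norm E4 \<le> T1 * (t ^ 2 * S ^ 2)"
      using T1(2)[OF mem(1,2)] mult_left_mono[OF pw[OF Ssmall(1), of 2] less_imp_le[OF T1(1)]]
      unfolding d E4_def Q_def by linarith
    have "norm E5 \<le> L * norm (t *\<^sub>R u) * norm e * norm e"
      using L(2)[OF mem(2,1), of e e] unfolding d E5_def Q_def by simp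
    also have "\<dots> \<le> L * (t * S) * S * S"
      using Ssmall L(1) t S0 by (intro mult_mono) auto
    finally have e5: "norm E5 \<le> L * (t * S ^ 3)" by (simp add: power3_eq_cube mult_ac)
    \<comment> \<open>Both expansions compute the same increment; \<open>E4\<close> and
      \<open>E5\<close> move the first and second derivatives in direction \<open>e\<close> from
      \<open>y\<close> back to \<open>x\<close>.\<close>
    have "E1 = E2 + E3 + t *\<^sub>R E4 + (t\<^sup>2/2) *\<^sub>R E5 + t\<^sup>2 *\<^sub>R ((1/2) *\<^sub>R (Q x e u - Q x u e))"
      unfolding E1_def E2_def E3_def E4_def E5_def
      using linear_cmul[OF linear_dderiv[OF U(1,2) yU], of t e]
      by (simp add: lin bil[OF U(3)] bil[OF yU] algebra_simps power2_eq_square flip: scaleR_add_left)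
    then have "t\<^sup>2 *\<^sub>R ((1/2) *\<^sub>R (Q x e u - Q x u e)) = E1 - E2 - E3 - t *\<^sub>R E4 - (t\<^sup>2/2) *\<^sub>R E5"
      by (simp add: algebra_simps)
    then have "norm (t\<^sup>2 *\<^sub>R ((1/2) *\<^sub>R (Q x e u - Q x u e))) \<le> norm E1 + norm E2 + norm E3 + norm (t *\<^sub>R E4) + norm ((t\<^sup>2/2) *\<^sub>R E5)"
      by (smt (verit) norm_triangle_ineq4)
    also have "\<dots> \<le> T2 * (t ^ 3 * S ^ 3) + T2 * (t ^ 3 * S ^ 3) + T2 * (t ^ 3 * S ^ 3) + t * (T1 * (t ^ 2 * S ^ 2)) + (t\<^sup>2/2) * (L * (t * S ^ 3))"
      using e1 e2 e3 e4 e5 t by (intro add_mono) (auto intro: mult_left_mono)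
    also have "\<dots> \<le> t\<^sup>2 * ((K + T2 * S ^ 3) * t)"
      unfolding K_def using L(1) t S0 by (simp add: algebra_simps power2_eq_square power3_eq_cube)
    finally have "t\<^sup>2 * norm ((1/2) *\<^sub>R (Q x e u - Q x u e)) \<le> t\<^sup>2 * ((K + T2 * S ^ 3) * t)" by simp
    then show ?thesis using t by simp
  qed
  have "((\<lambda>t. (K + T2 * S ^ 3) * t) \<longlongrightarrow> (K + T2 * S ^ 3) * 0) (at_right 0)"
    by (intro tendsto_intros)
  moreover have "eventually (\<lambda>t. norm ((1/2) *\<^sub>R (Q x e u - Q x u e)) \<le> (K + T2 * S ^ 3) * t) (at_right 0)"
    unfolding eventually_at_right_field
  proof (intro exI[of _ "R / (S + 1)"] conjI allI impI)
    show "0 < R / (S + 1)" using R S0 by simp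
    fix t assume t: "0 < t" "t < R / (S + 1)"
    then have "t * (S + 1) \<le> R" using S0 by (simp add: field_simps)
    then have "t * S \<le> R" using t by (simp add: algebra_simps)
    then show "norm ((1/2) *\<^sub>R (Q x e u - Q x u e)) \<le> (K + T2 * S ^ 3) * t" using main t by blast
  qed
  ultimately have "norm ((1/2) *\<^sub>R (Q x e u - Q x u e)) \<le> (K + T2 * S ^ 3) * 0"
    by (rule tendsto_lowerbound) simp
  then show ?thesis unfolding Q_def by simp
qed

section \<open>Families of functions with uniform bounds on derivatives\<close>

text \<open>The index will collect frequency direction, base point, shift and line direction. Bounds
  uniform over the index set make the constant of \<open>nonstationary_phase\<close> independent of
  these parameters.\<close>

fun unif_Ck :: "nat \<Rightarrow> 'i set \<Rightarrow> real set \<Rightarrow> ('i \<Rightarrow> real \<Rightarrow> real) \<Rightarrow> bool" where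
  "unif_Ck 0 I J f \<longleftrightarrow> (\<forall>i\<in>I. continuous_on J (f i)) \<and> (\<exists>C. \<forall>i\<in>I. \<forall>t\<in>J. \<bar>f i t\<bar> \<le> C)"
| "unif_Ck (Suc k) I J f \<longleftrightarrow> unif_Ck 0 I J f \<and>
     (\<exists>f'. (\<forall>i\<in>I. \<forall>t\<in>J. (f i has_real_derivative f' i t) (at t)) \<and> unif_Ck k I J f')"

lemma unif_Ck_0: "unif_Ck k I J f \<Longrightarrow> unif_Ck 0 I J f"
  by (cases k) auto

lemma unif_Ck_Suc_D: "unif_Ck (Suc k) I J f \<Longrightarrow> unif_Ck k I J f"
proof (induction k arbitrary: f)
  case (Suc k)
  then obtain f' where f': "\<forall>i\<in>I. \<forall>t\<in>J. (f i has_real_derivative f' i t) (at t)" "unif_Ck (Suc k) I J f'"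
    by auto
  then have "unif_Ck k I J f'" using Suc.IH by blast
  then show ?case using f'(1) unif_Ck_0[OF Suc.prems] by auto
qed auto

lemma unif_Ck_SucI:
  assumes "\<And>i t. i \<in> I \<Longrightarrow> t \<in> J \<Longrightarrow> (f i has_real_derivative f' i t) (at t)"
    and "\<And>i t. i \<in> I \<Longrightarrow> t \<in> J \<Longrightarrow> \<bar>f i t\<bar> \<le> C" and "unif_Ck k I J f'"
  shows "unif_Ck (Suc k) I J f"
proof -
  have "continuous_on J (f i)" if "i \<in> I" for i
    using assms(1)[OF that] by (meson DERIV_continuous continuous_at_imp_continuous_on)
  then show ?thesis using assms unfolding unif_Ck.simps by (intro conjI ballI exI[of _ f'] exI[of _ C])
qed

lemma unif_Ck_deriv:
  assumes "open J" "unif_Ck (Suc k) I J f"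
  shows "unif_Ck k I J (\<lambda>i. deriv (f i))"
    and "i \<in> I \<Longrightarrow> t \<in> J \<Longrightarrow> (f i has_real_derivative deriv (f i) t) (at t)"
proof -
  obtain f' where f': "\<forall>i\<in>I. \<forall>t\<in>J. (f i has_real_derivative f' i t) (at t)" "unif_Ck k I J f'"
    using assms(2) by auto
  have eq: "deriv (f i) t = f' i t" if "i \<in> I" "t \<in> J" for i t
    using f'(1) that DERIV_imp_deriv by blast
  show "i \<in> I \<Longrightarrow> t \<in> J \<Longrightarrow> (f i has_real_derivative deriv (f i) t) (at t)"
    using f'(1) eq by simp
  have cong: "unif_Ck k I J g'" if gU: "unif_Ck k I J g" and "\<And>i t. i \<in> I \<Longrightarrow> t \<in> J \<Longrightarrow> g i t = g' i t" for k g g'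
  proof (cases k)
    case 0
    have "continuous_on J (g' i) = continuous_on J (g i)" if "i \<in> I" for i
      by (rule continuous_on_cong) (use that \<open>\<And>i t. i \<in> I \<Longrightarrow> t \<in> J \<Longrightarrow> g i t = g' i t\<close> in auto)
    then show ?thesis using that 0 by auto
  next
    case (Suc j)
    then obtain h C where h: "\<forall>i\<in>I. \<forall>t\<in>J. (g i has_real_derivative h i t) (at t)" "unif_Ck j I J h"
      "\<forall>i\<in>I. \<forall>t\<in>J. \<bar>g i t\<bar> \<le> C" using gU unfolding Suc unif_Ck.simps by blast
    show ?thesis unfolding Suc
    proof (rule unif_Ck_SucI[where f' = h and C = C])
      show "(g' i has_real_derivative h i t) (at t)" if it: "i \<in> I" "t \<in> J" for i t
        by (rule has_field_derivative_transform_within_open[OF bspec[OF bspec[OF h(1) it(1)] it(2)] assms(1) it(2)])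
          (rule \<open>\<And>i t. i \<in> I \<Longrightarrow> t \<in> J \<Longrightarrow> g i t = g' i t\<close>[OF it(1)])
    qed (use h that in auto)
  qed
  show "unif_Ck k I J (\<lambda>i. deriv (f i))" by (rule cong[OF f'(2)]) (simp add: eq)
qed

lemma unif_Ck_const:
  assumes "\<And>i. i \<in> I \<Longrightarrow> \<bar>c i\<bar> \<le> C"
  shows "unif_Ck k I J (\<lambda>i t. c i)"
  using assms
proof (induction k arbitrary: c C)
  case 0
  then show ?case by auto
next
  case (Suc k)
  have "unif_Ck k I J (\<lambda>i t. 0)" by (rule Suc.IH[where C = 0]) auto
  then show ?case by (intro unif_Ck_SucI[where f' = "\<lambda>i t. 0" and C = C]) (use Suc.prems in auto)
qed

lemma unif_Ck_id:
  assumes "bounded J"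
  shows "unif_Ck k I J (\<lambda>i t. t)"
proof -
  obtain C where C: "\<And>t. t \<in> J \<Longrightarrow> \<bar>t\<bar> \<le> C" using assms unfolding bounded_iff by auto
  show ?thesis
  proof (cases k)
    case 0
    then show ?thesis using C by (auto intro!: continuous_intros)
  next
    case (Suc j)
    show ?thesis unfolding Suc
      by (rule unif_Ck_SucI[where f' = "\<lambda>i t. 1" and C = C])
        (use C unif_Ck_const[where c = "\<lambda>_. 1" and C = 1] in \<open>auto intro: DERIV_ident\<close>)
  qed
qed

lemma unif_Ck_add:
  assumes "unif_Ck k I J f" "unif_Ck k I J g"
  shows "unif_Ck k I J (\<lambda>i t. f i t + g i t)"
  using assms
proof (induction k arbitrary: f g)
  case 0
  then obtain C C' where "\<forall>i\<in>I. \<forall>t\<in>J. \<bar>f i t\<bar> \<le> C" "\<forall>i\<in>I. \<forall>t\<in>J. \<bar>g i t\<bar> \<le> C'" by auto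
  then have "\<forall>i\<in>I. \<forall>t\<in>J. \<bar>f i t + g i t\<bar> \<le> C + C'" by (meson abs_triangle_ineq add_mono order_trans)
  then show ?case using 0 by (auto intro!: continuous_intros)
next
  case (Suc k)
  obtain f' where f': "\<forall>i\<in>I. \<forall>t\<in>J. (f i has_real_derivative f' i t) (at t)" "unif_Ck k I J f'" using Suc.prems(1) by auto
  obtain g' where g': "\<forall>i\<in>I. \<forall>t\<in>J. (g i has_real_derivative g' i t) (at t)" "unif_Ck k I J g'" using Suc.prems(2) by auto
  obtain C C' where C: "\<forall>i\<in>I. \<forall>t\<in>J. \<bar>f i t\<bar> \<le> C" "\<forall>i\<in>I. \<forall>t\<in>J. \<bar>g i t\<bar> \<le> C'" using Suc.prems by auto
  show ?case
  proof (rule unif_Ck_SucI[where f' = "\<lambda>i t. f' i t + g' i t" and C = "C + C'"])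
    show "unif_Ck k I J (\<lambda>i t. f' i t + g' i t)" using Suc.IH f'(2) g'(2) by blast
    show "\<bar>f i t + g i t\<bar> \<le> C + C'" if "i \<in> I" "t \<in> J" for i t
      using C that by (meson abs_triangle_ineq add_mono order_trans)
  qed (use f'(1) g'(1) in \<open>auto intro!: DERIV_add\<close>)
qed

lemma unif_Ck_mult:
  assumes "unif_Ck k I J f" "unif_Ck k I J g"
  shows "unif_Ck k I J (\<lambda>i t. f i t * g i t)"
  using assms
proof (induction k arbitrary: f g)
  case 0
  then obtain C C' where "\<forall>i\<in>I. \<forall>t\<in>J. \<bar>f i t\<bar> \<le> C" "\<forall>i\<in>I. \<forall>t\<in>J. \<bar>g i t\<bar> \<le> C'" by auto
  then have "\<bar>f i t * g i t\<bar> \<le> C * C'" if "i \<in> I" "t \<in> J" for i t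
    unfolding abs_mult using that by (intro mult_mono) (auto intro: order_trans[OF abs_ge_zero])
  then show ?case using 0 by (auto intro!: continuous_intros)
next
  case (Suc k)
  obtain f' where f': "\<forall>i\<in>I. \<forall>t\<in>J. (f i has_real_derivative f' i t) (at t)" "unif_Ck k I J f'" using Suc.prems(1) by auto
  obtain g' where g': "\<forall>i\<in>I. \<forall>t\<in>J. (g i has_real_derivative g' i t) (at t)" "unif_Ck k I J g'" using Suc.prems(2) by auto
  obtain C C' where C: "\<forall>i\<in>I. \<forall>t\<in>J. \<bar>f i t\<bar> \<le> C" "\<forall>i\<in>I. \<forall>t\<in>J. \<bar>g i t\<bar> \<le> C'" using Suc.prems by auto
  have fg: "unif_Ck k I J f" "unif_Ck k I J g" using Suc.prems unif_Ck_Suc_D by blast+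
  show ?case
  proof (rule unif_Ck_SucI[where f' = "\<lambda>i t. f' i t * g i t + g' i t * f i t" and C = "C * C'"])
    show "unif_Ck k I J (\<lambda>i t. f' i t * g i t + g' i t * f i t)"
      using Suc.IH f'(2) g'(2) fg unif_Ck_add by blast
    show "\<bar>f i t * g i t\<bar> \<le> C * C'" if "i \<in> I" "t \<in> J" for i t
      unfolding abs_mult using C that by (intro mult_mono) (auto intro: order_trans[OF abs_ge_zero])
  qed (use f'(1) g'(1) in \<open>auto intro!: DERIV_mult\<close>)
qed

lemma unif_Ck_sum:
  assumes "finite B" "\<And>b. b \<in> B \<Longrightarrow> unif_Ck k I J (f b)"
  shows "unif_Ck k I J (\<lambda>i t. \<Sum>b\<in>B. f b i t)"
  using assms
proof (induction B rule: finite_induct)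
  case empty
  then show ?case using unif_Ck_const[where c = "\<lambda>_. 0" and C = 0] by simp
next
  case (insert x B)
  then show ?case using unif_Ck_add[of k I J "f x" "\<lambda>i t. \<Sum>b\<in>B. f b i t"] by simp
qed

lemma unif_Ck_cmult:
  assumes "unif_Ck k I J f" "\<And>i. i \<in> I \<Longrightarrow> \<bar>c i\<bar> \<le> C"
  shows "unif_Ck k I J (\<lambda>i t. c i * f i t)"
  using unif_Ck_mult[OF unif_Ck_const assms(1)] assms(2) by blast

text \<open>The derivative of \<open>1 / f\<close> is, up to sign, the product of \<open>f'\<close>
  and two copies of \<open>1 / f\<close>, so the induction closes.\<close>

lemma unif_Ck_inverse:
  assumes "unif_Ck k I J f" "c > 0" "\<And>i t. i \<in> I \<Longrightarrow> t \<in> J \<Longrightarrow> \<bar>f i t\<bar> \<ge> c"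
  shows "unif_Ck k I J (\<lambda>i t. 1 / f i t)"
  using assms(1,3)
proof (induction k arbitrary: f)
  case 0
  have "\<bar>1 / f i t\<bar> \<le> 1 / c" if "i \<in> I" "t \<in> J" for i t
    using 0(2)[OF that] assms(2) by (simp add: abs_divide frac_le)
  moreover have "f i t \<noteq> 0" if "i \<in> I" "t \<in> J" for i t using 0(2)[OF that] assms(2) by auto
  ultimately show ?case using 0 by (auto intro!: continuous_intros)
next
  case (Suc k)
  obtain f' where f': "\<forall>i\<in>I. \<forall>t\<in>J. (f i has_real_derivative f' i t) (at t)" "unif_Ck k I J f'" using Suc.prems(1) by auto
  have inv: "unif_Ck k I J (\<lambda>i t. 1 / f i t)"
    using Suc.IH[OF unif_Ck_Suc_D[OF Suc.prems(1)] Suc.prems(2)] .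
  have ne: "f i t \<noteq> 0" if "i \<in> I" "t \<in> J" for i t using Suc.prems(2)[OF that] assms(2) by auto
  show ?case
  proof (rule unif_Ck_SucI[where f' = "\<lambda>i t. -1 * (f' i t * (1 / f i t * (1 / f i t)))" and C = "1 / c"])
    show "((\<lambda>t. 1 / f i t) has_real_derivative -1 * (f' i t * (1 / f i t * (1 / f i t)))) (at t)" if "i \<in> I" "t \<in> J" for i t
      using f'(1) that ne[OF that] by (auto intro!: derivative_eq_intros simp: field_simps)
    show "\<bar>1 / f i t\<bar> \<le> 1 / c" if "i \<in> I" "t \<in> J" for i t
      using Suc.prems(2)[OF that] assms(2) by (simp add: abs_divide frac_le)
    show "unif_Ck k I J (\<lambda>i t. -1 * (f' i t * (1 / f i t * (1 / f i t))))"
      by (intro unif_Ck_cmult[where C = 1] unif_Ck_mult f'(2) inv) auto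
  qed
qed

lemma has_derivative_pos_part_power:
  "((\<lambda>x::real. (max 0 x) ^ Suc (Suc n)) has_real_derivative real (Suc (Suc n)) * (max 0 x) ^ Suc n) (at x)"
proof -
  consider "x > 0" | "x < 0" | "x = 0" by linarith
  then show ?thesis
  proof cases
    case 1
    have "((\<lambda>x::real. x ^ Suc (Suc n)) has_real_derivative real (Suc (Suc n)) * x ^ Suc n) (at x)"
      using DERIV_pow[of "Suc (Suc n)" x] by simp
    then have "((\<lambda>x::real. (max 0 x) ^ Suc (Suc n)) has_real_derivative real (Suc (Suc n)) * x ^ Suc n) (at x)"
      by (rule has_field_derivative_transform_within_open[where S = "{0<..}"]) (use 1 in auto)
    then show ?thesis using 1 by simp
  next
    case 2
    have "((\<lambda>x::real. 0) has_real_derivative 0) (at x)" by simp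
    then have "((\<lambda>x::real. (max 0 x) ^ Suc (Suc n)) has_real_derivative 0) (at x)"
      by (rule has_field_derivative_transform_within_open[where S = "{..<0}"]) (use 2 in auto)
    then show ?thesis using 2 by simp
  next
    case 3
    have "((\<lambda>h::real. \<bar>h\<bar> ^ Suc n) \<longlongrightarrow> \<bar>0\<bar> ^ Suc n) (at 0)" by (intro tendsto_intros)
    then have l: "((\<lambda>h::real. \<bar>h\<bar> ^ Suc n) \<longlongrightarrow> 0) (at 0)" by simp
    have "((\<lambda>h::real. ((max 0 h) ^ Suc (Suc n)) / h) \<longlongrightarrow> 0) (at 0)"
    proof (rule Lim_null_comparison[OF _ l])
      have "norm ((max 0 h) ^ Suc (Suc n) / h) \<le> \<bar>h\<bar> ^ Suc n" for h :: real
      proof (cases "h > 0")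
        case True
        then show ?thesis by (simp add: max_def)
      next
        case False
        then have *: "max 0 h = 0" by simp
        show ?thesis unfolding * power_0_Suc by simp
      qed
      then show "\<forall>\<^sub>F h::real in at 0. norm ((max 0 h) ^ Suc (Suc n) / h) \<le> \<bar>h\<bar> ^ Suc n" by simp
    qed
    then show ?thesis unfolding has_field_derivative_iff 3 by simp
  qed
qed

text \<open>Each derivative lowers the exponent by one, and with exponent 1 the positive part is
  still continuous. Smoothness of any prescribed finite order is thus available from
  polynomials.\<close>

lemma unif_Ck_pos_part_power:
  assumes "\<And>k. unif_Ck k I J q"
  shows "unif_Ck n I J (\<lambda>i t. (max 0 (q i t)) ^ Suc n)"
proof -
  obtain C where C: "\<forall>i\<in>I. \<forall>t\<in>J. \<bar>q i t\<bar> \<le> C" using assms[of 0] by auto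
  have bd: "\<bar>(max 0 (q i t)) ^ m\<bar> \<le> \<bar>C\<bar> ^ m" if "i \<in> I" "t \<in> J" for i t m
  proof -
    have "max 0 (q i t) \<le> \<bar>C\<bar>" using C that by fastforce
    then have "(max 0 (q i t)) ^ m \<le> \<bar>C\<bar> ^ m" by (intro power_mono) auto
    then show ?thesis by simp
  qed
  show ?thesis
  proof (induction n)
    case 0
    have "\<forall>i\<in>I. continuous_on J (q i)" using assms[of 0] by auto
    then show ?case using bd[where m = 1] by (auto intro!: continuous_intros exI[of _ "\<bar>C\<bar>"])
  next
    case (Suc n)
    obtain p where p: "\<forall>i\<in>I. \<forall>t\<in>J. (q i has_real_derivative p i t) (at t)" "unif_Ck n I J p"
      using assms[of "Suc n"] by auto
    show ?case
    proof (rule unif_Ck_SucI[where f' = "\<lambda>i t. real (Suc (Suc n)) * ((max 0 (q i t)) ^ Suc n * p i t)" and C = "\<bar>C\<bar> ^ Suc (Suc n)"])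
      show "((\<lambda>t. (max 0 (q i t)) ^ Suc (Suc n)) has_real_derivative real (Suc (Suc n)) * ((max 0 (q i t)) ^ Suc n * p i t)) (at t)"
        if "i \<in> I" "t \<in> J" for i t
        using DERIV_chain2[where f = "\<lambda>x. max 0 x ^ Suc (Suc n)" and g = "q i" and x = t and s = UNIV,
            OF has_derivative_pos_part_power bspec[OF bspec[OF p(1) that(1)] that(2)]]
        by (simp only: mult.assoc)
      show "unif_Ck n I J (\<lambda>i t. real (Suc (Suc n)) * ((max 0 (q i t)) ^ Suc n * p i t))"
        by (intro unif_Ck_cmult[where C = "real (Suc (Suc n))"] unif_Ck_mult Suc.IH p(2)) auto
    qed (use bd in blast)
  qed
qed

text \<open>Integrating by parts \<open>N\<close> times along a line; each step replaces the amplitude \<open>b\<close> by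
  \<open>-(b / g')' / (\<i> \<mu>)\<close>, which is again uniformly smooth.\<close>

lemma nonstationary_phase:
  fixes g b :: "'i \<Rightarrow> real \<Rightarrow> real"
  assumes h: "0 < h0" "h0 < h" "h < H"
    and g: "\<And>k. unif_Ck k I {-H<..<H} g"
    and c: "c > 0" "\<And>i t. i \<in> I \<Longrightarrow> t \<in> {-H<..<H} \<Longrightarrow> \<bar>deriv (g i) t\<bar> \<ge> c"
    and b: "unif_Ck N I {-H<..<H} b"
    and supp: "\<And>i t. i \<in> I \<Longrightarrow> t \<in> {-H<..<H} \<Longrightarrow> \<bar>t\<bar> > h0 \<Longrightarrow> b i t = 0"
  shows "\<exists>C\<ge>0. \<forall>i\<in>I. \<forall>\<mu>>0. cmod (integral {-h..h} (\<lambda>t. b i t *\<^sub>R cis (\<mu> * g i t))) \<le> C / \<mu> ^ N"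
  using b supp
proof (induction N arbitrary: b)
  case 0
  then obtain C where C: "\<forall>i\<in>I. \<forall>t\<in>{-H<..<H}. \<bar>b i t\<bar> \<le> C" by auto
  have sub: "{-h..h} \<subseteq> {-H<..<H}" using h by auto
  have "cmod (integral {-h..h} (\<lambda>t. b i t *\<^sub>R cis (\<mu> * g i t))) \<le> \<bar>C\<bar> * (2 * h)" if i: "i \<in> I" for i \<mu>
  proof -
    have "continuous_on {-H<..<H} (b i)" "continuous_on {-H<..<H} (g i)" using 0(1) g[of 0] i by auto
    then have "continuous_on {-h..h} (b i)" "continuous_on {-h..h} (g i)"
      using continuous_on_subset[OF _ sub] by blast+
    then have "continuous_on {-h..h} (\<lambda>t. b i t *\<^sub>R cis (\<mu> * g i t))" by (intro continuous_intros) auto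
    then have "norm (integral {-h..h} (\<lambda>t. b i t *\<^sub>R cis (\<mu> * g i t))) \<le> \<bar>C\<bar> * (h - (-h))"
    proof (rule integral_bound[rotated])
      show "- h \<le> h" using h by simp
      fix t assume "t \<in> {-h..h}"
      then have "\<bar>b i t\<bar> \<le> C" using C i sub by blast
      then show "norm (b i t *\<^sub>R cis (\<mu> * g i t)) \<le> \<bar>C\<bar>" by simp
    qed
    then show ?thesis by simp
  qed
  then show ?case using h by (intro exI[of _ "\<bar>C\<bar> * (2 * h)"]) auto
next
  case (Suc N)
  let ?J = "{-H<..<H}"
  have oJ: "open ?J" by simp
  have sub: "{-h..h} \<subseteq> ?J" using h by auto
  define g' where "g' i = deriv (g i)" for i
  have g'U: "unif_Ck k I ?J g'" for k unfolding g'_def using unif_Ck_deriv(1)[OF oJ g] .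
  have gd: "(g i has_real_derivative g' i t) (at t)" if "i \<in> I" "t \<in> ?J" for i t
    unfolding g'_def using unif_Ck_deriv(2)[OF oJ g that] .
  have g'ne: "g' i t \<noteq> 0" if "i \<in> I" "t \<in> ?J" for i t using c(2)[OF that] c(1) unfolding g'_def by auto
  \<comment> \<open>As \<open>b = q * g'\<close>, the derivative of
    \<open>q * cis (\<mu> * g)\<close> is \<open>q' * cis (\<mu> * g)\<close> plus
    \<open>\<i> * \<mu>\<close> times the given integrand; its integral vanishes, so
    \<open>b\<close> is traded for \<open>q'\<close> with a gain of
    \<open>1 / \<mu>\<close>.\<close>
  define q where "q i t = b i t * (1 / g' i t)" for i t
  have qU: "unif_Ck (Suc N) I ?J q"
    unfolding q_def using unif_Ck_mult[OF Suc.prems(1) unif_Ck_inverse[OF g'U c(1)]] c(2) unfolding g'_def by blast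
  define q' where "q' i = deriv (q i)" for i
  have q'U: "unif_Ck N I ?J q'" unfolding q'_def using unif_Ck_deriv(1)[OF oJ qU] .
  have qd: "(q i has_real_derivative q' i t) (at t)" if "i \<in> I" "t \<in> ?J" for i t
    unfolding q'_def using unif_Ck_deriv(2)[OF oJ qU that] .
  have q0: "q i t = 0" if "i \<in> I" "t \<in> ?J" "\<bar>t\<bar> > h0" for i t
    using Suc.prems(2)[OF that] unfolding q_def by simp
  \<comment> \<open>The support condition must be handed to \<open>q'\<close> for the induction; the
    set where \<open>q\<close> is known to vanish is open, so its derivative vanishes there
    too.\<close>
  have q'0: "q' i t = 0" if "i \<in> I" "t \<in> ?J" "\<bar>t\<bar> > h0" for i t
  proof -
    have "open (?J \<inter> {t. h0 < \<bar>t\<bar>})" by (intro open_Int oJ open_Collect_less continuous_intros)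
    then have "(q i has_real_derivative 0) (at t)"
      by (rule has_field_derivative_transform_within_open[OF DERIV_const[of 0]]) (use that q0 in auto)
    then show ?thesis using qd[OF that(1,2)] DERIV_unique by blast
  qed
  obtain C where C: "C \<ge> 0" "\<And>i \<mu>. i \<in> I \<Longrightarrow> \<mu> > 0 \<Longrightarrow>
      cmod (integral {-h..h} (\<lambda>t. q' i t *\<^sub>R cis (\<mu> * g i t))) \<le> C / \<mu> ^ N"
    using Suc.IH[OF q'U q'0] by blast
  have "cmod (integral {-h..h} (\<lambda>t. b i t *\<^sub>R cis (\<mu> * g i t))) \<le> C / \<mu> ^ Suc N"
    if i: "i \<in> I" and \<mu>: "\<mu> > 0" for i \<mu>
  proof -
    have "continuous_on ?J (b i)" "continuous_on ?J (g i)" "continuous_on ?J (q' i)"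
      using unif_Ck_0[OF Suc.prems(1)] g[of 0] unif_Ck_0[OF q'U] i by auto
    then have cont: "continuous_on {-h..h} (b i)" "continuous_on {-h..h} (g i)" "continuous_on {-h..h} (q' i)"
      using continuous_on_subset[OF _ sub] by blast+
    have i1: "(\<lambda>t. q' i t *\<^sub>R cis (\<mu> * g i t)) integrable_on {-h..h}"
      and i2: "(\<lambda>t. b i t *\<^sub>R cis (\<mu> * g i t)) integrable_on {-h..h}"
      using cont by (auto intro!: integrable_continuous_interval continuous_intros)
    let ?F = "\<lambda>t. q i t *\<^sub>R cis (\<mu> * g i t)"
    have F: "(?F has_vector_derivative q' i t *\<^sub>R cis (\<mu> * g i t) + (\<i> * complex_of_real \<mu>) * (b i t *\<^sub>R cis (\<mu> * g i t)))
        (at t within {-h..h})" if t: "t \<in> {-h..h}" for t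
    proof -
      have tJ: "t \<in> ?J" using t sub by blast
      have dg: "((\<lambda>t. \<mu> * g i t) has_derivative (\<lambda>s. s * (\<mu> * g' i t))) (at t within {-h..h})"
        using DERIV_cmult[OF gd[OF i tJ], of \<mu>] unfolding has_field_derivative_def
        by (rule has_derivative_at_withinI[THEN has_derivative_eq_rhs]) (auto simp: mult_ac)
      have dc: "((\<lambda>t. cis (\<mu> * g i t)) has_vector_derivative ((\<mu> * g' i t) *\<^sub>R (\<i> * cis (\<mu> * g i t)))) (at t within {-h..h})"
        unfolding has_vector_derivative_def using has_derivative_cis[OF dg] by (simp add: scaleR_scaleR)
      have dq: "(q i has_real_derivative q' i t) (at t within {-h..h})"
        using qd[OF i tJ] by (rule has_field_derivative_at_within)
      have "b i t = q i t * g' i t" unfolding q_def using g'ne[OF i tJ] by simp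
      then have "q i t *\<^sub>R ((\<mu> * g' i t) *\<^sub>R (\<i> * cis (\<mu> * g i t))) + q' i t *\<^sub>R cis (\<mu> * g i t)
         = q' i t *\<^sub>R cis (\<mu> * g i t) + (\<i> * complex_of_real \<mu>) * (b i t *\<^sub>R cis (\<mu> * g i t))"
        by (simp add: scaleR_conv_of_real mult_ac)
      then show ?thesis using has_vector_derivative_scaleR[OF dq dc] by (simp add: add.commute)
    qed
    have "((\<lambda>t. q' i t *\<^sub>R cis (\<mu> * g i t) + (\<i> * complex_of_real \<mu>) * (b i t *\<^sub>R cis (\<mu> * g i t))) has_integral ?F h - ?F (-h)) {-h..h}"
      by (rule fundamental_theorem_of_calculus) (use h F in auto)
    \<comment> \<open>The endpoints lie outside the support because \<open>h0 < h\<close>, and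
      \<open>h < H\<close> makes two-sided derivatives available up to them.\<close>
    moreover have "?F h = 0" "?F (-h) = 0" using q0[OF i, of h] q0[OF i, of "-h"] h by auto
    ultimately have "integral {-h..h} (\<lambda>t. q' i t *\<^sub>R cis (\<mu> * g i t) + (\<i> * complex_of_real \<mu>) * (b i t *\<^sub>R cis (\<mu> * g i t))) = 0"
      by (simp add: integral_unique)
    moreover have "integral {-h..h} (\<lambda>t. q' i t *\<^sub>R cis (\<mu> * g i t) + (\<i> * complex_of_real \<mu>) * (b i t *\<^sub>R cis (\<mu> * g i t)))
        = integral {-h..h} (\<lambda>t. q' i t *\<^sub>R cis (\<mu> * g i t)) + (\<i> * complex_of_real \<mu>) * integral {-h..h} (\<lambda>t. b i t *\<^sub>R cis (\<mu> * g i t))"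
      using Henstock_Kurzweil_Integration.integral_add[OF i1 integrable_on_mult_right[OF i2, of "\<i> * complex_of_real \<mu>"]]
      unfolding integral_mult_right .
    ultimately have "(\<i> * complex_of_real \<mu>) * integral {-h..h} (\<lambda>t. b i t *\<^sub>R cis (\<mu> * g i t))
        = - integral {-h..h} (\<lambda>t. q' i t *\<^sub>R cis (\<mu> * g i t))"
      by (simp add: add_eq_0_iff)
    then have "cmod ((\<i> * complex_of_real \<mu>) * integral {-h..h} (\<lambda>t. b i t *\<^sub>R cis (\<mu> * g i t)))
        = cmod (integral {-h..h} (\<lambda>t. q' i t *\<^sub>R cis (\<mu> * g i t)))"
      by simp
    then have "\<mu> * cmod (integral {-h..h} (\<lambda>t. b i t *\<^sub>R cis (\<mu> * g i t))) \<le> C / \<mu> ^ N"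
      using C(2)[OF i \<mu>] \<mu> by (simp add: norm_mult)
    then show ?thesis using \<mu> by (simp add: field_simps)
  qed
  then show ?case using C(1) by blast
qed

text \<open>The direction \<open>e i\<close> varies with the index, so the derivative is written in
  the basis: the coefficients are bounded, and the \<open>dderiv F b\<close> are finitely many fixed
  smooth functions to which the induction hypothesis applies.\<close>

lemma unif_Ck_line:
  fixes F :: "'a::euclidean_space \<Rightarrow> real"
  assumes V: "open V" "cball x0 \<rho> \<subseteq> V" and F: "smooth_on V F"
    and e: "\<And>i. i \<in> I \<Longrightarrow> norm (e i) \<le> 1"
    and mem: "\<And>i t. i \<in> I \<Longrightarrow> t \<in> J \<Longrightarrow> p i + t *\<^sub>R e i \<in> cball x0 \<rho>"
  shows "unif_Ck k I J (\<lambda>i t. F (p i + t *\<^sub>R e i))"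
  using F
proof (induction k arbitrary: F)
  case 0
  have c: "continuous_on (cball x0 \<rho>) F"
    using continuous_on_subset[OF smooth_on_continuous_on[OF 0] V(2)] .
  obtain B where "\<And>x. x \<in> cball x0 \<rho> \<Longrightarrow> norm (F x) \<le> B"
    using continuous_on_cball_bounded[OF c] by blast
  then have "\<forall>i\<in>I. \<forall>t\<in>J. \<bar>F (p i + t *\<^sub>R e i)\<bar> \<le> B" using mem by simp
  moreover have "continuous_on J (\<lambda>t. F (p i + t *\<^sub>R e i))" if "i \<in> I" for i
    by (rule continuous_on_compose2[OF c]) (use mem that in \<open>auto intro!: continuous_intros\<close>)
  ultimately show ?case by auto
next
  case (Suc k)
  from unif_Ck_0[OF Suc.IH[OF Suc.prems]] obtain C where C: "\<forall>i\<in>I. \<forall>t\<in>J. \<bar>F (p i + t *\<^sub>R e i)\<bar> \<le> C" by auto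
  show ?case
  proof (rule unif_Ck_SucI[where f' = "\<lambda>i t. \<Sum>b\<in>Basis. (e i \<bullet> b) * dderiv F b (p i + t *\<^sub>R e i)" and C = C])
    fix i t assume it: "i \<in> I" "t \<in> J"
    have yV: "p i + t *\<^sub>R e i \<in> V" using mem[OF it] V(2) by blast
    have "((\<lambda>t. F (p i + t *\<^sub>R e i)) has_real_derivative dderiv F (e i) (p i + t *\<^sub>R e i)) (at t)"
      using smooth_on_line[OF V(1) Suc.prems yV, of UNIV]
      by (simp add: has_real_derivative_iff_has_vector_derivative)
    then show "((\<lambda>t. F (p i + t *\<^sub>R e i)) has_real_derivative (\<Sum>b\<in>Basis. (e i \<bullet> b) * dderiv F b (p i + t *\<^sub>R e i))) (at t)"
      using dderiv_eq_sum_Basis[OF V(1) Suc.prems yV, of "e i"] by simp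
  next
    show "unif_Ck k I J (\<lambda>i t. \<Sum>b\<in>Basis. (e i \<bullet> b) * dderiv F b (p i + t *\<^sub>R e i))"
    proof (intro unif_Ck_sum unif_Ck_cmult[where C = 1] Suc.IH smooth_on_dderiv V(1) Suc.prems finite_Basis)
      fix b i assume "b \<in> (Basis :: 'a set)" "i \<in> I"
      then show "\<bar>e i \<bullet> b\<bar> \<le> 1" using order_trans[OF Basis_le_norm e] by blast
    qed
  qed (use C in blast)
qed

text \<open>Differentiation along the line commutes with the difference quotient, and every
  derivative of \<open>F\<close> is Lipschitz on the ball; the bounds thus survive division by
  \<open>norm (w i)\<close>, however small the shift.\<close>

lemma unif_Ck_diff_line:
  fixes F :: "'a::euclidean_space \<Rightarrow> real"
  assumes V: "open V" "cball x0 \<rho> \<subseteq> V" and F: "smooth_on V F"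
    and e: "\<And>i. i \<in> I \<Longrightarrow> norm (e i) \<le> 1"
    and mem: "\<And>i t. i \<in> I \<Longrightarrow> t \<in> J \<Longrightarrow> p i + t *\<^sub>R e i \<in> cball x0 \<rho>"
    and mem': "\<And>i t. i \<in> I \<Longrightarrow> t \<in> J \<Longrightarrow> p i + w i + t *\<^sub>R e i \<in> cball x0 \<rho>"
    and w: "\<And>i. i \<in> I \<Longrightarrow> w i \<noteq> 0"
  shows "unif_Ck k I J (\<lambda>i t. (F (p i + t *\<^sub>R e i) - F (p i + w i + t *\<^sub>R e i)) / norm (w i))"
  using F
proof (induction k arbitrary: F)
  case 0
  obtain L where L: "L > 0" "\<And>x y. x \<in> cball x0 \<rho> \<Longrightarrow> y \<in> cball x0 \<rho> \<Longrightarrow> norm (F x - F y) \<le> L * norm (x - y)"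
    using smooth_on_Lipschitz[OF V(1) 0 V(2)] by blast
  have c: "continuous_on (cball x0 \<rho>) F"
    using continuous_on_subset[OF smooth_on_continuous_on[OF 0] V(2)] .
  have "\<bar>(F (p i + t *\<^sub>R e i) - F (p i + w i + t *\<^sub>R e i)) / norm (w i)\<bar> \<le> L" if it: "i \<in> I" "t \<in> J" for i t
  proof -
    have "\<bar>F (p i + t *\<^sub>R e i) - F (p i + w i + t *\<^sub>R e i)\<bar> \<le> L * norm (w i)"
      using L(2)[OF mem[OF it] mem'[OF it]] by simp
    then show ?thesis using w[OF it(1)] by (simp add: abs_divide pos_divide_le_eq)
  qed
  moreover have "continuous_on J (\<lambda>t. (F (p i + t *\<^sub>R e i) - F (p i + w i + t *\<^sub>R e i)) / norm (w i))" if i: "i \<in> I" for i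
  proof -
    have "continuous_on J (\<lambda>t. F (p i + t *\<^sub>R e i))"
      by (rule continuous_on_compose2[OF c]) (use mem i in \<open>auto intro!: continuous_intros\<close>)
    moreover have "continuous_on J (\<lambda>t. F (p i + w i + t *\<^sub>R e i))"
      by (rule continuous_on_compose2[OF c]) (use mem' i in \<open>auto intro!: continuous_intros\<close>)
    ultimately show ?thesis using w[OF i] by (intro continuous_intros) auto
  qed
  ultimately show ?case by auto
next
  case (Suc k)
  from unif_Ck_0[OF Suc.IH[OF Suc.prems]] obtain C where
    C: "\<forall>i\<in>I. \<forall>t\<in>J. \<bar>(F (p i + t *\<^sub>R e i) - F (p i + w i + t *\<^sub>R e i)) / norm (w i)\<bar> \<le> C" by auto
  let ?f' = "\<lambda>i t. \<Sum>b\<in>Basis. (e i \<bullet> b) * ((dderiv F b (p i + t *\<^sub>R e i) - dderiv F b (p i + w i + t *\<^sub>R e i)) / norm (w i))"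
  show ?case
  proof (rule unif_Ck_SucI[where f' = ?f' and C = C])
    fix i t assume it: "i \<in> I" "t \<in> J"
    have yV: "p i + t *\<^sub>R e i \<in> V" "p i + w i + t *\<^sub>R e i \<in> V" using mem[OF it] mem'[OF it] V(2) by blast+
    have d: "((\<lambda>t. F (q + t *\<^sub>R e i)) has_real_derivative dderiv F (e i) (q + t *\<^sub>R e i)) (at t)"
      if "q + t *\<^sub>R e i \<in> V" for q
      using smooth_on_line[OF V(1) Suc.prems that, of UNIV]
      by (simp add: has_real_derivative_iff_has_vector_derivative)
    have "((\<lambda>t. (F (p i + t *\<^sub>R e i) - F (p i + w i + t *\<^sub>R e i)) / norm (w i)) has_real_derivative
        (dderiv F (e i) (p i + t *\<^sub>R e i) - dderiv F (e i) (p i + w i + t *\<^sub>R e i)) / norm (w i)) (at t)"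
      by (intro DERIV_cdivide DERIV_diff d yV)
    also have "(dderiv F (e i) (p i + t *\<^sub>R e i) - dderiv F (e i) (p i + w i + t *\<^sub>R e i)) / norm (w i) = ?f' i t"
      unfolding dderiv_eq_sum_Basis[OF V(1) Suc.prems yV(1), of "e i"] dderiv_eq_sum_Basis[OF V(1) Suc.prems yV(2), of "e i"]
      by (simp add: sum_subtractf[symmetric] sum_divide_distrib right_diff_distrib)
    finally show "((\<lambda>t. (F (p i + t *\<^sub>R e i) - F (p i + w i + t *\<^sub>R e i)) / norm (w i)) has_real_derivative ?f' i t) (at t)" .
  next
    show "unif_Ck k I J ?f'"
    proof (intro unif_Ck_sum unif_Ck_cmult[where C = 1] Suc.IH smooth_on_dderiv V(1) Suc.prems finite_Basis)
      fix b i assume "b \<in> (Basis :: 'a set)" "i \<in> I"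
      then show "\<bar>e i \<bullet> b\<bar> \<le> 1" using order_trans[OF Basis_le_norm e] by blast
    qed
  qed (use C in blast)
qed

section \<open>Bump functions and reductions by Fubini's theorem\<close>

text \<open>A bump of finite smoothness; the exponent is matched later to the number of integrations
  by parts.\<close>

definition bump :: "nat \<Rightarrow> real \<Rightarrow> 'a::euclidean_space \<Rightarrow> real" where
  "bump n r x = (max 0 (1 - (norm x / r)\<^sup>2)) ^ Suc n"

lemma bump_bounds: "0 \<le> bump n r x" "bump n r x \<le> 1"
  unfolding bump_def by (auto simp del: power_Suc intro!: power_le_one zero_le_power)

lemma bump_outside: "r > 0 \<Longrightarrow> norm x \<ge> r \<Longrightarrow> bump n r x = 0"
proof -
  assume "r > 0" "norm x \<ge> r"
  then have "1 \<le> (norm x / r)\<^sup>2" by simp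
  then show ?thesis unfolding bump_def by (simp add: max_def)
qed

lemma bump_pos: "r > 0 \<Longrightarrow> norm x < r \<Longrightarrow> bump n r x > 0"
proof -
  assume "r > 0" "norm x < r"
  then have "(norm x / r)\<^sup>2 < 1" by (simp add: power_less_one_iff abs_square_less_1)
  then show ?thesis unfolding bump_def by simp
qed

lemma continuous_bump: "continuous_on S (\<lambda>x. bump n r (f x))" if "continuous_on S f"
  unfolding bump_def divide_inverse by (intro continuous_intros that)

lemma bump_measurable[measurable]: "bump n r \<in> borel_measurable borel"
  by (intro borel_measurable_continuous_onI continuous_bump continuous_on_id)

text \<open>Along a line the expression inside the positive part is a quadratic polynomial in
  \<open>t\<close> with bounded coefficients.\<close>

lemma unif_Ck_bump_line:
  fixes p e :: "'i \<Rightarrow> 'a::euclidean_space"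
  assumes "bounded J" "r > 0" "\<And>i. i \<in> I \<Longrightarrow> norm (e i) \<le> 1" "\<And>i. i \<in> I \<Longrightarrow> norm (p i) \<le> C"
  shows "unif_Ck n I J (\<lambda>i t. bump n r (p i + t *\<^sub>R e i))"
proof -
  have eq: "1 - (norm (p i + t *\<^sub>R e i) / r)\<^sup>2 = (1 - (p i \<bullet> p i) / r\<^sup>2) + ((- 2 * (p i \<bullet> e i) / r\<^sup>2) * t + (- (e i \<bullet> e i) / r\<^sup>2) * (t * t))" for i t
    unfolding power_divide power2_norm_eq_inner
    by (simp add: inner_add_left inner_add_right inner_commute power2_eq_square add_divide_distrib diff_divide_distrib algebra_simps)
  have pp: "\<bar>p i \<bullet> p i\<bar> \<le> C * C" if "i \<in> I" for i
    using assms(4)[OF that] Cauchy_Schwarz_ineq2[of "p i" "p i"] mult_mono[of "norm (p i)" C "norm (p i)" C] norm_ge_zero[of "p i"]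
    by linarith
  have pe: "\<bar>p i \<bullet> e i\<bar> \<le> C" if "i \<in> I" for i
    using assms(3,4)[OF that] Cauchy_Schwarz_ineq2[of "p i" "e i"] mult_mono[of "norm (p i)" C "norm (e i)" 1] norm_ge_zero[of "p i"] norm_ge_zero[of "e i"]
    by linarith
  have ee: "\<bar>e i \<bullet> e i\<bar> \<le> 1" if "i \<in> I" for i
    using assms(3)[OF that] Cauchy_Schwarz_ineq2[of "e i" "e i"] mult_mono[of "norm (e i)" 1 "norm (e i)" 1] norm_ge_zero[of "e i"]
    by linarith
  have "unif_Ck k I J (\<lambda>i t. 1 - (norm (p i + t *\<^sub>R e i) / r)\<^sup>2)" for k
    unfolding eq
  proof (intro unif_Ck_add unif_Ck_cmult unif_Ck_mult unif_Ck_id assms(1))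
    show "unif_Ck k I J (\<lambda>i t. 1 - (p i \<bullet> p i) / r\<^sup>2)"
    proof (rule unif_Ck_const)
      fix i assume i: "i \<in> I"
      have "\<bar>1 - (p i \<bullet> p i) / r\<^sup>2\<bar> \<le> 1 + \<bar>p i \<bullet> p i\<bar> / r\<^sup>2"
        using abs_triangle_ineq4[of 1 "(p i \<bullet> p i) / r\<^sup>2"] unfolding abs_divide by simp
      also have "\<dots> \<le> 1 + C * C / r\<^sup>2" using pp[OF i] by (intro add_left_mono divide_right_mono) auto
      finally show "\<bar>1 - (p i \<bullet> p i) / r\<^sup>2\<bar> \<le> 1 + C * C / r\<^sup>2" .
    qed
    fix i assume i: "i \<in> I"
    show "\<bar>- 2 * (p i \<bullet> e i) / r\<^sup>2\<bar> \<le> 2 * C / r\<^sup>2"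
      using pe[OF i] by (simp add: abs_divide abs_mult divide_right_mono)
    show "\<bar>- (e i \<bullet> e i) / r\<^sup>2\<bar> \<le> 1 / r\<^sup>2"
      using ee[OF i] by (simp add: abs_divide divide_right_mono)
  qed
  from unif_Ck_pos_part_power[OF this] show ?thesis unfolding bump_def .
qed

lemma lborel_integral_translate:
  fixes f :: "'a::euclidean_space \<Rightarrow> 'b::{banach, second_countable_topology}"
  assumes "f \<in> borel_measurable borel"
  shows "(\<integral>x. f (c + x) \<partial>lborel) = (\<integral>x. f x \<partial>lborel)"
proof -
  have "(\<integral>x. f x \<partial>lborel) = (\<integral>x. f x \<partial>(distr lborel borel ((+) c)))" by (simp add: lborel_distr_plus)
  also have "\<dots> = (\<integral>x. f (c + x) \<partial>lborel)" using assms by (subst integral_distr) auto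
  finally show ?thesis by simp
qed

text \<open>By translation invariance the integral of \<open>K\<close> equals that of each translate
  along \<open>e\<close>; averaging these with weight \<open>\<eta>\<close> and exchanging the
  integrals leaves integrals over lines. Since \<open>K\<close> and \<open>\<eta>\<close> vanish
  beyond distance \<open>r\<close>, only base points in the ball of radius \<open>2 * r\<close>
  matter.\<close>

lemma average_along_line:
  fixes K :: "'a::euclidean_space \<Rightarrow> complex" and \<eta> :: "real \<Rightarrow> real"
  assumes Km[measurable]: "K \<in> borel_measurable borel" and K1: "\<And>x. cmod (K x) \<le> 1"
    and Ks: "\<And>x. norm (x - x0) \<ge> r \<Longrightarrow> K x = 0" and r: "r > 0"
    and \<eta>m[measurable]: "\<eta> \<in> borel_measurable borel" and \<eta>1: "\<And>t. 0 \<le> \<eta> t" "\<And>t. \<eta> t \<le> 1"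
    and \<eta>s: "\<And>t. \<bar>t\<bar> \<ge> r \<Longrightarrow> \<eta> t = 0" and e: "norm e = 1"
    and B: "\<And>x. x \<in> cball x0 (2 * r) \<Longrightarrow> cmod (\<integral>t. \<eta> t *\<^sub>R K (x + t *\<^sub>R e) \<partial>lborel) \<le> B"
  shows "(\<integral>t. \<eta> t \<partial>lborel) * cmod (\<integral>x. K x \<partial>lborel) \<le> B * measure lborel (cball x0 (2 * r))"
proof -
  define h where "h t x = \<eta> t *\<^sub>R K (x + t *\<^sub>R e)" for t x
  define A where "A = {-r..r} \<times> cball x0 (2 * r)"
  have hA: "h t x = 0" if "(t, x) \<notin> A" for t x
  proof (cases "\<bar>t\<bar> \<ge> r")
    case False
    then have "norm (x - x0) > 2 * r" using that unfolding A_def by (auto simp: dist_norm norm_minus_commute)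
    moreover have "norm (x - x0) \<le> norm (x + t *\<^sub>R e - x0) + norm (t *\<^sub>R e)"
      using norm_triangle_ineq4[of "x + t *\<^sub>R e - x0" "t *\<^sub>R e"] by (simp add: algebra_simps)
    ultimately have "norm (x + t *\<^sub>R e - x0) \<ge> r" using False e by simp
    then show ?thesis unfolding h_def using Ks by simp
  qed (simp add: h_def \<eta>s)
  have h1: "cmod (h t x) \<le> 1" for t x
    unfolding h_def using \<eta>1 K1 by (simp add: mult_le_one)
  have int: "integrable (lborel \<Otimes>\<^sub>M lborel) (\<lambda>(t, x). h t x)"
  proof (rule integrableI_bounded_set[where A = A and B = 1])
    have "compact A" unfolding A_def by (intro compact_Times) auto
    then show "emeasure (lborel \<Otimes>\<^sub>M lborel) A < \<infinity>" unfolding lborel_prod by (rule emeasure_compact_finite)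
    show "A \<in> sets (lborel \<Otimes>\<^sub>M lborel)" unfolding A_def by measurable
    show "(\<lambda>(t, x). h t x) \<in> borel_measurable (lborel \<Otimes>\<^sub>M lborel)"
      unfolding h_def by measurable
  qed (use hA h1 in auto)
  have "(\<integral>t. \<eta> t \<partial>lborel) * cmod (\<integral>x. K x \<partial>lborel) = cmod (complex_of_real (\<integral>t. \<eta> t \<partial>lborel) * (\<integral>x. K x \<partial>lborel))"
    using \<eta>1 by (simp add: norm_mult)
  also have "complex_of_real (\<integral>t. \<eta> t \<partial>lborel) * (\<integral>x. K x \<partial>lborel) = (\<integral>t. \<eta> t *\<^sub>R (\<integral>x. K x \<partial>lborel) \<partial>lborel)"
    by (simp add: scaleR_conv_of_real flip: integral_of_real)
  also have "\<dots> = (\<integral>t. (\<integral>x. h t x \<partial>lborel) \<partial>lborel)"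
  proof (rule Bochner_Integration.integral_cong[OF refl])
    fix t
    have "(\<integral>x. K x \<partial>lborel) = (\<integral>x. K (t *\<^sub>R e + x) \<partial>lborel)" by (rule lborel_integral_translate[OF Km, symmetric])
    then show "\<eta> t *\<^sub>R (\<integral>x. K x \<partial>lborel) = (\<integral>x. h t x \<partial>lborel)"
      unfolding h_def by (simp add: add.commute)
  qed
  also have "\<dots> = (\<integral>x. (\<integral>t. h t x \<partial>lborel) \<partial>lborel)"
    using lborel_pair.Fubini_integral[OF int] by simp
  also have "cmod \<dots> \<le> (\<integral>x. cmod (\<integral>t. h t x \<partial>lborel) \<partial>lborel)" by (rule integral_norm_bound)
  also have "\<dots> \<le> (\<integral>x. B * indicator (cball x0 (2 * r)) x \<partial>lborel)"
  proof (rule integral_mono)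
    show "integrable lborel (\<lambda>x. cmod (\<integral>t. h t x \<partial>lborel))"
      using lborel_pair.integrable_snd[OF int] by (intro integrable_norm) simp
    show "integrable lborel (\<lambda>x. B * indicator (cball x0 (2 * r)) x)"
      using emeasure_lborel_cball_finite[of x0 "2 * r"] by (intro integrable_mult_right integrable_real_indicator) auto
    fix x
    show "cmod (\<integral>t. h t x \<partial>lborel) \<le> B * indicator (cball x0 (2 * r)) x"
    proof (cases "x \<in> cball x0 (2 * r)")
      case False
      then have "h t x = 0" for t using hA[of t x] unfolding A_def by auto
      then show ?thesis using False by simp
    qed (use B in \<open>simp add: h_def\<close>)
  qed
  also have "\<dots> = B * measure lborel (cball x0 (2 * r))" by simp
  finally show ?thesis .
qed

text \<open>The squared modulus of the integral is an integral over all pairs \<open>x\<close>,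
  \<open>x + u\<close>. A majorant \<open>E\<close> with values in \<open>ennreal\<close> spares an
  integrability argument.\<close>

lemma square_integral_le_correlation:
  fixes K :: "'a::euclidean_space \<Rightarrow> complex" and E :: "'a \<Rightarrow> ennreal"
  assumes Km[measurable]: "K \<in> borel_measurable borel" and K1: "\<And>x. cmod (K x) \<le> 1"
    and Ks: "\<And>x. norm (x - x0) \<ge> r \<Longrightarrow> K x = 0"
    and E: "\<And>u. ennreal (cmod (\<integral>x. K x * cnj (K (x + u)) \<partial>lborel)) \<le> E u"
  shows "ennreal ((cmod (\<integral>x. K x \<partial>lborel))\<^sup>2) \<le> (\<integral>\<^sup>+u. E u \<partial>lborel)"
proof -
  define h where "h x u = K x * cnj (K (x + u))" for x u
  define A where "A = cball x0 r \<times> cball (0::'a) (2 * r)"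
  have [measurable]: "cnj \<in> borel_measurable borel"
    by (intro borel_measurable_continuous_onI continuous_intros)
  have hA: "h x u = 0" if "(x, u) \<notin> A" for x u
  proof (cases "norm (x - x0) \<ge> r")
    case False
    then have "norm u > 2 * r" using that unfolding A_def by (auto simp: dist_norm norm_minus_commute)
    moreover have "norm u \<le> norm (x + u - x0) + norm (x - x0)"
      using norm_triangle_ineq4[of "x + u - x0" "x - x0"] by simp
    ultimately have "norm (x + u - x0) \<ge> r" using False by simp
    then show ?thesis unfolding h_def using Ks by simp
  qed (simp add: h_def Ks)
  have h1: "cmod (h x u) \<le> 1" for x u unfolding h_def using K1 by (simp add: norm_mult mult_le_one)
  have int: "integrable (lborel \<Otimes>\<^sub>M lborel) (\<lambda>(x, u). h x u)"
  proof (rule integrableI_bounded_set[where A = A and B = 1])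
    have "compact A" unfolding A_def by (intro compact_Times) auto
    then show "emeasure (lborel \<Otimes>\<^sub>M lborel) A < \<infinity>" unfolding lborel_prod by (rule emeasure_compact_finite)
    show "A \<in> sets (lborel \<Otimes>\<^sub>M lborel)" unfolding A_def by measurable
    show "(\<lambda>(x, u). h x u) \<in> borel_measurable (lborel \<Otimes>\<^sub>M lborel)"
      unfolding h_def by measurable
  qed (use hA h1 in auto)
  define Z where "Z = (\<integral>x. K x \<partial>lborel)"
  have "(\<integral>u. h x u \<partial>lborel) = K x * cnj Z" for x
  proof -
    have "(\<integral>u. h x u \<partial>lborel) = K x * (\<integral>u. cnj (K (x + u)) \<partial>lborel)" unfolding h_def by simp
    also have "(\<integral>u. cnj (K (x + u)) \<partial>lborel) = cnj (\<integral>u. K (x + u) \<partial>lborel)" by (rule Bochner_Integration.integral_cnj)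
    also have "(\<integral>u. K (x + u) \<partial>lborel) = Z" unfolding Z_def by (rule lborel_integral_translate[OF Km])
    finally show ?thesis .
  qed
  then have "(\<integral>x. (\<integral>u. h x u \<partial>lborel) \<partial>lborel) = Z * cnj Z" by (simp add: Z_def)
  then have "(cmod Z)\<^sup>2 = cmod (\<integral>x. (\<integral>u. h x u \<partial>lborel) \<partial>lborel)"
    by (simp add: norm_mult power2_eq_square)
  also have "(\<integral>x. (\<integral>u. h x u \<partial>lborel) \<partial>lborel) = (\<integral>u. (\<integral>x. h x u \<partial>lborel) \<partial>lborel)"
    using lborel_pair.Fubini_integral[OF int] by simp
  finally have "ennreal ((cmod Z)\<^sup>2) = ennreal (cmod (\<integral>u. (\<integral>x. h x u \<partial>lborel) \<partial>lborel))" by simp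
  also have "\<dots> \<le> (\<integral>\<^sup>+u. ennreal (cmod (\<integral>x. h x u \<partial>lborel)) \<partial>lborel)"
    using lborel_pair.integrable_snd[OF int] by (intro integral_norm_bound_ennreal) simp
  also have "\<dots> \<le> (\<integral>\<^sup>+u. E u \<partial>lborel)" by (intro nn_integral_mono) (use E in \<open>simp add: h_def\<close>)
  finally show ?thesis unfolding Z_def .
qed

text \<open>A product weight stands in for a radial one, so that the integral factors into
  arctangents in the \<open>D\<close> coordinates and lengths \<open>2 * \<rho>\<close> in the
  others. The factor \<open>(1 / l) ^ card D\<close> is the origin of the decay exponent.\<close>

lemma nn_integral_prod_Cauchy_le:
  fixes D :: "'a::euclidean_space set"
  assumes D: "D \<subseteq> Basis" and l: "l > 0" and \<rho>: "\<rho> > 0"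
  shows "(\<integral>\<^sup>+u. ennreal (if \<forall>b\<in>Basis. \<bar>u \<bullet> b\<bar> \<le> \<rho> then \<Prod>b\<in>D. 2 / (1 + (l * (u \<bullet> b))\<^sup>2) else 0) \<partial>lborel)
    \<le> ennreal ((2 * pi / l) ^ card D * (2 * \<rho>) ^ (DIM('a) - card D))"
proof -
  define f :: "'a \<Rightarrow> real \<Rightarrow> ennreal" where
    "f b t = ennreal (if b \<in> D then 2 / (1 + (l * t)\<^sup>2) else 1) * indicator {-\<rho>..\<rho>} t" for b t
  have fD: "finite D" using D finite_Basis finite_subset by blast
  have eq: "ennreal (if \<forall>b\<in>Basis. \<bar>u \<bullet> b\<bar> \<le> \<rho> then \<Prod>b\<in>D. 2 / (1 + (l * (u \<bullet> b))\<^sup>2) else 0) = (\<Prod>b\<in>Basis. f b (u \<bullet> b))" for u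
  proof (cases "\<forall>b\<in>Basis. \<bar>u \<bullet> b\<bar> \<le> \<rho>")
    case True
    have "(\<Prod>b\<in>Basis. f b (u \<bullet> b)) = (\<Prod>b\<in>Basis. ennreal (if b \<in> D then 2 / (1 + (l * (u \<bullet> b))\<^sup>2) else 1))"
      by (rule prod.cong) (use True in \<open>auto simp: f_def indicator_def abs_le_iff\<close>)
    also have "\<dots> = ennreal (\<Prod>b\<in>Basis. if b \<in> D then 2 / (1 + (l * (u \<bullet> b))\<^sup>2) else 1)"
      by (rule prod_ennreal) auto
    also have "(\<Prod>b\<in>Basis. if b \<in> D then 2 / (1 + (l * (u \<bullet> b))\<^sup>2) else 1) = (\<Prod>b\<in>D. 2 / (1 + (l * (u \<bullet> b))\<^sup>2))"
      using D by (simp add: prod.If_cases Int_absorb1)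
    finally show ?thesis using True by simp
  next
    case False
    then obtain b where b: "b \<in> Basis" "\<not> \<bar>u \<bullet> b\<bar> \<le> \<rho>" by blast
    then have "f b (u \<bullet> b) = 0" by (auto simp: f_def indicator_def abs_le_iff)
    then have 0: "(\<Prod>b\<in>Basis. f b (u \<bullet> b)) = 0" using b(1) by (intro prod_zero) auto
    show ?thesis unfolding 0 if_not_P[OF False] by simp
  qed
  have fm: "f b \<in> borel_measurable borel" for b unfolding f_def by measurable
  have "(\<integral>\<^sup>+u. (\<Prod>b\<in>Basis. f b (u \<bullet> b)) \<partial>lborel) = (\<Prod>b\<in>(Basis::'a set). \<integral>\<^sup>+t. f b t \<partial>lborel)"
    by (rule nn_integral_lborel_prod) (use fm in auto)
  also have "\<dots> \<le> (\<Prod>b\<in>(Basis::'a set). ennreal (if b \<in> D then 2 * pi / l else 2 * \<rho>))"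
  proof (rule prod_mono_ennreal)
    fix b :: 'a
    show "(\<integral>\<^sup>+t. f b t \<partial>lborel) \<le> ennreal (if b \<in> D then 2 * pi / l else 2 * \<rho>)"
    proof (cases "b \<in> D")
      case True
      have "(\<integral>\<^sup>+t. ennreal (2 / (1 + (l * t)\<^sup>2)) * indicator {-\<rho>..\<rho>} t \<partial>lborel)
          = ennreal (2 * arctan (l * \<rho>) / l - 2 * arctan (l * (-\<rho>)) / l)"
      proof (rule nn_integral_FTC_Icc)
        have pos: "1 + (l * x)\<^sup>2 > 0" for x by (simp add: add_pos_nonneg)
        fix x assume "x \<in> {-\<rho>..\<rho>}"
        show "((\<lambda>x. 2 * arctan (l * x) / l) has_real_derivative 2 / (1 + (l * x)\<^sup>2)) (at x)"
        proof -
          have "((\<lambda>x. l * x) has_real_derivative l) (at x)"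
            using DERIV_cmult[OF DERIV_ident, of l] by simp
          from DERIV_chain2[OF DERIV_arctan this]
          have "((\<lambda>x. arctan (l * x)) has_real_derivative inverse (1 + (l * x)\<^sup>2) * l) (at x)" .
          from DERIV_cdivide[OF DERIV_cmult[OF this, of 2], of l]
          show ?thesis using l by (simp add: divide_inverse mult.assoc)
        qed
      qed (use \<rho> in auto)
      also have "\<dots> \<le> ennreal (2 * pi / l)"
      proof (rule ennreal_leI)
        have "2 * arctan (l * \<rho>) \<le> pi" "- pi \<le> 2 * arctan (l * (-\<rho>))"
          using arctan_ubound[of "l * \<rho>"] arctan_lbound[of "l * (-\<rho>)"] by linarith+
        then have "(2 * arctan (l * \<rho>) - 2 * arctan (l * (-\<rho>))) / l \<le> 2 * pi / l"
          using l by (intro divide_right_mono) auto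
        then show "2 * arctan (l * \<rho>) / l - 2 * arctan (l * (-\<rho>)) / l \<le> 2 * pi / l"
          by (simp only: diff_divide_distrib)
      qed
      finally show ?thesis using True by (simp add: f_def)
    next
      case False
      then have "(\<integral>\<^sup>+t. f b t \<partial>lborel) = ennreal (2 * \<rho>)" using \<rho> by (simp add: f_def)
      then show ?thesis using False by simp
    qed
  qed
  also have "\<dots> = ennreal (\<Prod>b\<in>(Basis::'a set). if b \<in> D then 2 * pi / l else 2 * \<rho>)"
    using l \<rho> by (intro prod_ennreal) auto
  also have "(\<Prod>b\<in>(Basis::'a set). if b \<in> D then 2 * pi / l else 2 * \<rho>) = (2 * pi / l) ^ card D * (2 * \<rho>) ^ (DIM('a) - card D)"
  proof -
    have "Basis \<inter> - D = Basis - D" by auto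
    then show ?thesis using D card_Diff_subset[OF fD D] by (simp add: prod.If_cases Int_absorb1)
  qed
  finally show ?thesis unfolding eq .
qed


section \<open>Fourier decay at a nondegenerate point\<close>

lemma lborel_integral_eq_interval:
  fixes f :: "real \<Rightarrow> complex"
  assumes "continuous_on {a..b} f" "\<And>t. G t = indicator {a..b} t *\<^sub>R f t"
  shows "(\<integral>t. G t \<partial>lborel) = integral {a..b} f"
  using set_borel_integral_eq_integral(2)[OF borel_integrable_atLeastAtMost'[OF assms(1)]] assms(2)
  unfolding set_lebesgue_integral_def by simp

lemma scaleR_cis_mult_cnj: "(a *\<^sub>R cis s) * cnj (b *\<^sub>R cis t) = (a * b) *\<^sub>R cis (s - t)"
proof -
  have "cis s * cnj (cis t) = cis (s - t)" by (simp add: cis_cnj cis_mult)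
  then show ?thesis by (simp add: scaleR_conv_of_real mult_ac)
qed

lemma bump_integral_pos:
  assumes "r > 0"
  shows "(\<integral>t. bump n r (t::real) \<partial>lborel) > 0"
proof -
  have int: "integrable lborel (\<lambda>t::real. bump n r t)"
  proof (rule integrableI_bounded_set[where A = "{-r..r}" and B = 1])
    show "AE t in lborel. t \<in> {-r..r} \<longrightarrow> norm (bump n r (t::real)) \<le> 1"
      using bump_bounds[of n r "_ :: real"] by (intro AE_I2) (simp add: abs_of_nonneg)
    show "AE t in lborel. t \<notin> {-r..r} \<longrightarrow> bump n r (t::real) = 0"
      by (intro AE_I2 impI bump_outside[OF assms]) auto
  qed (use assms in auto)
  have "(3/4) ^ Suc n * r = (\<integral>t. (3/4) ^ Suc n * indicator {-(r/2)..r/2} t \<partial>lborel)" using assms by simp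
  also have "\<dots> \<le> (\<integral>t. bump n r (t::real) \<partial>lborel)"
  proof (rule integral_mono[OF _ int])
    show "integrable lborel (\<lambda>t. (3/4) ^ Suc n * indicat_real {-(r/2)..r/2} t)"
      by (intro integrable_mult_right integrable_real_indicator) (auto simp: emeasure_lborel_Icc_eq)
    fix t :: real
    show "(3/4) ^ Suc n * indicator {-(r/2)..r/2} t \<le> bump n r t"
    proof (cases "t \<in> {-(r/2)..r/2}")
      case True
      then have "\<bar>t / r\<bar> \<le> 1/2" using assms by (auto simp: abs_le_iff field_simps)
      then have "\<bar>t / r\<bar>\<^sup>2 \<le> (1/2)\<^sup>2" by (intro power_mono) auto
      moreover have "(norm t / r)\<^sup>2 = \<bar>t / r\<bar>\<^sup>2" using assms by (simp add: abs_divide)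
      ultimately have "3/4 \<le> 1 - (norm t / r)\<^sup>2" by (simp add: power_divide)
      then have "3/4 \<le> max 0 (1 - (norm t / r)\<^sup>2)" by (rule max.coboundedI2)
      then have "(3/4) ^ Suc n \<le> (max 0 (1 - (norm t / r)\<^sup>2)) ^ Suc n" by (rule power_mono) simp
      then show ?thesis using True unfolding bump_def by simp
    qed (use bump_bounds in auto)
  qed
  finally have "(3/4) ^ Suc n * r \<le> (\<integral>t. bump n r (t::real) \<partial>lborel)" .
  moreover have "0 < (3/4::real) ^ Suc n * r" by (intro mult_pos_pos zero_less_power assms) simp
  ultimately show ?thesis by (rule less_le_trans[rotated])
qed

context chart_ball begin

text \<open>On the compact set of pairs of a frequency direction and a unit parameter vector,
  gradient and Hessian never vanish together, so the sum of their norms is at least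
  \<open>2 * c\<close>. For a given \<open>\<omega>\<close> either the gradient has norm at least
  \<open>c\<close>, or the Hessian does so on all unit vectors at once. Choosing \<open>e\<close> as
  the normalised gradient or Hessian image turns a norm into a signed lower bound, which persists
  near \<open>x0\<close>.\<close>

lemma phase_dichotomy:
  assumes nondeg: "\<forall>\<zeta>. \<zeta> \<noteq> 0 \<longrightarrow> normal_at x0 \<zeta> \<longrightarrow>
      (\<forall>u\<in>span D. (\<forall>e\<in>span D. hess x0 \<zeta> u e = 0) \<longrightarrow> u = 0)"
  obtains c r0 where "c > 0" "r0 > 0" "r0 \<le> 2 * R"
    "\<And>\<omega>. norm \<omega> = 1 \<Longrightarrow>
       (\<exists>e\<in>span D. norm e = 1 \<and> (\<forall>y\<in>cball x0 r0. c \<le> \<omega> \<bullet> dderiv \<psi> e y)) \<or>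
       (\<forall>w\<in>span D. w \<noteq> 0 \<longrightarrow> (\<exists>e\<in>span D. norm e = 1 \<and>
          (\<forall>y\<in>cball x0 r0. c * norm w \<le> \<omega> \<bullet> dderiv (dderiv \<psi> e) w y)))"
proof -
  have x0V: "x0 \<in> V" using ball_V' R_pos by (auto simp: subset_eq)
  define A where "A e = dderiv \<psi> e x0" for e
  define Q where "Q e w = dderiv (dderiv \<psi> e) w x0" for e w
  have linA: "linear A" unfolding A_def using linear_dderiv[OF open_V smooth_psi x0V] .
  have bilQ: "bilinear Q" unfolding Q_def using bilinear_dderiv2[OF x0V] .
  have linQ: "linear (\<lambda>e. Q e w)" "linear (Q e)" for w e using bilQ unfolding bilinear_def by auto
  \<comment> \<open>The gradient of the height in the parameters at \<open>x0\<close>, and its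
    Hessian applied to \<open>u\<close>, as vectors of \<open>span D\<close>.\<close>
  define G1 where "G1 \<omega> = (\<Sum>b\<in>D. (\<omega> \<bullet> A b) *\<^sub>R b)" for \<omega>
  define G2 where "G2 \<omega> u = (\<Sum>b\<in>D. (\<omega> \<bullet> Q b u) *\<^sub>R b)" for \<omega> u
  have G1: "G1 \<omega> \<bullet> e = \<omega> \<bullet> A e" if "e \<in> span D" for \<omega> e
  proof -
    have "\<omega> \<bullet> A e = \<omega> \<bullet> A (proj e)" using proj_id[OF that] by simp
    also have "\<dots> = G1 \<omega> \<bullet> e"
      unfolding proj_def G1_def linear_sum[OF linA] linear_cmul[OF linA] inner_sum_right inner_sum_left
      by (simp add: inner_commute mult.commute)
    finally show ?thesis by simp
  qed
  have G2: "G2 \<omega> u \<bullet> e = \<omega> \<bullet> Q e u" if "e \<in> span D" for \<omega> u e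
  proof -
    have "\<omega> \<bullet> Q e u = \<omega> \<bullet> Q (proj e) u" using proj_id[OF that] by simp
    also have "\<dots> = G2 \<omega> u \<bullet> e"
      unfolding proj_def G2_def linear_sum[OF linQ(1)] linear_cmul[OF linQ(1)] inner_sum_right inner_sum_left
      by (simp add: inner_commute mult.commute)
    finally show ?thesis by simp
  qed
  have Gs: "G1 \<omega> \<in> span D" "G2 \<omega> u \<in> span D" for \<omega> u
    unfolding G1_def G2_def by (intro span_sum span_scale span_base; assumption)+
  define H where "H p = norm (G1 (fst p)) + norm (G2 (fst p) (snd p))" for p
  define X where "X = sphere (0::'a) 1 \<times> (span D \<inter> sphere 0 1)"
  have compX: "compact X" unfolding X_def by (intro compact_Times closed_Int_compact closed_span) auto
  have contH: "continuous_on X H"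
  proof -
    have "continuous_on X (\<lambda>p. Q b (snd p))" for b
      by (rule continuous_on_compose2[OF linear_continuous_on[OF linear_conv_bounded_linear[THEN iffD1, OF linQ(2)], of UNIV]])
        (auto intro!: continuous_intros)
    then show ?thesis unfolding H_def G1_def G2_def by (intro continuous_intros)
  qed
  have posH: "H p > 0" if p: "p \<in> X" for p
  proof (rule ccontr)
    assume "\<not> H p > 0"
    then have "H p = 0" unfolding H_def by (smt (verit) norm_ge_zero)
    then have g0: "G1 (fst p) = 0" "G2 (fst p) (snd p) = 0"
      unfolding H_def using norm_ge_zero[of "G1 (fst p)"] norm_ge_zero[of "G2 (fst p) (snd p)"]
      by (smt (verit) norm_eq_zero)+
    have pX: "norm (fst p) = 1" "snd p \<in> span D" "norm (snd p) = 1" using p unfolding X_def by auto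
    have "normal_at x0 (fst p)"
      unfolding normal_at_def using G1[of _ "fst p"] g0(1) by (simp add: A_def)
    moreover have "\<forall>e\<in>span D. hess x0 (fst p) (snd p) e = 0"
    proof
      fix e assume e: "e \<in> span D"
      have "Q (snd p) e = Q e (snd p)" unfolding Q_def by (rule dderiv2_symmetric[OF open_V smooth_psi x0V])
      then have "hess x0 (fst p) (snd p) e = fst p \<bullet> Q e (snd p)"
        unfolding hess_def Q_def by (simp add: inner_add_right)
      also have "\<dots> = 0" using G2[OF e, of "fst p" "snd p"] g0(2) by simp
      finally show "hess x0 (fst p) (snd p) e = 0" .
    qed
    moreover have "fst p \<noteq> 0" using pX(1) by auto
    ultimately have "snd p = 0" using nondeg pX(2) by blast
    then show False using pX(3) by simp
  qed
  obtain c where c: "c > 0" "\<And>p. p \<in> X \<Longrightarrow> 2 * c \<le> H p"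
  proof (cases "X = {}")
    \<comment> \<open>\<open>X\<close> is empty when \<open>span D\<close> contains no unit vector;
      any positive constant then serves.\<close>
    case True
    then show ?thesis using that[of 1] by simp
  next
    case False
    obtain q where q: "q \<in> X" "\<And>p. p \<in> X \<Longrightarrow> H q \<le> H p"
      using continuous_attains_inf[OF compX False contH] by blast
    show ?thesis by (rule that[of "H q / 2"]) (use posH[OF q(1)] q(2) in auto)
  qed
  obtain L1 where L1: "L1 > 0" "\<And>x y v. x \<in> cball x0 (2 * R) \<Longrightarrow> y \<in> cball x0 (2 * R) \<Longrightarrow>
       norm (dderiv \<psi> v x - dderiv \<psi> v y) \<le> L1 * norm (x - y) * norm v"
    using dderiv_Lipschitz[OF open_V smooth_psi ball_V'] by blast
  obtain L2 where L2: "L2 > 0" "\<And>x y u w. x \<in> cball x0 (2 * R) \<Longrightarrow> y \<in> cball x0 (2 * R) \<Longrightarrow>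
       norm (dderiv (dderiv \<psi> u) w x - dderiv (dderiv \<psi> u) w y) \<le> L2 * norm (x - y) * norm u * norm w"
    using dderiv2_Lipschitz[OF open_V smooth_psi ball_V'] by blast
  \<comment> \<open>Within this radius the first and second derivatives in unit directions change by
    at most \<open>c / 2\<close>, so half of the lower bound survives.\<close>
  define r0 where "r0 = min (2 * R) (c / (2 * (L1 + L2)))"
  have r0: "r0 > 0" "r0 \<le> 2 * R" "r0 \<le> c / (2 * (L1 + L2))"
    unfolding r0_def using R_pos c(1) L1(1) L2(1) by auto
  have "2 * (L1 + L2) * r0 \<le> c" using r0(3) L1(1) L2(1) by (simp add: field_simps)
  then have Lr: "L1 * r0 \<le> c / 2" "L2 * r0 \<le> c / 2"
  proof -
    have "2 * (L1 * r0) + 2 * (L2 * r0) \<le> c" using \<open>2 * (L1 + L2) * r0 \<le> c\<close> by (simp add: algebra_simps)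
    then show "L1 * r0 \<le> c / 2" "L2 * r0 \<le> c / 2"
      using mult_pos_pos[OF L1(1) r0(1)] mult_pos_pos[OF L2(1) r0(1)] by linarith+
  qed
  have yb: "y \<in> cball x0 (2 * R)" "norm (x0 - y) \<le> r0" if "y \<in> cball x0 r0" for y
    using that r0(2) by (auto simp: dist_norm)
  have x0b: "x0 \<in> cball x0 (2 * R)" using R_pos by simp
  show ?thesis
  proof (rule that[of "c / 2" r0])
    fix \<omega> :: 'a assume \<omega>: "norm \<omega> = 1"
    show "(\<exists>e\<in>span D. norm e = 1 \<and> (\<forall>y\<in>cball x0 r0. c / 2 \<le> \<omega> \<bullet> dderiv \<psi> e y)) \<or>
       (\<forall>w\<in>span D. w \<noteq> 0 \<longrightarrow> (\<exists>e\<in>span D. norm e = 1 \<and>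
          (\<forall>y\<in>cball x0 r0. c / 2 * norm w \<le> \<omega> \<bullet> dderiv (dderiv \<psi> e) w y)))"
    proof (cases "norm (G1 \<omega>) \<ge> c")
      case True
      define e where "e = (1 / norm (G1 \<omega>)) *\<^sub>R G1 \<omega>"
      have n: "norm (G1 \<omega>) > 0" using True c(1) by linarith
      have e: "e \<in> span D" "norm e = 1" unfolding e_def using Gs n by (auto intro: span_scale)
      have "\<omega> \<bullet> A e = norm (G1 \<omega>)"
        using G1[OF e(1), of \<omega>] n unfolding e_def by (simp add: power2_norm_eq_inner[symmetric] power2_eq_square)
      have "c / 2 \<le> \<omega> \<bullet> dderiv \<psi> e y" if y: "y \<in> cball x0 r0" for y
      proof -
        have "\<bar>\<omega> \<bullet> (A e - dderiv \<psi> e y)\<bar> \<le> norm \<omega> * norm (A e - dderiv \<psi> e y)" by (rule Cauchy_Schwarz_ineq2)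
        also have "\<dots> \<le> L1 * norm (x0 - y)" using L1(2)[OF x0b yb(1)[OF y], of e] \<omega> e(2) unfolding A_def by simp
        also have "\<dots> \<le> L1 * r0" using yb(2)[OF y] L1(1) by (intro mult_left_mono) auto
        finally show ?thesis using Lr(1) \<open>\<omega> \<bullet> A e = norm (G1 \<omega>)\<close> True by (simp add: inner_diff_right)
      qed
      then show ?thesis using e by blast
    next
      case False
      have "\<exists>e\<in>span D. norm e = 1 \<and> (\<forall>y\<in>cball x0 r0. c / 2 * norm w \<le> \<omega> \<bullet> dderiv (dderiv \<psi> e) w y)"
        if w: "w \<in> span D" "w \<noteq> 0" for w
      proof -
        define u where "u = (1 / norm w) *\<^sub>R w"
        have u: "u \<in> span D" "norm u = 1" "w = norm w *\<^sub>R u" unfolding u_def using w by (auto intro: span_scale)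
        have "(\<omega>, u) \<in> X" unfolding X_def using \<omega> u by simp
        then have g: "norm (G2 \<omega> u) \<ge> c" using c(2) False unfolding H_def by fastforce
        define e where "e = (1 / norm (G2 \<omega> u)) *\<^sub>R G2 \<omega> u"
        have n: "norm (G2 \<omega> u) > 0" using g c(1) by linarith
        have e: "e \<in> span D" "norm e = 1" unfolding e_def using Gs n by (auto intro: span_scale)
        have v: "\<omega> \<bullet> Q e u = norm (G2 \<omega> u)"
          using G2[OF e(1), of \<omega> u] n unfolding e_def by (simp add: power2_norm_eq_inner[symmetric] power2_eq_square)
        have "Q e w = norm w *\<^sub>R Q e u" using linear_cmul[OF linQ(2), of e "norm w" u] u(3) by simp
        then have "\<omega> \<bullet> Q e w = norm w * norm (G2 \<omega> u)" using v by simp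
        then have vw: "c * norm w \<le> \<omega> \<bullet> Q e w" using mult_right_mono[OF g, of "norm w"] by (simp add: mult.commute)
        have "c / 2 * norm w \<le> \<omega> \<bullet> dderiv (dderiv \<psi> e) w y" if y: "y \<in> cball x0 r0" for y
        proof -
          have "\<bar>\<omega> \<bullet> (Q e w - dderiv (dderiv \<psi> e) w y)\<bar> \<le> norm \<omega> * norm (Q e w - dderiv (dderiv \<psi> e) w y)"
            by (rule Cauchy_Schwarz_ineq2)
          also have "\<dots> \<le> L2 * norm (x0 - y) * norm w"
            using L2(2)[OF x0b yb(1)[OF y], of e w] \<omega> e(2) unfolding Q_def by simp
          also have "\<dots> \<le> L2 * r0 * norm w" using yb(2)[OF y] L2(1) by (intro mult_right_mono mult_left_mono) auto
          also have "\<dots> \<le> c / 2 * norm w" using Lr(2) by (intro mult_right_mono) auto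
          finally have "\<bar>\<omega> \<bullet> Q e w - \<omega> \<bullet> dderiv (dderiv \<psi> e) w y\<bar> \<le> c / 2 * norm w"
            by (simp only: inner_diff_right)
          moreover have "c * norm w = c / 2 * norm w + c / 2 * norm w" by simp
          ultimately show ?thesis using vw by linarith
        qed
        then show ?thesis using e by blast
      qed
      then show ?thesis by blast
    qed
  qed (use c r0 in auto)
qed

text \<open>The parametrisation extended to an ambient ball by ignoring the coordinates outside
  \<open>D\<close>. The value 0 elsewhere makes the map total and measurable; the amplitudes used
  are supported inside the ball.\<close>

definition Psi :: "'a \<Rightarrow> 'a" where
  "Psi x = (if x \<in> cball x0 (2 * R) then \<psi> (proj x) else 0)"

lemma x0_span: "x0 \<in> span D" using x0_in_param unfolding param_def by blast

lemma proj_in_cball: "x \<in> cball x0 \<rho> \<Longrightarrow> proj x \<in> cball x0 \<rho>"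
  using proj_cball[OF x0_span] .

lemma Psi_measurable[measurable]: "Psi \<in> borel_measurable borel"
  unfolding Psi_def
proof (rule borel_measurable_continuous_on_if)
  show "continuous_on (cball x0 (2 * R)) (\<lambda>x. \<psi> (proj x))"
    by (rule continuous_on_compose2[OF continuous_on_subset[OF continuous_psi ball_V'] continuous_proj])
      (use proj_in_cball in blast)
qed auto

lemma smooth_psi_component: "smooth_on V (\<lambda>y. \<psi> y \<bullet> b)"
  by (rule smooth_on_bounded_linear[OF bounded_linear_inner_left smooth_psi])

lemma proj_line: "e \<in> span D \<Longrightarrow> proj (x + t *\<^sub>R e) = proj x + t *\<^sub>R e"
  by (simp add: linear_add[OF linear_proj] linear_cmul[OF linear_proj] proj_id)

lemma cball_shift: "x \<in> cball x0 a \<Longrightarrow> norm u \<le> b \<Longrightarrow> x + u \<in> cball x0 (a + b)"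
  using norm_triangle_ineq4[of "x0 - x" u] by (auto simp: dist_norm algebra_simps)

lemma cball_line: "x \<in> cball x0 a \<Longrightarrow> norm e = 1 \<Longrightarrow> \<bar>t\<bar> \<le> b \<Longrightarrow> x + t *\<^sub>R e \<in> cball x0 (a + b)"
  using cball_shift[of x a "t *\<^sub>R e" b] by simp

text \<open>Up to the factor \<open>- 2 * pi\<close> in the frequency, the integral of this function
  is the Fourier transform of the measure constructed in \<open>decay_measure_exists\<close> at
  frequency \<open>l\<close> in direction \<open>\<omega>\<close>.\<close>

definition osc :: "nat \<Rightarrow> real \<Rightarrow> real \<Rightarrow> 'a \<Rightarrow> 'a \<Rightarrow> complex" where
  "osc n r l \<omega> x = bump n r (x - x0) *\<^sub>R cis (l * (\<omega> \<bullet> Psi x))"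

lemma osc_measurable[measurable]: "osc n r l \<omega> \<in> borel_measurable borel"
  unfolding osc_def by measurable

lemma norm_osc: "cmod (osc n r l \<omega> x) \<le> 1"
  unfolding osc_def using bump_bounds[of n r "x - x0"] by simp

lemma osc_outside: "r > 0 \<Longrightarrow> norm (x - x0) \<ge> r \<Longrightarrow> osc n r l \<omega> x = 0"
  unfolding osc_def using bump_outside by simp

text \<open>Nonstationary phase on lines, with the triple of \<open>\<omega>\<close>,
  \<open>x\<close> and \<open>e\<close> as index, so that \<open>C\<close> depends on none of them.
  Base points within \<open>2 * r\<close> and times up to \<open>2 * r\<close> stay in the ball of
  radius \<open>4 * r\<close>, where the gradient bound holds.\<close>

lemma osc_line_bound:
  assumes r: "r > 0" "4 * r \<le> r0" "r0 \<le> 2 * R" and c: "c > 0"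
  obtains C where "C \<ge> 0"
    "\<And>\<omega> x e l. \<lbrakk>norm \<omega> = 1; x \<in> cball x0 (2 * r); e \<in> span D; norm e = 1; l > 0;
       \<forall>y\<in>cball x0 r0. c \<le> \<omega> \<bullet> dderiv \<psi> e y\<rbrakk> \<Longrightarrow>
     cmod (\<integral>t. bump n r t *\<^sub>R osc n r l \<omega> (x + t *\<^sub>R e) \<partial>lborel) \<le> C / l ^ n"
proof -
  define I where "I = {(\<omega>, x, e). norm \<omega> = 1 \<and> x \<in> cball x0 (2 * r) \<and> e \<in> span D \<and> norm e = 1 \<and>
       (\<forall>y\<in>cball x0 r0. c \<le> \<omega> \<bullet> dderiv \<psi> e y)}"
  define om xx ee where "om = (\<lambda>i::'a \<times> 'a \<times> 'a. fst i)" and "xx = (\<lambda>i::'a \<times> 'a \<times> 'a. fst (snd i))"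
    and "ee = (\<lambda>i::'a \<times> 'a \<times> 'a. snd (snd i))"
  have I: "norm (om i) = 1" "xx i \<in> cball x0 (2 * r)" "ee i \<in> span D" "norm (ee i) = 1"
    "\<And>y. y \<in> cball x0 r0 \<Longrightarrow> c \<le> om i \<bullet> dderiv \<psi> (ee i) y" if "i \<in> I" for i
    using that unfolding I_def om_def xx_def ee_def by auto
  \<comment> \<open>A value strictly between the support radius \<open>r\<close> and the radius
    \<open>2 * r\<close> of the open interval.\<close>
  define h where "h = 3 * r / 2"
  let ?J = "{-(2*r)<..<2*r}"
  define g where "g i t = om i \<bullet> \<psi> (proj (xx i) + t *\<^sub>R ee i)" for i t
  define b where "b i t = bump n r t * bump n r (xx i - x0 + t *\<^sub>R ee i)" for i t
  have V4: "cball x0 r0 \<subseteq> V" using ball_V' r by (auto simp: subset_eq)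
  have mem: "proj (xx i) + t *\<^sub>R ee i \<in> cball x0 r0" if "i \<in> I" "t \<in> ?J" for i t
  proof -
    have "\<bar>t\<bar> \<le> 2 * r" using that(2) by auto
    from cball_line[OF proj_in_cball[OF I(2)[OF that(1)]] I(4)[OF that(1)] this] r
    show ?thesis by auto
  qed
  have gU: "unif_Ck k I ?J g" for k
  proof -
    have eq: "g = (\<lambda>i t. \<Sum>a\<in>Basis. (om i \<bullet> a) * (\<psi> (proj (xx i) + t *\<^sub>R ee i) \<bullet> a))"
      unfolding g_def by (intro ext euclidean_inner)
    show ?thesis unfolding eq
    proof (intro unif_Ck_sum unif_Ck_cmult[where C = 1] finite_Basis unif_Ck_line[OF open_V V4 smooth_psi_component])
      show "\<bar>om i \<bullet> a\<bar> \<le> 1" if "a \<in> Basis" "i \<in> I" for a i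
        using Basis_le_norm[OF that(1), of "om i"] I(1)[OF that(2)] by simp
    qed (use I(4) mem in auto)
  qed
  have gd: "\<bar>deriv (g i) t\<bar> \<ge> c" if i: "i \<in> I" and t: "t \<in> ?J" for i t
  proof -
    have y: "proj (xx i) + t *\<^sub>R ee i \<in> cball x0 r0" using mem[OF i t] .
    have "((\<lambda>t. \<psi> (proj (xx i) + t *\<^sub>R ee i)) has_vector_derivative dderiv \<psi> (ee i) (proj (xx i) + t *\<^sub>R ee i)) (at t)"
      using smooth_on_line[OF open_V smooth_psi, of "proj (xx i)" t "ee i" UNIV] y V4 by auto
    then have "(g i has_real_derivative om i \<bullet> dderiv \<psi> (ee i) (proj (xx i) + t *\<^sub>R ee i)) (at t)"
      unfolding g_def has_vector_derivative_def has_field_derivative_def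
      by (auto intro!: derivative_eq_intros simp: mult.commute)
    from DERIV_imp_deriv[OF this] I(5)[OF i y] show ?thesis by simp
  qed
  have bU: "unif_Ck n I ?J b"
    unfolding b_def
  proof (intro unif_Ck_mult)
    show "unif_Ck n I ?J (\<lambda>i. bump n r)"
      using unif_Ck_bump_line[of ?J r I "\<lambda>_. 1::real" "\<lambda>_. 0" 0 n] r(1) by simp
    show "unif_Ck n I ?J (\<lambda>i t. bump n r (xx i - x0 + t *\<^sub>R ee i))"
      by (rule unif_Ck_bump_line[where C = "2 * r"]) (use I r in \<open>auto simp: dist_norm norm_minus_commute\<close>)
  qed
  have b0: "b i t = 0" if "\<bar>t\<bar> > r" for i t
    unfolding b_def using bump_outside[OF r(1), of t] that by simp
  obtain C where C: "C \<ge> 0" "\<And>i \<mu>. i \<in> I \<Longrightarrow> \<mu> > 0 \<Longrightarrow>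
      cmod (integral {-h..h} (\<lambda>t. b i t *\<^sub>R cis (\<mu> * g i t))) \<le> C / \<mu> ^ n"
    using nonstationary_phase[of r h "2 * r" I g c n b] r(1) gU c gd bU b0 unfolding h_def by force
  show ?thesis
  proof (rule that[OF C(1)])
    fix \<omega> x e :: 'a and l :: real
    assume a: "norm \<omega> = 1" "x \<in> cball x0 (2 * r)" "e \<in> span D" "norm e = 1" "l > 0"
      "\<forall>y\<in>cball x0 r0. c \<le> \<omega> \<bullet> dderiv \<psi> e y"
    define i where "i = (\<omega>, x, e)"
    have i: "i \<in> I" "om i = \<omega>" "xx i = x" "ee i = e"
      using a unfolding i_def I_def om_def xx_def ee_def by auto
    have hJ: "{-h..h} \<subseteq> ?J" unfolding h_def using r(1) by auto
    have "(\<integral>t. bump n r t *\<^sub>R osc n r l \<omega> (x + t *\<^sub>R e) \<partial>lborel) = integral {-h..h} (\<lambda>t. b i t *\<^sub>R cis (l * g i t))"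
    proof (rule lborel_integral_eq_interval)
      have "continuous_on ?J (b i)" "continuous_on ?J (g i)"
        using unif_Ck_0[OF bU] gU[of 0] i(1) by auto
      then have "continuous_on {-h..h} (b i)" "continuous_on {-h..h} (g i)"
        using continuous_on_subset[OF _ hJ] by blast+
      then show "continuous_on {-h..h} (\<lambda>t. b i t *\<^sub>R cis (l * g i t))" by (intro continuous_intros)
      fix t
      show "bump n r t *\<^sub>R osc n r l \<omega> (x + t *\<^sub>R e) = indicator {-h..h} t *\<^sub>R b i t *\<^sub>R cis (l * g i t)"
      proof (cases "t \<in> {-h..h}")
        case True
        then have "\<bar>t\<bar> \<le> 2 * r" unfolding h_def using r(1) by auto
        then have "x + t *\<^sub>R e \<in> cball x0 (2 * R)"
          using cball_line[OF a(2,4), of t "2 * r"] r by auto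
        then have "Psi (x + t *\<^sub>R e) = \<psi> (proj x + t *\<^sub>R e)" unfolding Psi_def using proj_line[OF a(3)] by simp
        then show ?thesis using True unfolding osc_def b_def g_def i(2-4)
          by (simp add: algebra_simps)
      next
        case False
        then have "\<bar>t\<bar> \<ge> r" unfolding h_def using r(1) by auto
        then show ?thesis using False bump_outside[OF r(1), of t] by simp
      qed
    qed
    then show "cmod (\<integral>t. bump n r t *\<^sub>R osc n r l \<omega> (x + t *\<^sub>R e) \<partial>lborel) \<le> C / l ^ n"
      using C(2)[OF i(1) a(5)] by simp
  qed
qed

text \<open>The difference of the two phases, divided by \<open>norm (proj u)\<close>, is a
  uniformly smooth family even as \<open>u\<close> tends to 0, and its derivative is bounded away
  from 0 through the second derivative in direction \<open>proj u\<close>. The effective frequency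
  is therefore \<open>l * norm (proj u)\<close>; the components of \<open>u\<close> outside
  \<open>span D\<close> leave the phase unchanged.\<close>

lemma osc_correlation_line_bound:
  assumes r: "r > 0" "6 * r \<le> r0" "r0 \<le> 2 * R" and c: "c > 0"
  obtains C where "C \<ge> 0"
    "\<And>\<omega> x u e l. \<lbrakk>norm \<omega> = 1; x \<in> cball x0 (2 * r); norm u \<le> 2 * r; proj u \<noteq> 0; e \<in> span D; norm e = 1; l > 0;
       \<forall>y\<in>cball x0 r0. c * norm (proj u) \<le> \<omega> \<bullet> dderiv (dderiv \<psi> e) (proj u) y\<rbrakk> \<Longrightarrow>
     cmod (\<integral>t. bump n r t *\<^sub>R (osc n r l \<omega> (x + t *\<^sub>R e) * cnj (osc n r l \<omega> (x + t *\<^sub>R e + u))) \<partial>lborel)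
       \<le> C / (l * norm (proj u)) ^ n"
proof -
  define I where "I = {(\<omega>, x, u, e). norm \<omega> = 1 \<and> x \<in> cball x0 (2 * r) \<and> norm u \<le> 2 * r \<and> proj u \<noteq> 0 \<and>
       e \<in> span D \<and> norm e = 1 \<and> (\<forall>y\<in>cball x0 r0. c * norm (proj u) \<le> \<omega> \<bullet> dderiv (dderiv \<psi> e) (proj u) y)}"
  define om xx uu ee where "om = (\<lambda>i::'a \<times> 'a \<times> 'a \<times> 'a. fst i)" and "xx = (\<lambda>i::'a \<times> 'a \<times> 'a \<times> 'a. fst (snd i))"
    and "uu = (\<lambda>i::'a \<times> 'a \<times> 'a \<times> 'a. fst (snd (snd i)))" and "ee = (\<lambda>i::'a \<times> 'a \<times> 'a \<times> 'a. snd (snd (snd i)))"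
  have I: "norm (om i) = 1" "xx i \<in> cball x0 (2 * r)" "norm (uu i) \<le> 2 * r" "proj (uu i) \<noteq> 0" "ee i \<in> span D" "norm (ee i) = 1"
    "\<And>y. y \<in> cball x0 r0 \<Longrightarrow> c * norm (proj (uu i)) \<le> om i \<bullet> dderiv (dderiv \<psi> (ee i)) (proj (uu i)) y" if "i \<in> I" for i
    using that unfolding I_def om_def xx_def uu_def ee_def by auto
  define h where "h = 3 * r / 2"
  let ?J = "{-(2*r)<..<2*r}"
  define g where "g i t = (om i \<bullet> \<psi> (proj (xx i) + t *\<^sub>R ee i) - om i \<bullet> \<psi> (proj (xx i) + proj (uu i) + t *\<^sub>R ee i)) / norm (proj (uu i))" for i t
  define b where "b i t = bump n r t * (bump n r (xx i - x0 + t *\<^sub>R ee i) * bump n r (xx i + uu i - x0 + t *\<^sub>R ee i))" for i t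
  have V4: "cball x0 r0 \<subseteq> V" using ball_V' r by (auto simp: subset_eq)
  have pu: "norm (proj (uu i)) \<le> 2 * r" if "i \<in> I" for i using norm_proj_le[of "uu i"] I(3)[OF that] by linarith
  have mem: "proj (xx i) + t *\<^sub>R ee i \<in> cball x0 r0" "proj (xx i) + proj (uu i) + t *\<^sub>R ee i \<in> cball x0 r0"
    if "i \<in> I" "t \<in> ?J" for i t
  proof -
    have "\<bar>t\<bar> \<le> 2 * r" using that(2) by auto
    from cball_line[OF proj_in_cball[OF I(2)[OF that(1)]] I(6)[OF that(1)] this] r
    show "proj (xx i) + t *\<^sub>R ee i \<in> cball x0 r0" by auto
    from cball_line[OF cball_shift[OF proj_in_cball[OF I(2)[OF that(1)]] pu[OF that(1)]] I(6)[OF that(1)] \<open>\<bar>t\<bar> \<le> 2 * r\<close>] r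
    show "proj (xx i) + proj (uu i) + t *\<^sub>R ee i \<in> cball x0 r0" by auto
  qed
  have gU: "unif_Ck k I ?J g" for k
  proof -
    have eq: "g = (\<lambda>i t. \<Sum>a\<in>Basis. (om i \<bullet> a) *
        ((\<psi> (proj (xx i) + t *\<^sub>R ee i) \<bullet> a - \<psi> (proj (xx i) + proj (uu i) + t *\<^sub>R ee i) \<bullet> a) / norm (proj (uu i))))"
      unfolding g_def euclidean_inner[of "om _" "\<psi> _"]
      by (simp add: sum_subtractf[symmetric] sum_divide_distrib right_diff_distrib)
    show ?thesis unfolding eq
    proof (intro unif_Ck_sum unif_Ck_cmult[where C = 1] finite_Basis unif_Ck_diff_line[OF open_V V4 smooth_psi_component])
      show "\<bar>om i \<bullet> a\<bar> \<le> 1" if "a \<in> Basis" "i \<in> I" for a i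
        using Basis_le_norm[OF that(1), of "om i"] I(1)[OF that(2)] by simp
    qed (use I(4,6) mem in auto)
  qed
  have gd: "\<bar>deriv (g i) t\<bar> \<ge> c" if i: "i \<in> I" and t: "t \<in> ?J" for i t
  proof -
    define y where "y = proj (xx i) + t *\<^sub>R ee i"
    define w where "w = proj (uu i)"
    have w0: "norm w > 0" using I(4)[OF i] unfolding w_def by simp
    have y: "y \<in> cball x0 r0" "y + w \<in> cball x0 r0"
      using mem[OF i t] unfolding y_def w_def by (auto simp: algebra_simps)
    have d: "((\<lambda>t. om i \<bullet> \<psi> (q + t *\<^sub>R ee i)) has_real_derivative om i \<bullet> dderiv \<psi> (ee i) (q + t *\<^sub>R ee i)) (at t)"
      if "q + t *\<^sub>R ee i \<in> V" for q
    proof -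
      have "((\<lambda>t. \<psi> (q + t *\<^sub>R ee i)) has_vector_derivative dderiv \<psi> (ee i) (q + t *\<^sub>R ee i)) (at t)"
        using smooth_on_line[OF open_V smooth_psi that, of UNIV] by simp
      then show ?thesis unfolding has_vector_derivative_def has_field_derivative_def
        by (auto intro!: derivative_eq_intros simp: mult.commute)
    qed
    have yw: "proj (xx i) + proj (uu i) + t *\<^sub>R ee i = y + w" unfolding y_def w_def by (simp add: algebra_simps)
    have "(g i has_real_derivative (om i \<bullet> dderiv \<psi> (ee i) (proj (xx i) + t *\<^sub>R ee i)
        - om i \<bullet> dderiv \<psi> (ee i) (proj (xx i) + proj (uu i) + t *\<^sub>R ee i)) / norm (proj (uu i))) (at t)"
      unfolding g_def by (intro DERIV_cdivide DERIV_diff d) (use mem[OF i t] V4 in blast)+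
    then have "(g i has_real_derivative (om i \<bullet> dderiv \<psi> (ee i) y - om i \<bullet> dderiv \<psi> (ee i) (y + w)) / norm w) (at t)"
      unfolding yw unfolding y_def[symmetric] w_def[symmetric] .
    from DERIV_imp_deriv[OF this]
    have dg: "deriv (g i) t = (om i \<bullet> dderiv \<psi> (ee i) y - om i \<bullet> dderiv \<psi> (ee i) (y + w)) / norm w" .
    define q where "q s = om i \<bullet> dderiv \<psi> (ee i) (y + s *\<^sub>R w)" for s
    have seg: "y + s *\<^sub>R w \<in> cball x0 r0" if "s \<in> {0..1}" for s
      using segment_in_cball[OF y that] by simp
    have "(q has_real_derivative om i \<bullet> dderiv (dderiv \<psi> (ee i)) w (y + s *\<^sub>R w)) (at s)" if "s \<in> {0..1}" for s
    proof -
      have "((\<lambda>s. dderiv \<psi> (ee i) (y + s *\<^sub>R w)) has_vector_derivative dderiv (dderiv \<psi> (ee i)) w (y + s *\<^sub>R w)) (at s)"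
        using smooth_on_line[OF open_V smooth_on_dderiv[OF open_V smooth_psi], where x = y and t = s and u = w and S = UNIV] seg[OF that] V4 by auto
      then show ?thesis unfolding q_def has_vector_derivative_def has_field_derivative_def
        by (auto intro!: derivative_eq_intros simp: mult.commute)
    qed
    \<comment> \<open>The mean value theorem turns the difference of gradients at \<open>y\<close>
      and \<open>y + w\<close> into a second derivative at an intermediate point, where the lower
      bound applies.\<close>
    then have "\<exists>s. 0 < s \<and> s < 1 \<and> q 1 - q 0 = (1 - 0) * (om i \<bullet> dderiv (dderiv \<psi> (ee i)) w (y + s *\<^sub>R w))"
      by (intro MVT2) auto
    then obtain s where s: "0 < s" "s < 1" "q 1 - q 0 = om i \<bullet> dderiv (dderiv \<psi> (ee i)) w (y + s *\<^sub>R w)" by auto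
    have "c * norm w \<le> q 1 - q 0" using I(7)[OF i seg[of s]] s unfolding w_def by simp
    then have "c \<le> (q 1 - q 0) / norm w" using w0 by (simp add: pos_le_divide_eq)
    moreover have "deriv (g i) t = - ((q 1 - q 0) / norm w)"
      unfolding dg q_def by (simp add: diff_divide_distrib)
    ultimately show ?thesis by linarith
  qed
  have bU: "unif_Ck n I ?J b"
    unfolding b_def
  proof (intro unif_Ck_mult)
    show "unif_Ck n I ?J (\<lambda>i. bump n r)"
      using unif_Ck_bump_line[of ?J r I "\<lambda>_. 1::real" "\<lambda>_. 0" 0 n] r(1) by simp
    show "unif_Ck n I ?J (\<lambda>i t. bump n r (xx i - x0 + t *\<^sub>R ee i))"
      by (rule unif_Ck_bump_line[where C = "2 * r"]) (use I r in \<open>auto simp: dist_norm norm_minus_commute\<close>)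
    show "unif_Ck n I ?J (\<lambda>i t. bump n r (xx i + uu i - x0 + t *\<^sub>R ee i))"
    proof (rule unif_Ck_bump_line[where C = "2 * r + 2 * r"])
      show "norm (xx i + uu i - x0) \<le> 2 * r + 2 * r" if "i \<in> I" for i
        using cball_shift[OF I(2)[OF that] I(3)[OF that]] by (simp add: dist_norm norm_minus_commute)
    qed (use I r in auto)
  qed
  have b0: "b i t = 0" if "\<bar>t\<bar> > r" for i t
    unfolding b_def using bump_outside[OF r(1), of t] that by simp
  obtain C where C: "C \<ge> 0" "\<And>i \<mu>. i \<in> I \<Longrightarrow> \<mu> > 0 \<Longrightarrow>
      cmod (integral {-h..h} (\<lambda>t. b i t *\<^sub>R cis (\<mu> * g i t))) \<le> C / \<mu> ^ n"
    using nonstationary_phase[of r h "2 * r" I g c n b] r(1) gU c gd bU b0 unfolding h_def by force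
  show ?thesis
  proof (rule that[OF C(1)])
    fix \<omega> x u e :: 'a and l :: real
    assume a: "norm \<omega> = 1" "x \<in> cball x0 (2 * r)" "norm u \<le> 2 * r" "proj u \<noteq> 0" "e \<in> span D" "norm e = 1" "l > 0"
      "\<forall>y\<in>cball x0 r0. c * norm (proj u) \<le> \<omega> \<bullet> dderiv (dderiv \<psi> e) (proj u) y"
    define i where "i = (\<omega>, x, u, e)"
    have i: "i \<in> I" "om i = \<omega>" "xx i = x" "uu i = u" "ee i = e"
      using a unfolding i_def I_def om_def xx_def uu_def ee_def by auto
    have w0: "norm (proj u) > 0" using a(4) by simp
    have hJ: "{-h..h} \<subseteq> ?J" unfolding h_def using r(1) by auto
    let ?m = "l * norm (proj u)"
    have "(\<integral>t. bump n r t *\<^sub>R (osc n r l \<omega> (x + t *\<^sub>R e) * cnj (osc n r l \<omega> (x + t *\<^sub>R e + u))) \<partial>lborel)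
        = integral {-h..h} (\<lambda>t. b i t *\<^sub>R cis (?m * g i t))"
    proof (rule lborel_integral_eq_interval)
      have "continuous_on ?J (b i)" "continuous_on ?J (g i)"
        using unif_Ck_0[OF bU] gU[of 0] i(1) by auto
      then have "continuous_on {-h..h} (b i)" "continuous_on {-h..h} (g i)"
        using continuous_on_subset[OF _ hJ] by blast+
      then show "continuous_on {-h..h} (\<lambda>t. b i t *\<^sub>R cis (?m * g i t))" by (intro continuous_intros)
      fix t
      show "bump n r t *\<^sub>R (osc n r l \<omega> (x + t *\<^sub>R e) * cnj (osc n r l \<omega> (x + t *\<^sub>R e + u)))
          = indicator {-h..h} t *\<^sub>R b i t *\<^sub>R cis (?m * g i t)"
      proof (cases "t \<in> {-h..h}")
        case True
        then have t: "\<bar>t\<bar> \<le> 2 * r" unfolding h_def using r(1) by auto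
        have m1: "x + t *\<^sub>R e \<in> cball x0 (2 * r + 2 * r)" by (rule cball_line[OF a(2,6) t])
        have m2: "x + t *\<^sub>R e + u \<in> cball x0 (2 * r + 2 * r + 2 * r)" by (rule cball_shift[OF m1 a(3)])
        have P1: "Psi (x + t *\<^sub>R e) = \<psi> (proj x + t *\<^sub>R e)"
          unfolding Psi_def using proj_line[OF a(5)] m1 r by auto
        have "proj (x + t *\<^sub>R e + u) = proj x + proj u + t *\<^sub>R e"
          using linear_add[OF linear_proj, of "x + t *\<^sub>R e" u] proj_line[OF a(5)] by simp
        then have P2: "Psi (x + t *\<^sub>R e + u) = \<psi> (proj x + proj u + t *\<^sub>R e)"
          unfolding Psi_def using m2 r by auto
        have P3: "?m * g i t = l * (\<omega> \<bullet> \<psi> (proj x + t *\<^sub>R e)) - l * (\<omega> \<bullet> \<psi> (proj x + proj u + t *\<^sub>R e))"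
          unfolding g_def i using w0 by (simp add: field_simps)
        have P4: "x + t *\<^sub>R e - x0 = x - x0 + t *\<^sub>R e" "x + t *\<^sub>R e + u - x0 = x + u - x0 + t *\<^sub>R e"
          by (simp_all add: algebra_simps)
        show ?thesis unfolding osc_def P1 P2 P3 P4 scaleR_cis_mult_cnj b_def i using True by simp
      next
        case False
        then have "\<bar>t\<bar> \<ge> r" unfolding h_def using r(1) by auto
        then show ?thesis using False bump_outside[OF r(1), of t] by simp
      qed
    qed
    then show "cmod (\<integral>t. bump n r t *\<^sub>R (osc n r l \<omega> (x + t *\<^sub>R e) * cnj (osc n r l \<omega> (x + t *\<^sub>R e + u))) \<partial>lborel)
       \<le> C / ?m ^ n"
      using C(2)[OF i(1), of ?m] a(7) w0 by simp
  qed
qed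

end

lemma norm_integral_le_measure:
  fixes f :: "'a::euclidean_space \<Rightarrow> complex"
  assumes "A \<in> sets lborel" "emeasure lborel A < \<infinity>" "\<And>x. cmod (f x) \<le> indicator A x"
  shows "cmod (\<integral>x. f x \<partial>lborel) \<le> measure lborel A"
proof -
  have "cmod (\<integral>x. f x \<partial>lborel) \<le> (\<integral>x. cmod (f x) \<partial>lborel)" by (rule integral_norm_bound)
  also have "\<dots> \<le> (\<integral>x. indicator A x \<partial>lborel)"
    by (rule integral_mono') (use assms in \<open>auto intro!: integrable_real_indicator\<close>)
  also have "\<dots> = measure lborel A" by simp
  finally show ?thesis .
qed

text \<open>Converts the radial bound, the smaller of 1 and \<open>1 / X ^ (2 * card D)\<close>,
  into the product weight; the numerator 2 compensates for the summand 1 in the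
  denominators.\<close>

lemma prod_Cauchy_ge:
  fixes t :: "'b \<Rightarrow> real"
  assumes "finite D" "\<And>b. b \<in> D \<Longrightarrow> \<bar>t b\<bar> \<le> X"
  shows "X \<le> 1 \<Longrightarrow> 1 \<le> (\<Prod>b\<in>D. 2 / (1 + (t b)\<^sup>2))"
    and "X > 1 \<Longrightarrow> 1 / X ^ (2 * card D) \<le> (\<Prod>b\<in>D. 2 / (1 + (t b)\<^sup>2))"
proof -
  have pos: "0 < 1 + (t b)\<^sup>2" for b by (simp add: add_pos_nonneg)
  have sq: "(t b)\<^sup>2 \<le> X\<^sup>2" if "b \<in> D" for b
    using power_mono[OF assms(2)[OF that], of 2] by simp
  show "1 \<le> (\<Prod>b\<in>D. 2 / (1 + (t b)\<^sup>2))" if "X \<le> 1"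
  proof (rule prod_ge_1)
    fix b assume b: "b \<in> D"
    have "\<bar>t b\<bar> \<le> 1" using assms(2)[OF b] that by simp
    then have "(t b)\<^sup>2 \<le> 1" by (simp add: abs_square_le_1)
    then show "1 \<le> 2 / (1 + (t b)\<^sup>2)" using pos[of b] by (simp add: pos_le_divide_eq)
  qed
  show "1 / X ^ (2 * card D) \<le> (\<Prod>b\<in>D. 2 / (1 + (t b)\<^sup>2))" if "X > 1"
  proof -
    have "1 / X ^ (2 * card D) = (\<Prod>b\<in>D. 1 / X\<^sup>2)" by (simp add: power_mult power_one_over)
    also have "\<dots> \<le> (\<Prod>b\<in>D. 2 / (1 + (t b)\<^sup>2))"
    proof (rule prod_mono, intro conjI)
      fix b assume b: "b \<in> D"
      have "1 \<le> X\<^sup>2" using one_le_power[of X 2] that by simp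
      then have "1 + (t b)\<^sup>2 \<le> 2 * X\<^sup>2" using sq[OF b] by linarith
      then show "1 / X\<^sup>2 \<le> 2 / (1 + (t b)\<^sup>2)" using pos[of b] that by (simp add: field_simps)
    qed simp
    finally show ?thesis .
  qed
qed

context chart_ball begin

text \<open>Where the gradient of the phase is bounded below, averaging along one direction gives
  decay \<open>1 / l ^ n\<close>. Otherwise the squared integral is bounded by correlations; the
  direction of integration then depends on the shift \<open>u\<close>, which is harmless since each
  correlation is estimated separately.\<close>

lemma osc_integral_bound:
  assumes nondeg: "\<forall>\<zeta>. \<zeta> \<noteq> 0 \<longrightarrow> normal_at x0 \<zeta> \<longrightarrow>
      (\<forall>u\<in>span D. (\<forall>e\<in>span D. hess x0 \<zeta> u e = 0) \<longrightarrow> u = 0)"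
  obtains n r C where "r > 0" "r \<le> 2 * R" "C \<ge> 0"
    "\<And>\<omega> l. norm \<omega> = 1 \<Longrightarrow> l \<ge> 1 \<Longrightarrow> cmod (\<integral>x. osc n r l \<omega> x \<partial>lborel) \<le> C * l powr (- (real (card D) / 2))"
proof -
  define m where "m = card D"
  \<comment> \<open>Matches the \<open>m\<close> Cauchy factors of the weight, each of which decays
    quadratically.\<close>
  define n where "n = 2 * m"
  obtain c r0 where c: "c > 0" and r0: "r0 > 0" "r0 \<le> 2 * R" and dich:
    "\<And>\<omega>. norm \<omega> = 1 \<Longrightarrow>
       (\<exists>e\<in>span D. norm e = 1 \<and> (\<forall>y\<in>cball x0 r0. c \<le> \<omega> \<bullet> dderiv \<psi> e y)) \<or>
       (\<forall>w\<in>span D. w \<noteq> 0 \<longrightarrow> (\<exists>e\<in>span D. norm e = 1 \<and>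
          (\<forall>y\<in>cball x0 r0. c * norm w \<le> \<omega> \<bullet> dderiv (dderiv \<psi> e) w y)))"
    using phase_dichotomy[OF nondeg] by blast
  \<comment> \<open>Base point, shift and time each contribute up to \<open>2 * r\<close>.\<close>
  define r where "r = r0 / 6"
  have r: "r > 0" "4 * r \<le> r0" "6 * r \<le> r0" "r \<le> 2 * R" unfolding r_def using r0 by auto
  obtain CA where CA: "CA \<ge> 0"
    "\<And>\<omega> x e l. \<lbrakk>norm \<omega> = 1; x \<in> cball x0 (2 * r); e \<in> span D; norm e = 1; l > 0;
       \<forall>y\<in>cball x0 r0. c \<le> \<omega> \<bullet> dderiv \<psi> e y\<rbrakk> \<Longrightarrow>
     cmod (\<integral>t. bump n r t *\<^sub>R osc n r l \<omega> (x + t *\<^sub>R e) \<partial>lborel) \<le> CA / l ^ n"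
    using osc_line_bound[OF r(1,2) r0(2) c, of n] by blast
  obtain CB where CB: "CB \<ge> 0"
    "\<And>\<omega> x u e l. \<lbrakk>norm \<omega> = 1; x \<in> cball x0 (2 * r); norm u \<le> 2 * r; proj u \<noteq> 0; e \<in> span D; norm e = 1; l > 0;
       \<forall>y\<in>cball x0 r0. c * norm (proj u) \<le> \<omega> \<bullet> dderiv (dderiv \<psi> e) (proj u) y\<rbrakk> \<Longrightarrow>
     cmod (\<integral>t. bump n r t *\<^sub>R (osc n r l \<omega> (x + t *\<^sub>R e) * cnj (osc n r l \<omega> (x + t *\<^sub>R e + u))) \<partial>lborel)
       \<le> CB / (l * norm (proj u)) ^ n"
    using osc_correlation_line_bound[OF r(1,3) r0(2) c, of n] by blast
  define vol where "vol = measure lborel (cball x0 (2 * r))"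
  have vol: "vol \<ge> 0" unfolding vol_def by simp
  define \<eta>0 where "\<eta>0 = (\<integral>t. bump n r (t::real) \<partial>lborel)"
  have \<eta>0: "\<eta>0 > 0" unfolding \<eta>0_def by (rule bump_integral_pos[OF r(1)])
  have le_div: "x \<le> A / \<eta>0" if "\<eta>0 * x \<le> A" for x A
    using that \<eta>0 by (simp add: pos_le_divide_eq mult.commute)
  have \<eta>out: "bump n r t = 0" if "\<bar>t\<bar> \<ge> r" for t :: real using bump_outside[OF r(1), of t] that by simp
  define C5 where "C5 = vol + CB * vol / \<eta>0"
  have C5: "C5 \<ge> 0" "vol \<le> C5" "CB * vol / \<eta>0 \<le> C5" unfolding C5_def using vol CB(1) \<eta>0 by auto
  define C6 where "C6 = C5 * ((2 * pi) ^ m * (2 * (2 * r)) ^ (DIM('a) - m))"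
  have C6: "C6 \<ge> 0" unfolding C6_def using C5(1) r(1) by simp
  define C where "C = CA * vol / \<eta>0 + sqrt C6"
  have C: "C \<ge> 0" "CA * vol / \<eta>0 \<le> C" "sqrt C6 \<le> C" unfolding C_def using CA(1) vol \<eta>0 C6 by auto
  have "cmod (\<integral>x. osc n r l \<omega> x \<partial>lborel) \<le> C * l powr (- (real m / 2))" if \<omega>: "norm \<omega> = 1" and l: "l \<ge> 1" for \<omega> l
  proof -
    have l0: "l > 0" using l by simp
    define K where "K = osc n r l \<omega>"
    have [measurable]: "K \<in> borel_measurable borel" unfolding K_def by simp
    have K1: "cmod (K x) \<le> 1" for x unfolding K_def by (rule norm_osc)
    have K0: "K x = 0" if "norm (x - x0) \<ge> r" for x unfolding K_def using osc_outside[OF r(1) that] .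
    have lpow: "1 / l ^ m = (l powr (- (real m / 2)))\<^sup>2"
    proof -
      have "(l powr (- (real m / 2)))\<^sup>2 = l powr (- (real m / 2) + - (real m / 2))"
        unfolding powr_add power2_eq_square by simp
      also have "\<dots> = l powr (- real m)" by simp
      finally show ?thesis using l0 by (simp add: powr_minus_divide powr_realpow)
    qed
    show ?thesis
      using dich[OF \<omega>]
    proof
      assume "\<exists>e\<in>span D. norm e = 1 \<and> (\<forall>y\<in>cball x0 r0. c \<le> \<omega> \<bullet> dderiv \<psi> e y)"
      then obtain e where e: "e \<in> span D" "norm e = 1" "\<forall>y\<in>cball x0 r0. c \<le> \<omega> \<bullet> dderiv \<psi> e y" by blast
      have "\<eta>0 * cmod (\<integral>x. K x \<partial>lborel) \<le> CA / l ^ n * vol"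
        unfolding \<eta>0_def vol_def
      proof (rule average_along_line[where e = e and r = r])
        show "cmod (\<integral>t. bump n r t *\<^sub>R K (x + t *\<^sub>R e) \<partial>lborel) \<le> CA / l ^ n" if "x \<in> cball x0 (2 * r)" for x
          unfolding K_def using CA(2)[OF \<omega> that e(1,2) l0 e(3)] .
      qed (use K1 K0 r \<eta>out e bump_bounds in auto)
      from le_div[OF this] have "cmod (\<integral>x. K x \<partial>lborel) \<le> CA / l ^ n * vol / \<eta>0" .
      also have "\<dots> = CA * vol / \<eta>0 * (1 / l ^ n)" by simp
      finally have "cmod (\<integral>x. K x \<partial>lborel) \<le> CA * vol / \<eta>0 * (1 / l ^ n)" .
      also have "\<dots> \<le> C * (1 / l ^ n)" using C(2) l0 by (intro mult_right_mono) auto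
      also have "1 / l ^ n \<le> l powr (- (real m / 2))"
      proof -
        have "1 / l ^ n = l powr (- real n)" using l0 by (simp add: powr_minus_divide powr_realpow)
        also have "\<dots> \<le> l powr (- (real m / 2))" using l unfolding n_def by (intro powr_mono) auto
        finally show ?thesis .
      qed
      then have "C * (1 / l ^ n) \<le> C * l powr (- (real m / 2))" using C(1) by (rule mult_left_mono)
      finally show ?thesis unfolding K_def .
    next
      assume B: "\<forall>w\<in>span D. w \<noteq> 0 \<longrightarrow> (\<exists>e\<in>span D. norm e = 1 \<and>
          (\<forall>y\<in>cball x0 r0. c * norm w \<le> \<omega> \<bullet> dderiv (dderiv \<psi> e) w y))"
      \<comment> \<open>Up to the factor \<open>C5\<close> an integrable majorant of the
        correlations; the cube contains every shift for which the two supports meet.\<close>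
      define P where "P u = (if \<forall>b\<in>Basis. \<bar>u \<bullet> b\<bar> \<le> 2 * r then \<Prod>b\<in>D. 2 / (1 + (l * (u \<bullet> b))\<^sup>2) else 0)" for u
      have P0: "P u \<ge> 0" for u unfolding P_def by (auto intro!: prod_nonneg)
      have corr: "cmod (\<integral>x. K x * cnj (K (x + u)) \<partial>lborel) \<le> C5 * P u" for u
      proof (cases "norm u \<le> 2 * r")
        case False
        have "K x * cnj (K (x + u)) = 0" for x
        proof (cases "norm (x - x0) \<ge> r")
          case F: False
          have "norm u \<le> norm (x + u - x0) + norm (x - x0)"
            using norm_triangle_ineq4[of "x + u - x0" "x - x0"] by simp
          then have "norm (x + u - x0) \<ge> r" using False F by simp
          then show ?thesis using K0 by simp
        qed (simp add: K0)
        then have z: "(\<lambda>x. K x * cnj (K (x + u))) = (\<lambda>x. 0)" by (rule ext)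
        show ?thesis unfolding z using C5(1) P0[of u] by simp
      next
        case True
        define X where "X = l * norm (proj u)"
        have ub: "\<bar>u \<bullet> b\<bar> \<le> 2 * r" if "b \<in> Basis" for b using Basis_le_norm[OF that, of u] True by simp
        then have Pu: "P u = (\<Prod>b\<in>D. 2 / (1 + (l * (u \<bullet> b))\<^sup>2))" unfolding P_def by simp
        have tb: "\<bar>l * (u \<bullet> b)\<bar> \<le> X" if "b \<in> D" for b
        proof -
          have "u \<bullet> b = proj u \<bullet> b" using that D_subset proj_inner[of b u] by auto
          then have "\<bar>u \<bullet> b\<bar> \<le> norm (proj u)" using Basis_le_norm[of b "proj u"] that D_subset by auto
          then show ?thesis unfolding X_def abs_mult using l0 by (simp add: mult_left_mono)
        qed
        have triv: "cmod (\<integral>x. K x * cnj (K (x + u)) \<partial>lborel) \<le> vol"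
          unfolding vol_def
        proof (rule norm_integral_le_measure)
          show "emeasure lborel (cball x0 (2 * r)) < \<infinity>" using emeasure_lborel_cball_finite[of x0 "2 * r"] by simp
          show "cmod (K x * cnj (K (x + u))) \<le> indicator (cball x0 (2 * r)) x" for x
          proof (cases "norm (x - x0) \<ge> r")
            case False
            then have "x \<in> cball x0 (2 * r)" using r(1) by (simp add: dist_norm norm_minus_commute)
            then show ?thesis using K1 by (simp add: norm_mult mult_le_one)
          qed (simp add: K0)
        qed simp
        show ?thesis
        \<comment> \<open>For small \<open>X\<close> the trivial bound by volume is enough; for
          large \<open>X\<close> the projected shift is nonzero and oscillation along
          \<open>e\<close> gives the decay.\<close>
        proof (cases "X \<le> 1")
          case X1: True
          have "1 \<le> P u" unfolding Pu by (rule prod_Cauchy_ge(1)[OF finite_D tb X1])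
          then have "C5 * 1 \<le> C5 * P u" using C5(1) by (intro mult_left_mono)
          then show ?thesis using triv C5(2) by simp
        next
          case X1: False
          then have pu: "proj u \<noteq> 0" unfolding X_def by auto
          obtain e where e: "e \<in> span D" "norm e = 1"
            "\<forall>y\<in>cball x0 r0. c * norm (proj u) \<le> \<omega> \<bullet> dderiv (dderiv \<psi> e) (proj u) y"
            using B proj_in[of u] pu by blast
          have [measurable]: "cnj \<in> borel_measurable borel"
            by (intro borel_measurable_continuous_onI continuous_intros)
          have "\<eta>0 * cmod (\<integral>x. K x * cnj (K (x + u)) \<partial>lborel) \<le> CB / X ^ n * vol"
            unfolding \<eta>0_def vol_def
          proof (rule average_along_line[where e = e and r = r])
            show "(\<lambda>x. K x * cnj (K (x + u))) \<in> borel_measurable borel" by measurable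
            show "cmod (K x * cnj (K (x + u))) \<le> 1" for x using K1 by (simp add: norm_mult mult_le_one)
            show "cmod (\<integral>t. bump n r t *\<^sub>R (K (x + t *\<^sub>R e) * cnj (K (x + t *\<^sub>R e + u))) \<partial>lborel) \<le> CB / X ^ n"
              if "x \<in> cball x0 (2 * r)" for x
              unfolding K_def X_def using CB(2)[OF \<omega> that True pu e(1,2) l0 e(3)] .
          qed (use K0 r \<eta>out e bump_bounds in auto)
          from le_div[OF this] have "cmod (\<integral>x. K x * cnj (K (x + u)) \<partial>lborel) \<le> CB / X ^ n * vol / \<eta>0" .
          also have "\<dots> = CB * vol / \<eta>0 * (1 / X ^ n)" by simp
          finally have "cmod (\<integral>x. K x * cnj (K (x + u)) \<partial>lborel) \<le> CB * vol / \<eta>0 * (1 / X ^ n)" .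
          also have "\<dots> \<le> C5 * (1 / X ^ n)" using C5(3) X1 by (intro mult_right_mono) auto
          also have "\<dots> \<le> C5 * P u"
            unfolding Pu n_def m_def using X1 C5(1) by (intro mult_left_mono prod_Cauchy_ge(2)[OF finite_D tb]) auto
          finally show ?thesis .
        qed
      qed
      have "ennreal ((cmod (\<integral>x. K x \<partial>lborel))\<^sup>2) \<le> (\<integral>\<^sup>+u. ennreal (C5 * P u) \<partial>lborel)"
        by (rule square_integral_le_correlation[where ?x0.0 = x0 and r = r]) (use K1 K0 corr in \<open>auto intro: ennreal_leI\<close>)
      also have "\<dots> = ennreal C5 * (\<integral>\<^sup>+u. ennreal (P u) \<partial>lborel)"
      proof -
        have "(\<lambda>u. ennreal (P u)) \<in> borel_measurable borel"
          unfolding P_def using finite_D by measurable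
        then show ?thesis using C5(1) P0 by (simp add: ennreal_mult nn_integral_cmult)
      qed
      also have "\<dots> \<le> ennreal C5 * ennreal ((2 * pi / l) ^ m * (2 * (2 * r)) ^ (DIM('a) - m))"
        unfolding P_def m_def using nn_integral_prod_Cauchy_le[OF D_subset l0, of "2 * r"] r(1)
        by (intro mult_left_mono) auto
      also have "\<dots> = ennreal (C6 * (1 / l ^ m))"
      proof -
        have "C5 * ((2 * pi / l) ^ m * (2 * (2 * r)) ^ (DIM('a) - m)) = C6 * (1 / l ^ m)"
          unfolding C6_def power_divide by simp
        then show ?thesis using ennreal_mult'[OF C5(1)] by metis
      qed
      finally have "(cmod (\<integral>x. K x \<partial>lborel))\<^sup>2 \<le> C6 * (1 / l ^ m)"
        using C6 l0 by (simp add: ennreal_le_iff)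
      also have "\<dots> = (sqrt C6 * l powr (- (real m / 2)))\<^sup>2"
        unfolding lpow power_mult_distrib using C6 by simp
      finally have "cmod (\<integral>x. K x \<partial>lborel) \<le> sqrt C6 * l powr (- (real m / 2))"
        by (rule power2_le_imp_le) (use C6 in simp)
      also have "\<dots> \<le> C * l powr (- (real m / 2))" using C(3) by (intro mult_right_mono) auto
      finally show ?thesis unfolding K_def .
    qed
  qed
  then show ?thesis using that[OF r(1,4) C(1), of n] unfolding m_def by blast
qed

text \<open>The measure is the image under \<open>Psi\<close> of Lebesgue measure weighted by the
  bump, so that its Fourier transform is an integral of \<open>osc\<close> over the ambient
  space.\<close>

lemma decay_measure_exists:
  assumes nondeg: "\<forall>\<zeta>. \<zeta> \<noteq> 0 \<longrightarrow> normal_at x0 \<zeta> \<longrightarrow>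
      (\<forall>u\<in>span D. (\<forall>e\<in>span D. hess x0 \<zeta> u e = 0) \<longrightarrow> u = 0)"
  shows "\<exists>\<mu>. fourier_decay_measure_on M (real (card D)) \<mu>"
proof -
  define m where "m = card D"
  obtain n r C where r: "r > 0" "r \<le> 2 * R" and C: "C \<ge> 0"
    "\<And>\<omega> l. norm \<omega> = 1 \<Longrightarrow> l \<ge> 1 \<Longrightarrow> cmod (\<integral>x. osc n r l \<omega> x \<partial>lborel) \<le> C * l powr (- (real m / 2))"
    by (rule osc_integral_bound[OF nondeg, folded m_def]) blast
  define a where "a x = bump n r (x - x0)" for x
  have [measurable]: "a \<in> borel_measurable borel" unfolding a_def by measurable
  have a: "0 \<le> a x" "a x \<le> 1" for x unfolding a_def using bump_bounds by auto
  have a0: "a x = 0" if "norm (x - x0) \<ge> r" for x unfolding a_def using bump_outside[OF r(1) that] .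
  define \<nu> where "\<nu> = density lborel (\<lambda>x. ennreal (a x))"
  define \<mu> where "\<mu> = distr \<nu> borel Psi"
  have sets: "sets \<mu> = sets borel" unfolding \<mu>_def by simp
  have Pm: "Psi \<in> measurable \<nu> borel" unfolding \<nu>_def by simp
  have ai: "cmod (of_real (a x)) \<le> indicator (cball x0 r) x" for x
    using a[of x] a0[of x] by (cases "x \<in> cball x0 r") (auto simp: dist_norm norm_minus_commute)
  have total: "emeasure \<mu> UNIV = (\<integral>\<^sup>+x. ennreal (a x) \<partial>lborel)"
    unfolding \<mu>_def using Pm by (simp add: emeasure_distr) (simp add: \<nu>_def emeasure_density)
  have fin: "finite_measure \<mu>"
  proof (rule finite_measureI)
    have "(\<integral>\<^sup>+x. ennreal (a x) \<partial>lborel) \<le> (\<integral>\<^sup>+x. indicator (cball x0 r) x \<partial>lborel)"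
    proof (rule nn_integral_mono)
      fix x
      show "ennreal (a x) \<le> indicator (cball x0 r) x"
        using a[of x] a0[of x] by (cases "x \<in> cball x0 r") (auto simp: dist_norm norm_minus_commute)
    qed
    also have "\<dots> < \<infinity>" using emeasure_lborel_cball_finite[of x0 r] by simp
    finally show "emeasure \<mu> (space \<mu>) \<noteq> \<infinity>" using total unfolding \<mu>_def by simp
  qed
  have pos: "emeasure \<mu> UNIV \<noteq> 0"
  proof
    assume "emeasure \<mu> UNIV = 0"
    then have "AE x in lborel. ennreal (a x) = 0" unfolding total by (subst (asm) nn_integral_0_iff_AE) auto
    then have "AE x in lborel. x \<notin> ball x0 r"
    proof eventually_elim
      case (elim x)
      then show ?case using bump_pos[OF r(1), of "x - x0" n] a(1)[of x]
        unfolding a_def by (auto simp: dist_norm norm_minus_commute ennreal_eq_0_iff)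
    qed
    then have "emeasure lborel (ball x0 r) = 0"
      by (subst (asm) AE_iff_measurable[where N = "ball x0 r"]) auto
    then show False using content_ball_pos[OF r(1), of x0] by (simp add: measure_def)
  qed
  have AEM: "AE z in \<mu>. z \<in> M"
  proof -
    \<comment> \<open>A compact subset of \<open>M\<close> carrying the measure: being Borel, it
      lets the almost-everywhere statement pass to the image measure.\<close>
    define M0 where "M0 = \<psi> ` param (2 * R)"
    have "compact (param (2 * R))" unfolding param_def by (intro closed_Int_compact closed_span compact_cball)
    moreover have "continuous_on (param (2 * R)) \<psi>"
      using continuous_on_subset[OF continuous_psi] param_V by blast
    ultimately have "compact M0" unfolding M0_def by (intro compact_continuous_image)
    then have M0b: "M0 \<in> sets borel" by (intro borel_compact)
    have M0M: "M0 \<subseteq> M" unfolding M0_def using psi_in_M param_V param_span by blast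
    have "AE x in \<nu>. Psi x \<in> M0"
      unfolding \<nu>_def
    proof (subst AE_density)
      show "AE x in lborel. 0 < ennreal (a x) \<longrightarrow> Psi x \<in> M0"
      proof (rule AE_I2, rule impI)
        fix x assume "0 < ennreal (a x)"
        then have "norm (x - x0) < r" using a0[of x] by force
        then have x: "x \<in> cball x0 (2 * R)" using r(2) by (simp add: dist_norm norm_minus_commute)
        then have "proj x \<in> param (2 * R)" unfolding param_def using proj_in proj_in_cball by blast
        then show "Psi x \<in> M0" unfolding M0_def Psi_def using x by simp
      qed
    qed simp
    then have "AE z in \<mu>. z \<in> M0" unfolding \<mu>_def using M0b Pm by (subst AE_distr_iff) auto
    then show ?thesis using M0M by (auto elim!: eventually_mono)
  qed
  define vol where "vol = measure lborel (cball x0 r)"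
  have ft: "fourier_transform_measure \<mu> \<zeta> = (\<integral>x. a x *\<^sub>R cis (- 2 * pi * (\<zeta> \<bullet> Psi x)) \<partial>lborel)" for \<zeta>
  proof -
    have "fourier_transform_measure \<mu> \<zeta> = (\<integral>x. cis (- 2 * pi * (\<zeta> \<bullet> Psi x)) \<partial>\<nu>)"
      unfolding fourier_transform_measure_def \<mu>_def using Pm by (subst integral_distr) auto
    also have "\<dots> = (\<integral>x. a x *\<^sub>R cis (- 2 * pi * (\<zeta> \<bullet> Psi x)) \<partial>lborel)"
      unfolding \<nu>_def using a(1) by (subst integral_density) auto
    finally show ?thesis .
  qed
  have "cmod (fourier_transform_measure \<mu> \<zeta>) \<le> (C + vol) * norm \<zeta> powr (- real m / 2)" if \<zeta>: "\<zeta> \<noteq> 0" for \<zeta>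
  \<comment> \<open>In the low-frequency case \<open>norm \<zeta> powr (- real m / 2)\<close> is at
    least 1, and the bound by volume suffices.\<close>
  proof (cases "2 * pi * norm \<zeta> \<ge> 1")
    case True
    \<comment> \<open>The minus sign absorbs the one in the definition of the transform.\<close>
    define \<omega> where "\<omega> = (- 1 / norm \<zeta>) *\<^sub>R \<zeta>"
    have \<omega>: "norm \<omega> = 1" unfolding \<omega>_def using \<zeta> by simp
    have "a x *\<^sub>R cis (- 2 * pi * (\<zeta> \<bullet> Psi x)) = osc n r (2 * pi * norm \<zeta>) \<omega> x" for x
    proof -
      have "2 * pi * norm \<zeta> * (\<omega> \<bullet> Psi x) = - 2 * pi * (\<zeta> \<bullet> Psi x)" unfolding \<omega>_def using \<zeta> by simp
      then show ?thesis unfolding osc_def a_def by (simp only:)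
    qed
    then have "cmod (fourier_transform_measure \<mu> \<zeta>) \<le> C * (2 * pi * norm \<zeta>) powr (- (real m / 2))"
      unfolding ft using C(2)[OF \<omega> True] by simp
    also have "\<dots> \<le> C * norm \<zeta> powr (- real m / 2)"
    proof (intro mult_left_mono C(1))
      have "norm \<zeta> \<le> 2 * pi * norm \<zeta>" using pi_gt3 by (simp add: mult_le_cancel_right1)
      then have "(2 * pi * norm \<zeta>) powr (- (real m / 2)) \<le> norm \<zeta> powr (- (real m / 2))"
        using \<zeta> by (intro powr_mono2') auto
      then show "(2 * pi * norm \<zeta>) powr (- (real m / 2)) \<le> norm \<zeta> powr (- real m / 2)" by simp
    qed
    also have "\<dots> \<le> (C + vol) * norm \<zeta> powr (- real m / 2)"
      unfolding vol_def by (intro mult_right_mono) auto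
    finally show ?thesis .
  next
    case False
    have "norm \<zeta> \<le> 2 * pi * norm \<zeta>" using pi_gt3 by (simp add: mult_le_cancel_right1)
    then have n1: "norm \<zeta> \<le> 1" using False by simp
    have "cmod (fourier_transform_measure \<mu> \<zeta>) \<le> vol"
      unfolding ft vol_def
    proof (rule norm_integral_le_measure)
      show "emeasure lborel (cball x0 r) < \<infinity>" using emeasure_lborel_cball_finite[of x0 r] by simp
      show "cmod (a x *\<^sub>R cis (- 2 * pi * (\<zeta> \<bullet> Psi x))) \<le> indicator (cball x0 r) x" for x
        using ai[of x] a(1)[of x] by simp
    qed simp
    also have "\<dots> \<le> (C + vol) * 1" using C(1) by simp
    also have "\<dots> \<le> (C + vol) * norm \<zeta> powr (- real m / 2)"
    proof (intro mult_left_mono)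
      have "1 powr (- (real m / 2)) \<le> norm \<zeta> powr (- (real m / 2))"
        using \<zeta> n1 by (intro powr_mono2') auto
      then show "1 \<le> norm \<zeta> powr (- real m / 2)" by simp
    qed (use C(1) in \<open>simp add: vol_def\<close>)
    finally show ?thesis .
  qed
  then show ?thesis
    unfolding fourier_decay_measure_on_def m_def[symmetric]
    using sets fin pos AEM by (intro exI[of _ \<mu>] conjI exI[of _ "C + vol"] allI impI)
qed

end

lemma fourier_dim_nondegenerate_ge:
  fixes M :: "'a::euclidean_space set"
  assumes sub: "smooth_submanifold m M" and m: "m \<ge> 1" and z0: "z0 \<in> M"
    and nd: "\<forall>\<zeta>0\<in>(tangent_space M z0)\<^sup>\<bottom>. \<zeta>0 \<noteq> 0 \<longrightarrow>
              nondegenerate_critical_point_on M (\<lambda>z. \<zeta>0 \<bullet> (z - z0)) z0"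
  shows "fourier_dim M \<ge> real m"
proof -
  obtain U V \<phi> \<psi> D where c: "chart M U V \<phi> \<psi> D" "card D = m" "z0 \<in> U"
    by (rule smooth_submanifold_chart[OF sub z0])
  interpret chart M U V \<phi> \<psi> D by fact
  obtain R R' L where "chart_ball M U V \<phi> \<psi> D z0 R R' L" by (rule chart_ball_exists[OF z0 c(3)])
  then interpret chart_ball M U V \<phi> \<psi> D z0 R R' L .
  have psi_x0: "\<psi> x0 = z0" unfolding x0_def using psi_phi c(3) by blast
  have x0V: "x0 \<in> V" using ball_V' R_pos by (auto simp: subset_eq)
  have "u = 0" if \<zeta>: "\<zeta> \<noteq> 0" "normal_at x0 \<zeta>" and u: "u \<in> span D" "\<forall>e\<in>span D. hess x0 \<zeta> u e = 0" for \<zeta> u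
  proof -
    have \<zeta>T: "\<zeta> \<in> (tangent_space M (\<psi> x0))\<^sup>\<bottom>"
      using \<zeta>(2) tangent_space_eq[OF x0_span x0V]
      by (auto simp: normal_at_def orthogonal_comp_def orthogonal_def inner_commute)
    then have "nondegenerate_critical_point_on M (\<lambda>z. \<zeta> \<bullet> (z - \<psi> x0)) (\<psi> x0)"
      using nd \<zeta>(1) psi_x0 by simp
    then show ?thesis using nondegenerate_critical_point_iff[OF x0_span x0V \<zeta>T] u by blast
  qed
  then have "\<exists>\<mu>. fourier_decay_measure_on M (real (card D)) \<mu>" by (intro decay_measure_exists) blast
  then have ex: "\<exists>\<mu>. fourier_decay_measure_on M (real m) \<mu>" using c(2) by simp
  \<comment> \<open>Together with \<open>m \<ge> 1\<close> this makes \<open>m\<close> an admissible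
    exponent in the supremum.\<close>
  have "m \<le> DIM('a)" using card_D_le c(2) by simp
  then show ?thesis
    unfolding fourier_dim_def using ex m
    by (intro cSup_upper) (auto intro!: bdd_aboveI[of _ "real DIM('a)"])
qed

theorem theorem1p1:
  fixes M :: "(real ^ 'd) set" and m :: nat
  assumes "m \<ge> 1"
    and "smooth_submanifold m M"
    and "M \<noteq> {}"
  shows "(salem M \<longleftrightarrow>
           (\<exists>z0\<in>M. \<forall>\<zeta>0\<in>(tangent_space M z0)\<^sup>\<bottom>. \<zeta>0 \<noteq> 0 \<longrightarrow>
              nondegenerate_critical_point_on M (\<lambda>z. \<zeta>0 \<bullet> (z - z0)) z0)) \<and>
         (\<not> (\<exists>z0\<in>M. \<forall>\<zeta>0\<in>(tangent_space M z0)\<^sup>\<bottom>. \<zeta>0 \<noteq> 0 \<longrightarrow>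
              nondegenerate_critical_point_on M (\<lambda>z. \<zeta>0 \<bullet> (z - z0)) z0) \<longrightarrow>
            fourier_dim M \<le> real m - 1 / 3)"
    (is "(_ \<longleftrightarrow> ?N) \<and> _")
proof -
  have H: "Hausdorff_dim M = real m" by (rule Hausdorff_dim_submanifold[OF assms(2,3)])
  have deg: "fourier_dim M \<le> real m - 1/3" if "\<not> ?N"
    by (rule fourier_dim_degenerate_le[OF assms(2,1) that])
  have "fourier_dim M = real m" if "?N"
    using that fourier_dim_nondegenerate_ge[OF assms(2,1)] fourier_dim_submanifold_le[OF assms(2)]
    by (auto intro: antisym)
  \<comment> \<open>If the condition fails, the gap of 1/3 already separates the Fourier dimension
    from the Hausdorff dimension \<open>m\<close>.\<close>
  then have "salem M \<longleftrightarrow> ?N" unfolding salem_def H using deg by force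
  then show ?thesis using deg by blast
qed

end
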